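(* Let $S$ be a set and let $r\in F(S)'\setminus\{e\}$. Then $$\|G_r\|=\sup_{\phi\in Q(r),\ D(\phi)>0}\frac{\phi(r)}{D(\phi)},$$ where $Q(r)$ is the space of all quasimorphisms $\phi\colon F(S)\to\mathbb R$ satisfying $\phi(g\cdot hrh^{-1})=\phi(g)+\phi(hrh^{-1})$ for all $g,h\in F(S)$.
   Context: A map $\phi\colon G\to\mathbb R$ on a group $G$ is a quasimorphism if its defect $D(\phi):=\sup_{g,h\in G}|\phi(g)+\phi(h)-\phi(gh)|$ is finite. For a set $S$, $F(S)$ is the free group on $S$, $F(S)'$ its commutator subgroup and $e$ the neutral element. For $r\in F(S)'\setminus\{e\}$ let $G_r:=\langle S\mid r\rangle$. Let $P_r$ be the presentation complex (one vertex, one $1$-cell for each element of $S$, one $2$-cell attached along $r$) and let $X_r$ be a classifying space of $G_r$ obtained from $P_r$ by attaching cells of dimension $\ge 3$, with inclusion $c_r\colon P_r\to X_r$. Since $r\in F(S)'$, the $2$-cell of $P_r$ defines a class $\widetilde\alpha_r\in H_2(P_r;\mathbb Z)$; the fundamental class is $\alpha_r:=H_2(c_r;\mathbb Z)(\widetilde\alpha_r)\in H_2(X_r;\mathbb Z)=H_2(G_r;\mathbb Z)$ (this group is infinite cyclic, generated by $\alpha_r$), and $\alpha_{r,\mathbb R}\in H_2(G_r;\mathbb R)$ is its image under change of coefficients. The simplicial volume of $G_r$ is $\|G_r\|:=\|\alpha_{r,\mathbb R}\|_1$, where $\|\alpha\|_1$ is the infimum of the $\ell^1$-norms (with respect to the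 basis of singular simplices) of all real singular cycles representing $\alpha$. *)

theory Defs
  imports "HOL-Analysis.Analysis" "HOL-Homology.Homology" "HOL-Algebra.Generated_Groups"
begin

section \<open>Free groups and one-relator groups\<close>

text \<open>The letter \<open>(s, True)\<close> is the generator \<open>s\<close>, and \<open>(s, False)\<close> is its inverse.
  Elements of the free group are the reduced words.\<close>

type_synonym 'a word = "('a \<times> bool) list"

definition inv_letter :: "'a \<times> bool \<Rightarrow> 'a \<times> bool"
  where "inv_letter x = (fst x, \<not> snd x)"

definition reduced_word :: "'a word \<Rightarrow> bool"
  where "reduced_word w \<longleftrightarrow> successively (\<lambda>x y. y \<noteq> inv_letter x) w"

fun cons_reduce :: "'a \<times> bool \<Rightarrow> 'a word \<Rightarrow> 'a word"
  where
    "cons_reduce x [] = [x]"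
  | "cons_reduce x (y # ys) = (if y = inv_letter x then ys else x # y # ys)"

definition reduce_word :: "'a word \<Rightarrow> 'a word"
  where "reduce_word w = foldr cons_reduce w []"

definition free_group :: "'a set \<Rightarrow> 'a word monoid"
  where "free_group S =
    \<lparr>carrier = {w. reduced_word w \<and> fst ` set w \<subseteq> S},
     monoid.mult = (\<lambda>v w. reduce_word (v @ w)),
     one = []\<rparr>"

lemma inv_letter_simps [simp]:
  "inv_letter (inv_letter x) = x" "fst (inv_letter x) = fst x"
  by (simp_all add: inv_letter_def)

lemma reduced_word_cons_reduce:
  "reduced_word w \<Longrightarrow> reduced_word (cons_reduce x w)"
  by (cases w) (auto simp: reduced_word_def successively_Cons)

lemma cons_reduce_cancel:
  "reduced_word w \<Longrightarrow> cons_reduce x (cons_reduce (inv_letter x) w) = w"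
  by (cases w; cases "tl w") (auto simp: reduced_word_def)

lemma reduced_word_foldr:
  "reduced_word w \<Longrightarrow> reduced_word (foldr cons_reduce v w)"
  by (induction v) (auto intro: reduced_word_cons_reduce)

lemma reduced_word_Nil [simp]: "reduced_word []"
  by (simp add: reduced_word_def)

lemma reduced_reduce_word [simp]: "reduced_word (reduce_word w)"
  by (simp add: reduce_word_def reduced_word_foldr)

lemma reduce_word_reduced: "reduced_word w \<Longrightarrow> reduce_word w = w"
proof (induction w)
  case (Cons x w)
  then show ?case
    by (cases w) (auto simp: reduced_word_def reduce_word_def)
qed (simp add: reduce_word_def)

lemma set_foldr_cons_reduce: "set (foldr cons_reduce v w) \<subseteq> set v \<union> set w"
proof (induction v)
  case (Cons x v)
  have "set (cons_reduce x u) \<subseteq> insert x (set u)" for u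
    by (cases u) auto
  with Cons show ?case by fastforce
qed simp

lemma foldr_cons_reduce:
  assumes "reduced_word w"
  shows "foldr cons_reduce (cons_reduce x v) w = cons_reduce x (foldr cons_reduce v w)"
proof (cases v)
  case (Cons y ys)
  have "reduced_word (foldr cons_reduce ys w)"
    by (rule reduced_word_foldr [OF assms])
  then show ?thesis
    using Cons by (auto simp: cons_reduce_cancel)
qed simp

lemma foldr_reduce_word:
  "reduced_word w \<Longrightarrow> foldr cons_reduce (reduce_word v) w = foldr cons_reduce v w"
  by (induction v) (auto simp: reduce_word_def foldr_cons_reduce)

lemma foldr_inverse_word:
  "reduced_word w \<Longrightarrow>
    foldr cons_reduce (map inv_letter (rev v)) (foldr cons_reduce v w) = w"
proof (induction v)
  case (Cons x v)
  then show ?case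
    using cons_reduce_cancel [of "foldr cons_reduce v w" "inv_letter x"]
    by (simp add: reduced_word_foldr)
qed simp

lemma group_free_group: "group (free_group S)"
proof (rule groupI)
  fix x y z
  assume "x \<in> carrier (free_group S)" "y \<in> carrier (free_group S)" "z \<in> carrier (free_group S)"
  then show "x \<otimes>\<^bsub>free_group S\<^esub> y \<otimes>\<^bsub>free_group S\<^esub> z
    = x \<otimes>\<^bsub>free_group S\<^esub> (y \<otimes>\<^bsub>free_group S\<^esub> z)"
    by (simp add: free_group_def)
      (metis foldr_append foldr_reduce_word reduce_word_def reduced_reduce_word reduced_word_Nil)
next
  fix x y
  assume xy: "x \<in> carrier (free_group S)" "y \<in> carrier (free_group S)"
  have "set (reduce_word (x @ y)) \<subseteq> set x \<union> set y"
    using set_foldr_cons_reduce [of "x @ y" "[]"] by (simp add: reduce_word_def)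
  with xy show "x \<otimes>\<^bsub>free_group S\<^esub> y \<in> carrier (free_group S)"
    by (fastforce simp: free_group_def)
next
  fix x
  assume x: "x \<in> carrier (free_group S)"
  let ?y = "reduce_word (map inv_letter (rev x))"
  have "set ?y \<subseteq> inv_letter ` set x"
    using set_foldr_cons_reduce [of "map inv_letter (rev x)" "[]"] by (simp add: reduce_word_def)
  with x have "?y \<in> carrier (free_group S)"
    by (fastforce simp: free_group_def)
  moreover have "foldr cons_reduce ?y (foldr cons_reduce x []) = []"
    by (simp add: foldr_reduce_word reduced_word_foldr foldr_inverse_word)
  then have "?y \<otimes>\<^bsub>free_group S\<^esub> x = \<one>\<^bsub>free_group S\<^esub>"
    by (simp add: free_group_def) (simp add: reduce_word_def)
  ultimately show "\<exists>y\<in>carrier (free_group S). y \<otimes>\<^bsub>free_group S\<^esub> x = \<one>\<^bsub>free_group S\<^esub>"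
    by blast
qed (auto simp: free_group_def reduce_word_reduced)

definition conjugate :: "('g, 'h) monoid_scheme \<Rightarrow> 'g \<Rightarrow> 'g \<Rightarrow> 'g"
  where "conjugate G h x = h \<otimes>\<^bsub>G\<^esub> x \<otimes>\<^bsub>G\<^esub> inv\<^bsub>G\<^esub> h"

definition one_relator_group :: "'a set \<Rightarrow> 'a word \<Rightarrow> 'a word set monoid"
  where "one_relator_group S r =
    free_group S Mod
      generate (free_group S) ((\<lambda>h. conjugate (free_group S) h r) ` carrier (free_group S))"

section \<open>Quasimorphisms\<close>

definition defect_values :: "('g, 'h) monoid_scheme \<Rightarrow> ('g \<Rightarrow> real) \<Rightarrow> real set"
  where "defect_values G \<phi> =
    {\<bar>\<phi> g + \<phi> h - \<phi> (g \<otimes>\<^bsub>G\<^esub> h)\<bar> | g h. g \<in> carrier G \<and> h \<in> carrier G}"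

definition quasimorphism :: "('g, 'h) monoid_scheme \<Rightarrow> ('g \<Rightarrow> real) \<Rightarrow> bool"
  where "quasimorphism G \<phi> \<longleftrightarrow> bdd_above (defect_values G \<phi>)"

definition defect :: "('g, 'h) monoid_scheme \<Rightarrow> ('g \<Rightarrow> real) \<Rightarrow> real"
  where "defect G \<phi> = Sup (defect_values G \<phi>)"

definition relator_quasimorphisms :: "'a set \<Rightarrow> 'a word \<Rightarrow> ('a word \<Rightarrow> real) set"
  where "relator_quasimorphisms S r =
    {\<phi>. quasimorphism (free_group S) \<phi> \<and>
        (\<forall>g\<in>carrier (free_group S). \<forall>h\<in>carrier (free_group S).
          \<phi> (g \<otimes>\<^bsub>free_group S\<^esub> conjugate (free_group S) h r)
            = \<phi> g + \<phi> (conjugate (free_group S) h r))}"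

section \<open>The presentation complex\<close>

text \<open>The points of the presentation complex: the vertex, the points \<open>Edge s t\<close>
  (\<open>0 < t < 1\<close>) of the open 1-cells and the points \<open>Face z\<close> (\<open>|z| < 1\<close>) of the
  open 2-cell.\<close>

datatype 'a cell_point = Vertex | Edge 'a real | Face complex

definition edge_map :: "'a \<Rightarrow> real \<Rightarrow> 'a cell_point"
  where "edge_map s t = (if 0 < t \<and> t < 1 then Edge s t else Vertex)"

text \<open>The loop \<open>[0,1] \<rightarrow> P\<^sub>r\<close> that runs with constant speed through the edges spelled by
  a word, an edge being traversed backwards for an inverse letter.\<close>

definition word_loop :: "'a word \<Rightarrow> real \<Rightarrow> 'a cell_point"
  where "word_loop w t =
    (let u = real (length w) * t; j = nat \<lfloor>u\<rfloor> in
      if j < length w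
      then (case w ! j of (s, b) \<Rightarrow> edge_map s (if b then u - real j else 1 - (u - real j)))
      else Vertex)"

definition face_map :: "'a word \<Rightarrow> complex \<Rightarrow> 'a cell_point"
  where "face_map r z = (if cmod z < 1 then Face z else word_loop r (Arg2pi z / (2 * pi)))"

definition one_skeleton :: "'a set \<Rightarrow> 'a cell_point set"
  where "one_skeleton S = insert Vertex {Edge s t | s t. s \<in> S \<and> 0 < t \<and> t < 1}"

text \<open>The topology is the final one for the characteristic maps of all cells.\<close>

definition presentation_complex :: "'a set \<Rightarrow> 'a word \<Rightarrow> 'a cell_point topology"
  where "presentation_complex S r = topology (\<lambda>U.
    U \<subseteq> one_skeleton S \<union> Face ` ball 0 1 \<and>
    (\<forall>s\<in>S. openin (top_of_set {0..1}) {t \<in> {0..1}. edge_map s t \<in> U}) \<and>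
    openin (top_of_set (cball 0 1)) {z \<in> cball 0 1. face_map r z \<in> U})"

lemma openin_presentation_complex:
  "openin (presentation_complex S r) U \<longleftrightarrow>
    U \<subseteq> one_skeleton S \<union> Face ` ball 0 1 \<and>
    (\<forall>s\<in>S. openin (top_of_set {0..1}) {t \<in> {0..1}. edge_map s t \<in> U}) \<and>
    openin (top_of_set (cball 0 1)) {z \<in> cball 0 1. face_map r z \<in> U}"
proof -
  have *: "openin (top_of_set T) {t \<in> T. f t \<in> U \<inter> V}"
    if "openin (top_of_set T) {t \<in> T. f t \<in> U}" "openin (top_of_set T) {t \<in> T. f t \<in> V}"
    for T :: "'t::topological_space set" and f :: "'t \<Rightarrow> 'a cell_point" and U V
  proof -
    have "{t \<in> T. f t \<in> U \<inter> V} = {t \<in> T. f t \<in> U} \<inter> {t \<in> T. f t \<in> V}" by blast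
    then show ?thesis using that by (simp only: openin_Int)
  qed
  have **: "openin (top_of_set T) {t \<in> T. f t \<in> \<Union>\<K>}"
    if "\<And>K. K \<in> \<K> \<Longrightarrow> openin (top_of_set T) {t \<in> T. f t \<in> K}"
    for T :: "'t::topological_space set" and f :: "'t \<Rightarrow> 'a cell_point" and \<K>
  proof -
    have "{t \<in> T. f t \<in> \<Union>\<K>} = (\<Union>K\<in>\<K>. {t \<in> T. f t \<in> K})" by blast
    moreover have "openin (top_of_set T) (\<Union>K\<in>\<K>. {t \<in> T. f t \<in> K})"
      using that by (intro openin_Union) auto
    ultimately show ?thesis by simp
  qed
  show ?thesis
    unfolding presentation_complex_def
    apply (subst topology_inverse')
     apply (simp_all only: istopology_def)
    apply (intro conjI allI impI ballI)
         apply blast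
        apply (rule *; blast)
       apply (rule *; blast)
      apply blast
     apply (rule **; blast)
    apply (rule **; blast)
    done
qed

section \<open>Attaching cells\<close>

definition closed_disc :: "nat \<Rightarrow> (nat \<Rightarrow> real) topology"
  where "closed_disc n = subtopology (Euclidean_space n) {x. (\<Sum>i<n. (x i)\<^sup>2) \<le> 1}"

definition open_disc :: "nat \<Rightarrow> (nat \<Rightarrow> real) set"
  where "open_disc n = {x \<in> topspace (Euclidean_space n). (\<Sum>i<n. (x i)\<^sup>2) < 1}"

definition disc_boundary :: "nat \<Rightarrow> (nat \<Rightarrow> real) set"
  where "disc_boundary n = {x \<in> topspace (Euclidean_space n). (\<Sum>i<n. (x i)\<^sup>2) = 1}"

text \<open>The space \<open>X\<close> arises from its subspace \<open>A\<close> as the pushout along the attaching maps of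
  \<open>n\<close>-cells. The cells are indexed by their own characteristic maps.\<close>

definition attaches_cells :: "nat \<Rightarrow> 'b topology \<Rightarrow> 'b set \<Rightarrow> bool"
  where "attaches_cells n X A \<longleftrightarrow>
    A \<subseteq> topspace X \<and>
    (\<exists>\<Phi> :: ((nat \<Rightarrow> real) \<Rightarrow> 'b) set.
      (\<forall>f\<in>\<Phi>. continuous_map (closed_disc n) X f \<and> f ` disc_boundary n \<subseteq> A) \<and>
      bij_betw (\<lambda>(f, x). f x) (\<Phi> \<times> open_disc n) (topspace X - A) \<and>
      (\<forall>C. C \<subseteq> topspace X \<longrightarrow>
        (closedin X C \<longleftrightarrow>
          closedin (subtopology X A) (C \<inter> A) \<and>
          (\<forall>f\<in>\<Phi>. closedin (closed_disc n) {x \<in> topspace (closed_disc n). f x \<in> C}))))"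

text \<open>\<open>c\<close> identifies \<open>P\<close> with a subspace of \<open>X\<close>, and \<open>X\<close> arises from this subspace by
  successively attaching cells of dimension \<open>n + 1\<close>, \<open>n + 2\<close>, \dots: the set \<open>Y k\<close> is
  the relative \<open>k\<close>-skeleton, and \<open>X\<close> has the weak topology.\<close>

definition cw_extension_above :: "nat \<Rightarrow> 'p topology \<Rightarrow> 'b topology \<Rightarrow> ('p \<Rightarrow> 'b) \<Rightarrow> bool"
  where "cw_extension_above n P X c \<longleftrightarrow>
    embedding_map P X c \<and>
    (\<exists>Y :: nat \<Rightarrow> 'b set.
      Y n = c ` topspace P \<and>
      (\<forall>k>n. attaches_cells k (subtopology X (Y k)) (Y (k - 1))) \<and>
      topspace X = (\<Union>k\<in>{n..}. Y k) \<and>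
      (\<forall>C. C \<subseteq> topspace X \<longrightarrow>
        (closedin X C \<longleftrightarrow> (\<forall>k\<ge>n. closedin (subtopology X (Y k)) (C \<inter> Y k)))))"

section \<open>Classifying spaces\<close>

definition loops_at :: "'b topology \<Rightarrow> 'b \<Rightarrow> (real \<Rightarrow> 'b) set"
  where "loops_at X x = {p. pathin X p \<and> p 0 = x \<and> p 1 = x}"

definition loop_class :: "'b topology \<Rightarrow> 'b \<Rightarrow> (real \<Rightarrow> 'b) \<Rightarrow> (real \<Rightarrow> 'b) set"
  where "loop_class X x p =
    {q \<in> loops_at X x. homotopic_with (\<lambda>h. h 0 = x \<and> h 1 = x) (top_of_set {0..1}) X p q}"

definition join_loops :: "(real \<Rightarrow> 'b) \<Rightarrow> (real \<Rightarrow> 'b) \<Rightarrow> real \<Rightarrow> 'b"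
  where "join_loops p q t = (if t \<le> 1/2 then p (2 * t) else q (2 * t - 1))"

definition fundamental_group :: "'b topology \<Rightarrow> 'b \<Rightarrow> (real \<Rightarrow> 'b) set monoid"
  where "fundamental_group X x =
    \<lparr>carrier = loop_class X x ` loops_at X x,
     monoid.mult = (\<lambda>A B. \<Union>p\<in>A. \<Union>q\<in>B. loop_class X x (join_loops p q)),
     one = loop_class X x (\<lambda>_. x)\<rparr>"

text \<open>The homotopy groups in degrees \<open>n \<ge> 2\<close> vanish at every base point iff every map from
  the \<open>n\<close>-sphere is null-homotopic.\<close>

definition classifying_space :: "('g, 'h) monoid_scheme \<Rightarrow> 'b topology \<Rightarrow> 'b \<Rightarrow> bool"
  where "classifying_space G X x \<longleftrightarrow>
    x \<in> topspace X \<and> path_connected_space X \<and>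
    fundamental_group X x \<cong> G \<and>
    (\<forall>n\<ge>2. \<forall>f. continuous_map (nsphere n) X f \<longrightarrow>
      (\<exists>a. homotopic_with (\<lambda>_. True) (nsphere n) X f (\<lambda>_. a)))"

section \<open>Real singular chains and the \<open>\<ell>\<^sup>1\<close>-seminorm\<close>

type_synonym 'b real_chain = "((nat \<Rightarrow> real) \<Rightarrow> 'b) \<Rightarrow>\<^sub>0 real"

definition real_singular_chain :: "nat \<Rightarrow> 'b topology \<Rightarrow> 'b real_chain \<Rightarrow> bool"
  where "real_singular_chain p X c \<longleftrightarrow> Poly_Mapping.keys c \<subseteq> singular_simplex_set p X"

definition real_chain_boundary :: "nat \<Rightarrow> 'b real_chain \<Rightarrow> 'b real_chain"
  where "real_chain_boundary p c =
    (if p = 0 then 0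
     else \<Sum>\<sigma>\<in>Poly_Mapping.keys c. \<Sum>k\<le>p.
       Poly_Mapping.single (singular_face p k \<sigma>) ((-1) ^ k * Poly_Mapping.lookup c \<sigma>))"

definition real_singular_cycle :: "nat \<Rightarrow> 'b topology \<Rightarrow> 'b real_chain \<Rightarrow> bool"
  where "real_singular_cycle p X c \<longleftrightarrow> real_singular_chain p X c \<and> real_chain_boundary p c = 0"

definition real_homology_class :: "nat \<Rightarrow> 'b topology \<Rightarrow> 'b real_chain \<Rightarrow> 'b real_chain set"
  where "real_homology_class p X z =
    {c. real_singular_cycle p X c \<and>
        (\<exists>d. real_singular_chain (Suc p) X d \<and> real_chain_boundary (Suc p) d = c - z)}"

text \<open>Homology classes are cosets, so \<open>\<alpha>\<close> is the set of integral cycles representing it. All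
  of them give the same real class.\<close>

definition change_of_coefficients :: "nat \<Rightarrow> 'b topology \<Rightarrow> 'b chain set \<Rightarrow> 'b real_chain set"
  where "change_of_coefficients p X \<alpha> =
    (\<Union>z\<in>\<alpha>. real_homology_class p X (Poly_Mapping.map real_of_int z))"

definition l1_norm :: "'b real_chain \<Rightarrow> real"
  where "l1_norm c = (\<Sum>\<sigma>\<in>Poly_Mapping.keys c. \<bar>Poly_Mapping.lookup c \<sigma>\<bar>)"

definition l1_seminorm :: "'b real_chain set \<Rightarrow> real"
  where "l1_seminorm \<alpha> = Inf (l1_norm ` \<alpha>)"

section \<open>The fundamental class and the simplicial volume\<close>

text \<open>The homeomorphism from the standard 2-simplex to the closed unit disc that takes the
  vertices to the third roots of unity in counterclockwise order: the affine map to the triangle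
  they span, followed by the radial homeomorphism onto the disc. The factor
  \<open>1 - 3 min(x\<^sub>0, x\<^sub>1, x\<^sub>2)\<close> is the Minkowski gauge of the triangle.\<close>

definition disc_simplex :: "(nat \<Rightarrow> real) \<Rightarrow> complex"
  where "disc_simplex = (\<lambda>x\<in>standard_simplex 2.
    of_real (1 - 3 * min (x 0) (min (x 1) (x 2))) *
      sgn (\<Sum>i\<le>2. of_real (x i) * cis (2 * pi * real i / 3)))"

definition disc_class :: "complex chain set"
  where "disc_class = homologous_rel_set 2 (top_of_set (cball 0 1)) (sphere 0 1) (frag_of disc_simplex)"

text \<open>The 2-cell as a cellular 2-cycle: the class in \<open>H\<^sub>2(P\<^sub>r)\<close> whose image in
  \<open>H\<^sub>2(P\<^sub>r, P\<^sub>r\<^sup>(\<^sup>1\<^sup>))\<close> is the class of the 2-cell. It is unique as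
  the second homology of the 1-skeleton vanishes, and exists for \<open>r\<close> in the commutator subgroup.\<close>

definition face_class :: "'a set \<Rightarrow> 'a word \<Rightarrow> 'a cell_point chain set"
  where "face_class S r = (SOME \<alpha>.
    \<alpha> \<in> carrier (homology_group 2 (presentation_complex S r)) \<and>
    hom_induced 2 (presentation_complex S r) {} (presentation_complex S r) (one_skeleton S) id \<alpha>
      = hom_induced 2 (top_of_set (cball 0 1)) (sphere 0 1)
          (presentation_complex S r) (one_skeleton S) (face_map r) disc_class)"

definition fundamental_class ::
    "'a set \<Rightarrow> 'a word \<Rightarrow> 'b topology \<Rightarrow> ('a cell_point \<Rightarrow> 'b) \<Rightarrow> 'b chain set"
  where "fundamental_class S r X c =
    hom_induced 2 (presentation_complex S r) {} X {} c (face_class S r)"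

text \<open>The simplicial volume of the one-relator group, computed on a classifying space \<open>X\<close>
  into which \<open>c\<close> includes the presentation complex.\<close>

definition simplicial_volume ::
    "'a set \<Rightarrow> 'a word \<Rightarrow> 'b topology \<Rightarrow> ('a cell_point \<Rightarrow> 'b) \<Rightarrow> real"
  where "simplicial_volume S r X c =
    l1_seminorm (change_of_coefficients 2 X (fundamental_class S r X c))"

end

theory Submission
  imports Defs
begin

text \<open>Lower bound: a model of the classifying space of \<open>G\<^sub>r = F(S)/N\<close> by step functions
  assigns to the edges of a singular simplex in \<open>X\<close> their holonomies in \<open>G\<^sub>r\<close>. For
  \<open>\<phi>\<close> in \<open>Q(r)\<close> the deviation \<open>\<phi>(g) + \<phi>(h) - \<phi>(gh)\<close> only depends on the cosets of \<open>g\<close> and \<open>h\<close>,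
  hence defines a cocycle on \<open>X\<close> bounded by \<open>D(\<phi>)\<close>. On the one-skeleton it is the coboundary of
  \<open>\<phi>\<close> of the holonomy in \<open>F(S)\<close>, and the boundary of the 2-cell has holonomy \<open>r\<close>, so its value on
  the fundamental class is \<open>- \<phi>(r)\<close>.

  Upper bound: by Hahn-Banach there is a cocycle \<open>f\<close> on \<open>X\<close> with \<open>|f| \<le> 1\<close> that takes the
  value \<open>\<parallel>G\<^sub>r\<parallel>\<close> on the fundamental class. Since the second homotopy group of \<open>X\<close>
  vanishes, \<open>f\<close> only depends on the edges of a 2-simplex. Its values on triangles of loops,
  chosen one for each homotopy class, form a bounded 2-cocycle on \<open>F(S)\<close>, which is the deviation
  of a function \<open>p\<close> because \<open>F(S)\<close> is free. The antisymmetrization of \<open>p\<close> is in \<open>Q(r)\<close>, has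
  defect at most 1 and the value \<open>\<parallel>G\<^sub>r\<parallel>\<close> at \<open>r\<close> up to sign.\<close>

section \<open>Spaces of step functions\<close>

text \<open>Covering space theory is replaced by one rigidity: distinct translates of a step
  function have distance 1, so a lift known up to a small error is known exactly. Holonomies are
  thereby defined for single singular edges, closed or not, and multiply exactly on 2-simplices. The
  main obstacle is the passage from singular simplices to words. A singular edge of the one-skeleton
  may be wild, and with infinitely many generators the vertex has no compact neighbourhood. It is
  overcome by the statement that such an edge is homotopic, up to base edges at its ends, to the
  word given by its holonomy. This serves twice: commutators of words bound in the one-skeleton,
  which yields a fundamental cycle made of the 2-cell and a chain of the one-skeleton; and the loops
  of \<open>X\<close> used for the upper bound can be compared with arbitrary simplices. A cocycle
  with a primitive on the one-skeleton is then evaluated on the 2-cell alone. Homotopies of paths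
  are treated by filling horns and spheres, so that they become combinatorics of tetrahedra.\<close>

lemma connected_space_locally_constant:
  assumes K: "connected_space K"
    and loc: "\<And>x. x \<in> topspace K \<Longrightarrow> \<exists>U. openin K U \<and> x \<in> U \<and> (\<forall>y\<in>U. c y = c x)"
    and xy: "x \<in> topspace K" "y \<in> topspace K"
  shows "c x = c y"
proof (rule ccontr)
  assume ne: "c x \<noteq> c y"
  have op: "openin K {y \<in> topspace K. P (c y)}" for P
  proof (subst openin_subopen, clarify)
    fix y assume y: "y \<in> topspace K" "P (c y)"
    obtain U where U: "openin K U" "y \<in> U" "\<forall>z\<in>U. c z = c y" using loc[OF y(1)] by auto
    have "U \<subseteq> {y \<in> topspace K. P (c y)}"
    proof
      fix z assume "z \<in> U"
      then have "c z = c y" "z \<in> topspace K" using U(3) openin_subset[OF U(1)] by blast+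
      then show "z \<in> {y \<in> topspace K. P (c y)}" using y(2) by simp
    qed
    then show "\<exists>T. openin K T \<and> y \<in> T \<and> T \<subseteq> {y \<in> topspace K. P (c y)}"
      using U(1,2) by blast
  qed
  let ?E = "{z \<in> topspace K. c z = c x}" and ?F = "{z \<in> topspace K. c z \<noteq> c x}"
  have "topspace K \<subseteq> ?E \<union> ?F" "?E \<inter> ?F = {}" "?E \<noteq> {}" "?F \<noteq> {}"
    using xy ne by auto
  then show False
    using K op[of "\<lambda>g. g = c x"] op[of "\<lambda>g. g \<noteq> c x"] unfolding connected_space_def by meson
qed

section \<open>Topologies given by a nearness relation\<close>

definition nearness_topology :: "'a set \<Rightarrow> (real \<Rightarrow> 'a \<Rightarrow> 'a \<Rightarrow> bool) \<Rightarrow> 'a topology"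
  where "nearness_topology M R = topology (\<lambda>U. U \<subseteq> M \<and> (\<forall>x\<in>U. \<exists>e>0. \<forall>y\<in>M. R e x y \<longrightarrow> y \<in> U))"

text \<open>A relation with a radius takes the place of a distance function: for orbits, nearness is
  the existence of a suitable translation, which avoids an infimum over the group.\<close>

locale nearness =
  fixes M :: "'a set" and R :: "real \<Rightarrow> 'a \<Rightarrow> 'a \<Rightarrow> bool"
  assumes near_mono: "R d x y \<Longrightarrow> d \<le> e \<Longrightarrow> R e x y"
    and near_refl: "x \<in> M \<Longrightarrow> 0 < e \<Longrightarrow> R e x x"
    and near_trans: "x \<in> M \<Longrightarrow> y \<in> M \<Longrightarrow> z \<in> M \<Longrightarrow> R d x y \<Longrightarrow> R e y z \<Longrightarrow> R (d + e) x z"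
begin

lemma openin_nearness_topology:
  "openin (nearness_topology M R) U \<longleftrightarrow> U \<subseteq> M \<and> (\<forall>x\<in>U. \<exists>e>0. \<forall>y\<in>M. R e x y \<longrightarrow> y \<in> U)"
proof -
  have "\<exists>e>0. \<forall>y\<in>M. R e x y \<longrightarrow> y \<in> U \<inter> V"
    if "\<exists>e>0. \<forall>y\<in>M. R e x y \<longrightarrow> y \<in> U" "\<exists>e>0. \<forall>y\<in>M. R e x y \<longrightarrow> y \<in> V" for x U V
  proof -
    from that obtain d e where "d > 0" "\<forall>y\<in>M. R d x y \<longrightarrow> y \<in> U" "e > 0" "\<forall>y\<in>M. R e x y \<longrightarrow> y \<in> V"
      by blast
    then have "min d e > 0 \<and> (\<forall>y\<in>M. R (min d e) x y \<longrightarrow> y \<in> U \<inter> V)"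
      using near_mono[of "min d e" x _ d] near_mono[of "min d e" x _ e] by auto
    then show ?thesis by blast
  qed
  then have "istopology (\<lambda>U. U \<subseteq> M \<and> (\<forall>x\<in>U. \<exists>e>0. \<forall>y\<in>M. R e x y \<longrightarrow> y \<in> U))"
    unfolding istopology_def by auto (metis UnionI)+
  then show ?thesis
    by (simp add: nearness_topology_def topology_inverse')
qed

lemma topspace_nearness_topology [simp]: "topspace (nearness_topology M R) = M"
proof (rule antisym)
  show "topspace (nearness_topology M R) \<subseteq> M"
    using openin_nearness_topology openin_topspace by blast
  have "openin (nearness_topology M R) M"
    by (auto simp: openin_nearness_topology intro: exI[of _ 1])
  then show "M \<subseteq> topspace (nearness_topology M R)" by (rule openin_subset)
qed

lemma near_neighbourhood:
  assumes "x \<in> M" "0 < e"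
  shows "\<exists>U. openin (nearness_topology M R) U \<and> x \<in> U \<and> (\<forall>y\<in>U. R e x y)"
proof -
  \<comment> \<open>The interior of the \<open>e\<close>-ball. As \<open>near_trans\<close> adds
    radii, halving \<open>d\<close> keeps the neighbours of a point of \<open>U\<close> inside
    \<open>U\<close>.\<close>
  define U where "U = {y\<in>M. \<exists>d>0. \<forall>z\<in>M. R d y z \<longrightarrow> R e x z}"
  have "openin (nearness_topology M R) U"
    unfolding openin_nearness_topology
  proof (intro conjI ballI)
    fix y assume "y \<in> U"
    then obtain d where d: "y \<in> M" "d > 0" "\<And>z. z \<in> M \<Longrightarrow> R d y z \<Longrightarrow> R e x z"
      by (auto simp: U_def)
    have "y' \<in> U" if y': "y' \<in> M" "R (d/2) y y'" for y'
    proof -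
      have "R e x z" if "z \<in> M" "R (d/2) y' z" for z
        using near_trans[OF d(1) y'(1) that(1) y'(2) that(2)] d that by simp
      then show ?thesis using y' d unfolding U_def by (auto intro!: exI[of _ "d/2"])
    qed
    then show "\<exists>e>0. \<forall>y'\<in>M. R e y y' \<longrightarrow> y' \<in> U" using d by (intro exI[of _ "d/2"]) auto
  qed (auto simp: U_def)
  moreover have "x \<in> U" using assms by (auto simp: U_def)
  moreover have "R e x y" if "y \<in> U" for y
    using that near_refl unfolding U_def by auto
  ultimately show ?thesis by blast
qed

lemma continuous_map_nearness:
  "continuous_map T (nearness_topology M R) f \<longleftrightarrow>
    f \<in> topspace T \<rightarrow> M \<and>
    (\<forall>x\<in>topspace T. \<forall>e>0. \<exists>U. openin T U \<and> x \<in> U \<and> (\<forall>y\<in>U. R e (f x) (f y)))"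
  (is "?L \<longleftrightarrow> ?R")
proof
  assume L: ?L
  then have M: "f \<in> topspace T \<rightarrow> M" by (auto simp: continuous_map_def)
  moreover have "\<exists>U. openin T U \<and> x \<in> U \<and> (\<forall>y\<in>U. R e (f x) (f y))"
    if x: "x \<in> topspace T" and "e > 0" for x e
  proof -
    obtain U where "openin (nearness_topology M R) U" "f x \<in> U" "\<forall>y\<in>U. R e (f x) y"
      using near_neighbourhood[of "f x" e] M x \<open>e > 0\<close> by blast
    then show ?thesis
      using L x by (intro exI[of _ "{x \<in> topspace T. f x \<in> U}"]) (auto simp: continuous_map_def)
  qed
  ultimately show ?R by blast
next
  assume R: ?R
  show ?L
    unfolding continuous_map_def
  proof (intro conjI allI impI)
    show "f \<in> topspace T \<rightarrow> topspace (nearness_topology M R)" using R by simp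
    fix U assume U: "openin (nearness_topology M R) U"
    show "openin T {x \<in> topspace T. f x \<in> U}"
    proof (subst openin_subopen, intro ballI)
      fix x assume x: "x \<in> {x \<in> topspace T. f x \<in> U}"
      then obtain e where e: "e > 0" "\<And>y. y \<in> M \<Longrightarrow> R e (f x) y \<Longrightarrow> y \<in> U"
        using U unfolding openin_nearness_topology by blast
      then obtain V where V: "openin T V" "x \<in> V" "\<And>y. y \<in> V \<Longrightarrow> R e (f x) (f y)"
        using R[THEN conjunct2, rule_format, of x e] x by auto
      have "V \<subseteq> {x \<in> topspace T. f x \<in> U}"
      proof
        fix y assume "y \<in> V"
        then show "y \<in> {x \<in> topspace T. f x \<in> U}"
          using R[THEN conjunct1] e(2)[OF _ V(3)[of y]] openin_subset[OF V(1)] by auto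
      qed
      then show "\<exists>V. openin T V \<and> x \<in> V \<and> V \<subseteq> {x \<in> topspace T. f x \<in> U}"
        using V by blast
    qed
  qed
qed

end

text \<open>Finite range with measurable level sets replaces a measurable structure on the group,
  and the class is stable under translating, cutting and pointwise products. Values outside
  \<open>[0,1)\<close> are invisible to \<open>step_dist\<close>, which is therefore only a
  pseudometric.\<close>

definition step_functions :: "('g, 'h) monoid_scheme \<Rightarrow> (real \<Rightarrow> 'g) set"
  where "step_functions G =
    {x. range x \<subseteq> carrier G \<and> finite (range x) \<and> (\<forall>g. {t. x t = g} \<in> sets lborel)}"

definition step_dist :: "(real \<Rightarrow> 'g) \<Rightarrow> (real \<Rightarrow> 'g) \<Rightarrow> real"
  where "step_dist x y = measure lborel {t \<in> {0..<1}. x t \<noteq> y t}"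

definition translate :: "('g, 'h) monoid_scheme \<Rightarrow> 'g \<Rightarrow> (real \<Rightarrow> 'g) \<Rightarrow> real \<Rightarrow> 'g"
  where "translate G g x = (\<lambda>t. g \<otimes>\<^bsub>G\<^esub> x t)"

text \<open>Step functions on \<open>[0,1)\<close> form a contractible space with a free action of \<open>G\<close>, so the
  orbit space is a classifying space. Instead of the quotient we take its topology pulled back to
  the step functions; continuous maps into it have lifts up to translations.\<close>

definition step_topology :: "('g, 'h) monoid_scheme \<Rightarrow> (real \<Rightarrow> 'g) topology"
  where "step_topology G = nearness_topology (step_functions G) (\<lambda>e x y. step_dist x y < e)"

definition orbit_topology :: "('g, 'h) monoid_scheme \<Rightarrow> (real \<Rightarrow> 'g) topology"
  where "orbit_topology G = nearness_topology (step_functions G)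
    (\<lambda>e x y. \<exists>g\<in>carrier G. step_dist x (translate G g y) < e)"

lemma step_differ_measurable:
  assumes "x \<in> step_functions G" "y \<in> step_functions G"
  shows "{t \<in> {0..<1::real}. x t \<noteq> y t} \<in> sets lborel"
proof -
  have "{t \<in> {0..<1}. x t \<noteq> y t} = {0..<1} - (\<Union>g\<in>range x. {t. x t = g} \<inter> {t. y t = g})"
    by auto
  moreover have "(\<Union>g\<in>range x. {t. x t = g} \<inter> {t. y t = g}) \<in> sets lborel"
    using assms by (intro sets.finite_UN sets.Int) (auto simp: step_functions_def)
  ultimately show ?thesis using sets.Diff[of "{0..<1::real}" lborel] by simp
qed

lemma unit_interval_subset_fmeasurable:
  assumes "A \<in> sets lborel" "A \<subseteq> {0..<1::real}"
  shows "A \<in> fmeasurable lborel"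
  by (rule fmeasurableI2[OF _ assms(2,1)]) (simp add: fmeasurable_def)

lemma step_dist_refl [simp]: "step_dist x x = 0"
  by (simp add: step_dist_def)

lemma step_dist_sym: "step_dist x y = step_dist y x"
  by (simp add: step_dist_def eq_commute)

lemma step_dist_triangle:
  assumes "x \<in> step_functions G" "y \<in> step_functions G" "z \<in> step_functions G"
  shows "step_dist x z \<le> step_dist x y + step_dist y z"
proof -
  let ?D = "\<lambda>x y. {t \<in> {0..<1::real}. x t \<noteq> y t}"
  have "measure lborel (?D x z) \<le> measure lborel (?D x y \<union> ?D y z)"
    using step_differ_measurable[OF assms(1,2)] step_differ_measurable[OF assms(2,3)]
      step_differ_measurable[OF assms(1,3)]
    by (intro measure_mono_fmeasurable unit_interval_subset_fmeasurable) auto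
  also have "\<dots> \<le> measure lborel (?D x y) + measure lborel (?D y z)"
    using step_differ_measurable[OF assms(1,2)] step_differ_measurable[OF assms(2,3)]
    by (intro measure_Un_le) auto
  finally show ?thesis by (simp add: step_dist_def)
qed

lemma step_dist_le_interval:
  assumes "\<And>t. t \<in> {0..<1} \<Longrightarrow> x t \<noteq> y t \<Longrightarrow> t \<in> {a..b}" "a \<le> b"
    and "x \<in> step_functions G" "y \<in> step_functions G"
  shows "step_dist x y \<le> b - a"
proof -
  have "step_dist x y \<le> measure lborel {a..b}"
    unfolding step_dist_def
    using assms step_differ_measurable[OF assms(3,4)]
    by (intro measure_mono_fmeasurable) (auto simp: fmeasurable_def)
  then show ?thesis using assms by simp
qed

context group
begin

lemma translate_step_functions [intro, simp]:
  assumes "g \<in> carrier G" "x \<in> step_functions G"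
  shows "translate G g x \<in> step_functions G"
proof -
  have "range (translate G g x) = (\<lambda>h. g \<otimes> h) ` range x"
    by (auto simp: translate_def)
  moreover have "{t. translate G g x t = h} \<in> sets lborel" for h
  proof (cases "h \<in> carrier G")
    case True
    then have "{t. translate G g x t = h} = {t. x t = inv g \<otimes> h}"
    proof -
      have "x t \<in> carrier G" for t using assms by (auto simp: step_functions_def)
      then show ?thesis
        using True assms(1) by (auto simp: translate_def inv_solve_left)
    qed
    then show ?thesis using assms by (simp add: step_functions_def)
  next
    case False
    then have "{t. translate G g x t = h} = {}"
      using assms by (auto simp: translate_def step_functions_def)
    then show ?thesis by simp
  qed
  ultimately show ?thesis
    using assms by (auto simp: step_functions_def)
qed

lemma step_in_carrier [intro, simp]: "x \<in> step_functions G \<Longrightarrow> x t \<in> carrier G"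
  by (auto simp: step_functions_def)

lemma translate_one [simp]: "x \<in> step_functions G \<Longrightarrow> translate G \<one> x = x"
  by (auto simp: translate_def)

lemma translate_translate:
  "\<lbrakk>g \<in> carrier G; h \<in> carrier G; x \<in> step_functions G\<rbrakk> \<Longrightarrow>
    translate G g (translate G h x) = translate G (g \<otimes> h) x"
  by (auto simp: translate_def m_assoc)

lemma translate_inv_cancel:
  assumes "g \<in> carrier G" "x \<in> step_functions G"
  shows "translate G (inv g) (translate G g x) = x" "translate G g (translate G (inv g) x) = x"
  using assms by (simp_all add: translate_translate)

lemma step_dist_translate [simp]:
  assumes "g \<in> carrier G" "x \<in> step_functions G" "y \<in> step_functions G"
  shows "step_dist (translate G g x) (translate G g y) = step_dist x y"
  using assms by (simp add: step_dist_def translate_def)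

lemma step_dist_translate_left:
  assumes "g \<in> carrier G" "x \<in> step_functions G" "y \<in> step_functions G"
  shows "step_dist (translate G g x) y = step_dist x (translate G (inv g) y)"
  using step_dist_translate[of "inv g" "translate G g x" y] assms
  by (simp add: translate_inv_cancel)

text \<open>The action is free in a strong sense: by cancellation \<open>g \<otimes> x t\<close> and
  \<open>h \<otimes> x t\<close> differ at every time \<open>t\<close>. This gap of 1 is what makes
  lifts rigid.\<close>

lemma step_dist_translate_distinct:
  assumes "g \<in> carrier G" "h \<in> carrier G" "x \<in> step_functions G" "g \<noteq> h"
  shows "step_dist (translate G g x) (translate G h x) = 1"
proof -
  have "{t \<in> {0..<1}. translate G g x t \<noteq> translate G h x t} = {0..<1::real}"
    using assms by (auto simp: translate_def)
  then show ?thesis by (simp add: step_dist_def)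
qed

lemma translate_inject:
  assumes "step_dist (translate G g x) (translate G h x) < 1"
    and "g \<in> carrier G" "h \<in> carrier G" "x \<in> step_functions G"
  shows "g = h"
  using step_dist_translate_distinct[of g h x] assms by auto

sublocale step: nearness "step_functions G" "\<lambda>e x y. step_dist x y < e"
proof
  fix x y z :: "real \<Rightarrow> 'a" and d e
  assume "x \<in> step_functions G" "y \<in> step_functions G" "z \<in> step_functions G"
    and "step_dist x y < d" "step_dist y z < e"
  then show "step_dist x z < d + e" using step_dist_triangle[of x G y z] by simp
qed auto

sublocale orbit: nearness "step_functions G"
  "\<lambda>e x y. \<exists>g\<in>carrier G. step_dist x (translate G g y) < e"
proof
  fix x y z d e
  assume *: "x \<in> step_functions G" "y \<in> step_functions G" "z \<in> step_functions G"
    and "\<exists>g\<in>carrier G. step_dist x (translate G g y) < d"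
    and "\<exists>g\<in>carrier G. step_dist y (translate G g z) < e"
  then obtain g h where gh: "g \<in> carrier G" "step_dist x (translate G g y) < d"
    "h \<in> carrier G" "step_dist y (translate G h z) < e" by blast
  have "step_dist x (translate G g (translate G h z)) \<le> step_dist x (translate G g y) +
    step_dist (translate G g y) (translate G g (translate G h z))"
    using * gh by (intro step_dist_triangle[of _ G]) auto
  also have "\<dots> < d + e" using * gh by simp
  finally show "\<exists>g\<in>carrier G. step_dist x (translate G g z) < d + e"
    using * gh by (auto simp: translate_translate)
next
  fix d x y e
  assume "\<exists>g\<in>carrier G. step_dist x (translate G g y) < d" "d \<le> e"
  then show "\<exists>g\<in>carrier G. step_dist x (translate G g y) < e" by force
qed (auto intro!: bexI[of _ \<one>])

lemma topspace_step_topology [simp]: "topspace (step_topology G) = step_functions G"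
  and topspace_orbit_topology [simp]: "topspace (orbit_topology G) = step_functions G"
  by (simp_all add: step_topology_def orbit_topology_def)

lemmas continuous_map_step = step.continuous_map_nearness[folded step_topology_def]
lemmas continuous_map_orbit = orbit.continuous_map_nearness[folded orbit_topology_def]

text \<open>Translations are invisible to the orbit topology, so the translating elements may be
  picked pointwise, without continuity. In this way a continuous family of step functions certifies
  a discontinuous choice of orbit representatives.\<close>

lemma continuous_map_orbit_translates:
  assumes "continuous_map T (orbit_topology G) F"
    and "\<And>x. x \<in> topspace T \<Longrightarrow> f x \<in> step_functions G"
    and "\<And>x. x \<in> topspace T \<Longrightarrow> \<exists>g\<in>carrier G. F x = translate G g (f x)"
  shows "continuous_map T (orbit_topology G) f"
proof -
  have "\<exists>U. openin T U \<and> x \<in> U \<and> (\<forall>y\<in>U. \<exists>g\<in>carrier G. step_dist (f x) (translate G g (f y)) < e)"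
    if x: "x \<in> topspace T" and "e > 0" for x e
  proof -
    obtain U where U: "openin T U" "x \<in> U"
      "\<And>y. y \<in> U \<Longrightarrow> \<exists>g\<in>carrier G. step_dist (F x) (translate G g (F y)) < e"
      using assms(1) x \<open>e > 0\<close> unfolding continuous_map_orbit by meson
    obtain a where a: "a \<in> carrier G" "F x = translate G a (f x)" using assms x by blast
    have "\<exists>g\<in>carrier G. step_dist (f x) (translate G g (f y)) < e" if yU: "y \<in> U" for y
    proof -
      have y: "y \<in> topspace T" using yU openin_subset[OF U(1)] by blast
      obtain b where b: "b \<in> carrier G" "F y = translate G b (f y)" using assms y by blast
      obtain g where g: "g \<in> carrier G" "step_dist (F x) (translate G g (F y)) < e"
        using U(3)[OF yU] by blast
      have "step_dist (f x) (translate G (inv a \<otimes> g \<otimes> b) (f y)) < e"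
        using g a b assms(2)[OF x] assms(2)[OF y]
        by (simp add: step_dist_translate_left translate_translate m_assoc)
      then show ?thesis using a b g by blast
    qed
    then show ?thesis using U by blast
  qed
  then show ?thesis using assms(2) by (simp add: continuous_map_orbit)
qed

lemma continuous_map_step_imp_orbit:
  "continuous_map T (step_topology G) f \<Longrightarrow> continuous_map T (orbit_topology G) f"
proof -
  assume f: "continuous_map T (step_topology G) f"
  show ?thesis
    unfolding continuous_map_orbit
  proof (intro conjI ballI allI impI)
    show "f \<in> topspace T \<rightarrow> step_functions G" using f by (simp add: continuous_map_step)
    fix x and e :: real assume "x \<in> topspace T" "0 < e"
    then obtain U where U: "openin T U" "x \<in> U" "\<forall>y\<in>U. step_dist (f x) (f y) < e"
      using f[unfolded continuous_map_step] by blast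
    have "step_dist (f x) (translate G \<one> (f y)) < e" if "y \<in> U" for y
      using U that openin_subset[OF U(1)] f by (subst translate_one) (auto simp: continuous_map_step)
    then show "\<exists>U. openin T U \<and> x \<in> U \<and> (\<forall>y\<in>U. \<exists>g\<in>carrier G. step_dist (f x) (translate G g (f y)) < e)"
      using U by blast
  qed
qed

text \<open>Closed sets are unions of orbits. Hence maps that agree only up to translation, as they
  do on the boundaries of cells, can still be pasted.\<close>

lemma closedin_orbit_translate:
  assumes "closedin (orbit_topology G) C" "x \<in> step_functions G" "g \<in> carrier G"
  shows "translate G g x \<in> C \<longleftrightarrow> x \<in> C"
proof -
  have op: "openin (orbit_topology G) (step_functions G - C)"
    using assms(1) by (simp add: closedin_def)
  have "translate G h y \<in> step_functions G - C" if "y \<in> step_functions G - C" "h \<in> carrier G" for y h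
  proof -
    have "\<exists>e>0. \<forall>z\<in>step_functions G. (\<exists>g\<in>carrier G. step_dist y (translate G g z) < e)
      \<longrightarrow> z \<in> step_functions G - C"
      using op that(1) unfolding orbit_topology_def orbit.openin_nearness_topology by blast
    then obtain e where e: "e > 0" "\<forall>z\<in>step_functions G.
      (\<exists>g\<in>carrier G. step_dist y (translate G g z) < e) \<longrightarrow> z \<in> step_functions G - C"
      by blast
    have "step_dist y (translate G (inv h) (translate G h y)) < e"
      using that e by (simp add: translate_inv_cancel)
    then show ?thesis
      using e(2) that by (meson DiffD1 inv_closed translate_step_functions)
  qed
  from this[of x g] this[of "translate G g x" "inv g"] show ?thesis
    using assms by (auto simp: translate_inv_cancel)
qed

text \<open>The translates of a step function have distance 1 from each other, so two lifts of the same
  map can only differ by a locally constant factor.\<close>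

lemma lift_unique:
  assumes K: "connected_space K"
    and F: "continuous_map K (step_topology G) (\<lambda>x. translate G (a x) (f x))"
      "continuous_map K (step_topology G) (\<lambda>x. translate G (b x) (f x))"
    and ab: "\<And>x. x \<in> topspace K \<Longrightarrow> a x \<in> carrier G" "\<And>x. x \<in> topspace K \<Longrightarrow> b x \<in> carrier G"
    and f: "\<And>x. x \<in> topspace K \<Longrightarrow> f x \<in> step_functions G"
    and xy: "x \<in> topspace K" "y \<in> topspace K"
  shows "b x \<otimes> inv (a x) = b y \<otimes> inv (a y)"
proof -
  let ?c = "\<lambda>x. b x \<otimes> inv (a x)"
  have loc: "\<exists>U. openin K U \<and> x \<in> U \<and> (\<forall>y\<in>U. ?c y = ?c x)" if x: "x \<in> topspace K" for x
  proof -
    obtain U where U: "openin K U" "x \<in> U"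
      "\<And>y. y \<in> U \<Longrightarrow> step_dist (translate G (a x) (f x)) (translate G (a y) (f y)) < 1/2"
      using F(1)[unfolded continuous_map_step, THEN conjunct2, rule_format, OF x, of "1/2"] by auto
    obtain V where V: "openin K V" "x \<in> V"
      "\<And>y. y \<in> V \<Longrightarrow> step_dist (translate G (b x) (f x)) (translate G (b y) (f y)) < 1/2"
      using F(2)[unfolded continuous_map_step, THEN conjunct2, rule_format, OF x, of "1/2"] by auto
    have eq: "?c y = ?c x" if "y \<in> U \<inter> V" for y
    proof -
      have y: "y \<in> topspace K" using that openin_subset[OF U(1)] by blast
      note s = ab[OF x] ab[OF y] f[OF x] f[OF y]
      have ya: "translate G (a y) (f y) \<in> step_functions G" using s by simp
      \<comment> \<open>Both elements are close to the second lift at \<open>x\<close>: one because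
        the first lift moves by less than 1/2 between \<open>x\<close> and \<open>y\<close>, the
        other because the second lift does.\<close>
      have "step_dist (translate G (?c x) (translate G (a y) (f y)))
          (translate G (?c y) (translate G (a y) (f y))) \<le>
        step_dist (translate G (?c x) (translate G (a y) (f y))) (translate G (b x) (f x)) +
        step_dist (translate G (b x) (f x)) (translate G (?c y) (translate G (a y) (f y)))"
        using s ya by (intro step_dist_triangle[of _ G]) auto
      also have "translate G (?c y) (translate G (a y) (f y)) = translate G (b y) (f y)"
        using s by (simp add: translate_translate m_assoc)
      also have "translate G (b x) (f x) = translate G (?c x) (translate G (a x) (f x))"
        using s by (simp add: translate_translate m_assoc)
      also have "step_dist (translate G (?c x) (translate G (a y) (f y))) (translate G (?c x) (translate G (a x) (f x)))
        = step_dist (translate G (a x) (f x)) (translate G (a y) (f y))"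
        using s by (subst step_dist_translate) (auto simp: step_dist_sym)
      also have "translate G (?c x) (translate G (a x) (f x)) = translate G (b x) (f x)"
        using s by (simp add: translate_translate m_assoc)
      also have "step_dist (translate G (a x) (f x)) (translate G (a y) (f y)) +
        step_dist (translate G (b x) (f x)) (translate G (b y) (f y)) < 1"
        using U(3)[of y] V(3)[of y] that by simp
      finally have "step_dist (translate G (?c x) (translate G (a y) (f y)))
          (translate G (?c y) (translate G (a y) (f y))) < 1"
        using s by (simp add: translate_translate m_assoc)
      then show ?thesis
        using translate_inject[of "?c x" "translate G (a y) (f y)" "?c y"] s by simp
    qed
    have "openin K (U \<inter> V) \<and> x \<in> U \<inter> V \<and> (\<forall>y\<in>U \<inter> V. ?c y = ?c x)"
      using U(1,2) V(1,2) eq by blast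
    then show ?thesis by blast
  qed
  show ?thesis
    by (rule connected_space_locally_constant[OF K loc xy])
qed

end

section \<open>Existence of lifts over contractible compact spaces\<close>

context group
begin

text \<open>\<open>F\<close> is a reference map that already takes values in step functions. Over
  each point the translate of \<open>f\<close> within 1/4 of \<open>F\<close> is unique, and it
  varies continuously because four errors of 1/4 still add up to less than the gap 1.\<close>

lemma lift_nearby:
  assumes F: "continuous_map K (step_topology G) F" and f: "continuous_map K (orbit_topology G) f"
    and near: "\<And>x. x \<in> topspace K \<Longrightarrow> \<exists>g\<in>carrier G. step_dist (F x) (translate G g (f x)) < 1/4"
  shows "\<exists>g. (\<forall>x\<in>topspace K. g x \<in> carrier G) \<and>
    continuous_map K (step_topology G) (\<lambda>x. translate G (g x) (f x))"
proof -
  obtain g where g: "\<And>x. x \<in> topspace K \<Longrightarrow> g x \<in> carrier G"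
    "\<And>x. x \<in> topspace K \<Longrightarrow> step_dist (F x) (translate G (g x) (f x)) < 1/4"
    using near by metis
  have Fs: "F x \<in> step_functions G" "f x \<in> step_functions G" if "x \<in> topspace K" for x
    using F f that by (auto simp: continuous_map_step continuous_map_orbit)
  have "\<exists>U. openin K U \<and> x \<in> U \<and>
      (\<forall>y\<in>U. step_dist (translate G (g x) (f x)) (translate G (g y) (f y)) < e)"
    if x: "x \<in> topspace K" and e: "e > 0" for x e
  proof -
    obtain U where U: "openin K U" "x \<in> U" "\<And>y. y \<in> U \<Longrightarrow> step_dist (F x) (F y) < 1/4"
      using F[unfolded continuous_map_step, THEN conjunct2, rule_format, OF x, of "1/4"] by auto
    obtain V where V: "openin K V" "x \<in> V"
      "\<And>y. y \<in> V \<Longrightarrow> \<exists>k\<in>carrier G. step_dist (f x) (translate G k (f y)) < min e (1/4)"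
      using f[unfolded continuous_map_orbit, THEN conjunct2, rule_format, OF x, of "min e (1/4)"] e
      by auto
    have "step_dist (translate G (g x) (f x)) (translate G (g y) (f y)) < e" if yU: "y \<in> U \<inter> V" for y
    proof -
      have y: "y \<in> topspace K" using yU openin_subset[OF U(1)] by blast
      obtain k where k: "k \<in> carrier G" "step_dist (f x) (translate G k (f y)) < min e (1/4)"
        using V(3)[of y] yU by blast
      let ?k = "g x \<otimes> k"
      note s = Fs[OF x] Fs[OF y] g(1)[OF x] g(1)[OF y] k(1)
      have sk: "translate G ?k (f y) \<in> step_functions G" "translate G (g x) (f x) \<in> step_functions G"
        "translate G (g y) (f y) \<in> step_functions G" using s by auto
      have 1: "step_dist (translate G (g x) (f x)) (translate G ?k (f y)) < min e (1/4)"
        using k s step_dist_translate[of "g x" "f x" "translate G k (f y)"]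
        by (simp add: translate_translate)
      have "step_dist (translate G ?k (f y)) (translate G (g y) (f y)) \<le>
        step_dist (translate G ?k (f y)) (translate G (g x) (f x)) +
        (step_dist (translate G (g x) (f x)) (F x) + (step_dist (F x) (F y) +
        step_dist (F y) (translate G (g y) (f y))))"
        using step_dist_triangle[OF sk(1) sk(2) sk(3)] step_dist_triangle[OF sk(2) s(1) sk(3)]
          step_dist_triangle[OF s(1) s(3) sk(3)] by linarith
      also have "\<dots> < 1"
        using 1 g(2)[OF x] g(2)[OF y] U(3)[of y] yU
        by (simp add: step_dist_sym[of "translate G ?k (f y)"] step_dist_sym[of _ "F x"]) 
      finally have "?k = g y"
        by (rule translate_inject) (use s in auto)
      then show ?thesis using 1 by simp
    qed
    then have "openin K (U \<inter> V) \<and> x \<in> U \<inter> V \<and> (\<forall>y\<in>U \<inter> V.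
      step_dist (translate G (g x) (f x)) (translate G (g y) (f y)) < e)"
      using U(1,2) V(1,2) by blast
    then show ?thesis by blast
  qed
  moreover have "translate G (g x) (f x) \<in> step_functions G" if "x \<in> topspace K" for x
    using that g(1) Fs(2) by simp
  ultimately have "continuous_map K (step_topology G) (\<lambda>x. translate G (g x) (f x))"
    by (simp add: continuous_map_step)
  then show ?thesis using g(1) by blast
qed

text \<open>A Lebesgue number argument on the compact product of the interval with \<open>K\<close>,
  phrased for orbit nearness.\<close>

lemma orbit_uniformly_continuous_in_time:
  assumes K: "compact_space K"
    and f: "continuous_map (prod_topology (top_of_set {0..1::real}) K) (orbit_topology G) f"
    and e: "e > 0"
  shows "\<exists>d>0. \<forall>x\<in>topspace K. \<forall>t\<in>{0..1}. \<forall>t'\<in>{0..1}. \<bar>t - t'\<bar> < d \<longrightarrow>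
    (\<exists>g\<in>carrier G. step_dist (f (t, x)) (translate G g (f (t', x))) < e)"
proof -
  let ?I = "top_of_set {0..1::real}" and ?P = "prod_topology (top_of_set {0..1::real}) K"
  let ?near = "\<lambda>e p q. \<exists>g\<in>carrier G. step_dist (f p) (translate G g (f q)) < e"
  have fs: "f p \<in> step_functions G" if "p \<in> topspace ?P" for p
    using f that by (auto simp: continuous_map_orbit)
  have near_sym: "?near e q p" if pq: "?near e p q" "p \<in> topspace ?P" "q \<in> topspace ?P" for e p q
  proof -
    obtain g where g: "g \<in> carrier G" "step_dist (f p) (translate G g (f q)) < e" using pq by blast
    have "step_dist (f q) (translate G (inv g) (f p)) = step_dist (f p) (translate G g (f q))"
      using g fs[OF pq(2)] fs[OF pq(3)]
      by (metis step_dist_sym step_dist_translate_left)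
    then show ?thesis using g by (metis inv_closed)
  qed
  \<comment> \<open>Nearness is required for times up to \<open>2 * r\<close> while the covering
    boxes have radius \<open>r\<close>: a time closer than \<open>d \<le> r\<close> to a time of the
    box is then still controlled from the same centre.\<close>
  define Q where "Q = (\<lambda>(t, x) r U. r > 0 \<and> openin K U \<and> x \<in> U \<and>
    (\<forall>s\<in>{0..1}. \<bar>s - t\<bar> < 2 * r \<longrightarrow> (\<forall>y\<in>U. ?near (e/2) (t, x) (s, y))))"
  define I where "I = {(t, x, r, U). t \<in> {0..1} \<and> x \<in> topspace K \<and> Q (t, x) r U}"
  define box where "box = (\<lambda>(t::real, x::'c, r, U). ({0..1} \<inter> ball t r) \<times> (U :: 'c set))"
  have ex: "\<exists>r U. Q (t, x) r U" if "t \<in> {0..1}" "x \<in> topspace K" for t x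
  proof -
    have "(t, x) \<in> topspace ?P" "e/2 > 0" using that e by auto
    then obtain W where W: "openin ?P W" "(t, x) \<in> W" "\<forall>p\<in>W. ?near (e/2) (t, x) p"
      using f[unfolded continuous_map_orbit] by blast
    then obtain J U where J: "openin ?I J" "openin K U" "t \<in> J" "x \<in> U" "J \<times> U \<subseteq> W"
      using openin_prod_topology_alt[of ?I K W] by blast
    obtain r where r: "r > 0" "\<And>s. s \<in> {0..1} \<Longrightarrow> dist s t < r \<Longrightarrow> s \<in> J"
      using J(1,3) unfolding openin_euclidean_subtopology_iff by blast
    have "s \<in> J" if "s \<in> {0..1}" "\<bar>s - t\<bar> < 2 * (r/2)" for s
      using r(2)[of s] that by (simp add: dist_real_def)
    then have "?near (e/2) (t, x) (s, y)" if "s \<in> {0..1}" "\<bar>s - t\<bar> < 2 * (r/2)" "y \<in> U" for s y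
      using that J(5) W(3) by blast
    then have "Q (t, x) (r/2) U"
      using r(1) J(2,4) unfolding Q_def by auto
    then show ?thesis by blast
  qed
  have "compactin ?P (topspace ?P)"
    using K unfolding compact_space_def[symmetric]
    by (simp add: compact_space_prod_topology compact_space_subtopology)
  moreover have "openin ?P W" if "W \<in> box ` I" for W
  proof -
    obtain t x r U where W: "W = ({0..1} \<inter> ball t r) \<times> U" "Q (t, x) r U"
      using \<open>W \<in> box ` I\<close> unfolding I_def box_def by auto
    have "openin K U" using W(2) by (simp add: Q_def)
    moreover have "openin ?I ({0..1} \<inter> ball t r)" by (simp add: openin_open_Int)
    ultimately show "openin ?P W" unfolding W(1) by (simp add: openin_prod_Times_iff)
  qed
  moreover have "p \<in> \<Union>(box ` I)" if "p \<in> topspace ?P" for p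
  proof -
    obtain t x where p: "p = (t, x)" "t \<in> {0..1}" "x \<in> topspace K" using \<open>p \<in> topspace ?P\<close> by auto
    obtain r U where Q: "Q (t, x) r U" using ex[OF p(2,3)] by blast
    have "(t, x, r, U) \<in> I" using p Q by (simp add: I_def)
    moreover have "r > 0" "x \<in> U" using Q by (simp_all add: Q_def)
    then have "p \<in> box (t, x, r, U)" using p by (simp add: box_def)
    ultimately show ?thesis by (rule UN_I)
  qed
  ultimately obtain D where D: "finite D" "D \<subseteq> box ` I" "topspace ?P \<subseteq> \<Union>D"
    unfolding compactin_def by (meson subsetI)
  obtain J where J: "finite J" "J \<subseteq> I" "D = box ` J"
    using finite_subset_image[OF D(1,2)] by blast
  define d where "d = Min (insert 1 ((\<lambda>(t, x, r, U). r) ` J))"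
  have Jd: "t \<in> {0..1}" "x \<in> topspace K" "Q (t, x) r U" "r > 0" "d \<le> r" if "(t, x, r, U) \<in> J" for t x r U
  proof -
    have "(t, x, r, U) \<in> I" using J(2) that by blast
    then show "t \<in> {0..1}" "x \<in> topspace K" "Q (t, x) r U" "r > 0" by (auto simp: I_def Q_def)
    show "d \<le> r" unfolding d_def using J(1) that by (intro Min_le) force+
  qed
  have d: "d > 0"
    unfolding d_def using J(1) Jd(4) by (subst Min_gr_iff) auto
  have "?near e (t, x) (t', x)"
    if x: "x \<in> topspace K" and t: "t \<in> {0..1}" "t' \<in> {0..1}" "\<bar>t - t'\<bar> < d" for x t t'
  proof -
    have "(t, x) \<in> topspace ?P" using x t by simp
    then have "(t, x) \<in> \<Union>(box ` J)" using D(3) J(3) by blast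
    then obtain t0 x0 r U where A: "(t0, x0, r, U) \<in> J" "(t, x) \<in> box (t0, x0, r, U)" by auto
    let ?p = "(t0, x0)"
    have inA: "t \<in> ball t0 r" "x \<in> U" using A(2) by (auto simp: box_def)
    have q: "?near (e/2) ?p (s, y)" if "s \<in> {0..1}" "\<bar>s - t0\<bar> < 2 * r" "y \<in> U" for s y
      using Jd(3)[OF A(1)] that unfolding Q_def prod.case by blast
    have 1: "?near (e/2) ?p (t, x)"
      using inA Jd(4)[OF A(1)] t(1) by (intro q) (auto simp: dist_real_def)
    have 2: "?near (e/2) ?p (t', x)"
      using inA t(2,3) Jd(5)[OF A(1)] by (intro q) (auto simp: dist_real_def)
    have p: "?p \<in> topspace ?P" "(t, x) \<in> topspace ?P" "(t', x) \<in> topspace ?P"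
      using Jd(1,2)[OF A(1)] x t by auto
    have "?near (e/2) (t, x) ?p" using near_sym[OF 1 p(1,2)] .
    then show ?thesis
      using orbit.near_trans[OF fs[OF p(2)] fs[OF p(1)] fs[OF p(3)] _ 2, of "e/2"] by simp
  qed
  then show ?thesis using d by blast
qed

text \<open>At time 0 the map \<open>f \<circ> h\<close> is constant, hence lifted by the neutral
  element. \<open>lift_nearby\<close> carries the lift along the contraction in \<open>N\<close>
  short time steps, up to the map \<open>f\<close> at time 1.\<close>

lemma lift_exists:
  assumes K: "compact_space K"
    and h: "continuous_map (prod_topology (top_of_set {0..1::real}) K) K h"
    and h0: "\<And>x. x \<in> topspace K \<Longrightarrow> h (0, x) = a" and a: "a \<in> topspace K"
    and h1: "\<And>x. x \<in> topspace K \<Longrightarrow> h (1, x) = x"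
    and f: "continuous_map K (orbit_topology G) f"
  shows "\<exists>g. (\<forall>x\<in>topspace K. g x \<in> carrier G) \<and>
    continuous_map K (step_topology G) (\<lambda>x. translate G (g x) (f x))"
proof -
  let ?P = "prod_topology (top_of_set {0..1::real}) K"
  have fh: "continuous_map ?P (orbit_topology G) (f \<circ> h)"
    by (rule continuous_map_compose[OF h f])
  obtain d where d: "d > 0" "\<And>x t t'. \<lbrakk>x \<in> topspace K; t \<in> {0..1}; t' \<in> {0..1}; \<bar>t - t'\<bar> < d\<rbrakk> \<Longrightarrow>
    \<exists>g\<in>carrier G. step_dist (f (h (t, x))) (translate G g (f (h (t', x)))) < 1/4"
    using orbit_uniformly_continuous_in_time[OF K fh, of "1/4"] by auto
  obtain N :: nat where N: "0 < N" "1 / real N < d"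
    using d(1) by (metis nat_approx_posE zero_less_Suc)
  have cont: "continuous_map K (orbit_topology G) (\<lambda>x. f (h (t, x)))" if "t \<in> {0..1}" for t
  proof -
    have "continuous_map K ?P (\<lambda>x. (t, x))"
      using that by (simp add: continuous_map_pairwise o_def)
    from continuous_map_compose[OF this fh] show ?thesis by (simp add: o_def)
  qed
  have "\<exists>g. (\<forall>x\<in>topspace K. g x \<in> carrier G) \<and>
    continuous_map K (step_topology G) (\<lambda>x. translate G (g x) (f (h (real j / real N, x))))"
    if "j \<le> N" for j
    using that
  proof (induction j)
    case 0
    have "f a \<in> step_functions G" using f a by (auto simp: continuous_map_orbit)
    then have "continuous_map K (step_topology G) (\<lambda>x. f a)" by simp
    then have "continuous_map K (step_topology G) (\<lambda>x. translate G \<one> (f (h (0, x))))"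
      by (rule continuous_map_eq) (use \<open>f a \<in> step_functions G\<close> h0 in simp)
    then show ?case by (intro exI[of _ "\<lambda>_. \<one>"]) simp
  next
    case (Suc j)
    then obtain g where g: "\<And>x. x \<in> topspace K \<Longrightarrow> g x \<in> carrier G"
      "continuous_map K (step_topology G) (\<lambda>x. translate G (g x) (f (h (real j / real N, x))))"
      by auto
    have t: "real j / real N \<in> {0..1}" "real (Suc j) / real N \<in> {0..1}"
      using Suc.prems N by auto
    show ?case
    proof (rule lift_nearby[OF g(2) cont[OF t(2)]])
      fix x assume x: "x \<in> topspace K"
      have s: "f (h (real j / real N, x)) \<in> step_functions G"
        "f (h (real (Suc j) / real N, x)) \<in> step_functions G"
        using cont[OF t(1)] cont[OF t(2)] x by (auto simp: continuous_map_orbit)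
      have "\<bar>real j / real N - real (Suc j) / real N\<bar> < d"
        using N by (simp add: field_simps)
      then obtain k where k: "k \<in> carrier G"
        "step_dist (f (h (real j / real N, x))) (translate G k (f (h (real (Suc j) / real N, x)))) < 1/4"
        using d(2)[OF x t] by blast
      then have "step_dist (translate G (g x) (f (h (real j / real N, x))))
        (translate G (g x) (translate G k (f (h (real (Suc j) / real N, x))))) < 1/4"
        using g(1)[OF x] s by (subst step_dist_translate) auto
      then show "\<exists>k\<in>carrier G. step_dist (translate G (g x) (f (h (real j / real N, x))))
        (translate G k (f (h (real (Suc j) / real N, x)))) < 1/4"
        using k g(1)[OF x] s by (auto simp: translate_translate)
    qed
  qed
  from this[of N] N(1) obtain g where g: "\<forall>x\<in>topspace K. g x \<in> carrier G"
    "continuous_map K (step_topology G) (\<lambda>x. translate G (g x) (f (h (1, x))))"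
    by auto
  have "continuous_map K (step_topology G) (\<lambda>x. translate G (g x) (f x))"
    by (rule continuous_map_eq[OF g(2)]) (simp add: h1)
  then show ?thesis using g(1) by blast
qed

text \<open>Straight lines to \<open>a\<close> contract \<open>K\<close>. The intended cases are
  simplices and discs.\<close>

lemma lift_exists_starlike:
  fixes K :: "(nat \<Rightarrow> real) set"
  assumes "compactin (powertop_real UNIV) K" "a \<in> K"
    and star: "\<And>x t. \<lbrakk>x \<in> K; 0 \<le> t; t \<le> 1\<rbrakk> \<Longrightarrow> (\<lambda>i. (1 - t) * a i + t * x i) \<in> K"
    and f: "continuous_map (subtopology (powertop_real UNIV) K) (orbit_topology G) f"
  shows "\<exists>g. (\<forall>x\<in>K. g x \<in> carrier G) \<and>
    continuous_map (subtopology (powertop_real UNIV) K) (step_topology G) (\<lambda>x. translate G (g x) (f x))"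
proof -
  let ?K = "subtopology (powertop_real UNIV) K"
  let ?P = "prod_topology (top_of_set {0..1::real}) ?K"
  have c1: "continuous_map ?P euclideanreal fst"
    using continuous_map_fst[of "top_of_set {0..1::real}" ?K] by (simp add: continuous_map_in_subtopology)
  have c2: "continuous_map ?P euclideanreal (\<lambda>p. snd p i)" for i
  proof -
    have "continuous_map ?P (powertop_real UNIV) snd"
      using continuous_map_snd[of "top_of_set {0..1::real}" ?K] by (simp add: continuous_map_in_subtopology)
    then show ?thesis by (simp add: continuous_map_componentwise_UNIV)
  qed
  have "continuous_map ?P ?K (\<lambda>(t, x) i. (1 - t) * a i + t * x i)"
    unfolding continuous_map_in_subtopology
  proof
    show "continuous_map ?P (powertop_real UNIV) (\<lambda>(t, x) i. (1 - t) * a i + t * x i)"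
      unfolding continuous_map_componentwise_UNIV case_prod_unfold
      by (intro allI continuous_intros c1 c2)
  qed (auto intro!: star)
  then show ?thesis
    using lift_exists[of ?K "\<lambda>(t, x) i. (1 - t) * a i + t * x i" a f] assms
    by (auto simp: compact_space_subtopology)
qed

end

section \<open>Holonomy\<close>

definition std_vertex :: "nat \<Rightarrow> nat \<Rightarrow> real"
  where "std_vertex i = (\<lambda>j. if j = i then 1 else 0)"

lemma std_vertex_in_simplex [simp]: "std_vertex i \<in> standard_simplex p \<longleftrightarrow> i \<le> p"
  by (simp add: std_vertex_def)

lemma simplical_face_vertex [simp]:
  "simplical_face k (std_vertex i) = std_vertex (if i < k then i else Suc i)"
  by (auto simp: simplical_face_def std_vertex_def fun_eq_iff)

abbreviation simplex_space :: "nat \<Rightarrow> (nat \<Rightarrow> real) topology"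
  where "simplex_space p \<equiv> subtopology (powertop_real UNIV) (standard_simplex p)"

lemma continuous_map_simplical_face:
  assumes "1 \<le> p" "k \<le> p"
  shows "continuous_map (simplex_space (p - Suc 0)) (simplex_space p) (simplical_face k)"
proof -
  have "continuous_map (simplex_space (p - Suc 0)) euclideanreal (\<lambda>x. simplical_face k x i)" for i
    unfolding simplical_face_def
    by (auto intro!: continuous_map_from_subtopology continuous_map_product_projection)
  then show ?thesis
    using assms simplical_face_in_standard_simplex
    by (force simp: continuous_map_in_subtopology continuous_map_componentwise_UNIV)
qed

text \<open>Only the translating elements are recorded, not the lifted step functions: holonomy is
  read off from them.\<close>

definition lift_of :: "('g, 'h) monoid_scheme \<Rightarrow> ('x \<Rightarrow> real \<Rightarrow> 'g) \<Rightarrow> nat \<Rightarrow>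
    ((nat \<Rightarrow> real) \<Rightarrow> 'x) \<Rightarrow> ((nat \<Rightarrow> real) \<Rightarrow> 'g) \<Rightarrow> bool"
  where "lift_of G f p \<sigma> g \<longleftrightarrow> (\<forall>x\<in>standard_simplex p. g x \<in> carrier G) \<and>
    continuous_map (simplex_space p) (step_topology G) (\<lambda>x. translate G (g x) (f (\<sigma> x)))"

text \<open>Two lifts over a connected space differ by one left factor, which cancels in this
  product, so the choice is immaterial. The edge need not be closed: the representatives that
  \<open>f\<close> selects at its ends serve as base points.\<close>

definition holonomy :: "('g, 'h) monoid_scheme \<Rightarrow> ('x \<Rightarrow> real \<Rightarrow> 'g) \<Rightarrow>
    ((nat \<Rightarrow> real) \<Rightarrow> 'x) \<Rightarrow> 'g"
  where "holonomy G f \<tau> =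
    (SOME h. \<exists>g. lift_of G f 1 \<tau> g \<and> h = inv\<^bsub>G\<^esub> g (std_vertex 0) \<otimes>\<^bsub>G\<^esub> g (std_vertex 1))"

context group
begin

lemma mult_inv_cancel [simp]:
  assumes "a \<in> carrier G" "b \<in> carrier G"
  shows "inv a \<otimes> (a \<otimes> b) = b" "a \<otimes> (inv a \<otimes> b) = b"
  using assms by (simp_all flip: m_assoc)

lemma continuous_map_step_translate:
  assumes k: "k \<in> carrier G" and F: "continuous_map K (step_topology G) F"
  shows "continuous_map K (step_topology G) (\<lambda>x. translate G k (F x))"
proof -
  have Fs: "F x \<in> step_functions G" if "x \<in> topspace K" for x
    using F that by (auto simp: continuous_map_step)
  have "\<exists>U. openin K U \<and> x \<in> U \<and> (\<forall>y\<in>U. step_dist (translate G k (F x)) (translate G k (F y)) < e)"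
    if x: "x \<in> topspace K" "0 < e" for x e
  proof -
    obtain U where U: "openin K U" "x \<in> U" "\<forall>y\<in>U. step_dist (F x) (F y) < e"
      using F x unfolding continuous_map_step by blast
    have "step_dist (translate G k (F x)) (translate G k (F y)) < e" if "y \<in> U" for y
      using U that Fs x openin_subset[OF U(1)] k by (subst step_dist_translate) auto
    then show ?thesis using U by blast
  qed
  then show ?thesis using Fs k by (simp add: continuous_map_step)
qed

lemma lift_of_exists:
  assumes "continuous_map X (orbit_topology G) f" "singular_simplex p X \<sigma>"
  shows "\<exists>g. lift_of G f p \<sigma> g"
proof -
  have "continuous_map (simplex_space p) (orbit_topology G) (\<lambda>x. f (\<sigma> x))"
    using continuous_map_compose[of _ X \<sigma> _ f] assms by (simp add: singular_simplex_def o_def)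
  from lift_exists_starlike[OF compactin_standard_simplex _ convex_standard_simplex this, of "std_vertex 0"]
  show ?thesis
    by (simp add: lift_of_def)
qed

lemma lift_of_face:
  assumes "lift_of G f p \<sigma> g" "1 \<le> p" "k \<le> p"
  shows "lift_of G f (p - 1) (singular_face p k \<sigma>) (\<lambda>x. g (simplical_face k x))"
proof -
  have "continuous_map (simplex_space (p - 1)) (step_topology G)
      ((\<lambda>x. translate G (g x) (f (\<sigma> x))) \<circ> simplical_face k)"
    using assms continuous_map_simplical_face[OF assms(2,3)]
    by (intro continuous_map_compose) (auto simp: lift_of_def)
  then have "continuous_map (simplex_space (p - 1)) (step_topology G)
     (\<lambda>x. translate G (g (simplical_face k x)) (f (singular_face p k \<sigma> x)))"
    by (rule continuous_map_eq) (simp add: singular_face_def)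
  then show ?thesis
    using assms simplical_face_in_standard_simplex[OF assms(2,3)] by (auto simp: lift_of_def)
qed

lemma holonomy_eq:
  assumes f: "continuous_map X (orbit_topology G) f" and \<tau>: "singular_simplex 1 X \<tau>"
    and g: "lift_of G f 1 \<tau> g"
  shows "holonomy G f \<tau> = inv g (std_vertex 0) \<otimes> g (std_vertex 1)"
proof -
  define h where "h = holonomy G f \<tau>"
  have "\<exists>h g. lift_of G f 1 \<tau> g \<and> h = inv g (std_vertex 0) \<otimes> g (std_vertex 1)"
    using lift_of_exists[OF f \<tau>] by blast
  then have "\<exists>g. lift_of G f 1 \<tau> g \<and> h = inv g (std_vertex 0) \<otimes> g (std_vertex 1)"
    unfolding h_def holonomy_def by (rule someI_ex)
  then obtain g' where g': "lift_of G f 1 \<tau> g'" "h = inv g' (std_vertex 0) \<otimes> g' (std_vertex 1)"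
    by blast
  have "\<tau> x \<in> topspace X" if "x \<in> standard_simplex 1" for x
    using \<tau> that by (auto simp: singular_simplex_def continuous_map_def)
  then have fs: "f (\<tau> x) \<in> step_functions G" if "x \<in> standard_simplex 1" for x
    using f that by (auto simp: continuous_map_orbit)
  have cs: "connected_space (simplex_space 1)"
    using connectedin_standard_simplex by (simp add: connectedin_def)
  have "g' (std_vertex 0) \<otimes> inv g (std_vertex 0) = g' (std_vertex 1) \<otimes> inv g (std_vertex 1)"
    using lift_unique[OF cs, of g "\<lambda>x. f (\<tau> x)" g' "std_vertex 0" "std_vertex 1"] g g' fs
    by (auto simp: lift_of_def)
  moreover have "g (std_vertex i) \<in> carrier G" "g' (std_vertex i) \<in> carrier G" if "i \<le> 1" for i
    using g g'(1) that by (auto simp: lift_of_def)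
  then have *: "g (std_vertex 0) \<in> carrier G" "g' (std_vertex 0) \<in> carrier G"
    "g (std_vertex 1) \<in> carrier G" "g' (std_vertex 1) \<in> carrier G" by auto
  ultimately have "g' (std_vertex 1) = g' (std_vertex 0) \<otimes> inv g (std_vertex 0) \<otimes> g (std_vertex 1)"
    by (simp add: inv_solve_right)
  then have "inv g' (std_vertex 0) \<otimes> g' (std_vertex 1) = inv g (std_vertex 0) \<otimes> g (std_vertex 1)"
    using * by (simp add: m_assoc)
  then show ?thesis using g' h_def by simp
qed

lemma holonomy_closed:
  assumes "continuous_map X (orbit_topology G) f" "singular_simplex 1 X \<tau>"
  shows "holonomy G f \<tau> \<in> carrier G"
proof -
  obtain g where "lift_of G f 1 \<tau> g" using lift_of_exists[OF assms] by blast
  then show ?thesis using holonomy_eq[OF assms] by (auto simp: lift_of_def)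
qed

text \<open>A single lift over the triangle restricts to all three faces, so the values at the
  middle vertex cancel.\<close>

lemma holonomy_triangle:
  assumes f: "continuous_map X (orbit_topology G) f" and \<sigma>: "singular_simplex 2 X \<sigma>"
  shows "holonomy G f (singular_face 2 1 \<sigma>) =
    holonomy G f (singular_face 2 2 \<sigma>) \<otimes> holonomy G f (singular_face 2 0 \<sigma>)"
proof -
  obtain g where g: "lift_of G f 2 \<sigma> g" using lift_of_exists[OF f \<sigma>] by blast
  have *: "holonomy G f (singular_face 2 k \<sigma>) =
      inv g (simplical_face k (std_vertex 0)) \<otimes> g (simplical_face k (std_vertex 1))"
    if "k \<le> 2" for k
  proof (rule holonomy_eq[OF f])
    show "singular_simplex 1 X (singular_face 2 k \<sigma>)"
      using singular_simplex_singular_face[OF \<sigma>] that by simp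
    show "lift_of G f 1 (singular_face 2 k \<sigma>) (\<lambda>x. g (simplical_face k x))"
      using lift_of_face[OF g] that by simp
  qed
  have "g (std_vertex i) \<in> carrier G" if "i \<le> 2" for i
    using g that by (auto simp: lift_of_def)
  from this[of 0] this[of 1] this[of 2] show ?thesis
    by (simp add: * m_assoc) (simp add: numeral_2_eq_2 m_assoc)
qed

end

section \<open>Extending over cells\<close>

text \<open>The contraction of the space of step functions: as \<open>s\<close> runs from 0 to 1, a
  growing initial piece is overwritten by the neutral element. The path has speed at most 1 in
  \<open>step_dist\<close>.\<close>

definition cut :: "('g, 'h) monoid_scheme \<Rightarrow> real \<Rightarrow> (real \<Rightarrow> 'g) \<Rightarrow> real \<Rightarrow> 'g"
  where "cut G s x = (\<lambda>t. if 0 \<le> t \<and> t < s then \<one>\<^bsub>G\<^esub> else x t)"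

context group
begin

lemma cut_step_functions [simp, intro]:
  assumes "x \<in> step_functions G"
  shows "cut G s x \<in> step_functions G"
proof -
  have "range (cut G s x) \<subseteq> insert \<one> (range x)" by (auto simp: cut_def)
  moreover have "{t. cut G s x t = g} \<in> sets lborel" for g
  proof -
    have "{t. cut G s x t = g} = (if g = \<one> then {0..<s} else {}) \<union> ({t. x t = g} - {0..<s})"
      by (auto simp: cut_def)
    moreover have "{t. x t = g} \<in> sets lborel" using assms by (simp add: step_functions_def)
    then have "{t. x t = g} - {0..<s} \<in> sets lborel"
      by (rule sets.Diff) simp
    ultimately show ?thesis by (simp only:) (intro sets.Un, auto)
  qed
  ultimately show ?thesis
    using assms finite_subset[of "range (cut G s x)" "insert \<one> (range x)"]
    by (auto simp: step_functions_def)
qed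

lemma const_one_step_function [simp, intro]: "(\<lambda>_. \<one>) \<in> step_functions G"
  by (auto simp: step_functions_def)

lemma cut_0 [simp]: "cut G 0 x = x"
  by (auto simp: cut_def fun_eq_iff)

lemma step_dist_cut_same:
  assumes "x \<in> step_functions G" "y \<in> step_functions G"
  shows "step_dist (cut G s x) (cut G s y) \<le> step_dist x y"
proof -
  have "{t \<in> {0..<1}. cut G s x t \<noteq> cut G s y t} \<subseteq> {t \<in> {0..<1}. x t \<noteq> y t}"
    by (auto simp: cut_def)
  then show ?thesis
    using assms step_differ_measurable[of "cut G s x" G "cut G s y"] step_differ_measurable[of x G y]
    unfolding step_dist_def
    by (intro measure_mono_fmeasurable unit_interval_subset_fmeasurable) auto
qed

lemma step_dist_cut_cut:
  assumes "x \<in> step_functions G"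
  shows "step_dist (cut G s x) (cut G s' x) \<le> \<bar>s - s'\<bar>"
proof -
  have "step_dist (cut G s x) (cut G s' x) \<le> max s s' - min s s'"
    using assms cut_step_functions[of x]
    by (intro step_dist_le_interval[of _ _ _ _ G]) (auto simp: cut_def[of G _ x] split: if_splits)
  then show ?thesis by linarith
qed

text \<open>After cutting at \<open>1 - \<rho> x\<close> only a set of measure at most
  \<open>\<rho> x\<close> can carry values other than the neutral element, so continuity at the cone
  point follows without any control of \<open>F\<close> near it.\<close>

lemma continuous_map_cone:
  assumes \<rho>: "continuous_map K euclideanreal \<rho>" and r01: "\<And>x. x \<in> topspace K \<Longrightarrow> \<rho> x \<in> {0..1}"
    and F: "continuous_map (subtopology K {x. 0 < \<rho> x}) (step_topology G) F"
  shows "continuous_map K (step_topology G)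
    (\<lambda>x. cut G (1 - \<rho> x) (if \<rho> x = 0 then \<lambda>_. \<one> else F x))" (is "continuous_map K _ ?H")
proof -
  have Fs: "F x \<in> step_functions G" if "x \<in> topspace K" "0 < \<rho> x" for x
    using F that by (auto simp: continuous_map_step Pi_iff)
  have Hs: "?H x \<in> step_functions G" if "x \<in> topspace K" for x
    using that r01[OF that] Fs[OF that] by auto
  have "\<exists>U. openin K U \<and> x \<in> U \<and> (\<forall>y\<in>U. step_dist (?H x) (?H y) < e)"
    if x: "x \<in> topspace K" and e: "e > 0" for x e
  proof (cases "\<rho> x = 0")
    case True
    define U where "U = {y \<in> topspace K. \<rho> y < e}"
    have "openin K U"
    proof -
      have "openin K {y \<in> topspace K. \<rho> y \<in> {..<e}}"
        by (rule openin_continuous_map_preimage[OF \<rho>]) simp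
      then show ?thesis by (simp add: U_def)
    qed
    moreover have "step_dist (?H x) (?H y) < e" if "y \<in> U" for y
    proof -
      have y: "y \<in> topspace K" "\<rho> y < e" using that by (auto simp: U_def)
      have "step_dist (?H x) (?H y) \<le> 1 - (1 - \<rho> y)"
        using r01[OF x] r01[OF y(1)] True
        by (intro step_dist_le_interval[of _ _ _ _ G] Hs x y) (auto simp: cut_def split: if_splits)
      then show ?thesis using y by simp
    qed
    ultimately show ?thesis using True x e by (intro exI[of _ U]) (auto simp: U_def)
  next
    case False
    then have rx: "\<rho> x > 0" using r01[OF x] by auto
    let ?K = "subtopology K {x. 0 < \<rho> x}"
    obtain V where V: "openin ?K V" "x \<in> V" "\<And>y. y \<in> V \<Longrightarrow> step_dist (F x) (F y) < e/2"
      using F[unfolded continuous_map_step, THEN conjunct2, rule_format, of x "e/2"] x rx e by auto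
    have opr: "openin K {y \<in> topspace K. \<rho> y \<in> {0<..}}"
      by (rule openin_continuous_map_preimage[OF \<rho>]) simp
    have "{y \<in> topspace K. \<rho> y \<in> {0<..}} = topspace K \<inter> {x. 0 < \<rho> x}" by auto
    then have "openin K (topspace K \<inter> {x. 0 < \<rho> x})" using opr by simp
    then have V': "openin K V"
      using V(1) by (metis openin_open_subtopology subtopology_restrict)
    have Vpos: "\<rho> y > 0" "y \<in> topspace K" if "y \<in> V" for y
      using openin_subset[OF V(1)] that by auto
    have opd: "openin K {y \<in> topspace K. \<rho> y \<in> ball (\<rho> x) (e/2)}"
      by (rule openin_continuous_map_preimage[OF \<rho>]) simp
    have "step_dist (?H x) (?H y) < e" if y: "y \<in> V" "\<rho> y \<in> ball (\<rho> x) (e/2)" for y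
    proof -
      have s: "F x \<in> step_functions G" "F y \<in> step_functions G" using Fs x rx Vpos[OF y(1)] by auto
      have "step_dist (cut G (1 - \<rho> x) (F x)) (cut G (1 - \<rho> y) (F y)) \<le>
        step_dist (cut G (1 - \<rho> x) (F x)) (cut G (1 - \<rho> y) (F x)) +
        step_dist (cut G (1 - \<rho> y) (F x)) (cut G (1 - \<rho> y) (F y))"
        using s by (intro step_dist_triangle[of _ G]) auto
      also have "\<dots> \<le> \<bar>(1 - \<rho> x) - (1 - \<rho> y)\<bar> + step_dist (F x) (F y)"
        using s by (intro add_mono step_dist_cut_cut step_dist_cut_same)
      also have "\<dots> < e" using V(3)[OF y(1)] y(2) by (simp add: dist_real_def abs_minus_commute)
      finally show ?thesis using rx Vpos[OF y(1)] by simp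
    qed
    then show ?thesis
      using openin_Int[OF V' opd] V(2) x e
      by (intro exI[of _ "V \<inter> {y \<in> topspace K. \<rho> y \<in> ball (\<rho> x) (e/2)}"]) auto
  qed
  then show ?thesis using Hs by (simp add: continuous_map_step)
qed

end

section \<open>Discs and spheres\<close>

definition disc_set :: "nat \<Rightarrow> (nat \<Rightarrow> real) set"
  where "disc_set n = {x. (\<forall>i\<ge>n. x i = 0) \<and> (\<Sum>i<n. (x i)\<^sup>2) \<le> 1}"

lemma closed_disc_eq: "closed_disc n = subtopology (powertop_real UNIV) (disc_set n)"
  by (auto simp: closed_disc_def Euclidean_space_def subtopology_subtopology disc_set_def
      intro!: arg_cong[of _ _ "subtopology _"])

lemma topspace_closed_disc [simp]: "topspace (closed_disc n) = disc_set n"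
  by (simp add: closed_disc_eq)

lemma nsphere_eq: "topspace (nsphere n) = {x. (\<Sum>i\<le>n. (x i)\<^sup>2) = 1 \<and> (\<forall>i>n. x i = 0)}"
  by (simp add: nsphere)

lemma disc_boundary_eq: "disc_boundary (Suc n) = topspace (nsphere n)"
  by (auto simp: disc_boundary_def topspace_Euclidean_space nsphere_eq lessThan_Suc_atMost)

lemma disc_boundary_subset: "disc_boundary n \<subseteq> disc_set n"
  by (auto simp: disc_boundary_def topspace_Euclidean_space disc_set_def)

lemma closed_disc_boundary: "subtopology (closed_disc (Suc n)) (topspace (nsphere n)) = nsphere n"
proof -
  have "disc_set (Suc n) \<inter> topspace (nsphere n) = topspace (nsphere n)"
    using disc_boundary_subset[of "Suc n"] by (auto simp: disc_boundary_eq)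
  then show ?thesis
    unfolding closed_disc_eq subtopology_subtopology
    by (simp add: nsphere)
qed

lemma compactin_disc_set: "compactin (powertop_real UNIV) (disc_set n)"
proof (rule closed_compactin)
  show "compactin (powertop_real UNIV) (UNIV \<rightarrow>\<^sub>E {-1..1})"
    by (simp add: compactin_PiE)
  have "x i \<in> {-1..1}" if "x \<in> disc_set n" for x i
  proof (cases "i < n")
    case True
    then have "(x i)\<^sup>2 \<le> (\<Sum>i<n. (x i)\<^sup>2)"
      by (intro member_le_sum) auto
    also have "\<dots> \<le> 1" using that by (simp add: disc_set_def)
    finally show ?thesis by (simp add: abs_square_le_1 abs_le_iff)
  qed (use that in \<open>auto simp: disc_set_def\<close>)
  then show "disc_set n \<subseteq> UNIV \<rightarrow>\<^sub>E {-1..1}" by auto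
  have eq: "disc_set n = (\<Inter>i\<in>{n..}. {x \<in> topspace (powertop_real UNIV). x i \<in> {0}}) \<inter>
    {x \<in> topspace (powertop_real UNIV). (\<Sum>i<n. (x i)\<^sup>2) \<in> {..1}}"
    by (auto simp: disc_set_def)
  show "closedin (powertop_real UNIV) (disc_set n)"
    unfolding eq
    by (intro closedin_Int closedin_INT closedin_continuous_map_preimage[where Y = euclideanreal]
        continuous_map_sum continuous_map_real_pow continuous_map_product_projection) auto
qed

lemma zero_in_disc_set [simp]: "(\<lambda>_. 0) \<in> disc_set n"
  by (simp add: disc_set_def)

lemma scale_in_disc_set:
  assumes "x \<in> disc_set n" "0 \<le> t" "t \<le> (1::real)"
  shows "(\<lambda>i. t * x i) \<in> disc_set n"
proof -
  have "(\<Sum>i<n. (t * x i)\<^sup>2) = t\<^sup>2 * (\<Sum>i<n. (x i)\<^sup>2)"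
    by (simp add: power_mult_distrib sum_distrib_left)
  also have "\<dots> \<le> 1" using assms
    by (intro mult_le_one) (auto simp: disc_set_def power_le_one sum_nonneg)
  finally show ?thesis using assms by (simp add: disc_set_def)
qed

lemma connected_space_closed_disc: "connected_space (closed_disc n)"
proof -
  have "path_connectedin (powertop_real UNIV) (disc_set n)"
  proof -
    have "\<exists>g. pathin (closed_disc n) g \<and> g 0 = (\<lambda>_. 0) \<and> g 1 = x" if "x \<in> disc_set n" for x
    proof (intro exI conjI)
      show "pathin (closed_disc n) (\<lambda>t i. t * x i)"
        unfolding pathin_def closed_disc_eq continuous_map_in_subtopology
        using scale_in_disc_set[OF that]
        by (auto simp: continuous_map_componentwise_UNIV intro!: continuous_intros)
    qed auto
    then have "path_component_of (closed_disc n) (\<lambda>_. 0) x" if "x \<in> disc_set n" for x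
      using that by (auto simp: path_component_of_def)
    then have "path_connected_space (closed_disc n)"
      using path_connected_space_iff_path_component[of "closed_disc n"]
      by (metis path_component_of_sym path_component_of_trans topspace_closed_disc)
    then show ?thesis by (simp add: closed_disc_eq path_connectedin_def)
  qed
  then show ?thesis
    using path_connectedin_imp_connectedin connectedin_def closed_disc_eq by metis
qed

lemma continuous_map_sqrt:
  assumes "continuous_map X euclideanreal f"
  shows "continuous_map X euclideanreal (\<lambda>x. sqrt (f x))"
proof -
  have "continuous_map euclideanreal euclideanreal sqrt"
    by (simp add: continuous_on_real_sqrt)
  from continuous_map_compose[OF assms this] show ?thesis by (simp add: o_def)
qed

text \<open>The graph over the disc; the sign \<open>s\<close> selects the upper or the lower half
  of the sphere, on which \<open>equator_projection\<close> is the inverse.\<close>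

definition hemisphere :: "real \<Rightarrow> nat \<Rightarrow> (nat \<Rightarrow> real) \<Rightarrow> nat \<Rightarrow> real"
  where "hemisphere s n y = (\<lambda>i. if i < n then y i else if i = n then s * sqrt (1 - (\<Sum>i<n. (y i)\<^sup>2)) else 0)"

lemma continuous_map_coordinate:
  "continuous_map (subtopology (powertop_real UNIV) A) euclideanreal (\<lambda>x. x i)"
  by (intro continuous_map_from_subtopology continuous_map_product_projection) auto

lemma continuous_map_hemisphere:
  assumes "\<bar>s\<bar> = 1"
  shows "continuous_map (closed_disc n) (nsphere n) (hemisphere s n)"
proof -
  have "continuous_map (closed_disc n) euclideanreal (\<lambda>y. hemisphere s n y i)" for i
    unfolding hemisphere_def closed_disc_eq
    by (auto intro!: continuous_intros continuous_map_coordinate continuous_map_sqrt)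
  moreover have "hemisphere s n y \<in> topspace (nsphere n)" if "y \<in> disc_set n" for y
  proof -
    have "s\<^sup>2 = 1" using assms by (metis one_power2 power2_abs)
    moreover have "(\<Sum>i<n. (hemisphere s n y i)\<^sup>2) = (\<Sum>i<n. (y i)\<^sup>2)"
      by (simp add: hemisphere_def)
    ultimately show ?thesis using that
      by (auto simp: nsphere_eq disc_set_def hemisphere_def power_mult_distrib simp flip: lessThan_Suc_atMost)
  qed
  ultimately show ?thesis
    unfolding nsphere continuous_map_in_subtopology
    by (auto simp: continuous_map_componentwise_UNIV nsphere_eq Pi_iff)
qed

definition equator_projection :: "nat \<Rightarrow> (nat \<Rightarrow> real) \<Rightarrow> nat \<Rightarrow> real"
  where "equator_projection n x = (\<lambda>i. if i < n then x i else 0)"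

lemma continuous_map_equator_projection:
  "continuous_map (nsphere n) (closed_disc n) (equator_projection n)"
proof -
  have "continuous_map (nsphere n) euclideanreal (\<lambda>y. equator_projection n y i)" for i
    unfolding equator_projection_def nsphere
    by (auto intro!: continuous_intros continuous_map_coordinate)
  moreover have "equator_projection n y \<in> disc_set n" if "y \<in> topspace (nsphere n)" for y
    using that by (auto simp: nsphere_eq disc_set_def equator_projection_def simp flip: lessThan_Suc_atMost)
      (smt (verit) zero_le_power2)
  ultimately show ?thesis
    unfolding closed_disc_eq continuous_map_in_subtopology
    by (auto simp: continuous_map_componentwise_UNIV)
qed

lemma hemisphere_projection:
  assumes "x \<in> topspace (nsphere n)" "\<bar>s\<bar> = 1" "0 \<le> s * x n"
  shows "hemisphere s n (equator_projection n x) = x"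
proof -
  have "(\<Sum>i<n. (x i)\<^sup>2) + (x n)\<^sup>2 = 1" using assms by (simp add: nsphere_eq flip: lessThan_Suc_atMost)
  then have "1 - (\<Sum>i<n. (x i)\<^sup>2) = (x n)\<^sup>2" by linarith
  moreover have "s * \<bar>x n\<bar> = x n"
    using assms by (auto simp: abs_if zero_le_mult_iff split: if_splits)
  ultimately show ?thesis
    using assms by (auto simp: hemisphere_def equator_projection_def fun_eq_iff nsphere_eq)
qed

text \<open>The two hemispheres are images of a connected disc, and for \<open>1 \<le> n\<close>
  they share the point \<open>std_vertex 0\<close> of the equator.\<close>

lemma connected_space_nsphere:
  assumes "1 \<le> n"
  shows "connected_space (nsphere n)"
proof -
  let ?H = "\<lambda>s. hemisphere s n ` disc_set n"
  have c: "connectedin (nsphere n) (?H s)" if "\<bar>s\<bar> = 1" for s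
  proof -
    have "connectedin (closed_disc n) (disc_set n)"
      using connected_space_closed_disc[of n] by (metis connectedin_topspace topspace_closed_disc)
    then show ?thesis
      by (rule connectedin_continuous_map_image[OF continuous_map_hemisphere[OF that]])
  qed
  have "hemisphere 1 n (std_vertex 0) = hemisphere (-1) n (std_vertex 0)"
  proof -
    have "(\<Sum>i<n. (std_vertex 0 i)\<^sup>2) = (\<Sum>i\<in>{0}. (std_vertex 0 i)\<^sup>2)"
      using assms by (intro sum.mono_neutral_right) (auto simp: std_vertex_def)
    then have "(\<Sum>i<n. (std_vertex 0 i)\<^sup>2) = (1::real)" by (simp add: std_vertex_def)
    then show ?thesis by (simp add: hemisphere_def fun_eq_iff)
  qed
  moreover have "std_vertex 0 \<in> disc_set n"
  proof -
    have "(\<Sum>i<n. (std_vertex 0 i)\<^sup>2) = (\<Sum>i\<in>{0}. (std_vertex 0 i)\<^sup>2)"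
      using assms by (intro sum.mono_neutral_right) (auto simp: std_vertex_def)
    then show ?thesis using assms by (simp add: disc_set_def std_vertex_def)
  qed
  ultimately have "?H 1 \<inter> ?H (-1) \<noteq> {}" by blast
  then have "connectedin (nsphere n) (?H 1 \<union> ?H (-1))"
    by (intro connectedin_Un c) auto
  moreover have "?H 1 \<union> ?H (-1) = topspace (nsphere n)"
  proof
    show "?H 1 \<union> ?H (-1) \<subseteq> topspace (nsphere n)"
      using c[of 1] c[of "-1"] connectedin_subset_topspace by fastforce
    show "topspace (nsphere n) \<subseteq> ?H 1 \<union> ?H (-1)"
    proof
      fix x assume x: "x \<in> topspace (nsphere n)"
      have p: "equator_projection n x \<in> disc_set n"
        using continuous_map_equator_projection[of n] x by (auto simp: continuous_map_def Pi_iff)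
      consider "0 \<le> x n" | "0 \<le> - x n" by linarith
      then show "x \<in> ?H 1 \<union> ?H (-1)"
        using hemisphere_projection[OF x, of 1] hemisphere_projection[OF x, of "-1"] p
        by cases (force intro: rev_image_eqI)+
    qed
  qed
  ultimately show ?thesis by (metis connectedin_topspace)
qed

context group
begin

text \<open>Lifts exist over both hemispheres, which are discs. They can be matched because the
  equator has dimension at least 1 and is connected: along it the two lifts differ by a single group
  element.\<close>

lemma lift_nsphere:
  assumes f: "continuous_map (nsphere n) (orbit_topology G) f" and n: "2 \<le> n"
  shows "\<exists>g. (\<forall>x\<in>topspace (nsphere n). g x \<in> carrier G) \<and>
    continuous_map (nsphere n) (step_topology G) (\<lambda>x. translate G (g x) (f x))"
proof -
  have "\<exists>g. (\<forall>y\<in>disc_set n. g y \<in> carrier G) \<and>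
    continuous_map (closed_disc n) (step_topology G) (\<lambda>y. translate G (g y) (f (hemisphere s n y)))"
    if "\<bar>s\<bar> = 1" for s
  proof -
    have "continuous_map (closed_disc n) (orbit_topology G) (\<lambda>y. f (hemisphere s n y))"
      using continuous_map_compose[OF continuous_map_hemisphere[OF that] f] by (simp add: o_def)
    then show ?thesis
      using lift_exists_starlike[OF compactin_disc_set zero_in_disc_set, of n "\<lambda>y. f (hemisphere s n y)"]
        scale_in_disc_set by (simp add: closed_disc_eq)
  qed
  from this[of 1] this[of "-1"] obtain a b where
    a: "\<And>y. y \<in> disc_set n \<Longrightarrow> a y \<in> carrier G"
    "continuous_map (closed_disc n) (step_topology G) (\<lambda>y. translate G (a y) (f (hemisphere 1 n y)))" and
    b: "\<And>y. y \<in> disc_set n \<Longrightarrow> b y \<in> carrier G"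
    "continuous_map (closed_disc n) (step_topology G) (\<lambda>y. translate G (b y) (f (hemisphere (-1) n y)))"
    by auto
  obtain m where m: "n = Suc m" "1 \<le> m" using n by (cases n) auto
  have bd: "y \<in> disc_set n" "hemisphere 1 n y = y" "hemisphere (-1) n y = y" if "y \<in> topspace (nsphere m)" for y
  proof -
    show "y \<in> disc_set n" using that disc_boundary_subset[of n] by (auto simp: m disc_boundary_eq)
    have "(\<Sum>i<n. (y i)\<^sup>2) = 1" "\<And>i. i \<ge> n \<Longrightarrow> y i = 0"
      using that by (auto simp: m nsphere_eq lessThan_Suc_atMost)
    then show "hemisphere 1 n y = y" "hemisphere (-1) n y = y"
      by (auto simp: hemisphere_def fun_eq_iff)
  qed
  have sub: "nsphere m = subtopology (closed_disc n) (topspace (nsphere m))"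
    using closed_disc_boundary[of m] m by simp
  have fs: "f x \<in> step_functions G" if "x \<in> topspace (nsphere n)" for x
    using f that by (auto simp: continuous_map_orbit)
  have hs: "hemisphere s n y \<in> topspace (nsphere n)" if "y \<in> disc_set n" "\<bar>s\<bar> = 1" for y s
    using continuous_map_hemisphere[OF that(2), of n] that(1) by (auto simp: continuous_map_def)
  have sm: "topspace (nsphere m) \<subseteq> topspace (nsphere n)"
    using bd hs[of _ 1] by fastforce
  have const: "a x \<otimes> inv b x = a y \<otimes> inv b y" if "x \<in> topspace (nsphere m)" "y \<in> topspace (nsphere m)" for x y
  proof (rule lift_unique[OF connected_space_nsphere[OF m(2)]])
    have "continuous_map (nsphere m) (step_topology G) (\<lambda>y. translate G (b y) (f (hemisphere (-1) n y)))"
      by (subst sub) (rule continuous_map_from_subtopology[OF b(2)])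
    then show "continuous_map (nsphere m) (step_topology G) (\<lambda>y. translate G (b y) (f y))"
      by (rule continuous_map_eq) (simp add: bd)
    have "continuous_map (nsphere m) (step_topology G) (\<lambda>y. translate G (a y) (f (hemisphere 1 n y)))"
      by (subst sub) (rule continuous_map_from_subtopology[OF a(2)])
    then show "continuous_map (nsphere m) (step_topology G) (\<lambda>y. translate G (a y) (f y))"
      by (rule continuous_map_eq) (simp add: bd)
  qed (use that bd a b fs sm in auto)
  let ?e = "\<lambda>i. if i = (0::nat) then 1 else (0::real)"
  \<comment> \<open>\<open>?e\<close> is a sample point of the equator. Translating the lower lift
    by \<open>k\<close> makes it agree with the upper one on the whole equator.\<close>
  define k where "k = a ?e \<otimes> inv b ?e"
  have k: "k \<in> carrier G" using a(1) b(1) bd(1)[OF in_topspace_nsphere] by (simp add: k_def)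
  have ab: "a x = k \<otimes> b x" if "x \<in> topspace (nsphere m)" for x
    using const[OF that in_topspace_nsphere] a(1)[OF bd(1)[OF that]] b(1)[OF bd(1)[OF that]] k
    unfolding k_def[symmetric] by (metis inv_solve_right k_def)
  let ?p = "equator_projection n"
  have p: "?p x \<in> disc_set n" if "x \<in> topspace (nsphere n)" for x
    using continuous_map_equator_projection[of n] that by (auto simp: continuous_map_def Pi_iff)
  define g where "g x = (if 0 \<le> x n then a (?p x) else k \<otimes> b (?p x))" for x
  have "continuous_map (nsphere n) (step_topology G)
    (\<lambda>x. if 0 \<le> x n then translate G (a (?p x)) (f (hemisphere 1 n (?p x)))
      else translate G (k \<otimes> b (?p x)) (f (hemisphere (-1) n (?p x))))"
  proof (rule continuous_map_cases_le)
    show "continuous_map (nsphere n) euclideanreal (\<lambda>x. 0)" by simp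
    show "continuous_map (nsphere n) euclideanreal (\<lambda>x. x n)"
      by (rule continuous_map_nsphere_projection)
    have "continuous_map (nsphere n) (step_topology G) (\<lambda>x. translate G (a (?p x)) (f (hemisphere 1 n (?p x))))"
      using continuous_map_compose[OF continuous_map_equator_projection a(2)] by (simp add: o_def)
    then show "continuous_map (subtopology (nsphere n) {x \<in> topspace (nsphere n). 0 \<le> x n}) (step_topology G)
      (\<lambda>x. translate G (a (?p x)) (f (hemisphere 1 n (?p x))))"
      by (rule continuous_map_from_subtopology)
    note kc = continuous_map_step_translate[OF k b(2)]
    have "continuous_map (closed_disc n) (step_topology G)
      (\<lambda>y. translate G (k \<otimes> b y) (f (hemisphere (-1) n y)))"
      by (rule continuous_map_eq[OF kc]) (use k b hs[of _ "-1"] fs in \<open>simp add: translate_translate\<close>)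
    from continuous_map_compose[OF continuous_map_equator_projection this]
    have "continuous_map (nsphere n) (step_topology G)
      (\<lambda>x. translate G (k \<otimes> b (?p x)) (f (hemisphere (-1) n (?p x))))"
      by (simp add: o_def)
    then show "continuous_map (subtopology (nsphere n) {x \<in> topspace (nsphere n). x n \<le> 0}) (step_topology G)
      (\<lambda>x. translate G (k \<otimes> b (?p x)) (f (hemisphere (-1) n (?p x))))"
      by (rule continuous_map_from_subtopology)
    fix x assume x: "x \<in> topspace (nsphere n)" "0 = x n"
    have px: "?p x = x"
      using x by (auto simp: equator_projection_def nsphere_eq fun_eq_iff) (metis linorder_neqE_nat)
    have xm: "x \<in> topspace (nsphere m)"
      using x by (auto simp: nsphere_eq m) (metis Suc_lessI)
    show "translate G (a (?p x)) (f (hemisphere 1 n (?p x))) =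
      translate G (k \<otimes> b (?p x)) (f (hemisphere (-1) n (?p x)))"
      by (simp add: px bd(2,3)[OF xm] ab[OF xm])
  qed
  then have "continuous_map (nsphere n) (step_topology G) (\<lambda>x. translate G (g x) (f x))"
    by (rule continuous_map_eq)
      (auto simp: g_def hemisphere_projection[of _ n 1] hemisphere_projection[of _ n "-1"])
  moreover have "g x \<in> carrier G" if "x \<in> topspace (nsphere n)" for x
    using p[OF that] a b k by (simp add: g_def)
  ultimately show ?thesis by blast
qed

text \<open>Since step functions form a contractible space, maps to it extend from a sphere over the disc.\<close>

lemma extend_over_cell:
  assumes f: "continuous_map (nsphere n) (orbit_topology G) f" and n: "2 \<le> n"
  shows "\<exists>F. continuous_map (closed_disc (Suc n)) (step_topology G) F \<and>
    (\<forall>x\<in>topspace (nsphere n). \<exists>g\<in>carrier G. F x = translate G g (f x))"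
proof -
  obtain g where g: "\<And>x. x \<in> topspace (nsphere n) \<Longrightarrow> g x \<in> carrier G"
    "continuous_map (nsphere n) (step_topology G) (\<lambda>x. translate G (g x) (f x))"
    using lift_nsphere[OF assms] by blast
  \<comment> \<open>The lift on the sphere is extended radially and cut at
    \<open>1 - \<rho>\<close>, so that it becomes the neutral function at the centre.\<close>
  define \<rho> :: "(nat \<Rightarrow> real) \<Rightarrow> real" where "\<rho> x = sqrt (\<Sum>i\<le>n. (x i)\<^sup>2)" for x
  let ?D = "closed_disc (Suc n)"
  have \<rho>: "continuous_map ?D euclideanreal \<rho>"
    unfolding \<rho>_def closed_disc_eq
    by (intro continuous_map_sqrt continuous_map_sum continuous_map_real_pow continuous_map_coordinate) auto
  have r01: "\<rho> x \<in> {0..1}" if "x \<in> topspace ?D" for x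
    using that by (auto simp: \<rho>_def disc_set_def lessThan_Suc_atMost sum_nonneg)
  let ?n = "\<lambda>x i. x i / \<rho> x"
  have cn: "continuous_map (subtopology ?D {x. 0 < \<rho> x}) (nsphere n) ?n"
    unfolding nsphere continuous_map_in_subtopology
  proof
    have "continuous_map (subtopology ?D {x. 0 < \<rho> x}) euclideanreal (\<lambda>x. x i / \<rho> x)" for i
      by (intro continuous_map_real_divide continuous_map_from_subtopology[OF \<rho>])
        (auto simp: closed_disc_eq subtopology_subtopology continuous_map_coordinate)
    then show "continuous_map (subtopology ?D {x. 0 < \<rho> x}) (powertop_real UNIV) ?n"
      by (simp add: continuous_map_componentwise_UNIV)
    show "?n \<in> topspace (subtopology ?D {x. 0 < \<rho> x}) \<rightarrow> {x. (\<Sum>i\<le>n. (x i)\<^sup>2) = 1 \<and> (\<forall>i>n. x i = 0)}"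
    proof
      fix x assume "x \<in> topspace (subtopology ?D {x. 0 < \<rho> x})"
      then have x: "x \<in> disc_set (Suc n)" "0 < \<rho> x" by auto
      have "(\<Sum>i\<le>n. (x i / \<rho> x)\<^sup>2) = (\<Sum>i\<le>n. (x i)\<^sup>2) / (\<rho> x)\<^sup>2"
        by (simp add: power_divide sum_divide_distrib)
      also have "\<dots> = 1" using x(2) by (simp add: \<rho>_def sum_nonneg)
      finally show "?n x \<in> {x. (\<Sum>i\<le>n. (x i)\<^sup>2) = 1 \<and> (\<forall>i>n. x i = 0)}"
        using x(1) by (auto simp: disc_set_def)
    qed
  qed
  define F0 where "F0 = (\<lambda>x. translate G (g x) (f x))"
  have "continuous_map (subtopology ?D {x. 0 < \<rho> x}) (step_topology G) (\<lambda>x. F0 (?n x))"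
    using continuous_map_compose[OF cn g(2)] by (simp add: o_def F0_def)
  from continuous_map_cone[OF \<rho> r01 this]
  have "continuous_map ?D (step_topology G) (\<lambda>x. cut G (1 - \<rho> x) (if \<rho> x = 0 then \<lambda>_. \<one> else F0 (?n x)))"
    by simp
  moreover have "cut G (1 - \<rho> x) (if \<rho> x = 0 then \<lambda>_. \<one> else F0 (?n x)) = translate G (g x) (f x)"
    if "x \<in> topspace (nsphere n)" for x
  proof -
    have "\<rho> x = 1" using that by (simp add: \<rho>_def nsphere_eq)
    then show ?thesis by (simp add: F0_def)
  qed
  ultimately show ?thesis using g(1) by blast
qed

end

section \<open>Maps on the presentation complex\<close>

text \<open>\<open>word_loop\<close> at unit speed, on the interval from 0 to the length of
  \<open>w\<close>. Removing the first letter is then a shift of the parameter by 1, which allows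
  induction over the word.\<close>

definition word_point :: "'a word \<Rightarrow> real \<Rightarrow> 'a cell_point"
  where "word_point w u =
    (let j = nat \<lfloor>u\<rfloor> in
      if j < length w
      then (case w ! j of (s, b) \<Rightarrow> edge_map s (if b then u - real j else 1 - (u - real j)))
      else Vertex)"

lemma word_loop_eq: "word_loop w t = word_point w (real (length w) * t)"
  by (simp add: word_loop_def word_point_def Let_def)

lemma word_point_Nil [simp]: "word_point [] u = Vertex"
  by (simp add: word_point_def)

lemma word_point_Cons_lt:
  assumes "0 \<le> u" "u < 1"
  shows "word_point ((s, b) # w) u = edge_map s (if b then u else 1 - u)"
proof -
  have "\<lfloor>u\<rfloor> = 0" using assms by linarith
  then show ?thesis by (simp add: word_point_def)
qed

lemma word_point_Cons_ge:
  assumes "1 \<le> u"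
  shows "word_point (x # w) u = word_point w (u - 1)"
proof -
  have "\<lfloor>u\<rfloor> = \<lfloor>u - 1\<rfloor> + 1" "0 \<le> \<lfloor>u - 1\<rfloor>" using assms by linarith+
  then have "nat \<lfloor>u\<rfloor> = Suc (nat \<lfloor>u - 1\<rfloor>)" by linarith
  then show ?thesis by (simp add: word_point_def Let_def algebra_simps split: prod.split)
qed

lemma edge_map_in_one_skeleton [simp]: "s \<in> S \<Longrightarrow> edge_map s t \<in> one_skeleton S"
  by (auto simp: edge_map_def one_skeleton_def)

lemma Vertex_in_one_skeleton [simp]: "Vertex \<in> one_skeleton S"
  by (simp add: one_skeleton_def)

lemma word_point_in_one_skeleton:
  assumes "fst ` set w \<subseteq> S"
  shows "word_point w u \<in> one_skeleton S"
proof (cases "nat \<lfloor>u\<rfloor> < length w")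
  case True
  then have "fst (w ! nat \<lfloor>u\<rfloor>) \<in> S" using assms nth_mem by blast
  then show ?thesis by (auto simp: word_point_def Let_def split: prod.split)
qed (simp add: word_point_def)

lemma topspace_presentation_complex:
  assumes "fst ` set r \<subseteq> S"
  shows "topspace (presentation_complex S r) = one_skeleton S \<union> Face ` ball 0 1"
proof
  show "topspace (presentation_complex S r) \<subseteq> one_skeleton S \<union> Face ` ball 0 1"
    using openin_topspace[of "presentation_complex S r"] by (simp only: openin_presentation_complex)
  have "{t \<in> {0..1}. edge_map s t \<in> one_skeleton S \<union> Face ` ball 0 1} = {0..1}" if "s \<in> S" for s
    using that by auto
  moreover have "{z \<in> cball 0 1. face_map r z \<in> one_skeleton S \<union> Face ` ball 0 1} = cball 0 1"
    using word_point_in_one_skeleton[OF assms] by (auto simp: face_map_def word_loop_eq)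
  ultimately have "openin (presentation_complex S r) (one_skeleton S \<union> Face ` ball 0 1)"
    unfolding openin_presentation_complex by auto
  then show "one_skeleton S \<union> Face ` ball 0 1 \<subseteq> topspace (presentation_complex S r)"
    by (rule openin_subset)
qed

text \<open>The universal property of the final topology for the characteristic maps.\<close>

lemma continuous_map_presentation_complex:
  assumes r: "fst ` set r \<subseteq> S"
    and edge: "\<And>s. s \<in> S \<Longrightarrow> continuous_map (top_of_set {0..1}) T (f \<circ> edge_map s)"
    and face: "continuous_map (top_of_set (cball 0 1)) T (f \<circ> face_map r)"
    and im: "f \<in> one_skeleton S \<union> Face ` ball 0 1 \<rightarrow> topspace T"
  shows "continuous_map (presentation_complex S r) T f"
  unfolding continuous_map_def topspace_presentation_complex[OF r]
proof (intro conjI allI impI im)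
  fix U assume U: "openin T U"
  let ?P = "one_skeleton S \<union> Face ` ball 0 1"
  have "openin (top_of_set {0..1}) {t \<in> {0..1}. edge_map s t \<in> {x \<in> ?P. f x \<in> U}}" if "s \<in> S" for s
  proof -
    have "{t \<in> {0..1}. edge_map s t \<in> {x \<in> ?P. f x \<in> U}} =
        {t \<in> topspace (top_of_set {0..1}). (f \<circ> edge_map s) t \<in> U}"
      using that by auto
    then show ?thesis using edge[OF that] U by (simp only: openin_continuous_map_preimage)
  qed
  moreover have "openin (top_of_set (cball 0 1)) {z \<in> cball 0 1. face_map r z \<in> {x \<in> ?P. f x \<in> U}}"
  proof -
    have "{z \<in> cball 0 1. face_map r z \<in> {x \<in> ?P. f x \<in> U}} =
        {z \<in> topspace (top_of_set (cball 0 1)). (f \<circ> face_map r) z \<in> U}"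
      using word_point_in_one_skeleton[OF r] by (auto simp: face_map_def word_loop_eq)
    then show ?thesis using face U by (simp only: openin_continuous_map_preimage)
  qed
  ultimately show "openin (presentation_complex S r) {x \<in> ?P. f x \<in> U}"
    unfolding openin_presentation_complex by auto
qed

lemma continuous_map_edge_map:
  assumes "fst ` set r \<subseteq> S" "s \<in> S"
  shows "continuous_map (top_of_set {0..1}) (presentation_complex S r) (edge_map s)"
  using assms unfolding continuous_map_def topspace_presentation_complex[OF assms(1)]
  by (auto simp: openin_presentation_complex)

lemma continuous_map_face_map:
  assumes "fst ` set r \<subseteq> S"
  shows "continuous_map (top_of_set (cball 0 1)) (presentation_complex S r) (face_map r)"
  using word_point_in_one_skeleton[OF assms] unfolding continuous_map_def topspace_presentation_complex[OF assms(1)]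
  by (auto simp: openin_presentation_complex face_map_def word_loop_eq)

text \<open>\<open>Arg2pi\<close> jumps across the positive reals, where \<open>L 0 = L 1\<close>
  absorbs the jump. On the lower half plane \<open>Arg2pi (- z) + pi\<close> is used, which is
  continuous up to the real axis, and the two halves are pasted there.\<close>

lemma continuous_map_angle_loop:
  assumes L: "continuous_map (top_of_set {0..1}) T L" and L01: "L 0 = L 1" and K: "0 \<notin> K"
  shows "continuous_map (top_of_set K) T (\<lambda>z. L (Arg2pi z / (2 * pi)))"
proof -
  have comp: "continuous_map (top_of_set A) T (\<lambda>z. L (\<theta> z / (2 * pi)))"
    if "continuous_on A \<theta>" "\<And>z. z \<in> A \<Longrightarrow> \<theta> z \<in> {0..2 * pi}" for A :: "complex set" and \<theta>
  proof -
    have "continuous_map (top_of_set A) (top_of_set {0..1}) (\<lambda>z. \<theta> z / (2 * pi))"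
      using that by (auto simp: continuous_map_in_subtopology divide_le_eq intro!: continuous_intros)
    from continuous_map_compose[OF this L] show ?thesis by (simp add: o_def)
  qed
  have "continuous_map (top_of_set K) T
    (\<lambda>z. if 0 \<le> Im z then L (Arg2pi z / (2 * pi)) else L ((Arg2pi (- z) + pi) / (2 * pi)))"
  proof (rule continuous_map_cases_le)
    show "continuous_map (top_of_set K) euclideanreal (\<lambda>x. 0)" by simp
    show "continuous_map (top_of_set K) euclideanreal Im"
      by (simp add: continuous_on_Im)
    have "continuous_on (K \<inter> {z. 0 \<le> Im z}) Arg2pi"
      by (rule continuous_on_subset[OF continuous_on_upperhalf_Arg2pi]) (use K in auto)
    then have "continuous_map (top_of_set (K \<inter> {z. 0 \<le> Im z})) T (\<lambda>z. L (Arg2pi z / (2 * pi)))"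
      using Arg2pi by (intro comp) (auto simp: less_imp_le)
    moreover have "K \<inter> {x \<in> topspace (top_of_set K). 0 \<le> Im x} = K \<inter> {z. 0 \<le> Im z}" by auto
    ultimately show "continuous_map (subtopology (top_of_set K) {x \<in> topspace (top_of_set K). 0 \<le> Im x}) T
        (\<lambda>z. L (Arg2pi z / (2 * pi)))"
      by (simp add: subtopology_subtopology)
    have "continuous_on (K \<inter> {z. Im z \<le> 0}) (\<lambda>z. Arg2pi (- z))"
      by (intro continuous_on_compose2[OF continuous_on_upperhalf_Arg2pi, of _ uminus] continuous_intros)
        (use K in auto)
    then have "continuous_map (top_of_set (K \<inter> {z. Im z \<le> 0})) T (\<lambda>z. L ((Arg2pi (- z) + pi) / (2 * pi)))"
      using Arg2pi Arg2pi_le_pi by (intro comp continuous_intros) (auto simp: add_nonneg_nonneg)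
    moreover have "K \<inter> {x \<in> topspace (top_of_set K). Im x \<le> 0} = K \<inter> {z. Im z \<le> 0}" by auto
    ultimately show "continuous_map (subtopology (top_of_set K) {x \<in> topspace (top_of_set K). Im x \<le> 0}) T
        (\<lambda>z. L ((Arg2pi (- z) + pi) / (2 * pi)))"
      by (simp add: subtopology_subtopology)
    fix z assume z: "z \<in> topspace (top_of_set K)" "0 = Im z"
    then have nz: "z \<noteq> 0" "z \<in> \<real>" "Re z \<noteq> 0"
      using K complex_eqI[of z 0] by (auto simp: complex_is_Real_iff)
    show "L (Arg2pi z / (2 * pi)) = L ((Arg2pi (- z) + pi) / (2 * pi))"
      using nz L01 by (cases "0 < Re z") (simp_all add: Arg2pi_real)
  qed
  then show ?thesis
  proof (rule continuous_map_eq)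
    fix z assume z: "z \<in> topspace (top_of_set K)"
    then have "z \<noteq> 0" using K by auto
    then have "Arg2pi z = Arg2pi (- z) + pi" if "Im z < 0"
      using that Arg2pi_minus[of "- z"] Arg2pi_lt_pi[of "- z"] by auto
    then show "(if 0 \<le> Im z then L (Arg2pi z / (2 * pi)) else L ((Arg2pi (- z) + pi) / (2 * pi))) =
        L (Arg2pi z / (2 * pi))" by auto
  qed
qed

text \<open>The default 0 off \<open>[0,1)\<close> makes \<open>jump\<close> constant on the whole
  line for parameters outside the open unit interval, so that ends of paths agree as functions and
  not just almost everywhere.\<close>

definition clamp_unit :: "real \<Rightarrow> real"
  where "clamp_unit t = (if 0 \<le> t \<and> t < 1 then t else 0)"

lemma clamp_unit_bounds: "0 \<le> clamp_unit t" "clamp_unit t < 1"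
  by (auto simp: clamp_unit_def)

text \<open>A path of step functions of speed at most 1, from the constant \<one> to the constant
  \<open>g\<close>. It lies over a 1-cell labelled \<open>g\<close>.\<close>

definition jump :: "('g, 'h) monoid_scheme \<Rightarrow> 'g \<Rightarrow> real \<Rightarrow> real \<Rightarrow> 'g"
  where "jump G g u = (\<lambda>t. if clamp_unit t < u then g else \<one>\<^bsub>G\<^esub>)"

text \<open>An inverse letter runs the path of its generator backwards. Translating by the inverse
  makes it start at the neutral function, so that letter paths can be multiplied.\<close>

definition letter_path :: "('g, 'h) monoid_scheme \<Rightarrow> ('a \<Rightarrow> 'g) \<Rightarrow> 'a \<times> bool \<Rightarrow> real \<Rightarrow> real \<Rightarrow> 'g"
  where "letter_path G a x u = (case x of (s, b) \<Rightarrow>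
    if b then jump G (a s) u else translate G (inv\<^bsub>G\<^esub> (a s)) (jump G (a s) (1 - u)))"

text \<open>A pointwise product instead of a concatenation: at time \<open>u\<close> finished
  letters contribute constants, later letters are still neutral, and one letter moves. The end is
  the constant \<open>eval_word\<close>.\<close>

fun word_path :: "('g, 'h) monoid_scheme \<Rightarrow> ('a \<Rightarrow> 'g) \<Rightarrow> 'a word \<Rightarrow> real \<Rightarrow> real \<Rightarrow> 'g"
  where
    "word_path G a [] u = (\<lambda>_. \<one>\<^bsub>G\<^esub>)"
  | "word_path G a (x # w) u = (\<lambda>t. letter_path G a x u t \<otimes>\<^bsub>G\<^esub> word_path G a w (u - 1) t)"

fun eval_word :: "('g, 'h) monoid_scheme \<Rightarrow> ('a \<Rightarrow> 'g) \<Rightarrow> 'a word \<Rightarrow> 'g"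
  where
    "eval_word G a [] = \<one>\<^bsub>G\<^esub>"
  | "eval_word G a (x # w) = (if snd x then a (fst x) else inv\<^bsub>G\<^esub> (a (fst x))) \<otimes>\<^bsub>G\<^esub> eval_word G a w"

text \<open>Towards the end of an edge labelled \<open>g\<close> the value tends to the constant
  \<open>g\<close>, while the vertex has the constant \<one>. The jump is a translation, so the map
  is continuous into the orbit topology.\<close>

definition skeleton_map :: "('g, 'h) monoid_scheme \<Rightarrow> ('a \<Rightarrow> 'g) \<Rightarrow> 'a cell_point \<Rightarrow> real \<Rightarrow> 'g"
  where "skeleton_map G a p = (case p of Edge s t \<Rightarrow> jump G (a s) t | _ \<Rightarrow> \<lambda>_. \<one>\<^bsub>G\<^esub>)"

text \<open>On the 2-cell this is the cone over the path of the relator: the angle is the parameter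
  of the path and the radius controls the cut.\<close>

definition complex_map ::
    "('g, 'h) monoid_scheme \<Rightarrow> ('a \<Rightarrow> 'g) \<Rightarrow> 'a word \<Rightarrow> 'a cell_point \<Rightarrow> real \<Rightarrow> 'g"
  where "complex_map G a r p = (case p of
      Face z \<Rightarrow> cut G (1 - cmod z) (if z = 0 then \<lambda>_. \<one>\<^bsub>G\<^esub>
        else word_path G a r (real (length r) * (Arg2pi z / (2 * pi))))
    | _ \<Rightarrow> skeleton_map G a p)"

lemma complex_map_skeleton: "p \<in> one_skeleton S \<Longrightarrow> complex_map G a r p = skeleton_map G a p"
  by (auto simp: complex_map_def one_skeleton_def)

context group
begin

lemma jump_step_functions [simp, intro]:
  assumes "g \<in> carrier G"
  shows "jump G g u \<in> step_functions G"
proof -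
  have "range (jump G g u) \<subseteq> {g, \<one>}" by (auto simp: jump_def)
  moreover have b: "{t. clamp_unit t < u} \<in> sets lborel"
  proof -
    have "{t. clamp_unit t < u} = ({0..<1} \<inter> {..<u}) \<union> (if 0 < u then - {0..<1} else {})"
      by (auto simp: clamp_unit_def)
    then show ?thesis by simp
  qed
  then have "{t. jump G g u t = h} \<in> sets lborel" for h
  proof -
    have "{t. jump G g u t = h} =
        ({t. clamp_unit t < u} \<inter> (if g = h then UNIV else {})) \<union> (- {t. clamp_unit t < u} \<inter> (if h = \<one> then UNIV else {}))"
      by (auto simp: jump_def)
    moreover have "- {t. clamp_unit t < u} \<in> sets lborel"
      using sets.compl_sets[OF b] by (simp add: Compl_eq_Diff_UNIV)
    ultimately show ?thesis using b by (auto intro!: sets.Un)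
  qed
  ultimately show ?thesis
    using assms finite_subset[of "range (jump G g u)" "{g, \<one>}"] by (auto simp: step_functions_def)
qed

lemma jump_0: "u \<le> 0 \<Longrightarrow> jump G g u = (\<lambda>_. \<one>)"
  and jump_1: "1 \<le> u \<Longrightarrow> jump G g u = (\<lambda>_. g)"
proof -
  show "u \<le> 0 \<Longrightarrow> jump G g u = (\<lambda>_. \<one>)" "1 \<le> u \<Longrightarrow> jump G g u = (\<lambda>_. g)"
    using clamp_unit_bounds(1)[THEN leD] clamp_unit_bounds(2)
    by (auto simp: jump_def fun_eq_iff dest: order.strict_trans2)
qed

lemma step_dist_jump:
  assumes "g \<in> carrier G"
  shows "step_dist (jump G g u) (jump G g u') \<le> \<bar>u - u'\<bar>"
proof -
  have "step_dist (jump G g u) (jump G g u') \<le> max u u' - min u u'"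
  proof (rule step_dist_le_interval[of _ _ _ _ G])
    fix t :: real assume "t \<in> {0..<1}" "jump G g u t \<noteq> jump G g u' t"
    then show "t \<in> {min u u'..max u u'}" by (auto simp: jump_def clamp_unit_def split: if_splits)
  qed (use assms in auto)
  then show ?thesis by linarith
qed

lemma step_functions_mult:
  assumes "x \<in> step_functions G" "y \<in> step_functions G"
  shows "(\<lambda>t. x t \<otimes> y t) \<in> step_functions G"
proof -
  have "range (\<lambda>t. x t \<otimes> y t) \<subseteq> (\<lambda>(g, h). g \<otimes> h) ` (range x \<times> range y)" by auto
  then have "finite (range (\<lambda>t. x t \<otimes> y t))"
    by (rule finite_subset) (use assms in \<open>auto simp: step_functions_def\<close>)
  moreover have "{t. x t \<otimes> y t = g} \<in> sets lborel" for g
  proof -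
    let ?I = "{p \<in> range x \<times> range y. fst p \<otimes> snd p = g}"
    have "finite ?I" using assms by (auto simp: step_functions_def)
    moreover have "{t. x t = fst p} \<inter> {t. y t = snd p} \<in> sets lborel" for p
      using assms by (intro sets.Int) (simp_all add: step_functions_def)
    ultimately have "(\<Union>p\<in>?I. {t. x t = fst p} \<inter> {t. y t = snd p}) \<in> sets lborel"
      by (intro sets.finite_UN)
    also have "(\<Union>p\<in>?I. {t. x t = fst p} \<inter> {t. y t = snd p}) = {t. x t \<otimes> y t = g}"
      by auto metis
    finally show ?thesis .
  qed
  ultimately show ?thesis using assms by (auto simp: step_functions_def)
qed

text \<open>The products can differ only where one of the factors does.\<close>

lemma step_dist_mult:
  assumes "x \<in> step_functions G" "y \<in> step_functions G" "x' \<in> step_functions G" "y' \<in> step_functions G"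
  shows "step_dist (\<lambda>t. x t \<otimes> y t) (\<lambda>t. x' t \<otimes> y' t) \<le> step_dist x x' + step_dist y y'"
proof -
  let ?D = "\<lambda>x y. {t \<in> {0..<1::real}. x t \<noteq> y t}"
  have m: "?D x x' \<in> sets lborel" "?D y y' \<in> sets lborel"
    "?D (\<lambda>t. x t \<otimes> y t) (\<lambda>t. x' t \<otimes> y' t) \<in> sets lborel"
    using step_differ_measurable[OF assms(1,3)] step_differ_measurable[OF assms(2,4)]
      step_differ_measurable[OF step_functions_mult[OF assms(1,2)] step_functions_mult[OF assms(3,4)]]
    by auto
  have "measure lborel (?D (\<lambda>t. x t \<otimes> y t) (\<lambda>t. x' t \<otimes> y' t)) \<le> measure lborel (?D x x' \<union> ?D y y')"
    using m by (intro measure_mono_fmeasurable unit_interval_subset_fmeasurable) auto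
  also have "\<dots> \<le> measure lborel (?D x x') + measure lborel (?D y y')"
    using m by (intro measure_Un_le) auto
  finally show ?thesis by (simp add: step_dist_def)
qed

lemma letter_path_step_functions:
  assumes "a (fst x) \<in> carrier G"
  shows "letter_path G a x u \<in> step_functions G"
  using assms by (auto simp: letter_path_def split: prod.split)

lemma step_dist_letter_path:
  assumes "a (fst x) \<in> carrier G"
  shows "step_dist (letter_path G a x u) (letter_path G a x u') \<le> \<bar>u - u'\<bar>"
  using assms step_dist_jump[of "a (fst x)" u u'] step_dist_jump[of "a (fst x)" "1 - u" "1 - u'"]
  by (auto simp: letter_path_def abs_minus_commute split: prod.split)

lemma word_path_step_functions:
  assumes "\<forall>s\<in>fst ` set w. a s \<in> carrier G"
  shows "word_path G a w u \<in> step_functions G"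
  using assms
proof (induction w arbitrary: u)
  case (Cons x w)
  then show ?case using letter_path_step_functions[of a x u] step_functions_mult by simp
qed auto

lemma step_dist_word_path:
  assumes "\<forall>s\<in>fst ` set w. a s \<in> carrier G"
  shows "step_dist (word_path G a w u) (word_path G a w u') \<le> real (length w) * \<bar>u - u'\<bar>"
  using assms
proof (induction w arbitrary: u u')
  case (Cons x w)
  have "step_dist (word_path G a (x # w) u) (word_path G a (x # w) u') \<le>
    step_dist (letter_path G a x u) (letter_path G a x u') +
    step_dist (word_path G a w (u - 1)) (word_path G a w (u' - 1))"
    unfolding word_path.simps
    by (intro step_dist_mult letter_path_step_functions word_path_step_functions) (use Cons.prems in auto)
  also have "\<dots> \<le> \<bar>u - u'\<bar> + real (length w) * \<bar>(u - 1) - (u' - 1)\<bar>"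
    by (intro add_mono step_dist_letter_path Cons.IH) (use Cons.prems in auto)
  finally show ?case by (simp add: algebra_simps)
qed simp

lemma continuous_map_word_path:
  assumes w: "\<forall>s\<in>fst ` set w. a s \<in> carrier G" and u: "continuous_map K euclideanreal u"
  shows "continuous_map K (step_topology G) (\<lambda>x. word_path G a w (u x))"
proof -
  have "\<exists>U. openin K U \<and> x \<in> U \<and> (\<forall>y\<in>U. step_dist (word_path G a w (u x)) (word_path G a w (u y)) < e)"
    if x: "x \<in> topspace K" "0 < e" for x e
  proof -
    define d where "d = e / (real (length w) + 1)"
    have d: "d > 0" using x by (simp add: d_def)
    have "openin K {y \<in> topspace K. u y \<in> ball (u x) d}"
      by (rule openin_continuous_map_preimage[OF u]) simp
    moreover have "step_dist (word_path G a w (u x)) (word_path G a w (u y)) < e" if "u y \<in> ball (u x) d" for y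
    proof -
      have "step_dist (word_path G a w (u x)) (word_path G a w (u y)) \<le> real (length w) * \<bar>u x - u y\<bar>"
        by (rule step_dist_word_path[OF w])
      also have "\<dots> \<le> real (length w) * d"
        using that by (intro mult_left_mono) (auto simp: dist_real_def)
      also have "\<dots> < e" using x(2) by (simp add: d_def field_simps)
      finally show ?thesis .
    qed
    ultimately show ?thesis using x d
      by (intro exI[of _ "{y \<in> topspace K. u y \<in> ball (u x) d}"]) auto
  qed
  then show ?thesis using word_path_step_functions[OF w] by (simp add: continuous_map_step)
qed

lemma eval_word_closed:
  "\<forall>s\<in>fst ` set w. a s \<in> carrier G \<Longrightarrow> eval_word G a w \<in> carrier G"
  by (induction w) auto

lemma word_path_0:
  assumes "\<forall>s\<in>fst ` set w. a s \<in> carrier G" "u \<le> 0"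
  shows "word_path G a w u = (\<lambda>_. \<one>)"
  using assms
proof (induction w arbitrary: u)
  case (Cons x w)
  then show ?case
    by (auto simp: letter_path_def jump_0 jump_1 translate_def split: prod.split)
qed simp

lemma word_path_length:
  assumes "\<forall>s\<in>fst ` set w. a s \<in> carrier G" "real (length w) \<le> u"
  shows "word_path G a w u = (\<lambda>_. eval_word G a w)"
  using assms
proof (induction w arbitrary: u)
  case (Cons x w)
  then have "1 \<le> u" "1 - u \<le> 0" "word_path G a w (u - 1) = (\<lambda>_. eval_word G a w)" by auto
  then show ?case using Cons.prems
    by (auto simp: letter_path_def jump_0 jump_1 translate_def split: prod.split)
qed simp

lemma skeleton_map_step_functions:
  assumes "p \<in> one_skeleton S" "\<forall>s\<in>S. a s \<in> carrier G"
  shows "skeleton_map G a p \<in> step_functions G"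
  using assms by (auto simp: one_skeleton_def skeleton_map_def)

lemma letter_path_orbit:
  assumes "a s \<in> carrier G" "0 \<le> u" "u \<le> 1"
  shows "\<exists>g\<in>carrier G. letter_path G a (s, b) u = translate G g (skeleton_map G a (edge_map s (if b then u else 1 - u)))"
proof (cases "u = 0 \<or> u = 1")
  case True
  then have "\<exists>g\<in>carrier G. letter_path G a (s, b) u = (\<lambda>_. g)"
    using assms by (auto simp: letter_path_def jump_0 jump_1 translate_def)
  then show ?thesis
    using True by (auto simp: skeleton_map_def edge_map_def translate_def)
next
  case False
  then have u: "0 < u" "u < 1" using assms by auto
  show ?thesis
  proof (cases b)
    case True
    then have "letter_path G a (s, b) u = translate G \<one> (skeleton_map G a (edge_map s (if b then u else 1 - u)))"
      using u assms by (simp add: letter_path_def skeleton_map_def edge_map_def)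
    then show ?thesis by blast
  next
    case False
    then have "letter_path G a (s, b) u = translate G (inv (a s)) (skeleton_map G a (edge_map s (if b then u else 1 - u)))"
      using u assms by (simp add: letter_path_def skeleton_map_def edge_map_def)
    then show ?thesis using assms by blast
  qed
qed

text \<open>\<open>word_path\<close> lifts \<open>skeleton_map\<close> along the loop of the word:
  finished letters act as translations from the left.\<close>

lemma word_path_orbit:
  assumes "\<forall>s\<in>fst ` set w. a s \<in> carrier G" "0 \<le> u"
  shows "\<exists>g\<in>carrier G. word_path G a w u = translate G g (skeleton_map G a (word_point w u))"
  using assms
proof (induction w arbitrary: u)
  case Nil
  then show ?case by (auto simp: skeleton_map_def translate_def)
next
  case (Cons x w)
  obtain s b where x: "x = (s, b)" by (cases x)
  have s: "a s \<in> carrier G" "\<forall>s\<in>fst ` set w. a s \<in> carrier G" using Cons.prems x by auto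
  have p: "skeleton_map G a (word_point (x # w) u) \<in> step_functions G"
    using skeleton_map_step_functions[OF word_point_in_one_skeleton[of "x # w" "fst ` set (x # w)"]] Cons.prems
    by simp
  show ?case
  proof (cases "u < 1")
    case True
    then have "word_path G a (x # w) u = letter_path G a x u"
      using word_path_0[OF s(2), of "u - 1"] letter_path_step_functions[of a x u] x s
      by (auto simp: fun_eq_iff)
    then show ?thesis
      using letter_path_orbit[of a s u b] True Cons.prems s x by (simp add: word_point_Cons_lt)
  next
    case False
    then obtain g where g: "g \<in> carrier G"
      "word_path G a w (u - 1) = translate G g (skeleton_map G a (word_point w (u - 1)))"
      using Cons.IH[OF s(2), of "u - 1"] by auto
    have "letter_path G a x u = (\<lambda>_. if b then a s else inv (a s))"
      using False s x by (auto simp: letter_path_def jump_0 jump_1 translate_def)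
    then have "word_path G a (x # w) u = translate G (if b then a s else inv (a s)) (translate G g (skeleton_map G a (word_point (x # w) u)))"
      using g(2) False by (simp add: word_point_Cons_ge translate_def)
    also have "\<dots> = translate G ((if b then a s else inv (a s)) \<otimes> g) (skeleton_map G a (word_point (x # w) u))"
      using s g p by (intro translate_translate) auto
    finally show ?thesis using s g by (metis inv_closed m_closed)
  qed
qed

lemma continuous_map_skeleton_edge:
  assumes "a s \<in> carrier G"
  shows "continuous_map (top_of_set {0..1}) (orbit_topology G) (skeleton_map G a \<circ> edge_map s)"
proof (rule continuous_map_orbit_translates)
  show "continuous_map (top_of_set {0..1}) (orbit_topology G) (\<lambda>u. word_path G a [(s, True)] u)"
    using assms by (intro continuous_map_step_imp_orbit continuous_map_word_path) auto
  fix u :: real assume u: "u \<in> topspace (top_of_set {0..1})"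
  show "(skeleton_map G a \<circ> edge_map s) u \<in> step_functions G"
    using skeleton_map_step_functions[of _ "{s}"] assms by simp
  have "word_point [(s, True)] u = edge_map s u"
    using u by (cases "u < 1") (auto simp: word_point_Cons_lt word_point_Cons_ge edge_map_def)
  then show "\<exists>g\<in>carrier G. word_path G a [(s, True)] u = translate G g ((skeleton_map G a \<circ> edge_map s) u)"
    using word_path_orbit[of "[(s, True)]" a u] u assms by simp
qed

lemma continuous_map_angle_path:
  assumes a: "\<forall>s\<in>fst ` set r. a s \<in> carrier G" and r: "eval_word G a r = \<one>"
    and K: "0 \<notin> K"
  shows "continuous_map (top_of_set K) (step_topology G)
    (\<lambda>z. word_path G a r (real (length r) * (Arg2pi z / (2 * pi))))"
proof (rule continuous_map_angle_loop[OF _ _ K])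
  show "continuous_map (top_of_set {0..1}) (step_topology G) (\<lambda>t. word_path G a r (real (length r) * t))"
    by (intro continuous_map_word_path a) (auto intro!: continuous_intros)
  show "word_path G a r (real (length r) * 0) = word_path G a r (real (length r) * 1)"
    using word_path_0[OF a, of 0] word_path_length[OF a, of "real (length r)"] r by simp
qed

text \<open>The relation \<open>eval_word G a r = \<one>\<close> closes the word path of the relator
  to a loop of step functions, whose cone fills the 2-cell.\<close>

lemma continuous_map_complex_map:
  assumes rS: "fst ` set r \<subseteq> S" and a: "\<forall>s\<in>S. a s \<in> carrier G" and r: "eval_word G a r = \<one>"
  shows "continuous_map (presentation_complex S r) (orbit_topology G) (complex_map G a r)"
proof (rule continuous_map_presentation_complex[OF rS])
  have ar: "\<forall>s\<in>fst ` set r. a s \<in> carrier G" using a rS by auto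
  let ?L = "\<lambda>z. word_path G a r (real (length r) * (Arg2pi z / (2 * pi)))"
  let ?F = "\<lambda>z. cut G (1 - cmod z) (if cmod z = 0 then \<lambda>_. \<one> else ?L z)"
  have st: "complex_map G a r p \<in> step_functions G" if "p \<in> one_skeleton S \<union> Face ` ball 0 1" for p
  proof (cases p)
    case (Face z)
    then show ?thesis using word_path_step_functions[OF ar]
      by (auto simp: complex_map_def)
  qed (use that skeleton_map_step_functions[of p S a] a in \<open>auto simp: complex_map_def\<close>)
  then show "complex_map G a r \<in> one_skeleton S \<union> Face ` ball 0 1 \<rightarrow> topspace (orbit_topology G)" by auto
  fix s assume s: "s \<in> S"
  have "continuous_map (top_of_set {0..1}) (orbit_topology G) (skeleton_map G a \<circ> edge_map s)"
    by (rule continuous_map_skeleton_edge) (use s a in simp)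
  then show "continuous_map (top_of_set {0..1}) (orbit_topology G) (complex_map G a r \<circ> edge_map s)"
    by (rule continuous_map_eq) (use s in \<open>simp add: complex_map_skeleton[OF edge_map_in_one_skeleton[of s S]]\<close>)
next
  have ar: "\<forall>s\<in>fst ` set r. a s \<in> carrier G" using a rS by auto
  let ?L = "\<lambda>z. word_path G a r (real (length r) * (Arg2pi z / (2 * pi)))"
  let ?F = "\<lambda>z. cut G (1 - cmod z) (if cmod z = 0 then \<lambda>_. \<one> else ?L z)"
  have "continuous_map (top_of_set (cball 0 1)) (step_topology G) ?F"
  proof (rule continuous_map_cone)
    show "continuous_map (top_of_set (cball (0::complex) 1)) euclideanreal cmod"
      by (simp add: continuous_intros)
    show "continuous_map (subtopology (top_of_set (cball 0 1)) {z. 0 < cmod z}) (step_topology G) ?L"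
      unfolding subtopology_subtopology by (rule continuous_map_angle_path[OF ar r]) auto
  qed auto
  then have F: "continuous_map (top_of_set (cball 0 1)) (orbit_topology G) ?F"
    by (rule continuous_map_step_imp_orbit)
  show "continuous_map (top_of_set (cball 0 1)) (orbit_topology G) (complex_map G a r \<circ> face_map r)"
  proof (rule continuous_map_orbit_translates[OF F])
    fix z :: complex assume z: "z \<in> topspace (top_of_set (cball 0 1))"
    have w: "skeleton_map G a (word_point r u) \<in> step_functions G" for u
      by (rule skeleton_map_step_functions[OF word_point_in_one_skeleton[OF rS] a])
    show "(complex_map G a r \<circ> face_map r) z \<in> step_functions G"
    proof (cases "cmod z < 1")
      case True
      then show ?thesis
        using word_path_step_functions[OF ar] by (auto simp: face_map_def complex_map_def)
    next
      case False
      then show ?thesis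
        using w by (simp add: face_map_def word_loop_eq complex_map_skeleton[OF word_point_in_one_skeleton[OF rS]])
    qed
    show "\<exists>g\<in>carrier G. ?F z = translate G g ((complex_map G a r \<circ> face_map r) z)"
    proof (cases "cmod z < 1")
      case True
      then have "(complex_map G a r \<circ> face_map r) z = ?F z" by (simp add: face_map_def complex_map_def)
      moreover have "?F z \<in> step_functions G" using word_path_step_functions[OF ar] by auto
      ultimately show ?thesis by (metis one_closed translate_one)
    next
      case False
      then have z1: "cmod z = 1" using z by simp
      have "Arg2pi z \<ge> 0" using Arg2pi by blast
      then show ?thesis
        using word_path_orbit[OF ar, of "real (length r) * (Arg2pi z / (2 * pi))"] z1
        by (simp add: face_map_def word_loop_eq complex_map_skeleton[OF word_point_in_one_skeleton[OF rS]])
    qed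
  qed
qed

end

section \<open>Extension over cells of dimension at least three\<close>

lemma disc_set_cases: "disc_set n = open_disc n \<union> disc_boundary n"
  by (auto simp: disc_set_def open_disc_def disc_boundary_def topspace_Euclidean_space)

context group
begin

text \<open>For \<open>3 \<le> n\<close> the attaching sphere has dimension at least 2, so the map
  lifts over it and extends to the cell. The extension agrees with \<open>f\<close> on the boundary
  only up to translation; since closed sets of the orbit topology are unions of orbits, the weak
  topology still gives continuity.\<close>

lemma extend_over_attached_cells:
  assumes att: "attaches_cells n Z A" and n: "3 \<le> n"
    and f: "continuous_map (subtopology Z A) (orbit_topology G) f"
  shows "\<exists>f'. continuous_map Z (orbit_topology G) f' \<and> (\<forall>x\<in>A. f' x = f x)"
proof -
  have AZ: "A \<subseteq> topspace Z"
    using att by (simp add: attaches_cells_def)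
  obtain \<Phi> where *: "(\<forall>f\<in>\<Phi>. continuous_map (closed_disc n) Z f \<and> f ` disc_boundary n \<subseteq> A) \<and>
      bij_betw (\<lambda>(f, x). f x) (\<Phi> \<times> open_disc n) (topspace Z - A) \<and>
      (\<forall>C. C \<subseteq> topspace Z \<longrightarrow> (closedin Z C \<longleftrightarrow> closedin (subtopology Z A) (C \<inter> A) \<and>
          (\<forall>f\<in>\<Phi>. closedin (closed_disc n) {x \<in> topspace (closed_disc n). f x \<in> C})))"
    by (rule exE[OF conjunct2[OF att[unfolded attaches_cells_def]]])
  note \<Phi> = *[THEN conjunct1, rule_format, THEN conjunct1] *[THEN conjunct1, rule_format, THEN conjunct2]
  note bij = *[THEN conjunct2, THEN conjunct1]
  note closed = *[THEN conjunct2, THEN conjunct2, rule_format]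
  obtain m where m: "n = Suc m" "2 \<le> m" using n by (cases n) auto
  have bd: "disc_boundary n = topspace (nsphere m)" by (simp add: m disc_boundary_eq)
  have fs: "f x \<in> step_functions G" if "x \<in> A" for x
    using f that AZ by (auto simp: continuous_map_orbit)
  have "\<exists>F. continuous_map (closed_disc n) (step_topology G) F \<and>
    (\<forall>x\<in>disc_boundary n. \<exists>g\<in>carrier G. F x = translate G g (f (\<xi> x)))" if \<xi>: "\<xi> \<in> \<Phi>" for \<xi>
  proof -
    have "continuous_map (nsphere m) (subtopology Z A) \<xi>"
      using \<Phi>[OF \<xi>] bd continuous_map_from_subtopology[OF \<Phi>(1)[OF \<xi>], of "topspace (nsphere m)"]
      by (auto simp: continuous_map_in_subtopology m closed_disc_boundary)
    from continuous_map_compose[OF this f]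
    have "continuous_map (nsphere m) (orbit_topology G) (\<lambda>x. f (\<xi> x))" by (simp add: o_def)
    from extend_over_cell[OF this m(2)] show ?thesis by (simp add: m bd[unfolded m])
  qed
  then obtain F where F: "\<And>\<xi>. \<xi> \<in> \<Phi> \<Longrightarrow> continuous_map (closed_disc n) (step_topology G) (F \<xi>)"
    "\<And>\<xi> x. \<lbrakk>\<xi> \<in> \<Phi>; x \<in> disc_boundary n\<rbrakk> \<Longrightarrow> \<exists>g\<in>carrier G. F \<xi> x = translate G g (f (\<xi> x))"
    by metis
  define i where "i = inv_into (\<Phi> \<times> open_disc n) (\<lambda>(f, x). f x)"
  define f' where "f' y = (if y \<in> A then f y else F (fst (i y)) (snd (i y)))" for y
  have op: "f' (\<xi> x) = F \<xi> x" if "\<xi> \<in> \<Phi>" "x \<in> open_disc n" for \<xi> x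
  proof -
    have "\<xi> x \<in> topspace Z - A" using bij_betwE[OF bij] that by fastforce
    moreover have "i (\<xi> x) = (\<xi>, x)"
      using inv_into_f_f[OF bij_betw_imp_inj_on[OF bij], of "(\<xi>, x)"] that by (simp add: i_def)
    ultimately show ?thesis by (simp add: f'_def)
  qed
  have Fs: "F \<xi> x \<in> step_functions G" if "\<xi> \<in> \<Phi>" "x \<in> disc_set n" for \<xi> x
    using F(1)[OF that(1)] that(2) by (auto simp: continuous_map_step)
  have f's: "f' y \<in> step_functions G" if y: "y \<in> topspace Z" for y
  proof (cases "y \<in> A")
    case True
    then show ?thesis using fs by (simp add: f'_def)
  next
    case False
    then obtain \<xi> x where "\<xi> \<in> \<Phi>" "x \<in> open_disc n" "y = \<xi> x"
      using bij_betw_imp_surj_on[OF bij] y by fastforce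
    then show ?thesis using op Fs disc_set_cases by (metis UnI1)
  qed
  have "closedin Z {x \<in> topspace Z. f' x \<in> C}" if C: "closedin (orbit_topology G) C" for C
  proof -
    have "closedin (subtopology Z A) {x \<in> topspace (subtopology Z A). f x \<in> C}"
      using f C by (rule closedin_continuous_map_preimage)
    moreover have "{x \<in> topspace (subtopology Z A). f x \<in> C} = {x \<in> topspace Z. f' x \<in> C} \<inter> A"
      by (auto simp: f'_def)
    moreover have "closedin (closed_disc n) {x \<in> topspace (closed_disc n). \<xi> x \<in> {x \<in> topspace Z. f' x \<in> C}}"
      if \<xi>: "\<xi> \<in> \<Phi>" for \<xi>
    proof -
      have eq: "f' (\<xi> x) \<in> C \<longleftrightarrow> F \<xi> x \<in> C" if x: "x \<in> disc_set n" for x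
      proof (cases "x \<in> open_disc n")
        case False
        then have xb: "x \<in> disc_boundary n" using x disc_set_cases by blast
        then have "\<xi> x \<in> A" using \<Phi>(2)[OF \<xi>] by blast
        then have "f' (\<xi> x) = f (\<xi> x)" "f (\<xi> x) \<in> step_functions G" using fs by (simp_all add: f'_def)
        then show ?thesis using F(2)[OF \<xi> xb] closedin_orbit_translate[OF C] by metis
      qed (simp add: op[OF \<xi>])
      have "\<xi> x \<in> topspace Z" if "x \<in> disc_set n" for x
        using \<Phi>(1)[OF \<xi>] that by (auto simp: continuous_map_def)
      then have "{x \<in> topspace (closed_disc n). \<xi> x \<in> {x \<in> topspace Z. f' x \<in> C}} =
          {x \<in> topspace (closed_disc n). F \<xi> x \<in> C}"
        using eq by auto
      then show ?thesis
        using continuous_map_step_imp_orbit[OF F(1)[OF \<xi>]] C by (simp only: closedin_continuous_map_preimage)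
    qed
    ultimately show ?thesis by (subst closed) auto
  qed
  then have "continuous_map Z (orbit_topology G) f'"
    using f's by (auto simp: continuous_map_closedin)
  then show ?thesis by (auto simp: f'_def)
qed

lemma extend_over_cw_extension:
  assumes cw: "cw_extension_above n P X c" and n: "2 \<le> n"
    and f: "continuous_map P (orbit_topology G) f"
  shows "\<exists>f'. continuous_map X (orbit_topology G) f' \<and> (\<forall>p\<in>topspace P. f' (c p) = f p)"
proof -
  have emb: "embedding_map P X c" using cw by (simp add: cw_extension_above_def)
  obtain Y where *: "Y n = c ` topspace P \<and>
      (\<forall>k>n. attaches_cells k (subtopology X (Y k)) (Y (k - 1))) \<and>
      topspace X = (\<Union>k\<in>{n..}. Y k) \<and>
      (\<forall>C. C \<subseteq> topspace X \<longrightarrow>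
        (closedin X C \<longleftrightarrow> (\<forall>k\<ge>n. closedin (subtopology X (Y k)) (C \<inter> Y k))))"
    by (rule exE[OF conjunct2[OF cw[unfolded cw_extension_above_def]]])
  note Y0 = *[THEN conjunct1]
  note att = *[THEN conjunct2, THEN conjunct1, rule_format]
  note XY = *[THEN conjunct2, THEN conjunct2, THEN conjunct1]
  note closed = *[THEN conjunct2, THEN conjunct2, THEN conjunct2, rule_format]
  have YX: "Y k \<subseteq> topspace X" if "k \<ge> n" for k using XY that by auto
  have Ysub: "Y (n + k) \<subseteq> Y (n + Suc k)" for k
    using att[of "n + Suc k"] by (auto simp: attaches_cells_def)
  obtain d where d: "homeomorphic_maps P (subtopology X (Y n)) c d"
    using emb Y0 unfolding embedding_map_def homeomorphic_map_maps by auto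
  \<comment> \<open>Dependent choice of extensions, skeleton by skeleton; \<open>d\<close> is the
    inverse of \<open>c\<close> on the image of the complex.\<close>
  have "\<exists>fs. \<forall>k. continuous_map (subtopology X (Y (n + k))) (orbit_topology G) (fs k) \<and>
      (k = 0 \<longrightarrow> fs k = f \<circ> d) \<and> (\<forall>x\<in>Y (n + k). fs (Suc k) x = fs k x)"
  proof (rule dependent_nat_choice[where
        P = "\<lambda>k g. continuous_map (subtopology X (Y (n + k))) (orbit_topology G) g \<and> (k = 0 \<longrightarrow> g = f \<circ> d)"
        and Q = "\<lambda>k g g'. \<forall>x\<in>Y (n + k). g' x = g x", simplified conj_assoc])
    show "\<exists>g. continuous_map (subtopology X (Y (n + 0))) (orbit_topology G) g \<and> ((0::nat) = 0 \<longrightarrow> g = f \<circ> d)"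
      using d f by (auto simp: homeomorphic_maps_def intro!: continuous_map_compose)
    fix g k
    assume g: "continuous_map (subtopology X (Y (n + k))) (orbit_topology G) g \<and> (k = 0 \<longrightarrow> g = f \<circ> d)"
    let ?Z = "subtopology X (Y (n + Suc k))"
    have "continuous_map (subtopology ?Z (Y (n + k))) (orbit_topology G) g"
      using g Ysub[of k] by (simp add: subtopology_subtopology Int_absorb1 Int_absorb2 inf.absorb2)
    then obtain g' where "continuous_map ?Z (orbit_topology G) g'" "\<forall>x\<in>Y (n + k). g' x = g x"
      using extend_over_attached_cells[of "n + Suc k" ?Z "Y (n + k)" g] att[of "n + Suc k"] n by auto
    then show "\<exists>y. continuous_map (subtopology X (Y (n + Suc k))) (orbit_topology G) y \<and>
      (Suc k = 0 \<longrightarrow> y = f \<circ> d) \<and> (\<forall>x\<in>Y (n + k). y x = g x)" by auto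
  qed
  then obtain fs where fs: "\<And>k. continuous_map (subtopology X (Y (n + k))) (orbit_topology G) (fs k)"
    "fs 0 = f \<circ> d" "\<And>k x. x \<in> Y (n + k) \<Longrightarrow> fs (Suc k) x = fs k x" by blast
  have mono: "x \<in> Y (n + (k + j)) \<and> fs (k + j) x = fs k x" if "x \<in> Y (n + k)" for x k j
    by (induction j) (use that Ysub fs(3) in auto)
  define f' where "f' x = fs (LEAST k. x \<in> Y (n + k)) x" for x
  have f': "f' x = fs k x" if "x \<in> Y (n + k)" for x k
  proof -
    define l where "l = (LEAST k. x \<in> Y (n + k))"
    have "x \<in> Y (n + l)" "l \<le> k" unfolding l_def using that by (auto intro: LeastI Least_le)
    then show ?thesis using mono[of x l "k - l"] by (simp add: f'_def l_def)
  qed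
  have cover: "\<exists>k. x \<in> Y (n + k)" if "x \<in> topspace X" for x
    using that XY by (metis UN_E atLeast_iff le_Suc_ex)
  have "f' x \<in> step_functions G" if "x \<in> topspace X" for x
    using cover[OF that] f' fs(1) that by (fastforce simp: continuous_map_orbit Pi_iff)
  moreover have "closedin X {x \<in> topspace X. f' x \<in> C}" if C: "closedin (orbit_topology G) C" for C
  proof (subst closed)
    show "\<forall>k\<ge>n. closedin (subtopology X (Y k)) ({x \<in> topspace X. f' x \<in> C} \<inter> Y k)"
    proof clarify
      fix k assume "n \<le> k"
      then obtain j where j: "k = n + j" using le_Suc_ex by blast
      have "{x \<in> topspace X. f' x \<in> C} \<inter> Y k = {x \<in> topspace (subtopology X (Y k)). fs j x \<in> C}"
        using f' j by auto
      then show "closedin (subtopology X (Y k)) ({x \<in> topspace X. f' x \<in> C} \<inter> Y k)"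
        using closedin_continuous_map_preimage[OF fs(1)[of j] C] j by simp
    qed
  qed auto
  ultimately have "continuous_map X (orbit_topology G) f'" by (auto simp: continuous_map_closedin)
  moreover have "f' (c p) = f p" if "p \<in> topspace P" for p
  proof -
    have "f' (c p) = fs 0 (c p)" using f'[of "c p" 0] Y0 that by auto
    then show ?thesis using d that by (simp add: fs(2) homeomorphic_maps_def)
  qed
  ultimately show ?thesis by blast
qed

end

section \<open>Free groups\<close>

interpretation F: group "free_group S" for S :: "'a set"
  by (rule group_free_group)

lemma one_free_group [simp]: "\<one>\<^bsub>free_group S\<^esub> = []"
  by (simp add: free_group_def)

lemma free_group_Nil [simp]:
  "[] \<in> carrier (free_group S)"
  "w \<in> carrier (free_group S) \<Longrightarrow> w \<otimes>\<^bsub>free_group S\<^esub> [] = w"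
  "w \<in> carrier (free_group S) \<Longrightarrow> [] \<otimes>\<^bsub>free_group S\<^esub> w = w"
  "inv\<^bsub>free_group S\<^esub> [] = []"
  using F.one_closed[of S] F.r_one[of w S] F.l_one[of w S] F.inv_one[of S] by simp_all

lemma mult_free_group: "v \<otimes>\<^bsub>free_group S\<^esub> w = reduce_word (v @ w)"
  by (simp add: free_group_def)

lemma carrier_free_group: "w \<in> carrier (free_group S) \<longleftrightarrow> reduced_word w \<and> fst ` set w \<subseteq> S"
  by (simp add: free_group_def)

lemma reduced_word_ConsD: "reduced_word (x # w) \<Longrightarrow> reduced_word w"
  by (cases w) (auto simp: reduced_word_def)

lemma inv_generator:
  assumes "s \<in> S"
  shows "inv\<^bsub>free_group S\<^esub> [(s, True)] = [(s, False)]"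
  using assms by (intro F.inv_equality)
    (auto simp: mult_free_group carrier_free_group reduced_word_def reduce_word_def inv_letter_def)

lemma (in group) eval_word_cons_reduce:
  assumes "\<forall>s\<in>insert (fst x) (fst ` set w). a s \<in> carrier G"
  shows "eval_word G a (cons_reduce x w) = eval_word G a (x # w)"
proof (cases w)
  case (Cons y ys)
  have "eval_word G a ys \<in> carrier G" "a (fst x) \<in> carrier G"
    using assms Cons by (auto intro!: eval_word_closed)
  then show ?thesis
    using Cons by (auto simp: inv_letter_def)
qed simp

lemma (in group) eval_word_reduce_word:
  assumes "\<forall>s\<in>fst ` set w. a s \<in> carrier G"
  shows "eval_word G a (reduce_word w) = eval_word G a w"
  using assms
proof (induction w)
  case (Cons x w)
  have sub: "fst ` set (reduce_word w) \<subseteq> fst ` set w"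
    using set_foldr_cons_reduce[of w "[]"] by (auto simp: reduce_word_def)
  have "a s \<in> carrier G" if "s \<in> fst ` set (reduce_word w)" for s
    using Cons.prems subsetD[OF sub that] by auto
  then have "\<forall>s\<in>insert (fst x) (fst ` set (reduce_word w)). a s \<in> carrier G"
    using Cons.prems by simp
  from eval_word_cons_reduce[OF this]
  have "eval_word G a (reduce_word (x # w)) = eval_word G a (x # reduce_word w)"
    by (simp add: reduce_word_def)
  then show ?case using Cons by simp
qed (simp add: reduce_word_def)

lemma (in group) eval_word_append:
  assumes "\<forall>s\<in>fst ` set (v @ w). a s \<in> carrier G"
  shows "eval_word G a (v @ w) = eval_word G a v \<otimes> eval_word G a w"
  using assms by (induction v) (auto simp: m_assoc eval_word_closed)

lemma (in group) eval_word_hom: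
  assumes "\<forall>s\<in>S. a s \<in> carrier G"
  shows "eval_word G a \<in> hom (free_group S) G"
proof (rule homI)
  fix v w assume vw: "v \<in> carrier (free_group S)" "w \<in> carrier (free_group S)"
  then show "eval_word G a (v \<otimes>\<^bsub>free_group S\<^esub> w) = eval_word G a v \<otimes> eval_word G a w"
    using assms by (simp add: mult_free_group carrier_free_group eval_word_reduce_word eval_word_append subset_iff ball_Un image_Un)
qed (use assms in \<open>auto simp: carrier_free_group intro!: eval_word_closed\<close>)

lemma eval_word_hom_comp:
  assumes q: "group_hom G H q" and a: "\<forall>s\<in>fst ` set w. a s \<in> carrier G"
  shows "q (eval_word G a w) = eval_word H (\<lambda>s. q (a s)) w"
proof -
  interpret group_hom G H q by fact
  show ?thesis using a
    by (induction w) (auto simp: G.eval_word_closed)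
qed

definition generator :: "'a \<Rightarrow> 'a word"
  where "generator s = [(s, True)]"

lemma generator_closed: "s \<in> S \<Longrightarrow> generator s \<in> carrier (free_group S)"
  by (simp add: generator_def carrier_free_group reduced_word_def)

lemma eval_word_generator:
  assumes "w \<in> carrier (free_group S)"
  shows "eval_word (free_group S) generator w = w"
  using assms
proof (induction w)
  case (Cons x w)
  have w: "w \<in> carrier (free_group S)" "fst x \<in> S" "reduced_word (x # w)"
    using Cons.prems by (auto simp: carrier_free_group dest: reduced_word_ConsD)
  have "(if snd x then generator (fst x) else inv\<^bsub>free_group S\<^esub> (generator (fst x))) = [x]"
    using inv_generator[OF w(2)] by (cases x) (simp add: generator_def)
  then show ?case
    using Cons.IH[OF w(1)] w(3) reduce_word_reduced[OF w(3)] by (simp add: mult_free_group)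
qed simp

section \<open>The one-skeleton\<close>

abbreviation skeleton_space :: "'a set \<Rightarrow> 'a word \<Rightarrow> 'a cell_point topology"
  where "skeleton_space S r \<equiv> subtopology (presentation_complex S r) (one_skeleton S)"

lemma continuous_map_word_point:
  assumes edge: "\<And>s. s \<in> S \<Longrightarrow> continuous_map (top_of_set {0..1}) T (f \<circ> edge_map s)"
    and w: "fst ` set w \<subseteq> S" and V: "f Vertex \<in> topspace T"
  shows "continuous_map (top_of_set {0..real (length w)}) T (\<lambda>u. f (word_point w u))"
  using w
proof (induction w)
  case (Cons x w)
  obtain s b where x: "x = (s, b)" by (cases x)
  have s: "s \<in> S" "fst ` set w \<subseteq> S" using Cons.prems x by auto
  have T: "continuous_map (top_of_set {0..1}) (top_of_set {0..1}) (\<lambda>u::real. if b then u else 1 - u)"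
    by (cases b) (auto simp: continuous_map_in_subtopology intro!: continuous_intros)
  have 1: "continuous_map (top_of_set {0..1}) T (\<lambda>u. f (edge_map s (if b then u else 1 - u)))"
    using continuous_map_compose[OF T edge[OF s(1)]] by (simp add: o_def)
  have "continuous_map (top_of_set {1..real (Suc (length w))}) (top_of_set {0..real (length w)}) (\<lambda>u. u - 1)"
    by (auto simp: continuous_map_in_subtopology intro!: continuous_intros)
  from continuous_map_compose[OF this Cons.IH[OF s(2)]]
  have 2: "continuous_map (top_of_set {1..real (Suc (length w))}) T (\<lambda>u. f (word_point w (u - 1)))"
    by (simp add: o_def)
  have "continuous_map (top_of_set {0..real (Suc (length w))}) T
    (\<lambda>u. if u \<le> 1 then f (edge_map s (if b then u else 1 - u)) else f (word_point w (u - 1)))"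
  proof (rule continuous_map_cases_le)
    have "{0..real (Suc (length w))} \<inter> {x. 0 \<le> x \<and> x \<le> 1 + real (length w) \<and> x \<le> 1} = {0..1}" by auto
    then show "continuous_map (subtopology (top_of_set {0..real (Suc (length w))})
        {x \<in> topspace (top_of_set {0..real (Suc (length w))}). x \<le> 1}) T
        (\<lambda>u. f (edge_map s (if b then u else 1 - u)))"
      using 1 by (simp add: subtopology_subtopology conj_assoc)
    have "{0..real (Suc (length w))} \<inter> {x. 0 \<le> x \<and> x \<le> 1 + real (length w) \<and> 1 \<le> x} = {1..real (Suc (length w))}" by auto
    then show "continuous_map (subtopology (top_of_set {0..real (Suc (length w))})
        {x \<in> topspace (top_of_set {0..real (Suc (length w))}). 1 \<le> x}) T
        (\<lambda>u. f (word_point w (u - 1)))"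
      using 2 by (simp add: subtopology_subtopology conj_assoc)
    fix u :: real assume "u = 1"
    moreover have "word_point w 0 = Vertex"
    proof (cases w)
      case (Cons y v)
      then show ?thesis by (cases y) (auto simp: word_point_Cons_lt edge_map_def)
    qed simp
    ultimately show "f (edge_map s (if b then u else 1 - u)) = f (word_point w (u - 1))"
      by (simp add: edge_map_def)
  qed (auto intro!: continuous_intros)
  then show ?case
  proof (simp only: length_Cons, elim continuous_map_eq)
    fix u :: real assume u: "u \<in> topspace (top_of_set {0..real (Suc (length w))})"
    have "word_point w 0 = Vertex"
    proof (cases w)
      case (Cons y v)
      then show ?thesis by (cases y) (auto simp: word_point_Cons_lt edge_map_def)
    qed simp
    then show "(if u \<le> 1 then f (edge_map s (if b then u else 1 - u)) else f (word_point w (u - 1))) = f (word_point (x # w) u)"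
      using u by (cases "u < 1"; cases "u = 1") (auto simp: x word_point_Cons_lt word_point_Cons_ge edge_map_def)
  qed
qed (use V in simp)

lemma continuous_map_word_loop:
  assumes "\<And>s. s \<in> S \<Longrightarrow> continuous_map (top_of_set {0..1}) T (f \<circ> edge_map s)"
    and "fst ` set w \<subseteq> S" and "f Vertex \<in> topspace T"
  shows "continuous_map (top_of_set {0..1}) T (\<lambda>t. f (word_loop w t))"
proof -
  have "continuous_map (top_of_set {0..1}) (top_of_set {0..real (length w)}) (\<lambda>t. real (length w) * t)"
    by (auto simp: continuous_map_in_subtopology mult_left_le intro!: continuous_intros)
  from continuous_map_compose[OF this continuous_map_word_point[OF assms]]
  show ?thesis by (simp add: o_def word_loop_eq)
qed

lemma word_loop_ends [simp]: "word_loop w 0 = Vertex" "word_loop w 1 = Vertex"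
proof -
  show "word_loop w 0 = Vertex"
  proof (cases w)
    case (Cons y v)
    then show ?thesis by (cases y) (auto simp: word_loop_eq word_point_Cons_lt edge_map_def)
  qed (simp add: word_loop_eq)
qed (simp add: word_loop_eq word_point_def)

text \<open>The one-skeleton carries the subspace topology, so an open subset of it has to be
  thickened into the 2-cell. A point of the punctured disc is treated like the boundary point on its
  ray.\<close>

lemma continuous_map_one_skeleton:
  assumes r: "fst ` set r \<subseteq> S"
    and edge: "\<And>s. s \<in> S \<Longrightarrow> continuous_map (top_of_set {0..1}) T (f \<circ> edge_map s)"
    and im: "f \<in> one_skeleton S \<rightarrow> topspace T"
  shows "continuous_map (skeleton_space S r) T f"
proof -
  let ?L = "\<lambda>z. f (word_loop r (Arg2pi z / (2 * pi)))"
  have L: "continuous_map (top_of_set (cball 0 1 - {0})) T ?L"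
    using continuous_map_angle_loop[OF continuous_map_word_loop[OF edge r], of "cball 0 1 - {0}"] im
    by (auto simp: Pi_iff)
  have ts: "topspace (skeleton_space S r) = one_skeleton S"
    using topspace_presentation_complex[OF r] by auto
  have "openin (skeleton_space S r) {x \<in> one_skeleton S. f x \<in> U}" if U: "openin T U" for U
  proof -
    \<comment> \<open>Leaving out the centre, which lies on every ray, keeps the thickening
      open.\<close>
    define V where "V = {x \<in> one_skeleton S. f x \<in> U} \<union> Face ` {z \<in> ball 0 1 - {0}. ?L z \<in> U}"
    have "openin (top_of_set {0..1}) {t \<in> {0..1}. edge_map s t \<in> V}" if s: "s \<in> S" for s
    proof -
      have "{t \<in> {0..1}. edge_map s t \<in> V} = {t \<in> topspace (top_of_set {0..1}). (f \<circ> edge_map s) t \<in> U}"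
        using edge_map_in_one_skeleton[OF s] by (auto simp: V_def) (auto simp: edge_map_def split: if_splits)
      then show ?thesis using edge[OF s] U by (simp only: openin_continuous_map_preimage)
    qed
    moreover have "openin (top_of_set (cball 0 1)) {z \<in> cball 0 1. face_map r z \<in> V}"
    proof -
      have ns: "word_loop r t \<noteq> Face z" "word_loop r t \<in> one_skeleton S" for t z
        using word_point_in_one_skeleton[OF r, of "real (length r) * t"]
        by (auto simp: word_loop_eq one_skeleton_def)
      have "{z \<in> cball 0 1. face_map r z \<in> V} = {z \<in> topspace (top_of_set (cball 0 1 - {0})). ?L z \<in> U}"
        using ns by (auto simp: V_def face_map_def one_skeleton_def)
      then have "openin (top_of_set (cball 0 1 - {0})) {z \<in> cball 0 1. face_map r z \<in> V}"
        using L U by (simp only: openin_continuous_map_preimage)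
      moreover have "openin (top_of_set (cball 0 1)) (cball (0::complex) 1 - {0})"
        by (intro openin_diff) auto
      ultimately show ?thesis by (rule openin_trans)
    qed
    ultimately have "openin (presentation_complex S r) V"
      unfolding openin_presentation_complex by (auto simp: V_def)
    moreover have "{x \<in> one_skeleton S. f x \<in> U} = V \<inter> one_skeleton S"
      by (auto simp: V_def one_skeleton_def)
    ultimately show ?thesis by (auto simp: openin_subtopology)
  qed
  then show ?thesis using im by (simp only: continuous_map_def ts) auto
qed

lemma continuous_map_edge_map_skeleton:
  assumes "fst ` set r \<subseteq> S" "s \<in> S"
  shows "continuous_map (top_of_set {0..1}) (skeleton_space S r) (edge_map s)"
  using continuous_map_edge_map[OF assms] assms by (auto simp: continuous_map_in_subtopology)

abbreviation skeleton_lift :: "'a set \<Rightarrow> 'a cell_point \<Rightarrow> real \<Rightarrow> 'a word"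
  where "skeleton_lift S \<equiv> skeleton_map (free_group S) generator"

text \<open>Holonomy in the free group itself. It lives on the one-skeleton, where no relation has
  to be respected.\<close>

definition skeleton_holonomy :: "'a set \<Rightarrow> ((nat \<Rightarrow> real) \<Rightarrow> 'a cell_point) \<Rightarrow> 'a word"
  where "skeleton_holonomy S = holonomy (free_group S) (skeleton_lift S)"

lemma continuous_map_skeleton_lift:
  assumes "fst ` set r \<subseteq> S"
  shows "continuous_map (skeleton_space S r) (orbit_topology (free_group S)) (skeleton_lift S)"
proof (rule continuous_map_one_skeleton[OF assms])
  show "skeleton_lift S \<in> one_skeleton S \<rightarrow> topspace (orbit_topology (free_group S))"
  proof
    fix p assume "p \<in> one_skeleton S"
    then have "skeleton_lift S p \<in> step_functions (free_group S)"
      by (rule F.skeleton_map_step_functions) (simp add: generator_closed)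
    then show "skeleton_lift S p \<in> topspace (orbit_topology (free_group S))" by simp
  qed
qed (simp add: F.continuous_map_skeleton_edge generator_closed)

section \<open>Holonomy under homomorphisms and along the loops of words\<close>

lemma hom_step_functions:
  assumes q: "q \<in> hom G H" and x: "x \<in> step_functions G"
  shows "(\<lambda>t. q (x t)) \<in> step_functions H"
proof -
  have "range (\<lambda>t. q (x t)) = q ` range x" by auto
  moreover have "{t. q (x t) = h} \<in> sets lborel" for h
  proof -
    have "{t. q (x t) = h} = (\<Union>g\<in>{g \<in> range x. q g = h}. {t. x t = g})" by auto
    moreover have "finite {g \<in> range x. q g = h}" using x by (simp add: step_functions_def)
    ultimately show ?thesis using x by (auto simp: step_functions_def intro!: sets.finite_UN)
  qed
  ultimately show ?thesis
    using x hom_in_carrier[OF q] by (auto simp: step_functions_def)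
qed

lemma step_dist_hom:
  assumes q: "q \<in> hom G H" and xy: "x \<in> step_functions G" "y \<in> step_functions G"
  shows "step_dist (\<lambda>t. q (x t)) (\<lambda>t. q (y t)) \<le> step_dist x y"
  unfolding step_dist_def
  using step_differ_measurable[OF xy] step_differ_measurable[OF hom_step_functions[OF q xy(1)] hom_step_functions[OF q xy(2)]]
  by (intro measure_mono_fmeasurable unit_interval_subset_fmeasurable) auto

text \<open>The image of a lift under \<open>q\<close> is again a lift, because applying a
  homomorphism pointwise does not increase \<open>step_dist\<close>.\<close>

lemma holonomy_hom:
  assumes q: "group_hom G H q" and f: "continuous_map X (orbit_topology G) f"
    and f': "continuous_map X' (orbit_topology H) f'"
    and \<tau>: "singular_simplex 1 X \<tau>" and \<tau>': "singular_simplex 1 X' \<tau>'"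
    and ff': "\<And>x. x \<in> standard_simplex 1 \<Longrightarrow> f' (\<tau>' x) = (\<lambda>t. q (f (\<tau> x) t))"
  shows "holonomy H f' \<tau>' = q (holonomy G f \<tau>)"
proof -
  interpret group_hom G H q by fact
  obtain g where g: "lift_of G f 1 \<tau> g" using G.lift_of_exists[OF f \<tau>] by blast
  have gc: "g x \<in> carrier G" if "x \<in> standard_simplex 1" for x using g that by (simp add: lift_of_def)
  let ?\<phi> = "\<lambda>x. translate G (g x) (f (\<tau> x))"
  have \<phi>: "continuous_map (simplex_space 1) (step_topology G) ?\<phi>" using g by (simp add: lift_of_def)
  have \<phi>s: "?\<phi> x \<in> step_functions G" if "x \<in> standard_simplex 1" for x
    using \<phi> that by (auto simp: G.continuous_map_step)
  have "continuous_map (simplex_space 1) (step_topology H) (\<lambda>x t. q (?\<phi> x t))"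
    unfolding H.continuous_map_step
  proof (intro conjI ballI allI impI)
    show "(\<lambda>x t. q (?\<phi> x t)) \<in> topspace (simplex_space 1) \<rightarrow> step_functions H"
      using hom_step_functions[OF homh] \<phi>s by auto
    fix x and e :: real assume x: "x \<in> topspace (simplex_space 1)" and "0 < e"
    then obtain U where U: "openin (simplex_space 1) U" "x \<in> U" "\<And>y. y \<in> U \<Longrightarrow> step_dist (?\<phi> x) (?\<phi> y) < e"
      using \<phi>[unfolded G.continuous_map_step, THEN conjunct2, rule_format, OF x \<open>0 < e\<close>] by auto
    have "step_dist (\<lambda>t. q (?\<phi> x t)) (\<lambda>t. q (?\<phi> y t)) < e" if "y \<in> U" for y
      using step_dist_hom[OF homh \<phi>s \<phi>s, of x y] U(3)[OF that] openin_subset[OF U(1)] that x by auto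
    then show "\<exists>U. openin (simplex_space 1) U \<and> x \<in> U \<and> (\<forall>y\<in>U. step_dist (\<lambda>t. q (?\<phi> x t)) (\<lambda>t. q (?\<phi> y t)) < e)"
      using U(1,2) by blast
  qed
  then have "continuous_map (simplex_space 1) (step_topology H) (\<lambda>x. translate H (q (g x)) (f' (\<tau>' x)))"
  proof (rule continuous_map_eq)
    fix x assume x: "x \<in> topspace (simplex_space 1)"
    have "f (\<tau> x) \<in> step_functions G"
      using f \<tau> x by (auto simp: G.continuous_map_orbit singular_simplex_def continuous_map_def Pi_iff)
    then show "(\<lambda>t. q (?\<phi> x t)) = translate H (q (g x)) (f' (\<tau>' x))"
      using x gc by (auto simp: translate_def ff' fun_eq_iff)
  qed
  then have "lift_of H f' 1 \<tau>' (\<lambda>x. q (g x))" using gc by (simp add: lift_of_def)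
  from H.holonomy_eq[OF f' \<tau>' this] G.holonomy_eq[OF f \<tau> g] show ?thesis
    using gc[of "std_vertex 0"] gc[of "std_vertex 1"] by simp
qed

text \<open>The word path is one lift along the whole loop, with translations
  \<open>\<gamma>\<close>. An edge that factors through the loop by a continuous parameter
  \<open>\<theta>\<close> inherits the lift \<open>\<gamma> \<circ> \<theta>\<close>.\<close>

lemma skeleton_holonomy_word_loop:
  assumes r: "w \<in> carrier (free_group S)" "fst ` set r \<subseteq> S"
  shows "\<exists>\<gamma>. \<gamma> 0 = [] \<and> \<gamma> 1 = w \<and> (\<forall>t\<in>{0..1}. \<gamma> t \<in> carrier (free_group S)) \<and>
    (\<forall>\<tau> \<theta>. singular_simplex 1 (skeleton_space S r) \<tau> \<longrightarrow>
      continuous_map (simplex_space 1) (top_of_set {0..1}) \<theta> \<longrightarrow>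
      (\<forall>x\<in>standard_simplex 1. \<tau> x = word_loop w (\<theta> x)) \<longrightarrow>
      skeleton_holonomy S \<tau> =
        inv\<^bsub>free_group S\<^esub> \<gamma> (\<theta> (std_vertex 0)) \<otimes>\<^bsub>free_group S\<^esub> \<gamma> (\<theta> (std_vertex 1)))"
proof -
  let ?F = "free_group S" and ?n = "real (length w)"
  have wS: "fst ` set w \<subseteq> S" using r(1) by (simp add: carrier_free_group)
  have a: "\<forall>s\<in>fst ` set w. generator s \<in> carrier ?F"
    by (intro ballI generator_closed subsetD[OF wS])
  have "\<forall>t\<in>{0..1}. \<exists>g\<in>carrier ?F. word_path ?F generator w (?n * t) = translate ?F g (skeleton_lift S (word_loop w t))"
    using F.word_path_orbit[OF a] by (simp add: word_loop_eq)
  then obtain \<gamma> where \<gamma>: "\<And>t. t \<in> {0..1} \<Longrightarrow> \<gamma> t \<in> carrier ?F"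
    "\<And>t. t \<in> {0..1} \<Longrightarrow> word_path ?F generator w (?n * t) = translate ?F (\<gamma> t) (skeleton_lift S (word_loop w t))"
    by metis
  have e: "skeleton_lift S (word_loop w 0) = (\<lambda>_. [])" "skeleton_lift S (word_loop w 1) = (\<lambda>_. [])"
    by (simp_all add: skeleton_map_def)
  have "\<gamma> 0 = []"
    using \<gamma>(2)[of 0] F.word_path_0[OF a, of 0] F.r_one[OF \<gamma>(1)[of 0]] e
    by (auto simp: translate_def fun_eq_iff)
  moreover have "\<gamma> 1 = w"
    using \<gamma>(2)[of 1] F.word_path_length[OF a, of ?n] F.r_one[OF \<gamma>(1)[of 1]] e eval_word_generator[OF r(1)]
    by (auto simp: translate_def fun_eq_iff)
  moreover have "skeleton_holonomy S \<tau> = inv\<^bsub>?F\<^esub> \<gamma> (\<theta> (std_vertex 0)) \<otimes>\<^bsub>?F\<^esub> \<gamma> (\<theta> (std_vertex 1))"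
    if \<tau>: "singular_simplex 1 (skeleton_space S r) \<tau>"
      and \<theta>: "continuous_map (simplex_space 1) (top_of_set {0..1}) \<theta>"
      and eq: "\<forall>x\<in>standard_simplex 1. \<tau> x = word_loop w (\<theta> x)" for \<tau> \<theta>
    unfolding skeleton_holonomy_def
  proof (rule F.holonomy_eq[OF continuous_map_skeleton_lift[OF r(2)] \<tau>])
    have \<theta>01: "\<theta> x \<in> {0..1}" if "x \<in> standard_simplex 1" for x
      using \<theta> that by (auto simp: continuous_map_in_subtopology)
    have "continuous_map (simplex_space 1) (step_topology ?F) (\<lambda>x. word_path ?F generator w (?n * \<theta> x))"
      using \<theta> by (intro F.continuous_map_word_path[OF a] continuous_map_real_mult_left)
        (simp add: continuous_map_in_subtopology)
    then have "continuous_map (simplex_space 1) (step_topology ?F)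
        (\<lambda>x. translate ?F (\<gamma> (\<theta> x)) (skeleton_lift S (\<tau> x)))"
      by (rule continuous_map_eq) (use \<gamma>(2) \<theta>01 eq in auto)
    then show "lift_of ?F (skeleton_lift S) 1 \<tau> (\<lambda>x. \<gamma> (\<theta> x))"
      using \<gamma>(1) \<theta>01 by (simp add: lift_of_def)
  qed
  ultimately show ?thesis using \<gamma>(1) by blast
qed

section \<open>The 2-cell as a singular simplex\<close>

definition face_simplex :: "'a word \<Rightarrow> (nat \<Rightarrow> real) \<Rightarrow> 'a cell_point"
  where "face_simplex r = simplex_map 2 (face_map r) disc_simplex"

abbreviation face_edge :: "'a word \<Rightarrow> nat \<Rightarrow> (nat \<Rightarrow> real) \<Rightarrow> 'a cell_point"
  where "face_edge r k \<equiv> singular_face 2 k (face_simplex r)"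

definition third_root :: "nat \<Rightarrow> complex"
  where "third_root i = cis (2 * pi * real i / 3)"

definition triangle_point :: "(nat \<Rightarrow> real) \<Rightarrow> complex"
  where "triangle_point x = (\<Sum>i\<le>2. of_real (x i) * third_root i)"

lemma disc_simplex_eq:
  "x \<in> standard_simplex 2 \<Longrightarrow>
    disc_simplex x = of_real (1 - 3 * min (x 0) (min (x 1) (x 2))) * sgn (triangle_point x)"
  by (simp add: disc_simplex_def triangle_point_def third_root_def)

lemma third_root_eq:
  "third_root 0 = 1" "third_root 1 = Complex (-1/2) (sqrt 3 / 2)" "third_root 2 = Complex (-1/2) (- sqrt 3 / 2)"
proof -
  have "4 * pi / 3 = pi / 3 + pi" by simp
  then have "cos (4 * pi / 3) = - (1/2)" "sin (4 * pi / 3) = - (sqrt 3 / 2)"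
    by (simp_all only: cos_periodic_pi sin_periodic_pi cos_60 sin_60)
  then show "third_root 2 = Complex (-1/2) (- sqrt 3 / 2)"
    by (simp add: third_root_def complex_eq_iff)
  show "third_root 1 = Complex (-1/2) (sqrt 3 / 2)"
    using cos_120 sin_120 by (simp add: third_root_def complex_eq_iff)
qed (simp add: third_root_def)

lemma triangle_point_simps:
  "Re (triangle_point x) = x 0 - x 1 / 2 - x 2 / 2"
  "Im (triangle_point x) = sqrt 3 / 2 * (x 1 - x 2)"
  using third_root_eq by (simp_all add: triangle_point_def numeral_2_eq_2 algebra_simps)

lemma Arg2pi_third_root:
  "Arg2pi (third_root 0) = 0" "Arg2pi (third_root 1) = 2 * pi / 3" "Arg2pi (third_root 2) = 4 * pi / 3"
proof -
  have "Arg2pi (cis a) = a" if "0 \<le> a" "a < 2 * pi" for a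
    using that by (intro Arg2pi_unique[of 1]) (simp_all add: cis_conv_exp)
  then show "Arg2pi (third_root 0) = 0" "Arg2pi (third_root 1) = 2 * pi / 3" "Arg2pi (third_root 2) = 4 * pi / 3"
    by (simp_all add: third_root_def Arg2pi_eq_0)
qed

text \<open>\<open>sgn\<close> is discontinuous only at 0, that is at the barycentre, and there the
  gauge factor tends to 0.\<close>

lemma singular_simplex_disc_simplex: "singular_simplex 2 (top_of_set (cball 0 1)) disc_simplex"
proof -
  let ?T = "simplex_space 2"
  have co: "continuous_map ?T euclideanreal (\<lambda>x. x i)" for i
    by (rule continuous_map_coordinate)
  define \<rho> where "\<rho> = (\<lambda>x::nat \<Rightarrow> real. 1 - 3 * min (x 0) (min (x 1) (x 2)))"
  have c\<rho>: "continuous_map ?T euclideanreal \<rho>"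
    unfolding \<rho>_def by (intro continuous_intros co)
  have con: "continuous_on (standard_simplex 2) (\<lambda>x::nat \<Rightarrow> real. x i)" for i
    using co by (simp add: euclidean_product_topology)
  have contr: "continuous_on (standard_simplex 2) \<rho>"
    using c\<rho> by (simp add: euclidean_product_topology)
  have conz: "continuous_on (standard_simplex 2) triangle_point"
    unfolding triangle_point_def by (intro continuous_intros con)
  have z0: "\<rho> x = 0" if x: "x \<in> standard_simplex 2" "triangle_point x = 0" for x
  proof -
    have "x 1 = x 2" "x 0 = x 1" using triangle_point_simps[of x] x(2) by (auto simp: complex_eq_iff)
    moreover have "x 0 + x 1 + x 2 = 1" using x(1) by (simp add: standard_simplex_def numeral_2_eq_2)
    ultimately show ?thesis by (simp add: \<rho>_def)
  qed
  have r01: "0 \<le> \<rho> x" "\<rho> x \<le> 1" if "x \<in> standard_simplex 2" for x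
  proof -
    have "x 0 + x 1 + x 2 = 1" "0 \<le> x 0" "0 \<le> x 1" "0 \<le> x 2"
      using that by (auto simp: standard_simplex_def numeral_2_eq_2)
    then show "0 \<le> \<rho> x" "\<rho> x \<le> 1" by (auto simp: \<rho>_def min_def)
  qed
  let ?f = "\<lambda>x. of_real (\<rho> x) * sgn (triangle_point x)"
  have "continuous_on (standard_simplex 2) ?f"
    unfolding continuous_on_eq_continuous_within
  proof
    fix x :: "nat \<Rightarrow> real" assume x: "x \<in> standard_simplex 2"
    have cw: "continuous (at x within standard_simplex 2) triangle_point"
        "continuous (at x within standard_simplex 2) \<rho>"
      using conz contr x by (simp_all add: continuous_on_eq_continuous_within)
    show "continuous (at x within standard_simplex 2) ?f"
    proof (cases "triangle_point x = 0")
      case False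
      then show ?thesis using cw by (intro continuous_intros) auto
    next
      case True
      have "((\<lambda>y. complex_of_real (\<rho> y)) \<longlongrightarrow> of_real (\<rho> x)) (at x within standard_simplex 2)"
        using cw(2) by (intro tendsto_of_real) (simp add: continuous_within)
      then have "((\<lambda>y. complex_of_real (\<rho> y)) \<longlongrightarrow> 0) (at x within standard_simplex 2)"
        using z0[OF x True] by simp
      then have "((\<lambda>y. ?f y) \<longlongrightarrow> 0) (at x within standard_simplex 2)"
        by (rule Lim_null_comparison[rotated, OF tendsto_norm_zero])
          (simp add: norm_mult norm_sgn)
      then show ?thesis using True by (simp add: continuous_within)
    qed
  qed
  then have "continuous_map ?T (top_of_set (cball 0 1)) ?f"
    using r01 by (auto simp: euclidean_product_topology continuous_map_in_subtopology norm_mult norm_sgn)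
  then have "continuous_map ?T (top_of_set (cball 0 1)) disc_simplex"
    by (rule continuous_map_eq) (simp add: disc_simplex_eq \<rho>_def)
  then show ?thesis
    by (simp add: singular_simplex_def disc_simplex_def extensional_def)
qed

lemma singular_simplex_face_simplex:
  assumes "fst ` set r \<subseteq> S"
  shows "singular_simplex 2 (presentation_complex S r) (face_simplex r)"
  unfolding face_simplex_def
  by (rule singular_simplex_simplex_map[OF singular_simplex_disc_simplex continuous_map_face_map[OF assms]])

lemma standard_simplex_1D:
  assumes "y \<in> standard_simplex 1"
  shows "0 \<le> y 0" "0 \<le> y 1" "y 0 + y 1 = 1"
  using assms by (auto simp: standard_simplex_def)

text \<open>On a face the least barycentric coordinate is 0, so the gauge factor is 1 and only the
  direction remains.\<close>

lemma disc_simplex_face: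
  assumes y: "y \<in> standard_simplex 1" and k: "k \<le> 2"
  shows "disc_simplex (simplical_face k y) = sgn (triangle_point (simplical_face k y))"
    and "triangle_point (simplical_face k y) \<noteq> 0"
proof -
  let ?x = "simplical_face k y"
  note y01 = standard_simplex_1D[OF y]
  have x: "?x \<in> standard_simplex 2"
    using simplical_face_in_standard_simplex[of 2 k y] y k by simp
  have k3: "k = 0 \<or> k = 1 \<or> k = 2" using k by auto
  have min0: "min (?x 0) (min (?x 1) (?x 2)) = 0"
    using y01 k3 by (auto simp: simplical_face_def min_def)
  show "triangle_point ?x \<noteq> 0"
  proof
    assume "triangle_point ?x = 0"
    then have "?x 1 = ?x 2" "?x 0 = ?x 1" using triangle_point_simps[of ?x] by auto
    then show False using k3 y01 by (auto simp: simplical_face_def)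
  qed
  show "disc_simplex ?x = sgn (triangle_point ?x)"
    using disc_simplex_eq[OF x] min0 by simp
qed

lemma face_edge_eq:
  assumes y: "y \<in> standard_simplex 1" and k: "k \<le> 2"
  shows "face_edge r k y = word_loop r (Arg2pi (triangle_point (simplical_face k y)) / (2 * pi))"
proof -
  let ?x = "simplical_face k y"
  have x: "?x \<in> standard_simplex 2"
    using simplical_face_in_standard_simplex[of 2 k y] y k by simp
  note d = disc_simplex_face[OF y k]
  have "norm (sgn (triangle_point ?x)) = 1" using d(2) by (simp add: norm_sgn)
  moreover have "Arg2pi (sgn (triangle_point ?x)) = Arg2pi (triangle_point ?x)"
    using d(2) by (simp add: sgn_eq)
  ultimately show ?thesis
    using y x d(1) by (simp add: singular_face_def face_simplex_def simplex_map_def face_map_def)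
qed

lemma singular_simplex_face_edge:
  assumes "fst ` set r \<subseteq> S" "k \<le> 2"
  shows "singular_simplex 1 (skeleton_space S r) (face_edge r k)"
proof -
  have "singular_simplex 1 (presentation_complex S r) (face_edge r k)"
    using singular_simplex_singular_face[OF singular_simplex_face_simplex[OF assms(1)], of k] assms(2) by simp
  moreover have "face_edge r k y \<in> one_skeleton S" if "y \<in> standard_simplex 1" for y
    using face_edge_eq[OF that assms(2), of r] word_point_in_one_skeleton[OF assms(1)] by (simp add: word_loop_eq)
  ultimately show ?thesis by (auto simp: singular_simplex_subtopology)
qed

lemma continuous_map_triangle_angle:
  assumes A: "continuous_on A \<theta>" and k: "k \<le> 2"
    and im: "\<And>y. y \<in> standard_simplex 1 \<Longrightarrow> g (triangle_point (simplical_face k y)) \<in> A"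
    and g: "continuous_on UNIV g"
  shows "continuous_map (simplex_space 1) euclideanreal (\<lambda>y. \<theta> (g (triangle_point (simplical_face k y))))"
proof -
  have co: "continuous_map (simplex_space 1) euclideanreal (\<lambda>y. simplical_face k y i)" for i
    by (auto simp: simplical_face_def intro!: continuous_map_coordinate)
  then have "continuous_on (standard_simplex 1) (\<lambda>y::nat \<Rightarrow> real. simplical_face k y i)" for i
    by (simp add: euclidean_product_topology)
  then have "continuous_on (standard_simplex 1) (\<lambda>y. triangle_point (simplical_face k y))"
    unfolding triangle_point_def by (intro continuous_intros)
  then have "continuous_on (standard_simplex 1) (\<lambda>y. g (triangle_point (simplical_face k y)))"
    by (rule continuous_on_compose2[OF g]) auto
  then have "continuous_on (standard_simplex 1) (\<lambda>y. \<theta> (g (triangle_point (simplical_face k y))))"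
    by (rule continuous_on_compose2[OF A]) (use im in auto)
  then show ?thesis by (simp add: euclidean_product_topology)
qed

lemma triangle_point_vertex: "i \<le> 2 \<Longrightarrow> triangle_point (std_vertex i) = third_root i"
  by (auto simp: triangle_point_def std_vertex_def numeral_2_eq_2 le_Suc_eq)

text \<open>Edges 2 and 0 run through the first and the second third of the circle. Edge 1 runs
  backwards through the last third, so its lift starts at the parameter 1, where the translation is
  \<open>r\<close>, and not at 0, where it is \<open>[]\<close>.\<close>

lemma face_holonomy:
  assumes r: "r \<in> carrier (free_group S)"
  shows "skeleton_holonomy S (face_edge r 2) \<otimes>\<^bsub>free_group S\<^esub> skeleton_holonomy S (face_edge r 0) =
    r \<otimes>\<^bsub>free_group S\<^esub> skeleton_holonomy S (face_edge r 1)"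
proof -
  let ?F = "free_group S" and ?t = "\<lambda>k y. triangle_point (simplical_face k y)"
  have rS: "fst ` set r \<subseteq> S" using r by (simp add: carrier_free_group)
  obtain \<gamma> where \<gamma>: "\<gamma> 0 = []" "\<gamma> 1 = r" "\<And>t. t \<in> {0..1} \<Longrightarrow> \<gamma> t \<in> carrier ?F"
    and hol: "\<And>\<tau> \<theta>. \<lbrakk>singular_simplex 1 (skeleton_space S r) \<tau>;
      continuous_map (simplex_space 1) (top_of_set {0..1}) \<theta>;
      \<forall>x\<in>standard_simplex 1. \<tau> x = word_loop r (\<theta> x)\<rbrakk> \<Longrightarrow>
      skeleton_holonomy S \<tau> = inv\<^bsub>?F\<^esub> \<gamma> (\<theta> (std_vertex 0)) \<otimes>\<^bsub>?F\<^esub> \<gamma> (\<theta> (std_vertex 1))"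
    using skeleton_holonomy_word_loop[OF r rS] by blast
  have range01: "Arg2pi z / (2 * pi) \<in> {0..1}" for z
    using Arg2pi[of z] by (auto simp: divide_le_eq)
  \<comment> \<open>Edge 0 lies in the open left half plane, away from the jump of
    \<open>Arg2pi\<close>.\<close>
  have A1: "continuous_on {z. Re z < 0} Arg2pi"
    by (intro continuous_at_imp_continuous_on ballI continuous_at_Arg2pi) (auto simp: complex_nonneg_Reals_iff)
  have "skeleton_holonomy S (face_edge r 2) =
    inv\<^bsub>?F\<^esub> \<gamma> (Arg2pi (?t 2 (std_vertex 0)) / (2 * pi)) \<otimes>\<^bsub>?F\<^esub> \<gamma> (Arg2pi (?t 2 (std_vertex 1)) / (2 * pi))"
  proof (rule hol[OF singular_simplex_face_edge[OF rS]])
    have "?t 2 y \<in> {z. 0 \<le> Im z} - {0}" if "y \<in> standard_simplex 1" for y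
      using disc_simplex_face(2)[OF that, of 2] standard_simplex_1D[OF that]
      by (simp add: triangle_point_simps simplical_face_def)
    then have "continuous_map (simplex_space 1) euclideanreal (\<lambda>y. Arg2pi (id (?t 2 y)))"
      by (intro continuous_map_triangle_angle[OF continuous_on_upperhalf_Arg2pi]) auto
    then
    show "continuous_map (simplex_space 1) (top_of_set {0..1}) (\<lambda>y. Arg2pi (?t 2 y) / (2 * pi))"
      using range01 by (auto simp: continuous_map_in_subtopology intro!: continuous_map_real_divide)
  qed (simp_all add: face_edge_eq)
  moreover have "skeleton_holonomy S (face_edge r 0) =
    inv\<^bsub>?F\<^esub> \<gamma> (Arg2pi (?t 0 (std_vertex 0)) / (2 * pi)) \<otimes>\<^bsub>?F\<^esub> \<gamma> (Arg2pi (?t 0 (std_vertex 1)) / (2 * pi))"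
  proof (rule hol[OF singular_simplex_face_edge[OF rS]])
    have "?t 0 y \<in> {z. Re z < 0}" if "y \<in> standard_simplex 1" for y
      using standard_simplex_1D[OF that] by (simp add: triangle_point_simps simplical_face_def)
    then have "continuous_map (simplex_space 1) euclideanreal (\<lambda>y. Arg2pi (id (?t 0 y)))"
      by (intro continuous_map_triangle_angle[OF A1]) auto
    then
    show "continuous_map (simplex_space 1) (top_of_set {0..1}) (\<lambda>y. Arg2pi (?t 0 y) / (2 * pi))"
      using range01 by (auto simp: continuous_map_in_subtopology intro!: continuous_map_real_divide)
  qed (simp_all add: face_edge_eq)
  \<comment> \<open>On edge 1 the angle is counted as a full turn minus the argument of the
    conjugate. This is continuous up to the vertex \<open>third_root 0\<close>, where it equals the
    full turn while \<open>Arg2pi\<close> drops to 0.\<close>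
  moreover have "skeleton_holonomy S (face_edge r 1) =
    inv\<^bsub>?F\<^esub> \<gamma> (1 - Arg2pi (cnj (?t 1 (std_vertex 0))) / (2 * pi)) \<otimes>\<^bsub>?F\<^esub>
      \<gamma> (1 - Arg2pi (cnj (?t 1 (std_vertex 1))) / (2 * pi))"
  proof (rule hol[OF singular_simplex_face_edge[OF rS]])
    have *: "cnj (?t 1 y) \<in> {z. 0 \<le> Im z} - {0}" if "y \<in> standard_simplex 1" for y
      using disc_simplex_face(2)[OF that, of 1] standard_simplex_1D[OF that]
      by (simp add: triangle_point_simps simplical_face_def)
    have "continuous_map (simplex_space 1) euclideanreal (\<lambda>y. Arg2pi (cnj (?t 1 y)))"
      using * by (intro continuous_map_triangle_angle[OF continuous_on_upperhalf_Arg2pi])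
        (auto simp: continuous_on_cnj)
    moreover have "1 - Arg2pi z / (2 * pi) \<in> {0..1}" for z using range01[of z] by auto
    ultimately show "continuous_map (simplex_space 1) (top_of_set {0..1}) (\<lambda>y. 1 - Arg2pi (cnj (?t 1 y)) / (2 * pi))"
      by (auto simp: continuous_map_in_subtopology intro!: continuous_map_real_divide continuous_map_diff)
    show "\<forall>y\<in>standard_simplex 1. face_edge r 1 y = word_loop r (1 - Arg2pi (cnj (?t 1 y)) / (2 * pi))"
    proof
      fix y :: "nat \<Rightarrow> real" assume y: "y \<in> standard_simplex 1"
      let ?z = "?t 1 y"
      show "face_edge r 1 y = word_loop r (1 - Arg2pi (cnj ?z) / (2 * pi))"
      proof (cases "?z \<in> \<real>")
        case True
        then have "Im ?z = 0" by (simp add: complex_is_Real_iff)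
        then have "0 \<le> Re ?z" using standard_simplex_1D[OF y]
          by (simp add: triangle_point_simps simplical_face_def)
        then have "Arg2pi ?z = 0" "Arg2pi (cnj ?z) = 0"
          using True by (simp_all add: Arg2pi_real Arg2pi_cnj)
        then show ?thesis using face_edge_eq[OF y, of 1 r] by simp
      next
        case False
        then show ?thesis using face_edge_eq[OF y, of 1 r]
          by (simp add: Arg2pi_cnj diff_divide_distrib)
      qed
    qed
  qed auto
  moreover have v: "?t 2 (std_vertex 0) = third_root 0" "?t 2 (std_vertex 1) = third_root 1"
    "?t 0 (std_vertex 0) = third_root 1" "?t 0 (std_vertex 1) = third_root 2"
    "?t 1 (std_vertex 0) = third_root 0" "?t 1 (std_vertex 1) = third_root 2"
    by (simp_all add: triangle_point_vertex numeral_2_eq_2)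
  moreover have "cnj (third_root 2) = third_root 1" "cnj (third_root 0) = third_root 0"
    unfolding third_root_eq by (simp_all add: complex_eq_iff)
  moreover have "1 - 2 * pi / 3 / (2 * pi) = 2 / 3" "2 * pi / 3 / (2 * pi) = 1 / 3"
    "4 * pi / 3 / (2 * pi) = 2 / 3" "1 - 0 / (2 * pi) = 1" "0 / (2 * pi) = 0" by simp_all
  ultimately have "skeleton_holonomy S (face_edge r 2) = inv\<^bsub>?F\<^esub> [] \<otimes>\<^bsub>?F\<^esub> \<gamma> (1/3)"
    "skeleton_holonomy S (face_edge r 0) = inv\<^bsub>?F\<^esub> \<gamma> (1/3) \<otimes>\<^bsub>?F\<^esub> \<gamma> (2/3)"
    "skeleton_holonomy S (face_edge r 1) = inv\<^bsub>?F\<^esub> r \<otimes>\<^bsub>?F\<^esub> \<gamma> (2/3)"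
    by (simp_all only: Arg2pi_third_root \<gamma>(1,2))
  moreover have "\<gamma> (1/3) \<in> carrier ?F" "\<gamma> (2/3) \<in> carrier ?F" using \<gamma>(3) by auto
  moreover have "inv\<^bsub>?F\<^esub> [] = []" using F.inv_one[of S] by simp
  ultimately show ?thesis
    using r F.l_one[of _ S] by (simp add: F.m_assoc)
qed

section \<open>Filling horns and spheres\<close>

definition drop_coord :: "nat \<Rightarrow> (nat \<Rightarrow> real) \<Rightarrow> nat \<Rightarrow> real"
  where "drop_coord i x = (\<lambda>j. if j < i then x j else x (Suc j))"

lemma drop_simplical_face [simp]: "drop_coord i (simplical_face i x) = x"
  by (auto simp: drop_coord_def simplical_face_def fun_eq_iff)

lemma simplical_face_drop: "x i = 0 \<Longrightarrow> simplical_face i (drop_coord i x) = x"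
  by (auto simp: drop_coord_def simplical_face_def fun_eq_iff)

lemma simplical_face_commute:
  "i < j \<Longrightarrow> simplical_face j (simplical_face i x) = simplical_face i (simplical_face (j - 1) x)"
  by (auto simp: simplical_face_def fun_eq_iff)

lemma drop_coord_in_simplex:
  assumes x: "x \<in> standard_simplex (Suc p)" and i: "i \<le> Suc p" "x i = 0"
  shows "drop_coord i x \<in> standard_simplex p"
proof -
  have "(\<Sum>j\<le>p. drop_coord i x j) = (\<Sum>j\<in>{..Suc p} - {i}. x j)"
  proof (rule sum.reindex_bij_witness[where i = "\<lambda>j. if j < i then j else j - 1" and j = "\<lambda>j. if j < i then j else Suc j"])
  qed (use i in \<open>auto simp: drop_coord_def\<close>)
  also have "\<dots> = (\<Sum>j\<le>Suc p. x j)" using i by (subst (2) sum.remove[of _ i]) auto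
  finally show ?thesis
    using x i by (auto simp: standard_simplex_def drop_coord_def)
qed

lemma continuous_map_drop_coord:
  assumes "i \<le> Suc p"
  shows "continuous_map (subtopology (simplex_space (Suc p)) {x. x i = 0}) (simplex_space p) (drop_coord i)"
  unfolding continuous_map_in_subtopology
proof
  show "continuous_map (subtopology (simplex_space (Suc p)) {x. x i = 0}) (powertop_real UNIV) (drop_coord i)"
    unfolding continuous_map_componentwise_UNIV drop_coord_def subtopology_subtopology
    using continuous_map_coordinate by auto
qed (use drop_coord_in_simplex assms in auto)

definition face_set :: "nat \<Rightarrow> nat set \<Rightarrow> (nat \<Rightarrow> real) set"
  where "face_set p I = {x \<in> standard_simplex (Suc p). \<exists>i\<in>I. x i = 0}"

text \<open>Two faces meet where two coordinates vanish; there both values come from a face of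
  codimension two, on which \<open>compat\<close> identifies them. The rest is pasting along
  finitely many closed sets.\<close>

lemma glue_faces:
  assumes I: "I \<subseteq> {..Suc p}" and p: "1 \<le> p"
    and \<tau>: "\<And>i. i \<in> I \<Longrightarrow> singular_simplex p X (\<tau> i)"
    and compat: "\<And>i j. \<lbrakk>i \<in> I; j \<in> I; i < j\<rbrakk> \<Longrightarrow> singular_face p i (\<tau> j) = singular_face p (j - 1) (\<tau> i)"
  obtains g where "continuous_map (subtopology (powertop_real UNIV) (face_set p I)) X g"
    "\<And>i x. \<lbrakk>i \<in> I; x \<in> standard_simplex (Suc p); x i = 0\<rbrakk> \<Longrightarrow> g x = \<tau> i (drop_coord i x)"
proof -
  let ?B = "subtopology (powertop_real UNIV) (face_set p I)"
  have eq: "\<tau> i (drop_coord i x) = \<tau> j (drop_coord j x)"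
    if "i \<in> I" "j \<in> I" "i < j" and x: "x \<in> standard_simplex (Suc p)" "x i = 0" "x j = 0" for i j x
  proof -
    let ?y = "drop_coord j x"
    have y: "?y \<in> standard_simplex p" "?y i = 0"
      using drop_coord_in_simplex[OF x(1) _ x(3)] that I by (auto simp: drop_coord_def)
    define z where "z = drop_coord i ?y"
    obtain q where q: "p = Suc q" using p by (cases p) auto
    have "i \<le> p" using \<open>i < j\<close> \<open>j \<in> I\<close> I by fastforce
    then have z: "z \<in> standard_simplex (p - Suc 0)"
      using drop_coord_in_simplex[of ?y q i] y by (simp add: z_def q)
    have yz: "?y = simplical_face i z" using simplical_face_drop[of ?y i] y by (simp add: z_def)
    have "simplical_face i (simplical_face (j - 1) z) = x"
      using simplical_face_commute[OF \<open>i < j\<close>, of z] yz simplical_face_drop[of x j] x(3) by simp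
    then have "drop_coord i x = simplical_face (j - 1) z" by (metis drop_simplical_face)
    then have "\<tau> i (drop_coord i x) = singular_face p (j - 1) (\<tau> i) z"
      using z by (simp add: singular_face_def)
    also have "\<dots> = singular_face p i (\<tau> j) z" using compat[of i j] that by simp
    also have "\<dots> = \<tau> j ?y" using z yz by (simp add: singular_face_def)
    finally show ?thesis .
  qed
  have eq': "\<tau> i (drop_coord i x) = \<tau> j (drop_coord j x)"
    if "i \<in> I" "j \<in> I" "x \<in> standard_simplex (Suc p)" "x i = 0" "x j = 0" for i j x
  proof (cases i j rule: linorder_cases)
    case less
    then show ?thesis by (rule eq[OF that(1,2) _ that(3-5)])
  next
    case greater
    then show ?thesis by (rule eq[OF that(2,1) _ that(3,5,4), symmetric])
  qed simp
  define c where "c x = (SOME i. i \<in> I \<and> x i = 0)" for x :: "nat \<Rightarrow> real"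
  define g where "g x = \<tau> (c x) (drop_coord (c x) x)" for x
  have c: "c x \<in> I \<and> x (c x) = 0" if "i \<in> I" "x i = 0" for i x
    unfolding c_def by (rule someI[of _ i]) (use that in auto)
  have g: "g x = \<tau> i (drop_coord i x)" if "i \<in> I" "x \<in> standard_simplex (Suc p)" "x i = 0" for i x
    unfolding g_def using c[of i x] that by (intro eq') auto
  have "continuous_map ?B X g"
  proof (rule pasting_lemma_closed[where I = I and T = "\<lambda>i. {x \<in> topspace ?B. x i = 0}"
        and f = "\<lambda>i x. \<tau> i (drop_coord i x)"])
    show "finite I" using I by (rule finite_subset) simp
    fix i assume i: "i \<in> I"
    have "closedin ?B {x \<in> topspace ?B. x i \<in> {0}}"
      by (rule closedin_continuous_map_preimage[OF continuous_map_coordinate]) simp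
    then show "closedin ?B {x \<in> topspace ?B. x i = 0}" by simp
    have "face_set p I \<inter> {x \<in> topspace ?B. x i = 0} = standard_simplex (Suc p) \<inter> {x. x i = 0}"
      using i by (auto simp: face_set_def)
    then have "subtopology ?B {x \<in> topspace ?B. x i = 0} = subtopology (simplex_space (Suc p)) {x. x i = 0}"
      by (simp add: subtopology_subtopology)
    then show "continuous_map (subtopology ?B {x \<in> topspace ?B. x i = 0}) X (\<lambda>x. \<tau> i (drop_coord i x))"
      using continuous_map_compose[OF continuous_map_drop_coord[of i p], of X "\<tau> i"] \<tau>[OF i] i I
      by (auto simp: singular_simplex_def o_def)
  next
    fix i j x assume "i \<in> I" "j \<in> I" "x \<in> topspace ?B \<inter> {x \<in> topspace ?B. x i = 0} \<inter> {x \<in> topspace ?B. x j = 0}"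
    then show "\<tau> i (drop_coord i x) = \<tau> j (drop_coord j x)"
      by (intro eq') (auto simp: face_set_def)
  next
    fix x assume "x \<in> topspace ?B"
    then obtain i where "i \<in> I" "x i = 0" "x \<in> standard_simplex (Suc p)" by (auto simp: face_set_def)
    then show "\<exists>j. j \<in> I \<and> x \<in> {x \<in> topspace ?B. x j = 0} \<and> g x = \<tau> j (drop_coord j x)"
      using g by (intro exI[of _ i]) (auto simp: face_set_def)
  qed
  then show ?thesis using g that by blast
qed

lemma fill_from_glued:
  assumes f: "continuous_map (simplex_space (Suc p)) X f"
    and fg: "\<And>x. x \<in> face_set p I \<Longrightarrow> f x = g x" and I: "I \<subseteq> {..Suc p}"
    and g: "\<And>i x. \<lbrakk>i \<in> I; x \<in> standard_simplex (Suc p); x i = 0\<rbrakk> \<Longrightarrow> g x = \<tau> i (drop_coord i x)"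
    and \<tau>: "\<And>i. i \<in> I \<Longrightarrow> singular_simplex p X (\<tau> i)"
  shows "\<exists>T. singular_simplex (Suc p) X T \<and> (\<forall>i\<in>I. singular_face (Suc p) i T = \<tau> i)"
proof -
  define T where "T = restrict f (standard_simplex (Suc p))"
  have "singular_simplex (Suc p) X T" using f by (simp add: T_def singular_simplex_def)
  moreover have "singular_face (Suc p) i T = \<tau> i" if i: "i \<in> I" for i
  proof -
    have "singular_face (Suc p) i T y = \<tau> i y" for y
    proof (cases "y \<in> standard_simplex p")
      case True
      have x: "simplical_face i y \<in> standard_simplex (Suc p)"
        using simplical_face_in_standard_simplex[of "Suc p" i y] True i I by auto
      moreover have "simplical_face i y i = 0" by (simp add: simplical_face_def)
      ultimately show ?thesis
        using True i fg[of "simplical_face i y"] g[of i "simplical_face i y"]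
        by (auto simp: singular_face_def T_def face_set_def)
    next
      case False
      moreover have "\<tau> i \<in> extensional (standard_simplex p)"
        using \<tau>[OF i] by (simp add: singular_simplex_def)
      ultimately show ?thesis by (simp add: singular_face_def extensional_arb[of "\<tau> i"])
    qed
    then show ?thesis by (rule ext)
  qed
  ultimately show ?thesis by blast
qed

text \<open>The Kan condition: the simplex retracts onto the union of its faces other than the
  \<open>k\<close>-th.\<close>

lemma horn_fill:
  assumes k: "k \<le> Suc p" and p: "1 \<le> p"
    and \<tau>: "\<And>i. \<lbrakk>i \<le> Suc p; i \<noteq> k\<rbrakk> \<Longrightarrow> singular_simplex p X (\<tau> i)"
    and compat: "\<And>i j. \<lbrakk>i < j; j \<le> Suc p; i \<noteq> k; j \<noteq> k\<rbrakk> \<Longrightarrow>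
      singular_face p i (\<tau> j) = singular_face p (j - 1) (\<tau> i)"
  shows "\<exists>T. singular_simplex (Suc p) X T \<and> (\<forall>i\<le>Suc p. i \<noteq> k \<longrightarrow> singular_face (Suc p) i T = \<tau> i)"
proof -
  let ?I = "{..Suc p} - {k}"
  have fin: "finite ?I" "?I \<noteq> {}"
  proof -
    have "(if k = 0 then 1 else 0) \<in> ?I" by auto
    then show "?I \<noteq> {}" by blast
  qed auto
  obtain g where g: "continuous_map (subtopology (powertop_real UNIV) (face_set p ?I)) X g"
    "\<And>i x. \<lbrakk>i \<in> ?I; x \<in> standard_simplex (Suc p); x i = 0\<rbrakk> \<Longrightarrow> g x = \<tau> i (drop_coord i x)"
    using glue_faces[of ?I p X \<tau>] p \<tau> compat by auto
  define m where "m x = Min (x ` ?I)" for x :: "nat \<Rightarrow> real"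
  \<comment> \<open>The mass \<open>m x\<close> is moved from each of the \<open>Suc p\<close> other
    coordinates to the \<open>k\<close>-th one. One of them becomes 0, and on the horn
    \<open>m x\<close> is 0, so nothing moves.\<close>
  define R where "R x = (\<lambda>i. if i = k then x k + real (Suc p) * m x else if i \<le> Suc p then x i - m x else 0)"
    for x :: "nat \<Rightarrow> real"
  have m0: "0 \<le> m x" "\<And>i. i \<in> ?I \<Longrightarrow> m x \<le> x i" "\<exists>i\<in>?I. m x = x i" if "x \<in> standard_simplex (Suc p)" for x
  proof -
    show "m x \<le> x i" if "i \<in> ?I" for i unfolding m_def using fin that by (intro Min_le) auto
    have "m x \<in> x ` ?I" unfolding m_def using fin by (intro Min_in) auto
    then show "\<exists>i\<in>?I. m x = x i" by auto
    then show "0 \<le> m x" using that by (auto simp: standard_simplex_def)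
  qed
  have cm: "continuous_map (simplex_space (Suc p)) euclideanreal m"
  proof -
    have "continuous_map (simplex_space (Suc p)) euclideanreal (\<lambda>x. Min (x ` J))" if "finite J" "J \<noteq> {}" for J
      using that
    proof (induction J rule: finite_ne_induct)
      case (insert j J)
      then have "continuous_map (simplex_space (Suc p)) euclideanreal (\<lambda>x. min (x j) (Min (x ` J)))"
        by (intro continuous_map_real_min continuous_map_coordinate)
      then show ?case using insert by simp
    qed (simp add: continuous_map_coordinate)
    from this[OF fin] show ?thesis unfolding m_def .
  qed
  have RB: "R x \<in> face_set p ?I" if x: "x \<in> standard_simplex (Suc p)" for x
  proof -
    have split: "sum y {..Suc p} = y k + sum y ?I" for y :: "nat \<Rightarrow> real"
      using k by (intro sum.remove) auto
    note split[of "R x"]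
    also have "sum (R x) ?I = (\<Sum>i\<in>?I. x i - m x)" by (intro sum.cong) (auto simp: R_def)
    also have "\<dots> = sum x ?I - real (Suc p) * m x" using k by (simp add: sum_subtractf)
    also have "R x k + \<dots> = x k + sum x ?I" by (simp add: R_def)
    also have "\<dots> = 1" using x by (simp only: standard_simplex_def split[symmetric]) simp
    finally have s: "sum (R x) {..Suc p} = 1" .
    have nn: "0 \<le> R x i" for i
      using m0[OF x] x by (auto simp: R_def standard_simplex_def)
    have "R x i \<le> 1" for i
    proof (cases "i \<le> Suc p")
      case True
      then have "R x i \<le> sum (R x) {..Suc p}" using nn by (intro member_le_sum) auto
      then show ?thesis using s by simp
    qed (use k in \<open>auto simp: R_def\<close>)
    then have "R x \<in> standard_simplex (Suc p)" using nn s k by (auto simp: standard_simplex_def R_def)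
    moreover obtain i where "i \<in> ?I" "m x = x i" using m0(3)[OF x] by blast
    then have "\<exists>i\<in>?I. R x i = 0" by (auto simp: R_def)
    ultimately show ?thesis by (simp add: face_set_def)
  qed
  have "continuous_map (simplex_space (Suc p)) euclideanreal (\<lambda>x. R x i)" for i
    unfolding R_def by (auto intro!: continuous_intros continuous_map_coordinate cm)
  then have cR: "continuous_map (simplex_space (Suc p)) (subtopology (powertop_real UNIV) (face_set p ?I)) R"
    using RB by (auto simp: continuous_map_in_subtopology continuous_map_componentwise_UNIV)
  have "g (R x) = g x" if x: "x \<in> face_set p ?I" for x
  proof -
    have xs: "x \<in> standard_simplex (Suc p)" using x by (simp add: face_set_def)
    have "m x = 0" using x m0(1)[OF xs] m0(2)[OF xs] by (force simp: face_set_def)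
    then have "R x = x" using xs by (auto simp: R_def standard_simplex_def fun_eq_iff)
    then show ?thesis by simp
  qed
  then have "\<exists>T. singular_simplex (Suc p) X T \<and> (\<forall>i\<in>?I. singular_face (Suc p) i T = \<tau> i)"
    using fill_from_glued[of p X "g \<circ> R" ?I g \<tau>] continuous_map_compose[OF cR g(1)] g(2) \<tau> by auto
  then show ?thesis by auto
qed

text \<open>Polar coordinates: \<open>\<theta>\<close> need not have a limit where
  \<open>\<rho>\<close> vanishes. Compactness of \<open>Q\<close> makes the projection to the
  interval closed, so a neighbourhood of \<open>a\<close> contains \<open>h (t, q)\<close> for all
  small \<open>t\<close>, uniformly in \<open>q\<close>.\<close>

lemma continuous_map_collapse:
  assumes Q: "compact_space Q" and h: "continuous_map (prod_topology (top_of_set {0..1::real}) Q) X h"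
    and h0: "\<And>q. q \<in> topspace Q \<Longrightarrow> h (0, q) = a" and a: "a \<in> topspace X"
    and \<rho>: "continuous_map K euclideanreal \<rho>" and \<rho>01: "\<And>x. x \<in> topspace K \<Longrightarrow> \<rho> x \<in> {0..1}"
    and \<theta>: "continuous_map (subtopology K {x. 0 < \<rho> x}) Q \<theta>"
  shows "continuous_map K X (\<lambda>x. if 0 < \<rho> x then h (\<rho> x, \<theta> x) else a)"
proof -
  let ?P = "subtopology K {x. 0 < \<rho> x}" and ?I01 = "top_of_set {0..1::real}"
  let ?R = "prod_topology ?I01 Q"
  let ?f = "\<lambda>x. if 0 < \<rho> x then h (\<rho> x, \<theta> x) else a"
  have cK: "continuous_map K ?I01 \<rho>"
    using \<rho> \<rho>01 by (auto simp: continuous_map_in_subtopology)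
  then have "continuous_map ?P ?R (\<lambda>x. (\<rho> x, \<theta> x))"
    using \<theta> by (simp add: continuous_map_paired continuous_map_from_subtopology)
  from continuous_map_compose[OF this h]
  have cP: "continuous_map ?P X (\<lambda>x. h (\<rho> x, \<theta> x))" by (simp add: o_def)
  have opP: "openin K (topspace ?P)"
  proof -
    have "openin K {x \<in> topspace K. \<rho> x \<in> {0<..}}"
      by (rule openin_continuous_map_preimage[OF \<rho>]) simp
    moreover have "{x \<in> topspace K. \<rho> x \<in> {0<..}} = topspace ?P" by auto
    ultimately show ?thesis by simp
  qed
  have "openin K {x \<in> topspace K. ?f x \<in> W}" if W: "openin X W" for W
  proof -
    let ?V = "{x \<in> topspace ?P. h (\<rho> x, \<theta> x) \<in> W}"
    have "openin ?P ?V" using cP W by (rule openin_continuous_map_preimage)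
    then obtain U where U: "openin K U" "?V = U \<inter> {x. 0 < \<rho> x}"
      unfolding openin_subtopology by blast
    then have "?V = U \<inter> topspace ?P" using openin_subset[OF U(1)] by auto
    then have V: "openin K ?V" using openin_Int[OF U(1) opP] by simp
    show ?thesis
    proof (cases "a \<in> W")
      case False
      then have "{x \<in> topspace K. ?f x \<in> W} = ?V" by auto
      then show ?thesis using V by simp
    next
      case True
      define C where "C = {q \<in> topspace ?R. h q \<in> topspace X - W}"
      have "closedin ?R C"
        unfolding C_def using h W by (intro closedin_continuous_map_preimage) auto
      then have fC: "closedin ?I01 (fst ` C)"
        using Abstract_Topological_Spaces.closed_map_fst[OF Q, of ?I01] by (simp add: closed_map_def)
      let ?N = "{x \<in> topspace K. \<rho> x \<in> topspace ?I01 - fst ` C}"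
      have N: "openin K ?N"
        using cK fC by (intro openin_continuous_map_preimage) (auto simp: closedin_def)
      have "{x \<in> topspace K. ?f x \<in> W} = ?V \<union> ?N"
      proof (intro equalityI subsetI)
        fix x assume x: "x \<in> {x \<in> topspace K. ?f x \<in> W}"
        show "x \<in> ?V \<union> ?N"
        proof (cases "0 < \<rho> x")
          case False
          then have "\<rho> x = 0" using \<rho>01[of x] x by auto
          moreover have "0 \<notin> fst ` C" using h0 True by (auto simp: C_def)
          ultimately show ?thesis using x by auto
        qed (use x in auto)
      next
        fix x assume x: "x \<in> ?V \<union> ?N"
        show "x \<in> {x \<in> topspace K. ?f x \<in> W}"
        proof (cases "0 < \<rho> x")
          case True
          then have xP: "x \<in> topspace ?P" using x by auto
          have q: "(\<rho> x, \<theta> x) \<in> topspace ?R"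
            using xP \<theta> \<rho>01 by (auto simp: continuous_map_def)
          then have "h (\<rho> x, \<theta> x) \<in> topspace X" using h by (auto simp: continuous_map_def)
          moreover have "x \<in> ?N \<Longrightarrow> (\<rho> x, \<theta> x) \<notin> C" by force
          ultimately have "h (\<rho> x, \<theta> x) \<in> W" using x q by (auto simp: C_def)
          then show ?thesis using xP True by simp
        qed (use x \<open>a \<in> W\<close> in auto)
      qed
      then show ?thesis using openin_Un[OF V N] by (simp only:)
    qed
  qed
  moreover have "?f x \<in> topspace X" if "x \<in> topspace K" for x
    using that a cP by (auto simp: continuous_map_def Pi_iff)
  ultimately show ?thesis unfolding continuous_map_def by blast
qed

section \<open>Filling the boundary of the 3-simplex\<close>

definition aspherical_2 :: "'b topology \<Rightarrow> bool"
  where "aspherical_2 X \<longleftrightarrow> (\<forall>f. continuous_map (nsphere 2) X f \<longrightarrow>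
    (\<exists>a. homotopic_with (\<lambda>_. True) (nsphere 2) X f (\<lambda>_. a)))"

lemma compact_space_nsphere: "compact_space (nsphere n)"
proof -
  have "topspace (nsphere n) \<subseteq> disc_set (Suc n)"
    using disc_boundary_subset[of "Suc n"] by (simp add: disc_boundary_eq)
  moreover have "closedin (closed_disc (Suc n)) (topspace (nsphere n))"
  proof -
    have "closedin (closed_disc (Suc n)) {x \<in> topspace (closed_disc (Suc n)). (\<Sum>i\<le>n. (x i)\<^sup>2) \<in> {1}}"
      unfolding closed_disc_eq
      by (rule closedin_continuous_map_preimage[where Y = euclideanreal])
        (auto intro!: continuous_map_sum continuous_map_real_pow continuous_map_coordinate)
    moreover have "{x \<in> topspace (closed_disc (Suc n)). (\<Sum>i\<le>n. (x i)\<^sup>2) \<in> {1}} = topspace (nsphere n)"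
      by (auto simp: disc_set_def nsphere_eq lessThan_Suc_atMost Suc_le_eq)
    ultimately show ?thesis by simp
  qed
  ultimately show ?thesis
    using closedin_compact_space[of "closed_disc (Suc n)" "topspace (nsphere n)"] compactin_disc_set[of "Suc n"]
      closed_disc_boundary[of n]
    by (simp add: closed_disc_eq compact_space_subtopology compactin_subspace)
qed

text \<open>The boundary of the 3-simplex is a 2-sphere, by radial projection from the barycentre.\<close>

lemma sphere_fill:
  assumes X: "aspherical_2 X"
    and \<tau>: "\<And>i. i \<le> 3 \<Longrightarrow> singular_simplex 2 X (\<tau> i)"
    and compat: "\<And>i j. \<lbrakk>i < j; j \<le> 3\<rbrakk> \<Longrightarrow> singular_face 2 i (\<tau> j) = singular_face 2 (j - 1) (\<tau> i)"
  shows "\<exists>T. singular_simplex 3 X T \<and> (\<forall>i\<le>3. singular_face 3 i T = \<tau> i)"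
proof -
  let ?I = "{..Suc 2}" and ?D = "simplex_space 3" and ?I01 = "top_of_set {0..1::real}"
  let ?B = "subtopology (powertop_real UNIV) (face_set 2 ?I)"
  obtain g where g: "continuous_map ?B X g"
    "\<And>i x. \<lbrakk>i \<in> ?I; x \<in> standard_simplex (Suc 2); x i = 0\<rbrakk> \<Longrightarrow> g x = \<tau> i (drop_coord i x)"
    using glue_faces[of ?I 2 X \<tau>] \<tau> compat by auto
  have seq: "x 0 + x 1 + x 2 + x 3 = sum x {..3}" for x :: "nat \<Rightarrow> real"
    by (simp add: numeral_3_eq_3 numeral_2_eq_2)
  \<comment> \<open>Three coordinates are completed to a vector of sum zero, a direction in the
    hyperplane of the simplex.\<close>
  define v where "v u = (\<lambda>i. if i = 3 then - (u 0 + u 1 + u 2) else u i)" for u :: "nat \<Rightarrow> real"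
  define mn where "mn x = min (min (x 0) (x 1)) (min (x 2) (x 3))" for x :: "nat \<Rightarrow> real"
  have mn: "mn x \<le> x i" if "i \<le> 3" for x i
  proof -
    have "i = 0 \<or> i = 1 \<or> i = 2 \<or> i = 3" using that by auto
    then show ?thesis by (auto simp: mn_def)
  qed
  have mn_ex: "\<exists>i\<le>3. mn x = x i" for x
  proof -
    have "mn x = x 0 \<or> mn x = x 1 \<or> mn x = x 2 \<or> mn x = x 3" unfolding mn_def by linarith
    then show ?thesis by (metis le_numeral_extra(3) one_le_numeral zero_le order_refl numeral_le_iff semiring_norm(69) semiring_norm(72))
  qed
  have mn_neg: "mn (v u) < 0" if u: "u \<in> topspace (nsphere 2)" for u
  proof (rule ccontr)
    assume "\<not> mn (v u) < 0"
    then have "0 \<le> v u i" if "i \<le> 3" for i using mn[OF that, of "v u"] by linarith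
    from this[of 0] this[of 1] this[of 2] this[of 3]
    have "u 0 = 0" "u 1 = 0" "u 2 = 0" by (auto simp: v_def)
    then show False using u by (simp add: nsphere_eq numeral_2_eq_2)
  qed
  \<comment> \<open>The point where the ray from the barycentre in direction \<open>v u\<close>
    leaves the simplex: the factor \<open>- 1 / (4 * mn (v u))\<close> brings the least coordinate
    down to 0.\<close>
  define \<phi> where "\<phi> u = (\<lambda>i. if i \<le> 3 then 1/4 - v u i / (4 * mn (v u)) else 0)" for u
  have \<phi>B: "\<phi> u \<in> face_set 2 ?I" if u: "u \<in> topspace (nsphere 2)" for u
  proof -
    note neg = mn_neg[OF u]
    have "sum (v u) {..3} = 0" unfolding seq[symmetric] by (simp add: v_def)
    then have "v u 0 / (4 * mn (v u)) + v u 1 / (4 * mn (v u)) + v u 2 / (4 * mn (v u)) + v u 3 / (4 * mn (v u)) = 0"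
      unfolding seq[symmetric] by (simp flip: add_divide_distrib)
    then have s: "sum (\<phi> u) {..3} = 1" unfolding seq[symmetric] by (simp add: \<phi>_def)
    have nn: "0 \<le> \<phi> u i" for i
      using mn[of i "v u"] neg by (auto simp: \<phi>_def field_simps)
    have "\<phi> u i \<le> 1" for i
    proof (cases "i \<le> 3")
      case True
      then have "\<phi> u i \<le> sum (\<phi> u) {..3}" using nn by (intro member_le_sum) auto
      then show ?thesis using s by simp
    qed (auto simp: \<phi>_def)
    moreover obtain i where "i \<le> 3" "mn (v u) = v u i" using mn_ex[of "v u"] by blast
    then have "\<phi> u i = 0" "i \<le> 3" using neg by (auto simp: \<phi>_def)
    ultimately show ?thesis using s nn
      by (auto simp: face_set_def standard_simplex_def \<phi>_def[of u] numeral_3_eq_3)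
  qed
  have cS: "continuous_map (nsphere 2) euclideanreal (\<lambda>u. v u i)" for i
    unfolding v_def by (auto intro!: continuous_intros continuous_map_nsphere_projection)
  have c\<phi>: "continuous_map (nsphere 2) ?B \<phi>"
  proof -
    have "continuous_map (nsphere 2) euclideanreal (\<lambda>u. mn (v u))"
      unfolding mn_def by (intro continuous_map_real_min cS)
    then have "continuous_map (nsphere 2) euclideanreal (\<lambda>u. \<phi> u i)" for i
      unfolding \<phi>_def using mn_neg
      by (cases "i \<le> 3") (auto intro!: continuous_map_diff continuous_map_real_divide continuous_map_real_mult cS, force)
    then show ?thesis using \<phi>B by (auto simp: continuous_map_in_subtopology continuous_map_componentwise_UNIV)
  qed
  obtain a where "homotopic_with (\<lambda>_. True) (nsphere 2) X (g \<circ> \<phi>) (\<lambda>_. a)"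
    using X continuous_map_compose[OF c\<phi> g(1)] by (auto simp: aspherical_2_def)
  then obtain h where h: "continuous_map (prod_topology ?I01 (nsphere 2)) X h"
    "\<And>u. h (0, u) = g (\<phi> u)" "\<And>u. h (1, u) = a"
    by (auto simp: homotopic_with_def)
  \<comment> \<open>\<open>\<mu>\<close> is 0 at the barycentre and 1 on the boundary, and
    \<open>\<theta>\<close> is the direction from the barycentre. The null-homotopy \<open>h\<close>
    is run from the boundary inwards.\<close>
  define \<mu> where "\<mu> x = 1 - 4 * mn x" for x
  define n where "n x = sqrt (\<Sum>i\<le>2. (x i - 1/4)\<^sup>2)" for x :: "nat \<Rightarrow> real"
  define \<theta> where "\<theta> x = (\<lambda>i. if i \<le> 2 then (x i - 1/4) / n x else 0)" for x
  have \<mu>01: "\<mu> x \<in> {0..1}" if x: "x \<in> standard_simplex 3" for x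
  proof -
    have "sum x {..3} = 1" using x by (simp add: standard_simplex_def)
    then have "4 * mn x \<le> 1"
      using mn[of 0 x] mn[of 1 x] mn[of 2 x] mn[of 3 x] unfolding seq[symmetric] by simp
    moreover have "0 \<le> mn x" using x by (simp add: mn_def standard_simplex_def)
    ultimately show ?thesis by (simp add: \<mu>_def)
  qed
  have npos: "n x > 0" if x: "x \<in> standard_simplex 3" "0 < \<mu> x" for x
  proof (rule ccontr)
    assume "\<not> n x > 0"
    then have "(\<Sum>i\<le>2. (x i - 1/4)\<^sup>2) \<le> 0" by (simp add: n_def)
    then have "(\<Sum>i\<le>2. (x i - 1/4)\<^sup>2) = 0" by (meson order_antisym sum_nonneg zero_le_power2)
    then have "\<forall>i\<in>{..2}. (x i - 1/4)\<^sup>2 = 0" by (subst (asm) sum_nonneg_eq_0_iff) auto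
    then have "x 0 = 1/4" "x 1 = 1/4" "x 2 = 1/4" by auto
    moreover have "sum x {..3} = 1" using x by (simp add: standard_simplex_def)
    ultimately have "x 3 = 1/4" unfolding seq[symmetric] by simp
    then show False using x(2) \<open>x 0 = 1/4\<close> \<open>x 1 = 1/4\<close> \<open>x 2 = 1/4\<close> by (simp add: \<mu>_def mn_def)
  qed
  let ?P = "subtopology ?D {x. 0 < \<mu> x}"
  have co: "continuous_map ?P euclideanreal (\<lambda>x. x i)" for i
    unfolding subtopology_subtopology by (rule continuous_map_coordinate)
  have cD\<mu>: "continuous_map ?D euclideanreal \<mu>"
    unfolding \<mu>_def mn_def
    by (intro continuous_map_diff continuous_map_real_mult continuous_map_real_min continuous_map_coordinate) auto
  have c\<theta>: "continuous_map ?P (nsphere 2) \<theta>"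
    unfolding nsphere continuous_map_in_subtopology
  proof
    have cn: "continuous_map ?P euclideanreal n"
      unfolding n_def
      by (intro continuous_map_sqrt continuous_map_sum continuous_map_real_pow continuous_map_diff co) auto
    have "continuous_map ?P euclideanreal (\<lambda>x. \<theta> x i)" for i
      unfolding \<theta>_def using npos
      by (cases "i \<le> 2") (auto intro!: continuous_map_real_divide continuous_map_diff co cn, force)
    then show "continuous_map ?P (powertop_real UNIV) \<theta>" by (simp add: continuous_map_componentwise_UNIV)
    show "\<theta> \<in> topspace ?P \<rightarrow> {x. (\<Sum>i\<le>2. (x i)\<^sup>2) = 1 \<and> (\<forall>i>2. x i = 0)}"
    proof
      fix x assume "x \<in> topspace ?P"
      then have "n x > 0" using npos by auto
      have "(\<Sum>i\<le>2. (\<theta> x i)\<^sup>2) = (\<Sum>i\<le>2. (x i - 1/4)\<^sup>2) / (n x)\<^sup>2"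
        by (simp add: \<theta>_def power_divide sum_divide_distrib)
      also have "\<dots> = 1" using \<open>n x > 0\<close> by (simp add: n_def sum_nonneg)
      finally show "\<theta> x \<in> {x. (\<Sum>i\<le>2. (x i)\<^sup>2) = 1 \<and> (\<forall>i>2. x i = 0)}" by (simp add: \<theta>_def)
    qed
  qed
  define f where "f x = (if 0 < \<mu> x then h (1 - \<mu> x, \<theta> x) else a)" for x
  have aX: "a \<in> topspace X"
  proof -
    have "(1, \<lambda>n. if n = 0 then 1 else 0) \<in> topspace (prod_topology ?I01 (nsphere 2))"
      using in_topspace_nsphere by simp
    then have "h (1, \<lambda>n. if n = 0 then 1 else 0) \<in> topspace X"
      using h(1) unfolding continuous_map_def by blast
    then show ?thesis by (simp only: h(3))
  qed
  have "continuous_map (prod_topology ?I01 (nsphere 2)) (prod_topology ?I01 (nsphere 2)) (\<lambda>(t, u). (1 - t, u))"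
    using continuous_map_fst[of ?I01 "nsphere 2"] continuous_map_snd[of ?I01 "nsphere 2"]
    by (auto simp: continuous_map_pairwise o_def case_prod_unfold continuous_map_in_subtopology
        intro!: continuous_map_diff)
  from continuous_map_compose[OF this h(1)]
  have "continuous_map (prod_topology ?I01 (nsphere 2)) X (\<lambda>(t, u). h (1 - t, u))"
    by (simp add: o_def case_prod_unfold)
  then have cf: "continuous_map ?D X f"
    using continuous_map_collapse[OF compact_space_nsphere _ _ aX cD\<mu> _ c\<theta>, of "\<lambda>(t, u). h (1 - t, u)"] h(3) \<mu>01
    unfolding f_def prod.case by simp
  have "f x = g x" if x: "x \<in> face_set 2 ?I" for x
  proof -
    obtain i where xs: "x \<in> standard_simplex 3" "i \<le> 3" "x i = 0"
      using x by (auto simp: face_set_def numeral_3_eq_3)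
    have "mn x = 0" using mn[OF xs(2), of x] xs \<mu>01[OF xs(1)] by (simp add: \<mu>_def)
    then have \<mu>1: "\<mu> x = 1" by (simp add: \<mu>_def)
    have np: "n x > 0" using npos[OF xs(1)] \<mu>1 by simp
    have "sum x {..3} = 1" using xs(1) by (simp add: standard_simplex_def)
    then have s: "x 0 + x 1 + x 2 + x 3 = 1" by (simp only: seq)
    have "((x 0 - 1/4) + (x 1 - 1/4) + (x 2 - 1/4)) / n x = (x 0 - 1/4) / n x + (x 1 - 1/4) / n x + (x 2 - 1/4) / n x"
      by (simp only: add_divide_distrib)
    moreover have "(x 0 - 1/4) + (x 1 - 1/4) + (x 2 - 1/4) = - (x 3 - 1/4)" using s by simp
    moreover have "- (x 3 - 1/4) / n x = - ((x 3 - 1/4) / n x)"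
      by (rule minus_divide_left[symmetric])
    ultimately have "(x 0 - 1/4) / n x + (x 1 - 1/4) / n x + (x 2 - 1/4) / n x = - ((x 3 - 1/4) / n x)"
      by (simp only:)
    then have v3: "v (\<theta> x) 3 = (x 3 - 1/4) / n x"
      by (simp add: v_def \<theta>_def)
    have vi: "v (\<theta> x) i = (x i - 1/4) / n x" if "i \<le> 3" for i
      using v3 that by (cases "i = 3") (auto simp: v_def \<theta>_def)
    have "mn (v (\<theta> x)) = (mn x - 1/4) / n x"
      unfolding mn_def using np by (simp add: vi min_divide_distrib_right min_diff_distrib_left)
    then have mnv: "mn (v (\<theta> x)) = - 1 / (4 * n x)" using \<open>mn x = 0\<close> by simp
    have "\<phi> (\<theta> x) = x"
    proof
      fix j
      show "\<phi> (\<theta> x) j = x j"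
      proof (cases "j \<le> 3")
        case True
        then show ?thesis using np by (simp add: \<phi>_def vi mnv)
      next
        case False
        then show ?thesis using xs(1) by (simp add: \<phi>_def standard_simplex_def)
      qed
    qed
    then show ?thesis using h(2)[of "\<theta> x"] by (simp add: f_def \<mu>1)
  qed
  then have "\<exists>T. singular_simplex (Suc 2) X T \<and> (\<forall>i\<in>?I. singular_face (Suc 2) i T = \<tau> i)"
    using cf g(2) \<tau> by (intro fill_from_glued[where f = f and g = g]) (auto simp: numeral_3_eq_3 numeral_2_eq_2)
  then show ?thesis by (simp add: numeral_3_eq_3 numeral_2_eq_2 Ball_def)
qed

section \<open>The fundamental groupoid in terms of singular simplices\<close>

text \<open>\<open>triangle X a b c\<close> means that \<open>c\<close> is homotopic to the path \<open>a\<close> followed by \<open>b\<close>.\<close>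

definition triangle :: "'b topology \<Rightarrow> ((nat \<Rightarrow> real) \<Rightarrow> 'b) \<Rightarrow> ((nat \<Rightarrow> real) \<Rightarrow> 'b) \<Rightarrow> ((nat \<Rightarrow> real) \<Rightarrow> 'b) \<Rightarrow> bool"
  where "triangle X a b c \<longleftrightarrow> (\<exists>\<sigma>. singular_simplex 2 X \<sigma> \<and>
    singular_face 2 2 \<sigma> = a \<and> singular_face 2 0 \<sigma> = b \<and> singular_face 2 1 \<sigma> = c)"

definition edge_along :: "(real \<Rightarrow> 'b) \<Rightarrow> real \<Rightarrow> real \<Rightarrow> (nat \<Rightarrow> real) \<Rightarrow> 'b"
  where "edge_along q s t = restrict (\<lambda>x. q (x 0 * s + x 1 * t)) (standard_simplex 1)"

definition const_edge :: "'b \<Rightarrow> (nat \<Rightarrow> real) \<Rightarrow> 'b"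
  where "const_edge x = restrict (\<lambda>_. x) (standard_simplex 1)"

lemma triangleD:
  assumes "triangle X a b c"
  shows "singular_simplex 1 X a" "singular_simplex 1 X b" "singular_simplex 1 X c"
    "a (std_vertex 0) = c (std_vertex 0)" "a (std_vertex 1) = b (std_vertex 0)" "b (std_vertex 1) = c (std_vertex 1)"
proof -
  obtain \<sigma> where \<sigma>: "singular_simplex 2 X \<sigma>" "a = singular_face 2 2 \<sigma>" "b = singular_face 2 0 \<sigma>" "c = singular_face 2 1 \<sigma>"
    using assms by (auto simp: triangle_def)
  then show "singular_simplex 1 X a" "singular_simplex 1 X b" "singular_simplex 1 X c"
    using singular_simplex_singular_face[OF \<sigma>(1)] by auto
  show "a (std_vertex 0) = c (std_vertex 0)" "a (std_vertex 1) = b (std_vertex 0)" "b (std_vertex 1) = c (std_vertex 1)"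
    by (simp_all add: \<sigma> singular_face_def)
qed

lemma simplex_0_eq: "standard_simplex 0 = {std_vertex 0}"
  by (simp add: standard_simplex_0 std_vertex_def)

lemma singular_face_1_eqI:
  assumes "f (std_vertex (if i = 0 then 1 else 0)) = g (std_vertex (if j = 0 then 1 else 0))"
  shows "singular_face 1 i f = singular_face 1 j g"
proof -
  have "simplical_face i (std_vertex 0) = std_vertex (if i = 0 then 1 else 0)" for i
    by simp
  then show ?thesis
    using assms unfolding singular_face_def by (intro restrict_ext) (simp add: simplex_0_eq)
qed

text \<open>Filling of the inner horn, the one without face 1.\<close>

lemma triangle_composite:
  assumes "singular_simplex 1 X a" "singular_simplex 1 X b" "a (std_vertex 1) = b (std_vertex 0)"
  shows "\<exists>c. triangle X a b c"
proof -
  obtain \<sigma> where \<sigma>: "singular_simplex (Suc 1) X \<sigma>"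
    "\<And>i. \<lbrakk>i \<le> Suc 1; i \<noteq> 1\<rbrakk> \<Longrightarrow> singular_face (Suc 1) i \<sigma> = (if i = 0 then b else a)"
  proof -
    have "singular_face 1 0 a = singular_face 1 1 b"
      using assms(3) by (intro singular_face_1_eqI) simp
    then have "\<exists>T. singular_simplex (Suc 1) X T \<and>
        (\<forall>i\<le>Suc 1. i \<noteq> 1 \<longrightarrow> singular_face (Suc 1) i T = (if i = 0 then b else a))"
    proof (intro horn_fill)
      fix i j :: nat assume "i < j" "j \<le> Suc 1" "i \<noteq> 1" "j \<noteq> 1"
      then have "i = 0" "j = Suc 1" by linarith+
      then show "singular_face 1 i (if j = 0 then b else a) = singular_face 1 (j - 1) (if i = 0 then b else a)"
        using \<open>singular_face 1 0 a = singular_face 1 1 b\<close> by simp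
    qed (use assms(1,2) in auto)
    then show ?thesis using that by blast
  qed
  then have "triangle X a b (singular_face 2 1 \<sigma>)"
    using \<sigma>(2)[of 0] \<sigma>(2)[of 2] by (auto simp: triangle_def numeral_2_eq_2)
  then show ?thesis by blast
qed

lemma tetrahedron_fill:
  assumes "k \<le> 3" and "\<And>i. \<lbrakk>i \<le> 3; i \<noteq> k\<rbrakk> \<Longrightarrow> singular_simplex 2 X (\<tau> i)"
    and "\<And>i j. \<lbrakk>i < j; j \<le> 3; i \<noteq> k; j \<noteq> k\<rbrakk> \<Longrightarrow> singular_face 2 i (\<tau> j) = singular_face 2 (j - 1) (\<tau> i)"
  shows "\<exists>T. singular_simplex 3 X T \<and> (\<forall>i\<le>3. i \<noteq> k \<longrightarrow> singular_face 3 i T = \<tau> i)"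
  using horn_fill[of k 2 X \<tau>] assms by (simp add: numeral_3_eq_3 numeral_2_eq_2)

lemma singular_face_singular_face:
  assumes "i < j" "j \<le> Suc p" "1 \<le> p"
  shows "singular_face p i (singular_face (Suc p) j T) = singular_face p (j - 1) (singular_face (Suc p) i T)"
  using assms simplical_face_in_standard_simplex[of p i] simplical_face_in_standard_simplex[of p "j - 1"]
  by (auto simp: singular_face_def simplical_face_commute restrict_def fun_eq_iff)

lemma less_4_cases:
  "i < j \<Longrightarrow> j \<le> (3::nat) \<Longrightarrow>
    (i = 0 \<and> j = 1) \<or> (i = 0 \<and> j = 2) \<or> (i = 0 \<and> j = 3) \<or> (i = 1 \<and> j = 2) \<or> (i = 1 \<and> j = 3) \<or> (i = 2 \<and> j = 3)"
  by linarith

text \<open>Of the four faces of a tetrahedron with edges \<open>a\<close>, \<open>b\<close>, \<open>c\<close>, \<open>ab\<close>, \<open>bc\<close>, \<open>abc\<close>,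
  any three can be completed by the fourth.\<close>

lemma triangle_missing_face:
  assumes k: "k \<le> (3::nat)"
    and t: "k \<noteq> 0 \<Longrightarrow> triangle X b c bc" "k \<noteq> 1 \<Longrightarrow> triangle X ab c abc"
      "k \<noteq> 2 \<Longrightarrow> triangle X a bc abc" "k \<noteq> 3 \<Longrightarrow> triangle X a b ab"
  shows "triangle X b c bc \<and> triangle X ab c abc \<and> triangle X a bc abc \<and> triangle X a b ab"
proof -
  define e where "e i = ((if i \<le> 1 then c else if i = 2 then bc else b), (if i = 0 then bc else if i = 3 then ab else abc),
    (if i = 0 then b else if i = 1 then ab else a))" for i :: nat
  have "\<exists>\<sigma>. singular_simplex 2 X \<sigma> \<and> singular_face 2 0 \<sigma> = fst (e i) \<and>
      singular_face 2 1 \<sigma> = fst (snd (e i)) \<and> singular_face 2 2 \<sigma> = snd (snd (e i))"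
    if "i \<le> 3" "i \<noteq> k" for i
  proof -
    have "i = 0 \<or> i = 1 \<or> i = 2 \<or> i = 3" using that by auto
    then show ?thesis using t that(2) by (auto simp: triangle_def e_def)
  qed
  then obtain \<tau> where \<tau>: "\<And>i. \<lbrakk>i \<le> 3; i \<noteq> k\<rbrakk> \<Longrightarrow> singular_simplex 2 X (\<tau> i) \<and> singular_face 2 0 (\<tau> i) = fst (e i) \<and>
      singular_face 2 1 (\<tau> i) = fst (snd (e i)) \<and> singular_face 2 2 (\<tau> i) = snd (snd (e i))"
    by metis
  have "\<exists>T. singular_simplex 3 X T \<and> (\<forall>i\<le>3. i \<noteq> k \<longrightarrow> singular_face 3 i T = \<tau> i)"
  proof (rule tetrahedron_fill[OF k])
    fix i j assume *: "i < j" "j \<le> (3::nat)" "i \<noteq> k" "j \<noteq> k"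
    then have "singular_face 2 i (\<tau> j) = (if i = 0 then fst (e j) else if i = 1 then fst (snd (e j)) else snd (snd (e j)))"
      "singular_face 2 (j - 1) (\<tau> i) = (if j = 1 then fst (e i) else if j = 2 then fst (snd (e i)) else snd (snd (e i)))"
      using \<tau>[of i] \<tau>[of j] less_4_cases[OF *(1,2)] by (auto simp: numeral_3_eq_3 numeral_2_eq_2)
    then show "singular_face 2 i (\<tau> j) = singular_face 2 (j - 1) (\<tau> i)"
      using less_4_cases[OF *(1,2)] by (auto simp: e_def)
  qed (use \<tau> in auto)
  then obtain T where T: "singular_simplex 3 X T" "\<And>i. \<lbrakk>i \<le> 3; i \<noteq> k\<rbrakk> \<Longrightarrow> singular_face 3 i T = \<tau> i" by blast
  define \<sigma> where "\<sigma> i = singular_face 3 i T" for i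
  have \<sigma>s: "singular_simplex 2 X (\<sigma> i)" if "i \<le> 3" for i
    using singular_simplex_singular_face[OF T(1), of i] that by (simp add: \<sigma>_def)
  have \<sigma>f: "singular_face 2 i (\<sigma> j) = singular_face 2 (j - 1) (\<sigma> i)" if "i < j" "j \<le> 3" for i j
    using singular_face_singular_face[of i j 2 T] that by (simp add: \<sigma>_def numeral_3_eq_3)
  have e: "singular_face 2 0 (\<sigma> i) = fst (e i)" "singular_face 2 1 (\<sigma> i) = fst (snd (e i))"
    "singular_face 2 2 (\<sigma> i) = snd (snd (e i))" if "i \<le> 3" "i \<noteq> k" for i
    using \<tau>[OF that] T(2)[OF that] by (simp_all add: \<sigma>_def)
  note f = \<sigma>f[of 0 1] \<sigma>f[of 0 2] \<sigma>f[of 0 3] \<sigma>f[of 1 2] \<sigma>f[of 1 3] \<sigma>f[of 2 3]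
  have "singular_face 2 0 (\<sigma> k) = fst (e k) \<and> singular_face 2 1 (\<sigma> k) = fst (snd (e k)) \<and>
    singular_face 2 2 (\<sigma> k) = snd (snd (e k))"
  proof -
    consider "k = 0" | "k = 1" | "k = 2" | "k = 3" using k by linarith
    then show ?thesis
    proof cases
      case 1
      then show ?thesis using f e[of 1] e[of 2] e[of 3] by (simp add: e_def)
    next
      case 2
      then show ?thesis using f e[of 0] e[of 2] e[of 3] by (simp add: e_def)
    next
      case 3
      then show ?thesis using f e[of 0] e[of 1] e[of 3] by (simp add: e_def)
    next
      case 4
      then show ?thesis using f e[of 0] e[of 1] e[of 2] by (simp add: e_def)
    qed
  qed
  then have all: "singular_face 2 0 (\<sigma> i) = fst (e i)" "singular_face 2 1 (\<sigma> i) = fst (snd (e i))"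
    "singular_face 2 2 (\<sigma> i) = snd (snd (e i))" if "i \<le> 3" for i
    using e[OF that] by (cases "i = k", simp_all)+
  have "triangle X (snd (snd (e i))) (fst (e i)) (fst (snd (e i)))" if "i \<le> 3" for i
    unfolding triangle_def using \<sigma>s[OF that] all[OF that] by blast
  from this[of 0] this[of 1] this[of 2] this[of 3] show ?thesis by (simp add: e_def)
qed

lemma triangle_assoc:
  "\<lbrakk>triangle X a b ab; triangle X b c bc; triangle X ab c abc\<rbrakk> \<Longrightarrow> triangle X a bc abc"
  using triangle_missing_face[of 2 X b c bc ab abc a] by simp

lemma triangle_assoc':
  "\<lbrakk>triangle X a b ab; triangle X b c bc; triangle X a bc abc\<rbrakk> \<Longrightarrow> triangle X ab c abc"
  using triangle_missing_face[of 1 X b c bc ab abc a] by simp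

lemma triangle_left_quotient:
  "\<lbrakk>triangle X a b ab; triangle X ab c abc; triangle X a bc abc\<rbrakk> \<Longrightarrow> triangle X b c bc"
  using triangle_missing_face[of 0 X b c bc ab abc a] by simp

lemma triangle_right_quotient:
  "\<lbrakk>triangle X b c bc; triangle X ab c abc; triangle X a bc abc\<rbrakk> \<Longrightarrow> triangle X a b ab"
  using triangle_missing_face[of 3 X b c bc ab abc a] by simp

section \<open>Triangles given by explicit formulas\<close>

lemma triangleI:
  assumes "continuous_map (simplex_space 2) X f"
    and "\<And>x. x \<in> standard_simplex 1 \<Longrightarrow> a x = f (simplical_face 2 x)"
    and "\<And>x. x \<in> standard_simplex 1 \<Longrightarrow> b x = f (simplical_face 0 x)"
    and "\<And>x. x \<in> standard_simplex 1 \<Longrightarrow> c x = f (simplical_face 1 x)"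
    and "a \<in> extensional (standard_simplex 1)" "b \<in> extensional (standard_simplex 1)" "c \<in> extensional (standard_simplex 1)"
  shows "triangle X a b c"
proof -
  let ?\<sigma> = "restrict f (standard_simplex 2)"
  have "singular_simplex 2 X ?\<sigma>" using assms(1) by (simp add: singular_simplex_def)
  moreover have "singular_face 2 k ?\<sigma> = e"
    if "k \<le> 2" "\<And>x. x \<in> standard_simplex 1 \<Longrightarrow> e x = f (simplical_face k x)" "e \<in> extensional (standard_simplex 1)" for k e
  proof (rule extensionalityI[of _ "standard_simplex 1"])
    show "singular_face 2 k ?\<sigma> x = e x" if "x \<in> standard_simplex 1" for x
      using that \<open>k \<le> 2\<close> simplical_face_in_standard_simplex[of 2 k x] \<open>\<And>x. x \<in> standard_simplex 1 \<Longrightarrow> e x = _\<close>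
      by (simp add: singular_face_def)
  qed (use that in \<open>auto simp: singular_face_def\<close>)
  ultimately show ?thesis using assms(2-7) unfolding triangle_def by (intro exI[of _ ?\<sigma>]) auto
qed

lemma convex_combination_unit:
  assumes x: "x \<in> standard_simplex 2" and "s \<in> {0..1}" "t \<in> {0..1}" "u \<in> {0..1}"
  shows "x 0 * s + x 1 * t + x 2 * u \<in> {0..1::real}"
proof -
  have "x 0 + x 1 + x 2 = 1" "0 \<le> x 0" "0 \<le> x 1" "0 \<le> x 2"
    using x by (auto simp: standard_simplex_def numeral_2_eq_2)
  moreover have "x 0 * s \<le> x 0" "x 1 * t \<le> x 1" "x 2 * u \<le> x 2" "0 \<le> x 0 * s" "0 \<le> x 1 * t" "0 \<le> x 2 * u"
    using assms calculation by (auto intro: mult_left_le)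
  ultimately show ?thesis by (auto simp del: mult_eq_0_iff)
qed

text \<open>A triangle that factors through the path \<open>q\<close>, by the affine map of the
  2-simplex with vertex values \<open>s\<close>, \<open>t\<close>, \<open>u\<close>. Unit laws and
  the cancellation of inverse letters are special cases.\<close>

lemma thin_triangle:
  assumes q: "continuous_map (top_of_set {0..1}) X q" and stu: "s \<in> {0..1}" "t \<in> {0..1}" "u \<in> {0..1}"
  shows "triangle X (edge_along q s t) (edge_along q t u) (edge_along q s u)"
proof (rule triangleI[where f = "\<lambda>x. q (x 0 * s + x 1 * t + x 2 * u)"])
  have "continuous_map (simplex_space 2) (top_of_set {0..1}) (\<lambda>x. x 0 * s + x 1 * t + x 2 * u)"
    using convex_combination_unit[OF _ stu]
    by (auto simp: continuous_map_in_subtopology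
        intro!: continuous_map_add continuous_map_real_mult_right continuous_map_coordinate)
  from continuous_map_compose[OF this q]
  show "continuous_map (simplex_space 2) X (\<lambda>x. q (x 0 * s + x 1 * t + x 2 * u))" by (simp add: o_def)
qed (auto simp: edge_along_def simplical_face_def)

lemma edge_along_vertex [simp]:
  "edge_along q s t (std_vertex 0) = q s" "edge_along q s t (std_vertex (Suc 0)) = q t"
  by (simp_all add: edge_along_def std_vertex_def)

lemma const_edge_vertex [simp]: "i \<le> 1 \<Longrightarrow> const_edge x (std_vertex i) = x"
  by (simp add: const_edge_def)

lemma edge_along_const: "edge_along q s s = const_edge (q s)"
  unfolding edge_along_def const_edge_def
proof (rule restrict_ext)
  fix x :: "nat \<Rightarrow> real" assume "x \<in> standard_simplex 1"
  then have "x 0 * s + x 1 * s = s" by (simp only: standard_simplex_1D(3) mult_1 flip: distrib_right)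
  then show "q (x 0 * s + x 1 * s) = q s" by simp
qed

lemma path_of_edge:
  assumes "singular_simplex 1 X \<tau>"
  obtains q where "continuous_map (top_of_set {0..1}) X q" "\<tau> = edge_along q 0 1"
    "\<And>t. q t = \<tau> (\<lambda>i. if i = 0 then 1 - t else if i = 1 then t else 0)"
proof -
  let ?p = "\<lambda>t i. if i = 0 then 1 - t else if i = 1 then t else (0::real)"
  have "continuous_map (top_of_set {0..1}) euclideanreal (\<lambda>t. ?p t i)" for i :: nat
    by (cases "i = 0"; cases "i = 1") (auto intro!: continuous_intros)
  moreover have "?p t \<in> standard_simplex 1" if "t \<in> {0..1}" for t
    using that by (auto simp: standard_simplex_def)
  ultimately have "continuous_map (top_of_set {0..1}) (simplex_space 1) ?p"
    by (auto simp: continuous_map_in_subtopology continuous_map_componentwise_UNIV)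
  then have 1: "continuous_map (top_of_set {0..1}) X (\<lambda>t. \<tau> (?p t))"
    using continuous_map_compose[of _ _ ?p X \<tau>] assms by (simp add: singular_simplex_def o_def)
  have 2: "\<tau> = edge_along (\<lambda>t. \<tau> (?p t)) 0 1"
  proof (rule extensionalityI[of _ "standard_simplex 1"])
    fix x :: "nat \<Rightarrow> real" assume x: "x \<in> standard_simplex 1"
    have "?p (x 1) = x"
    proof
      fix i show "?p (x 1) i = x i"
        using standard_simplex_1D[OF x] x by (auto simp: standard_simplex_def)
    qed
    moreover have "x 0 * 0 + x 1 * 1 = x 1" by simp
    ultimately show "\<tau> x = edge_along (\<lambda>t. \<tau> (?p t)) 0 1 x" using x by (simp only: edge_along_def restrict_apply' )
  qed (use assms in \<open>auto simp: singular_simplex_def edge_along_def\<close>)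
  from that[OF 1 2] show ?thesis by simp
qed

lemma singular_simplex_edge_along:
  assumes "continuous_map (top_of_set {0..1}) X q" "s \<in> {0..1}" "t \<in> {0..1}"
  shows "singular_simplex 1 X (edge_along q s t)"
  using triangleD(1)[OF thin_triangle[OF assms assms(3)]] .

lemma singular_simplex_const_edge:
  "x \<in> topspace X \<Longrightarrow> singular_simplex 1 X (const_edge x)"
  by (simp add: singular_simplex_def const_edge_def)

lemma triangle_unit:
  assumes "singular_simplex 1 X a"
  shows "triangle X (const_edge (a (std_vertex 0))) a a" "triangle X a (const_edge (a (std_vertex 1))) a"
proof -
  obtain q where q: "continuous_map (top_of_set {0..1}) X q" "a = edge_along q 0 1"
    by (rule path_of_edge[OF assms])
  show "triangle X (const_edge (a (std_vertex 0))) a a" "triangle X a (const_edge (a (std_vertex 1))) a"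
    using thin_triangle[OF q(1), of 0 0 1] thin_triangle[OF q(1), of 0 1 1] q(2)
    by (simp_all add: edge_along_const)
qed

lemma triangle_map:
  assumes f: "continuous_map X Y f" and t: "triangle X a b c"
  shows "triangle Y (simplex_map 1 f a) (simplex_map 1 f b) (simplex_map 1 f c)"
proof -
  obtain \<sigma> where \<sigma>: "singular_simplex 2 X \<sigma>" "a = singular_face 2 2 \<sigma>" "b = singular_face 2 0 \<sigma>" "c = singular_face 2 1 \<sigma>"
    using t by (auto simp: triangle_def)
  have "singular_simplex 2 Y (simplex_map 2 f \<sigma>)"
    by (rule singular_simplex_simplex_map[OF \<sigma>(1) f])
  moreover have "singular_face 2 k (simplex_map 2 f \<sigma>) = simplex_map 1 f (singular_face 2 k \<sigma>)" if "k \<le> 2" for k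
    using that simplical_face_in_standard_simplex[of 2 k]
    by (auto simp: singular_face_def simplex_map_def restrict_def fun_eq_iff)
  ultimately show ?thesis unfolding triangle_def \<sigma> by (intro exI[of _ "simplex_map 2 f \<sigma>"]) simp
qed

text \<open>A square with one side collapsed to \<open>v\<close>; in the 2-simplex its coordinates
  are \<open>x 1 + x 2\<close> and \<open>x 2 / (x 1 + x 2)\<close>.\<close>

lemma cone_triangle:
  assumes G: "continuous_map (prod_topology (top_of_set {0..1::real}) (top_of_set {0..1::real})) X G"
    and G0: "\<And>p. p \<in> {0..1} \<Longrightarrow> G (0, p) = v"
  shows "triangle X (edge_along (\<lambda>t. G (t, 0)) 0 1) (edge_along (\<lambda>p. G (1, p)) 0 1) (edge_along (\<lambda>t. G (t, 1)) 0 1)"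
proof (rule triangleI[where f = "\<lambda>x. if 0 < x 1 + x 2 then G (x 1 + x 2, x 2 / (x 1 + x 2)) else v"])
  have "(0, 0) \<in> topspace (prod_topology (top_of_set {0..1::real}) (top_of_set {0..1::real}))" by simp
  then have "G (0, 0) \<in> topspace X" using G unfolding continuous_map_def by blast
  then have v: "v \<in> topspace X" using G0[of 0] by simp
  have x12: "x 1 + x 2 \<in> {0..1}" "0 \<le> x 1" "0 \<le> x 2" if "x \<in> standard_simplex 2" for x :: "nat \<Rightarrow> real"
  proof -
    have "x 0 + x 1 + x 2 = 1" "0 \<le> x 0" "0 \<le> x 1" "0 \<le> x 2"
      using that by (auto simp: standard_simplex_def numeral_2_eq_2)
    then show "x 1 + x 2 \<in> {0..1}" "0 \<le> x 1" "0 \<le> x 2" by auto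
  qed
  let ?P = "subtopology (simplex_space 2) {x. 0 < x 1 + x 2}"
  have "continuous_map ?P euclideanreal (\<lambda>x. x 2 / (x 1 + x 2))"
    unfolding subtopology_subtopology
    by (intro continuous_map_real_divide continuous_map_add continuous_map_coordinate) auto
  then have th: "continuous_map ?P (top_of_set {0..1}) (\<lambda>x. x 2 / (x 1 + x 2))"
    using x12 by (auto simp: continuous_map_in_subtopology divide_le_eq intro!: divide_nonneg_pos)
  show "continuous_map (simplex_space 2) X (\<lambda>x. if 0 < x 1 + x 2 then G (x 1 + x 2, x 2 / (x 1 + x 2)) else v)"
  proof (rule continuous_map_collapse[OF _ G _ v _ _ th])
    show "compact_space (top_of_set {0..1::real})" by (simp add: compact_space_subtopology)
    show "continuous_map (simplex_space 2) euclideanreal (\<lambda>x. x 1 + x 2)"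
      by (intro continuous_map_add continuous_map_coordinate)
  qed (use G0 x12 in auto)
  show "edge_along (\<lambda>t. G (t, 0)) 0 1 x =
      (if 0 < simplical_face 2 x 1 + simplical_face 2 x 2
       then G (simplical_face 2 x 1 + simplical_face 2 x 2,
               simplical_face 2 x 2 / (simplical_face 2 x 1 + simplical_face 2 x 2)) else v)"
    if "x \<in> standard_simplex 1" for x
    using standard_simplex_1D[OF that] that G0[of 0] by (cases "x 1 = 0") (auto simp: edge_along_def simplical_face_def)
  show "edge_along (\<lambda>t. G (t, 1)) 0 1 x =
      (if 0 < simplical_face 1 x 1 + simplical_face 1 x 2
       then G (simplical_face 1 x 1 + simplical_face 1 x 2,
               simplical_face 1 x 2 / (simplical_face 1 x 1 + simplical_face 1 x 2)) else v)"
    if "x \<in> standard_simplex 1" for x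
    using standard_simplex_1D[OF that] that G0[of 1] by (cases "x 1 = 0") (auto simp: edge_along_def simplical_face_def)
  show "edge_along (\<lambda>p. G (1, p)) 0 1 x =
      (if 0 < simplical_face 0 x 1 + simplical_face 0 x 2
       then G (simplical_face 0 x 1 + simplical_face 0 x 2,
               simplical_face 0 x 2 / (simplical_face 0 x 1 + simplical_face 0 x 2)) else v)"
    if "x \<in> standard_simplex 1" for x
    using standard_simplex_1D[OF that] that by (auto simp: edge_along_def simplical_face_def)
qed (auto simp: edge_along_def)

section \<open>Loops spelled by words\<close>

definition letter_edge :: "'a \<times> bool \<Rightarrow> (nat \<Rightarrow> real) \<Rightarrow> 'a cell_point"
  where "letter_edge x = edge_along (edge_map (fst x)) (if snd x then 0 else 1) (if snd x then 1 else 0)"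

text \<open>Any composite serves, since triangles express homotopy. The clause for single letters
  keeps them equal to the actual edges of the complex instead of composites with a constant
  edge.\<close>

fun word_edge :: "'a cell_point topology \<Rightarrow> 'a word \<Rightarrow> (nat \<Rightarrow> real) \<Rightarrow> 'a cell_point"
  where
    "word_edge X [] = const_edge Vertex"
  | "word_edge X [x] = letter_edge x"
  | "word_edge X (x # y # w) = (SOME c. triangle X (letter_edge x) (word_edge X (y # w)) c)"

context
  fixes S :: "'a set" and r :: "'a word"
  assumes r: "fst ` set r \<subseteq> S"
begin

lemma Vertex_in_topspace: "Vertex \<in> topspace (skeleton_space S r)"
  using topspace_presentation_complex[OF r] by simp

lemma letter_edge:
  assumes "fst x \<in> S"
  shows "singular_simplex 1 (skeleton_space S r) (letter_edge x)"
    "letter_edge x (std_vertex 0) = Vertex" "letter_edge x (std_vertex 1) = Vertex"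
  using singular_simplex_edge_along[OF continuous_map_edge_map_skeleton[OF r assms]]
  by (auto simp: letter_edge_def edge_map_def)

lemma word_edge:
  assumes "fst ` set w \<subseteq> S"
  shows "singular_simplex 1 (skeleton_space S r) (word_edge (skeleton_space S r) w) \<and>
    word_edge (skeleton_space S r) w (std_vertex 0) = Vertex \<and>
    word_edge (skeleton_space S r) w (std_vertex 1) = Vertex \<and>
    (\<forall>x. fst x \<in> S \<longrightarrow> triangle (skeleton_space S r) (letter_edge x)
      (word_edge (skeleton_space S r) w) (word_edge (skeleton_space S r) (x # w)))"
  using assms
proof (induction w)
  case Nil
  have "triangle (skeleton_space S r) (letter_edge x) (const_edge Vertex) (letter_edge x)" if "fst x \<in> S" for x
    using triangle_unit(2)[OF letter_edge(1)[OF that]] letter_edge(3)[OF that] by simp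
  then show ?case using singular_simplex_const_edge[OF Vertex_in_topspace] by simp
next
  case (Cons x w)
  let ?W = "word_edge (skeleton_space S r)"
  have x: "fst x \<in> S" and IH: "triangle (skeleton_space S r) (letter_edge x) (?W w) (?W (x # w))"
    "?W w (std_vertex 0) = Vertex" "?W w (std_vertex 1) = Vertex"
  proof -
    have wS: "fst ` set w \<subseteq> S" and x: "fst x \<in> S" using Cons.prems by auto
    show "fst x \<in> S" by fact
    show "triangle (skeleton_space S r) (letter_edge x) (?W w) (?W (x # w))"
      using Cons.IH[OF wS] x by blast
    show "?W w (std_vertex 0) = Vertex" "?W w (std_vertex 1) = Vertex"
      using Cons.IH[OF wS] by blast+
  qed
  have W: "singular_simplex 1 (skeleton_space S r) (?W (x # w))" "?W (x # w) (std_vertex 0) = Vertex"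
    "?W (x # w) (std_vertex 1) = Vertex"
    using triangleD[OF IH(1)] letter_edge[OF x] IH by simp_all
  have "triangle (skeleton_space S r) (letter_edge y) (?W (x # w)) (?W (y # x # w))" if "fst y \<in> S" for y
    unfolding word_edge.simps(3)
    by (rule someI_ex[of "triangle (skeleton_space S r) (letter_edge y) (?W (x # w))"], rule triangle_composite)
      (use W letter_edge[OF that] in simp_all)
  then show ?case using W by blast
qed

lemma triangle_word_edge_Cons:
  assumes "fst x \<in> S" "fst ` set w \<subseteq> S"
  shows "triangle (skeleton_space S r) (letter_edge x)
    (word_edge (skeleton_space S r) w) (word_edge (skeleton_space S r) (x # w))"
  using word_edge[OF assms(2)] assms(1) by blast

lemma triangle_letter_edge_inverse:
  assumes "fst x \<in> S"
  shows "triangle (skeleton_space S r) (letter_edge x) (letter_edge (inv_letter x)) (const_edge Vertex)"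
  using thin_triangle[OF continuous_map_edge_map_skeleton[OF r assms], of 0 1 0]
    thin_triangle[OF continuous_map_edge_map_skeleton[OF r assms], of 1 0 1]
  by (cases x) (auto simp: letter_edge_def inv_letter_def edge_along_const edge_map_def[of _ 0] edge_map_def[of _ 1])

text \<open>If the letter cancels, reassociation brings the two inverse edges together and replaces
  them by the constant edge.\<close>

lemma triangle_word_edge_cons_reduce:
  assumes x: "fst x \<in> S" and w: "fst ` set w \<subseteq> S"
  shows "triangle (skeleton_space S r) (letter_edge x) (word_edge (skeleton_space S r) w)
    (word_edge (skeleton_space S r) (cons_reduce x w))"
proof (cases "\<exists>ys. w = inv_letter x # ys")
  case True
  then obtain ys where ys: "w = inv_letter x # ys" by blast
  let ?W = "word_edge (skeleton_space S r)"
  have "triangle (skeleton_space S r) (const_edge Vertex) (?W ys) (?W ys)"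
    using triangle_unit(1)[of "skeleton_space S r" "?W ys"] word_edge[of ys] w ys by simp
  moreover have "triangle (skeleton_space S r) (letter_edge (inv_letter x)) (?W ys) (?W w)"
    unfolding ys by (rule triangle_word_edge_Cons) (use w ys x in auto)
  ultimately show ?thesis
    using triangle_assoc[OF triangle_letter_edge_inverse[OF x]] ys by auto
next
  case False
  then have "cons_reduce x w = x # w" by (cases w) auto
  then show ?thesis using triangle_word_edge_Cons[OF x w] by simp
qed

lemma triangle_word_edge_reduce:
  assumes "fst ` set v \<subseteq> S" "fst ` set w \<subseteq> S"
  shows "triangle (skeleton_space S r) (word_edge (skeleton_space S r) v) (word_edge (skeleton_space S r) w)
    (word_edge (skeleton_space S r) (foldr cons_reduce v w))"
  using assms(1)
proof (induction v)
  case Nil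
  then show ?case using triangle_unit(1)[of "skeleton_space S r" "word_edge (skeleton_space S r) w"] word_edge[OF assms(2)] by simp
next
  case (Cons x v)
  have "fst ` set (foldr cons_reduce v w) \<subseteq> fst ` set v \<union> fst ` set w"
    using image_mono[OF set_foldr_cons_reduce[of v w], of fst] by (simp add: image_Un)
  then have "fst ` set (foldr cons_reduce v w) \<subseteq> S"
    by (rule order_trans) (use Cons.prems assms(2) in simp)
  then have "triangle (skeleton_space S r) (letter_edge x) (word_edge (skeleton_space S r) (foldr cons_reduce v w))
      (word_edge (skeleton_space S r) (foldr cons_reduce (x # v) w))"
    using triangle_word_edge_cons_reduce[of x "foldr cons_reduce v w"] Cons.prems by simp
  moreover have "triangle (skeleton_space S r) (letter_edge x) (word_edge (skeleton_space S r) v)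
      (word_edge (skeleton_space S r) (x # v))"
    by (rule triangle_word_edge_Cons) (use Cons.prems in auto)
  moreover have "fst ` set v \<subseteq> S" using Cons.prems by simp
  ultimately show ?case using triangle_assoc' Cons.IH by blast
qed

text \<open>Although \<open>word_edge\<close> depends on choices, it is multiplicative up to
  homotopy: the product is reduced letter by letter, each cancellation being realized by a
  triangle.\<close>

lemma triangle_word_edge_mult:
  assumes "v \<in> carrier (free_group S)" "w \<in> carrier (free_group S)"
  shows "triangle (skeleton_space S r) (word_edge (skeleton_space S r) v) (word_edge (skeleton_space S r) w)
    (word_edge (skeleton_space S r) (v \<otimes>\<^bsub>free_group S\<^esub> w))"
proof -
  have "foldr cons_reduce v w = v \<otimes>\<^bsub>free_group S\<^esub> w"
    using assms by (simp add: mult_free_group carrier_free_group reduce_word_def)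
      (metis reduce_word_def reduce_word_reduced)
  then show ?thesis using triangle_word_edge_reduce[of v w] assms by (simp add: carrier_free_group)
qed

end

section \<open>Paths in the one-skeleton are determined by their holonomy\<close>

text \<open>The reference is a fixed step function \<open>c\<close>. Two translates of one element
  within 1/2 of \<open>c\<close> are less than 1 apart, so they coincide.\<close>

lemma (in group) continuous_map_near_const:
  assumes f: "continuous_map K (orbit_topology G) f"
    and k: "\<And>x. x \<in> topspace K \<Longrightarrow> k x \<in> carrier G" and c: "c \<in> step_functions G"
    and near: "\<And>x. x \<in> topspace K \<Longrightarrow> step_dist c (translate G (k x) (f x)) < 1/2"
  shows "continuous_map K (step_topology G) (\<lambda>x. translate G (k x) (f x))"
proof -
  have fs: "f x \<in> step_functions G" if "x \<in> topspace K" for x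
    using f that by (auto simp: continuous_map_orbit)
  have "\<exists>U. openin K U \<and> x \<in> U \<and> (\<forall>y\<in>U. step_dist (translate G (k x) (f x)) (translate G (k y) (f y)) < e)"
    if x: "x \<in> topspace K" and e: "0 < e" for x e
  proof -
    \<comment> \<open>The slack that is left below 1/2 at \<open>x\<close> is what the passage from
      \<open>x\<close> to \<open>y\<close> may use up.\<close>
    define d where "d = min e (1/2 - step_dist c (translate G (k x) (f x)))"
    have d: "0 < d" using near[OF x] e by (simp add: d_def)
    obtain U where U: "openin K U" "x \<in> U" "\<And>y. y \<in> U \<Longrightarrow> \<exists>g\<in>carrier G. step_dist (f x) (translate G g (f y)) < d"
      using f[unfolded continuous_map_orbit, THEN conjunct2, rule_format, OF x d] by auto
    have "step_dist (translate G (k x) (f x)) (translate G (k y) (f y)) < e" if "y \<in> U" for y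
    proof -
      have y: "y \<in> topspace K" using openin_subset[OF U(1)] \<open>y \<in> U\<close> by blast
      obtain g where g: "g \<in> carrier G" "step_dist (f x) (translate G g (f y)) < d" using U(3)[OF \<open>y \<in> U\<close>] by blast
      note s = fs[OF x] fs[OF y] k[OF x] k[OF y] g(1) c
      have a: "translate G (k x) (f x) \<in> step_functions G" "translate G (k y) (f y) \<in> step_functions G"
        "translate G (k x \<otimes> g) (f y) \<in> step_functions G" using s by auto
      have 1: "step_dist (translate G (k x) (f x)) (translate G (k x \<otimes> g) (f y)) < d"
        using g s step_dist_translate[of "k x" "f x" "translate G g (f y)"] by (simp add: translate_translate)
      have "step_dist (translate G (k x \<otimes> g) (f y)) (translate G (k y) (f y)) \<le>
        step_dist (translate G (k x) (f x)) (translate G (k x \<otimes> g) (f y)) +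
        (step_dist c (translate G (k x) (f x)) + step_dist c (translate G (k y) (f y)))"
        using step_dist_triangle[OF a(3,1,2)] step_dist_triangle[OF a(1) c a(2)]
        by (simp add: step_dist_sym[of "translate G (k x \<otimes> g) (f y)" "translate G (k x) (f x)"]
            step_dist_sym[of "translate G (k x) (f x)" c])
      also have "\<dots> < 1" using 1 near[OF y] unfolding d_def by linarith
      finally have "k x \<otimes> g = k y" by (rule translate_inject) (use s in auto)
      then show ?thesis using 1 by (simp add: d_def)
    qed
    then show ?thesis using U(1,2) by blast
  qed
  then show ?thesis using fs k by (simp add: continuous_map_step)
qed

definition base_edge :: "'a cell_point \<Rightarrow> (nat \<Rightarrow> real) \<Rightarrow> 'a cell_point"
  where "base_edge p = (case p of Edge s t \<Rightarrow> edge_along (edge_map s) 0 t | _ \<Rightarrow> const_edge Vertex)"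

text \<open>Base edges make \<open>\<tau>\<close> into a loop at \<open>Vertex\<close>. Instead of
  inverting the last of them, both sides are compared through a common composite
  \<open>u\<close>.\<close>

definition monodromy :: "'a cell_point topology \<Rightarrow> ((nat \<Rightarrow> real) \<Rightarrow> 'a cell_point) \<Rightarrow> 'a word \<Rightarrow> bool"
  where "monodromy X \<tau> h \<longleftrightarrow> (\<exists>u. triangle X (base_edge (\<tau> (std_vertex 0))) \<tau> u \<and>
    triangle X (word_edge X h) (base_edge (\<tau> (std_vertex 1))) u)"

definition coordinate :: "'a cell_point \<Rightarrow> real"
  where "coordinate p = (case p of Edge s t \<Rightarrow> t | _ \<Rightarrow> 0)"

text \<open>Paths from \<open>Vertex\<close> that reach a point through the nearer end of its edge.
  The branch changes at the midpoint, which \<open>star\<close> leaves out.\<close>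

definition star_contraction :: "'a cell_point \<Rightarrow> real \<Rightarrow> 'a cell_point"
  where "star_contraction p v = (case p of
    Edge s t \<Rightarrow> edge_map s (if t < 1/2 then v * t else 1 - v * (1 - t)) | _ \<Rightarrow> Vertex)"

lemma edge_along_reparametrize:
  assumes "\<And>t. t \<in> {0..1} \<Longrightarrow> p t = q ((1 - t) * a + t * b)"
  shows "edge_along p 0 1 = edge_along q a b"
  unfolding edge_along_def
proof (rule restrict_ext)
  fix x :: "nat \<Rightarrow> real" assume x: "x \<in> standard_simplex 1"
  have "x 0 = 1 - x 1" "x 1 \<in> {0..1}" using standard_simplex_1D[OF x] by auto
  then show "p (x 0 * 0 + x 1 * 1) = q (x 0 * a + x 1 * b)" using assms[of "x 1"] by simp
qed

context
  fixes S :: "'a set" and r :: "'a word"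
  assumes r: "fst ` set r \<subseteq> S"
begin

private abbreviation (input) "X1 \<equiv> skeleton_space S r"
private abbreviation (input) "FS \<equiv> free_group S"

lemma topspace_skeleton_space: "topspace X1 = one_skeleton S"
  using topspace_presentation_complex[OF r] by auto

lemma one_skeleton_topspace: "x \<in> one_skeleton S \<Longrightarrow> x \<in> topspace (presentation_complex S r)"
  using topspace_presentation_complex[OF r] by auto

lemma monodromy_composite:
  assumes t: "triangle X1 a b c" and h: "h \<in> carrier FS" "k \<in> carrier FS"
    and m: "monodromy X1 a h" "monodromy X1 b k"
  shows "monodromy X1 c (h \<otimes>\<^bsub>FS\<^esub> k)"
proof -
  note ends = triangleD[OF t]
  obtain u where u: "triangle X1 (base_edge (a (std_vertex 0))) a u"
    "triangle X1 (word_edge X1 h) (base_edge (a (std_vertex 1))) u"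
    using m(1) by (auto simp: monodromy_def)
  obtain v where v: "triangle X1 (base_edge (a (std_vertex 1))) b v"
    "triangle X1 (word_edge X1 k) (base_edge (b (std_vertex 1))) v"
    using m(2) ends(5) by (auto simp: monodromy_def)
  have "u (std_vertex 1) = b (std_vertex 0)"
    using triangleD(6)[OF u(1)] ends(5) by simp
  then obtain w where w: "triangle X1 u b w"
    using triangle_composite[of X1 u b] triangleD[OF u(1)] ends by auto
  have 1: "triangle X1 (base_edge (a (std_vertex 0))) c w"
    by (rule triangle_assoc[OF u(1) t w])
  have "triangle X1 (word_edge X1 h) v w" by (rule triangle_assoc[OF u(2) v(1) w])
  from triangle_assoc'[OF triangle_word_edge_mult[OF r h] v(2) this]
  show ?thesis unfolding monodromy_def using 1 ends by auto
qed

text \<open>Membership in \<open>U\<close> is a map to the Sierpinski space, so openness becomes an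
  instance of \<open>continuous_map_one_skeleton\<close>.\<close>

lemma openin_skeleton:
  assumes U: "U \<subseteq> one_skeleton S"
    and edge: "\<And>s. s \<in> S \<Longrightarrow> openin (top_of_set {0..1}) {t \<in> {0..1}. edge_map s t \<in> U}"
  shows "openin X1 U"
proof -
  define T where "T = topology (\<lambda>V::bool set. False \<in> V \<longrightarrow> V = UNIV)"
  have "istopology (\<lambda>V::bool set. False \<in> V \<longrightarrow> V = UNIV)"
    unfolding istopology_def by (metis Int_iff Int_UNIV Union_iff Sup_upper top.extremum_uniqueI)
  then have T: "openin T V \<longleftrightarrow> (False \<in> V \<longrightarrow> V = UNIV)" for V
    by (simp add: T_def topology_inverse')
  have tT: "topspace T = UNIV" using T[of UNIV] openin_subset by fastforce
  have "continuous_map X1 T (\<lambda>x. x \<in> U)"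
  proof (rule continuous_map_one_skeleton[OF r])
    fix s assume s: "s \<in> S"
    have "openin (top_of_set {0..1}) {t \<in> {0..1}. (edge_map s t \<in> U) \<in> V}" if "openin T V" for V
    proof (cases "False \<in> V")
      case True
      then have "V = UNIV" using that T by blast
      then have "{t \<in> {0..1}. (edge_map s t \<in> U) \<in> V} = {0..1}" by auto
      then show ?thesis by (simp only: openin_subtopology_self)
    next
      case False
      then have "V = {} \<or> V = {True}" by (metis (full_types) empty_iff insertCI subsetI subset_singletonD insert_iff)
      then show ?thesis using edge[OF s] by auto
    qed
    then show "continuous_map (top_of_set {0..1}) T ((\<lambda>x. x \<in> U) \<circ> edge_map s)"
      by (simp add: continuous_map_def tT)
  qed (simp add: tT)
  moreover have "openin T {True}" using T by simp
  ultimately have "openin X1 {x \<in> topspace X1. (x \<in> U) \<in> {True}}"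
    by (rule openin_continuous_map_preimage)
  moreover have "{x \<in> topspace X1. (x \<in> U) \<in> {True}} = U" using U topspace_skeleton_space by auto
  ultimately show ?thesis by simp
qed

lemma openin_edge_part:
  assumes s: "s \<in> S" and A: "open A"
  shows "openin X1 {Edge s t | t. 0 < t \<and> t < 1 \<and> t \<in> A}"
proof (rule openin_skeleton)
  show "{Edge s t | t. 0 < t \<and> t < 1 \<and> t \<in> A} \<subseteq> one_skeleton S" using s by (auto simp: one_skeleton_def)
  fix s' assume "s' \<in> S"
  have "{t \<in> {0..1}. edge_map s' t \<in> {Edge s t | t. 0 < t \<and> t < 1 \<and> t \<in> A}} =
      {0..1} \<inter> (if s' = s then {0<..<1} \<inter> A else {})"
    by (auto simp: edge_map_def)
  then show "openin (top_of_set {0..1}) {t \<in> {0..1}. edge_map s' t \<in> {Edge s t | t. 0 < t \<and> t < 1 \<and> t \<in> A}}"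
    using A by (simp add: openin_open_Int open_Int)
qed

private abbreviation (input) "open_edge s \<equiv> {Edge s t | t. 0 < t \<and> t < 1}"

lemma continuous_map_coordinate_edge:
  assumes s: "s \<in> S"
  shows "continuous_map (subtopology X1 (open_edge s)) euclideanreal coordinate"
  unfolding continuous_map_def
proof (intro conjI allI impI)
  fix A :: "real set" assume "openin euclideanreal A"
  then have "openin X1 {Edge s t | t. 0 < t \<and> t < 1 \<and> t \<in> A}" using openin_edge_part[OF s] by simp
  moreover have "{x \<in> topspace (subtopology X1 (open_edge s)). coordinate x \<in> A} =
      {Edge s t | t. 0 < t \<and> t < 1 \<and> t \<in> A} \<inter> open_edge s"
  proof -
    have "Edge s t \<in> topspace X1" if "0 < t" "t < 1" for t
    proof -
      have "Edge s t \<in> one_skeleton S" using s that by (auto simp: one_skeleton_def)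
      then show ?thesis by (simp only: topspace_skeleton_space)
    qed
    then show ?thesis by (auto simp: coordinate_def)
  qed
  ultimately show "openin (subtopology X1 (open_edge s)) {x \<in> topspace (subtopology X1 (open_edge s)). coordinate x \<in> A}"
    by (auto simp: openin_subtopology)
qed simp

lemma continuous_map_edge_homotopy:
  fixes \<psi> :: "real \<times> real \<Rightarrow> real"
  assumes s: "s \<in> S" and \<psi>: "continuous_on UNIV \<psi>"
    and im: "\<And>t v. \<lbrakk>t \<in> {0<..<1}; v \<in> {0..1}\<rbrakk> \<Longrightarrow> \<psi> (t, v) \<in> {0..1}"
  shows "continuous_map (prod_topology (subtopology X1 (open_edge s)) (top_of_set {0..1})) X1
    (\<lambda>(x, v). edge_map s (\<psi> (coordinate x, v)))"
proof -
  let ?P = "prod_topology (subtopology X1 (open_edge s)) (top_of_set {0..1::real})"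
  have "continuous_map ?P euclideanreal (\<lambda>p. coordinate (fst p))"
    using continuous_map_compose[OF continuous_map_fst continuous_map_coordinate_edge[OF s]] by (simp add: o_def)
  moreover have "continuous_map ?P euclideanreal snd"
    using continuous_map_snd[of "subtopology X1 (open_edge s)" "top_of_set {0..1::real}"]
    by (simp add: continuous_map_in_subtopology)
  ultimately have "continuous_map ?P (prod_topology euclideanreal euclideanreal) (\<lambda>p. (coordinate (fst p), snd p))"
    by (simp only: continuous_map_paired)
  then have "continuous_map ?P euclideanreal (\<lambda>p. \<psi> (coordinate (fst p), snd p))"
    using continuous_map_compose[of ?P _ _ euclideanreal \<psi>] \<psi> by (simp add: o_def)
  then have "continuous_map ?P (top_of_set {0..1}) (\<lambda>p. \<psi> (coordinate (fst p), snd p))"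
    using im by (auto simp: continuous_map_in_subtopology coordinate_def)
  from continuous_map_compose[OF this continuous_map_edge_map_skeleton[OF r s]]
  show ?thesis by (simp add: o_def case_prod_unfold)
qed

definition "star = {x \<in> one_skeleton S. \<forall>s. x \<noteq> Edge s (1/2)}"

lemma openin_star: "openin X1 star"
proof (rule openin_skeleton)
  fix s assume s: "s \<in> S"
  have "{t \<in> {0..1}. edge_map s t \<in> star} = {0..1} \<inter> - {1/2}"
    using s by (auto simp: star_def edge_map_def one_skeleton_def)
  then show "openin (top_of_set {0..1}) {t \<in> {0..1}. edge_map s t \<in> star}"
    by (simp add: openin_open_Int open_Compl)
qed (auto simp: star_def)

text \<open>With infinitely many generators there need not be a uniform radius around the vertex;
  the topology allows a separate radius \<open>e s\<close> for each edge.\<close>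

lemma star_contraction_nbhd:
  assumes W: "openin X1 W" and V: "Vertex \<in> W"
  shows "\<exists>N. openin X1 N \<and> Vertex \<in> N \<and> N \<subseteq> star \<and> (\<forall>x\<in>N. \<forall>v\<in>{0..1}. star_contraction x v \<in> W)"
proof -
  have "\<exists>e. 0 < e \<and> e \<le> 1/2 \<and> (\<forall>t\<in>{0..1}. t < e \<or> 1 - e < t \<longrightarrow> edge_map s t \<in> W)" if s: "s \<in> S" for s
  proof -
    have op: "openin (top_of_set {0..1}) {t \<in> topspace (top_of_set {0..1}). edge_map s t \<in> W}"
      by (rule openin_continuous_map_preimage[OF continuous_map_edge_map_skeleton[OF r s] W])
    have "0 \<in> {t \<in> topspace (top_of_set {0..1}). edge_map s t \<in> W}"
      "1 \<in> {t \<in> topspace (top_of_set {0..1}). edge_map s t \<in> W}"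
      using V by (auto simp: edge_map_def)
    then have "\<exists>d>0. \<forall>t\<in>{0..1}. dist t 0 < d \<longrightarrow> edge_map s t \<in> W" "\<exists>d>0. \<forall>t\<in>{0..1}. dist t 1 < d \<longrightarrow> edge_map s t \<in> W"
      using op unfolding openin_euclidean_subtopology_iff by blast+
    then obtain d e where d: "0 < d" "\<And>t. \<lbrakk>t \<in> {0..1}; dist t 0 < d\<rbrakk> \<Longrightarrow> edge_map s t \<in> W"
      and e: "0 < e" "\<And>t. \<lbrakk>t \<in> {0..1}; dist t 1 < e\<rbrakk> \<Longrightarrow> edge_map s t \<in> W"
      by blast
    show ?thesis
      using d(1) e(1) d(2) e(2) by (intro exI[of _ "min (1/2) (min d e)"]) (auto simp: dist_real_def)
  qed
  then obtain e where e: "\<And>s. s \<in> S \<Longrightarrow> 0 < e s \<and> e s \<le> 1/2"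
    "\<And>s t. \<lbrakk>s \<in> S; t \<in> {0..1}; t < e s \<or> 1 - e s < t\<rbrakk> \<Longrightarrow> edge_map s t \<in> W"
    by metis
  define N where "N = insert Vertex {Edge s t | s t. s \<in> S \<and> 0 < t \<and> t < 1 \<and> (t < e s \<or> 1 - e s < t)}"
  have "openin X1 N"
  proof (rule openin_skeleton)
    fix s assume s: "s \<in> S"
    have "{t \<in> {0..1}. edge_map s t \<in> N} = {0..1} \<inter> ({..<e s} \<union> {1 - e s<..})"
      using s e(1)[OF s] by (auto simp: N_def edge_map_def)
    then show "openin (top_of_set {0..1}) {t \<in> {0..1}. edge_map s t \<in> N}"
      by (simp add: openin_open_Int open_Un)
  qed (auto simp: N_def one_skeleton_def)
  moreover have "N \<subseteq> star"
    using e(1) by (force simp: N_def star_def one_skeleton_def)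
  moreover have "star_contraction x v \<in> W" if "x \<in> N" and v: "v \<in> {0..1}" for x v
  proof -
    consider "x = Vertex" | s t where "x = Edge s t" "s \<in> S" "0 < t" "t < 1" "t < e s \<or> 1 - e s < t"
      using \<open>x \<in> N\<close> by (auto simp: N_def)
    then show ?thesis
    proof cases
      case (2 s t)
      have vt: "v * t \<le> t" "v * (1 - t) \<le> 1 - t" "0 \<le> v * t" "0 \<le> v * (1 - t)" "v * t \<le> 1" "v * (1 - t) \<le> 1"
        using v 2 by (auto intro: mult_left_le_one_le mult_le_one)
      show ?thesis
      proof (cases "t < 1/2")
        case True
        then have "v * t < e s" using 2(5) e(1)[OF 2(2)] vt(1) True by linarith
        then show ?thesis using True 2 vt e(2)[of s "v * t"] by (simp add: star_contraction_def)
      next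
        case False
        then have "1 - e s < 1 - v * (1 - t)" using 2(5) e(1)[OF 2(2)] vt(2) False by linarith
        then show ?thesis using False 2 vt e(2)[of s "1 - v * (1 - t)"] by (simp add: star_contraction_def)
      qed
    qed (use V in \<open>simp add: star_contraction_def\<close>)
  qed
  moreover have "Vertex \<in> N" by (simp add: N_def)
  ultimately show ?thesis by blast
qed

text \<open>At the vertex \<open>star_contraction_nbhd\<close> applies. Any other point of the star
  has half of an open edge as a neighbourhood, on which the contraction is given by one
  formula.\<close>

lemma continuous_map_star_contraction:
  "continuous_map (prod_topology (subtopology X1 star) (top_of_set {0..1})) X1 (\<lambda>(x, v). star_contraction x v)"
proof -
  let ?P = "prod_topology (subtopology X1 star) (top_of_set {0..1::real})"
  have "\<exists>T. openin ?P T \<and> (x, v) \<in> T \<and> T \<subseteq> {p \<in> topspace ?P. star_contraction (fst p) (snd p) \<in> W}"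
    if W: "openin X1 W" and x: "x \<in> star" and v: "v \<in> {0..1}" and xW: "star_contraction x v \<in> W" for W x v
  proof -
    consider "x = Vertex" | s t where "x = Edge s t" "s \<in> S" "0 < t" "t < 1" "t \<noteq> 1/2"
      using x by (auto simp: star_def one_skeleton_def)
    then show ?thesis
    proof cases
      case 1
      then have "Vertex \<in> W" using xW by (simp add: star_contraction_def)
      then obtain N where N: "openin X1 N" "Vertex \<in> N" "N \<subseteq> star" "\<forall>x\<in>N. \<forall>v\<in>{0..1}. star_contraction x v \<in> W"
        using star_contraction_nbhd[OF W] by blast
      then have "openin (subtopology X1 star) N" by (simp add: openin_open_subtopology openin_star)
      then have op: "openin ?P (N \<times> {0..1})" by (simp add: openin_prod_Times_iff)
      moreover have "N \<times> {0..1} \<subseteq> {p \<in> topspace ?P. star_contraction (fst p) (snd p) \<in> W}"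
        using openin_subset[OF op] N(4) by (simp only: subset_iff mem_Collect_eq mem_Times_iff) blast
      moreover have "(x, v) \<in> N \<times> {0..1}" using 1 N(2) v by simp
      ultimately show ?thesis by blast
    next
      case (2 s t)
      define A where "A = (if t < 1/2 then {..<1/2} else {1/2<..} :: real set)"
      define E where "E = {Edge s t | t. 0 < t \<and> t < 1 \<and> t \<in> A}"
      define \<psi> where "\<psi> = (\<lambda>(t', v). if t < 1/2 then v * t' else 1 - v * (1 - t') :: real)"
      have E: "openin X1 E" unfolding E_def by (rule openin_edge_part[OF 2(2)]) (simp add: A_def)
      have xE: "x \<in> E" "E \<subseteq> star" "E \<subseteq> open_edge s" using 2 by (auto simp: E_def A_def star_def one_skeleton_def)
      have "continuous_on UNIV \<psi>" unfolding \<psi>_def case_prod_unfold by (cases "t < 1/2") (auto intro!: continuous_intros)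
      moreover have "\<psi> (t', v) \<in> {0..1}" if "t' \<in> {0<..<1}" "v \<in> {0..1}" for t' v
        using that by (auto simp: \<psi>_def mult_le_one)
      ultimately have c: "continuous_map (prod_topology (subtopology X1 (open_edge s)) (top_of_set {0..1})) X1
          (\<lambda>(x, v). edge_map s (\<psi> (coordinate x, v)))"
        by (rule continuous_map_edge_homotopy[OF 2(2)])
      let ?Q = "prod_topology (subtopology X1 (open_edge s)) (top_of_set {0..1::real})"
      let ?U = "{p \<in> topspace ?Q. (case p of (x, v) \<Rightarrow> edge_map s (\<psi> (coordinate x, v))) \<in> W}"
      have U: "openin ?Q ?U" by (rule openin_continuous_map_preimage[OF c W])
      have eq: "star_contraction y w = edge_map s (\<psi> (coordinate y, w))" if "y \<in> E" for y w
        using that by (auto simp: E_def A_def star_contraction_def \<psi>_def coordinate_def split: if_splits)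
      have "(x, v) \<in> ?U" using xE xW eq v 2 openin_subset[OF E] by auto
      from U[unfolded openin_prod_topology_alt, rule_format, OF this]
      obtain B D where BD: "openin (subtopology X1 (open_edge s)) B" "openin (top_of_set {0..1}) D"
        "x \<in> B" "v \<in> D" "B \<times> D \<subseteq> ?U"
        by (elim exE conjE)
      from openin_subtopology[of X1 "open_edge s" B, THEN iffD1, OF BD(1)]
      obtain B' where B': "openin X1 B'" "B = B' \<inter> open_edge s"
        by (elim exE conjE)
      have "openin X1 (B' \<inter> E)" by (rule openin_Int[OF B'(1) E])
      moreover have "B' \<inter> E \<subseteq> star" using xE(2) by (simp add: le_infI2)
      ultimately have "openin (subtopology X1 star) (B' \<inter> E)" by (simp add: openin_open_subtopology openin_star)
      then have op: "openin ?P ((B' \<inter> E) \<times> D)" using BD(2) by (simp add: openin_prod_Times_iff)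
      moreover have "(x, v) \<in> (B' \<inter> E) \<times> D" using xE BD B' by auto
      moreover have "(B' \<inter> E) \<times> D \<subseteq> {p \<in> topspace ?P. star_contraction (fst p) (snd p) \<in> W}"
      proof
        fix p assume p: "p \<in> (B' \<inter> E) \<times> D"
        then have "p \<in> B \<times> D" using B'(2) xE(3) by auto
        then have "p \<in> ?U" using BD(5) by blast
        then show "p \<in> {p \<in> topspace ?P. star_contraction (fst p) (snd p) \<in> W}"
          using openin_subset[OF op] p eq[of "fst p"] by (auto simp: case_prod_unfold)
      qed
      ultimately show ?thesis by blast
    qed
  qed
  then have "openin ?P {p \<in> topspace ?P. star_contraction (fst p) (snd p) \<in> W}" if "openin X1 W" for W
    using that by (subst openin_subopen) auto
  moreover have "star_contraction x v \<in> topspace X1" if "x \<in> star" "v \<in> {0..1}" for x v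
  proof -
    have "star_contraction x v \<in> one_skeleton S"
      using that edge_map_in_one_skeleton by (cases x) (auto simp: star_def star_contraction_def one_skeleton_def edge_map_def)
    then show ?thesis by (simp only: topspace_skeleton_space)
  qed
  ultimately show ?thesis
    by (auto simp: continuous_map_def case_prod_unfold)
qed

text \<open>The base edge of a point jumps when the point passes the middle of a 1-cell. In a chart,
  composing it with the loop \<open>k x\<close> gives a continuous family of paths, and translating
  the lift by \<open>k x\<close> makes it continuous.\<close>

definition "chart U H k \<longleftrightarrow> openin X1 U \<and>
  continuous_map (prod_topology (subtopology X1 U) (top_of_set {0..1})) X1 (\<lambda>(x, v). H x v) \<and>
  (\<forall>x\<in>U. H x 0 = Vertex \<and> H x 1 = x \<and> k x \<in> carrier FS \<and>
    triangle X1 (word_edge X1 (k x)) (base_edge x) (edge_along (H x) 0 1)) \<and>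
  continuous_map (subtopology X1 U) (step_topology FS) (\<lambda>x. translate FS (k x) (skeleton_lift S x))"

lemma base_edge_props:
  assumes "x \<in> one_skeleton S"
  shows "singular_simplex 1 X1 (base_edge x)" "base_edge x (std_vertex 0) = Vertex" "base_edge x (std_vertex 1) = x"
proof -
  consider "x = Vertex" | s t where "x = Edge s t" "s \<in> S" "0 < t" "t < 1"
    using assms by (auto simp: one_skeleton_def)
  then have "singular_simplex 1 X1 (base_edge x) \<and> base_edge x (std_vertex 0) = Vertex \<and> base_edge x (std_vertex 1) = x"
  proof cases
    case 1
    then show ?thesis using singular_simplex_const_edge[of Vertex X1] one_skeleton_topspace[of Vertex] by (simp add: base_edge_def)
  next
    case (2 s t)
    then show ?thesis using singular_simplex_edge_along[OF continuous_map_edge_map_skeleton[OF r 2(2)], of 0 t]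
      by (simp add: base_edge_def edge_map_def)
  qed
  then show "singular_simplex 1 X1 (base_edge x)" "base_edge x (std_vertex 0) = Vertex" "base_edge x (std_vertex 1) = x"
    by auto
qed

text \<open>Inside one edge the base edges themselves form a continuous family, so the correcting
  loop is trivial.\<close>

lemma chart_edge:
  assumes s: "s \<in> S"
  shows "chart (open_edge s) (\<lambda>x v. edge_map s (v * coordinate x)) (\<lambda>_. [])"
  unfolding chart_def
proof (intro conjI ballI)
  show "openin X1 (open_edge s)" using openin_edge_part[OF s, of UNIV] by simp
  have "continuous_map (prod_topology (subtopology X1 (open_edge s)) (top_of_set {0..1})) X1
      (\<lambda>(x, v). edge_map s ((\<lambda>(t, v). v * t) (coordinate x, v)))"
    by (rule continuous_map_edge_homotopy[OF s]) (auto simp: case_prod_unfold mult_le_one intro!: continuous_intros)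
  then show "continuous_map (prod_topology (subtopology X1 (open_edge s)) (top_of_set {0..1})) X1
      (\<lambda>(x, v). edge_map s (v * coordinate x))" by simp
  fix x assume "x \<in> open_edge s"
  then obtain t where t: "x = Edge s t" "0 < t" "t < 1" by blast
  then show "edge_map s (0 * coordinate x) = Vertex" "edge_map s (1 * coordinate x) = x"
    by (simp_all add: edge_map_def coordinate_def)
  show "[] \<in> carrier FS" using F.one_closed[of S] by simp
  have x: "x \<in> one_skeleton S" using t s by (auto simp: one_skeleton_def)
  have "edge_along (\<lambda>v. edge_map s (v * coordinate x)) 0 1 = base_edge x"
    using t by (auto simp: base_edge_def coordinate_def intro!: edge_along_reparametrize)
  then show "triangle X1 (word_edge X1 []) (base_edge x) (edge_along (\<lambda>v. edge_map s (v * coordinate x)) 0 1)"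
    using triangle_unit(1)[OF base_edge_props(1)[OF x]] base_edge_props(2)[OF x] by simp
next
  have "continuous_map (subtopology X1 (open_edge s)) (step_topology FS) (\<lambda>x. word_path FS generator [(s, True)] (coordinate x))"
    using generator_closed[OF s] continuous_map_coordinate_edge[OF s] by (intro F.continuous_map_word_path) auto
  then show "continuous_map (subtopology X1 (open_edge s)) (step_topology FS) (\<lambda>x. translate FS [] (skeleton_lift S x))"
  proof (rule continuous_map_eq)
    fix x assume "x \<in> topspace (subtopology X1 (open_edge s))"
    then obtain t where t: "x = Edge s t" "0 < t" "t < 1" by auto
    have "jump FS (generator s) t \<in> step_functions FS" using generator_closed[OF s] by auto
    then show "word_path FS generator [(s, True)] (coordinate x) = translate FS [] (skeleton_lift S x)"
      using F.translate_one[of "jump FS (generator s) t" S] F.step_in_carrier[of "jump FS (generator s) t" S] F.r_one[of _ S]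
      by (simp add: t coordinate_def skeleton_map_def letter_path_def)
  qed
qed

text \<open>On the second half of an edge the path through the end 1 is the inverse letter followed
  by the base edge, hence the loop \<open>[(s, False)]\<close>. The same translation brings
  \<open>skeleton_lift\<close> to within 1/2 of the neutral function, so
  \<open>continuous_map_near_const\<close> applies on the whole star.\<close>

lemma chart_star:
  "chart star star_contraction (\<lambda>x. case x of Edge s t \<Rightarrow> if t < 1/2 then [] else [(s, False)] | _ \<Rightarrow> [])"
  (is "chart star star_contraction ?k")
  unfolding chart_def
proof (intro conjI ballI openin_star continuous_map_star_contraction)
  have cases: "x = Vertex \<or> (\<exists>s t. x = Edge s t \<and> s \<in> S \<and> 0 < t \<and> t < 1 \<and> t \<noteq> 1/2)" if "x \<in> star" for x
    using that by (auto simp: star_def one_skeleton_def)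
  have inv: "inv\<^bsub>FS\<^esub> generator s = [(s, False)]" "[(s, False)] \<in> carrier FS" if "s \<in> S" for s
    using inv_generator[OF that] F.inv_closed[OF generator_closed[OF that]] by (simp_all add: generator_def)
  have one: "[] \<in> carrier FS" using F.one_closed[of S] by simp
  have kc: "?k x \<in> carrier FS" if "x \<in> star" for x
    using cases[OF that] inv one by auto
  fix x assume x: "x \<in> star"
  have xs: "x \<in> one_skeleton S" using x by (simp add: star_def)
  show "star_contraction x 0 = Vertex" "star_contraction x 1 = x"
    using cases[OF x] by (auto simp: star_contraction_def edge_map_def)
  show "?k x \<in> carrier FS" by (rule kc[OF x])
  show "triangle X1 (word_edge X1 (?k x)) (base_edge x) (edge_along (star_contraction x) 0 1)"
  proof (cases "\<exists>s t. x = Edge s t \<and> s \<in> S \<and> 1/2 < t \<and> t < 1")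
    case True
    then obtain s t where t: "x = Edge s t" "s \<in> S" "1/2 < t" "t < 1" by blast
    have "edge_along (star_contraction x) 0 1 = edge_along (edge_map s) 1 t"
      using t by (intro edge_along_reparametrize) (simp add: star_contraction_def algebra_simps)
    then show ?thesis
      using thin_triangle[OF continuous_map_edge_map_skeleton[OF r t(2)], of 1 0 t] t
      by (simp add: base_edge_def letter_edge_def)
  next
    case False
    then have "?k x = []" using cases[OF x] by force
    moreover have "edge_along (star_contraction x) 0 1 = base_edge x"
    proof (cases "x = Vertex")
      case True
      then show ?thesis by (simp add: base_edge_def edge_along_def const_edge_def star_contraction_def)
    next
      case False
      then obtain s t where "x = Edge s t" "t < 1/2"
        using cases[OF x] \<open>\<not> (\<exists>s t. x = Edge s t \<and> s \<in> S \<and> 1/2 < t \<and> t < 1)\<close> by force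
      then show ?thesis
        by (auto simp: base_edge_def star_contraction_def intro!: edge_along_reparametrize)
    qed
    ultimately show ?thesis
      using triangle_unit(1)[OF base_edge_props(1)[OF xs]] base_edge_props(2)[OF xs] by simp
  qed
next
  have cases: "x = Vertex \<or> (\<exists>s t. x = Edge s t \<and> s \<in> S \<and> 0 < t \<and> t < 1 \<and> t \<noteq> 1/2)" if "x \<in> star" for x
    using that by (auto simp: star_def one_skeleton_def)
  have inv: "inv\<^bsub>FS\<^esub> generator s = [(s, False)]" "[(s, False)] \<in> carrier FS" if "s \<in> S" for s
    using inv_generator[OF that] F.inv_closed[OF generator_closed[OF that]] by (simp_all add: generator_def)
  have one: "[] \<in> carrier FS" using F.one_closed[of S] by simp
  show "continuous_map (subtopology X1 star) (step_topology FS) (\<lambda>x. translate FS (?k x) (skeleton_lift S x))"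
  proof (rule F.continuous_map_near_const)
    show "continuous_map (subtopology X1 star) (orbit_topology FS) (skeleton_lift S)"
      by (intro continuous_map_from_subtopology continuous_map_skeleton_lift r)
    show "(\<lambda>_. []) \<in> step_functions FS" using F.const_one_step_function[of S] by simp
    fix x assume "x \<in> topspace (subtopology X1 star)"
    then have x: "x \<in> star" by auto
    show "?k x \<in> carrier FS" using cases[OF x] inv one by auto
    consider "x = Vertex" | s t where "x = Edge s t" "s \<in> S" "0 < t" "t < 1/2"
      | s t where "x = Edge s t" "s \<in> S" "1/2 < t" "t < 1"
      using cases[OF x] by fastforce
    then show "step_dist (\<lambda>_. []) (translate FS (?k x) (skeleton_lift S x)) < 1/2"
    proof cases
      case 1
      then show ?thesis using F.translate_one[OF F.const_one_step_function, of S] by (simp add: skeleton_map_def)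
    next
      case (2 s t)
      note g = generator_closed[OF 2(2)]
      have "step_dist (jump FS (generator s) 0) (jump FS (generator s) t) \<le> \<bar>0 - t\<bar>" by (rule F.step_dist_jump[OF g])
      then show ?thesis
        using 2 F.translate_one[OF F.jump_step_functions[OF g], of t] F.jump_0[of 0 S "generator s"]
        by (simp add: skeleton_map_def)
    next
      case (3 s t)
      note g = generator_closed[OF 3(2)]
      have "step_dist (jump FS (generator s) 1) (jump FS (generator s) t) \<le> \<bar>1 - t\<bar>" by (rule F.step_dist_jump[OF g])
      moreover have "step_dist (translate FS [(s, False)] (jump FS (generator s) 1)) (translate FS [(s, False)] (jump FS (generator s) t))
          = step_dist (jump FS (generator s) 1) (jump FS (generator s) t)"
        using inv[OF 3(2)] g by (intro F.step_dist_translate) auto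
      moreover have "translate FS [(s, False)] (jump FS (generator s) 1) = (\<lambda>_. [])"
        using F.jump_1[of 1 S "generator s"] F.l_inv[OF g] inv[OF 3(2)] by (simp add: translate_def)
      ultimately show ?thesis using 3 by (simp add: skeleton_map_def)
    qed
  qed
qed

lemma chart_exists:
  assumes "x \<in> one_skeleton S"
  shows "\<exists>U H k. chart U H k \<and> x \<in> U"
proof (cases "x \<in> star")
  case True
  then show ?thesis using chart_star by blast
next
  case False
  then obtain s where "x \<in> open_edge s" "s \<in> S" using assms by (auto simp: star_def one_skeleton_def)
  then show ?thesis using chart_edge by blast
qed

text \<open>Two lifts along \<open>q\<close> are available, one from \<open>g\<close> and one from
  the chart. By uniqueness \<open>k (q s)\<close> times the holonomy is \<open>k (q t)\<close>. The
  paths \<open>H\<close> give the corresponding relation between homotopy classes, and cancelling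
  the loop of \<open>k (q s)\<close> leaves the claim.\<close>

lemma chart_monodromy:
  assumes chart: "chart U H k" and q: "continuous_map (top_of_set {0..1}) X1 q"
    and J: "J \<subseteq> {0..1}" "convex J" "q ` J \<subseteq> U" "s \<in> J" "t \<in> J"
    and g: "\<And>t. t \<in> {0..1} \<Longrightarrow> g t \<in> carrier FS"
      "continuous_map (top_of_set {0..1}) (step_topology FS) (\<lambda>t. translate FS (g t) (skeleton_lift S (q t)))"
  shows "monodromy X1 (edge_along q s t) (inv\<^bsub>FS\<^esub> g s \<otimes>\<^bsub>FS\<^esub> g t)"
proof -
  note ch = chart[unfolded chart_def]
  have H: "continuous_map (prod_topology (subtopology X1 U) (top_of_set {0..1})) X1 (\<lambda>(x, v). H x v)"
    and kc: "continuous_map (subtopology X1 U) (step_topology FS) (\<lambda>x. translate FS (k x) (skeleton_lift S x))"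
    and U: "\<And>x. x \<in> U \<Longrightarrow> H x 0 = Vertex" "\<And>x. x \<in> U \<Longrightarrow> H x 1 = x" "\<And>x. x \<in> U \<Longrightarrow> k x \<in> carrier FS"
      "\<And>x. x \<in> U \<Longrightarrow> triangle X1 (word_edge X1 (k x)) (base_edge x) (edge_along (H x) 0 1)"
    using ch by simp_all
  have st01: "s \<in> {0..1}" "t \<in> {0..1}" using J by auto
  have qU: "q s \<in> U" "q t \<in> U" using J by auto
  have qX: "q u \<in> topspace X1" if "u \<in> {0..1}" for u
    using q that by (auto simp: continuous_map_def)
  have "continuous_map (top_of_set J) X1 q"
    using continuous_map_from_subtopology[OF q, of J] J(1) by (simp add: subtopology_subtopology Int_absorb1)
  then have qJ: "continuous_map (top_of_set J) (subtopology X1 U) q" using J(3) by (auto simp: continuous_map_in_subtopology)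
  have seg: "(1 - p) * s + p * t \<in> J" if "p \<in> {0..1}" for p
    using convexD[OF J(2,4,5), of "1 - p" p] that by simp
  let ?I = "top_of_set {0..1::real}"
  have tri: "triangle X1 (edge_along (H (q s)) 0 1) (edge_along q s t) (edge_along (H (q t)) 0 1)"
  proof -
    let ?G = "\<lambda>(v, p). H (q ((1 - p) * s + p * t)) v"
    have "continuous_map (prod_topology ?I ?I) euclideanreal snd"
      using continuous_map_snd[of ?I ?I] by (simp add: continuous_map_in_subtopology)
    then have "continuous_map (prod_topology ?I ?I) (top_of_set J) (\<lambda>p. (1 - snd p) * s + snd p * t)"
      using seg by (auto simp: continuous_map_in_subtopology intro!: continuous_intros)
    from continuous_map_compose[OF this qJ]
    have "continuous_map (prod_topology ?I ?I) (prod_topology (subtopology X1 U) ?I)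
        (\<lambda>p. (q ((1 - snd p) * s + snd p * t), fst p))"
      using continuous_map_fst[of ?I ?I] by (simp add: continuous_map_paired o_def)
    from continuous_map_compose[OF this H]
    have "continuous_map (prod_topology ?I ?I) X1 ?G" by (simp add: o_def case_prod_unfold)
    moreover have "?G (0, p) = Vertex" if "p \<in> {0..1}" for p using U(1) J(3) seg[OF that] by auto
    ultimately have "triangle X1 (edge_along (\<lambda>v. ?G (v, 0)) 0 1) (edge_along (\<lambda>p. ?G (1, p)) 0 1) (edge_along (\<lambda>v. ?G (v, 1)) 0 1)"
      by (rule cone_triangle)
    moreover have "edge_along (\<lambda>p. ?G (1, p)) 0 1 = edge_along q s t"
      using U(2) J(3) seg by (intro edge_along_reparametrize) auto
    ultimately show ?thesis by simp
  qed
  have "connected_space (top_of_set J)" using convex_connected[OF J(2)] by (simp add: connectedin_def flip: connectedin_iff_connected)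
  moreover have "continuous_map (top_of_set J) (step_topology FS) (\<lambda>t. translate FS (g t) (skeleton_lift S (q t)))"
    using continuous_map_from_subtopology[OF g(2), of J] J(1) by (simp add: subtopology_subtopology Int_absorb1)
  moreover have "continuous_map (top_of_set J) (step_topology FS) (\<lambda>t. translate FS (k (q t)) (skeleton_lift S (q t)))"
    using continuous_map_compose[OF qJ kc] by (simp add: o_def)
  moreover have "skeleton_lift S (q t) \<in> step_functions FS" if "t \<in> J" for t
    using continuous_map_skeleton_lift[OF r] qX[of t] J(1) that unfolding F.continuous_map_orbit by blast
  ultimately have "k (q s) \<otimes>\<^bsub>FS\<^esub> inv\<^bsub>FS\<^esub> g s = k (q t) \<otimes>\<^bsub>FS\<^esub> inv\<^bsub>FS\<^esub> g t"
    using J g(1) U(3) by (intro F.lift_unique[where K = "top_of_set J" and f = "\<lambda>t. skeleton_lift S (q t)"]) auto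
  then have eq: "k (q s) \<otimes>\<^bsub>FS\<^esub> (inv\<^bsub>FS\<^esub> g s \<otimes>\<^bsub>FS\<^esub> g t) = k (q t)"
    using g(1)[OF st01(1)] g(1)[OF st01(2)] U(3)[OF qU(1)] U(3)[OF qU(2)] by (simp add: F.m_assoc flip: F.m_assoc[of "k (q s)"])
  define h where "h = inv\<^bsub>FS\<^esub> g s \<otimes>\<^bsub>FS\<^esub> g t"
  have h: "h \<in> carrier FS" using g(1)[OF st01(1)] g(1)[OF st01(2)] by (simp add: h_def)
  have qs: "q s \<in> one_skeleton S" "q t \<in> one_skeleton S" using qX st01 topspace_skeleton_space by auto
  obtain u where u: "triangle X1 (base_edge (q s)) (edge_along q s t) u"
    using triangle_composite[OF base_edge_props(1)[OF qs(1)] singular_simplex_edge_along[OF q st01]]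
      base_edge_props(3)[OF qs(1)] by auto
  have "triangle X1 (word_edge X1 (k (q s))) u (edge_along (H (q t)) 0 1)"
    by (rule triangle_assoc[OF U(4)[OF qU(1)] u tri])
  moreover have "triangle X1 (word_edge X1 (k (q s))) (word_edge X1 h) (word_edge X1 (k (q t)))"
    using triangle_word_edge_mult[OF r U(3)[OF qU(1)] h] eq by (simp add: h_def)
  ultimately have "triangle X1 (word_edge X1 h) (base_edge (q t)) u"
    using triangle_left_quotient U(4)[OF qU(2)] by blast
  then show ?thesis using u unfolding monodromy_def h_def by auto
qed

text \<open>The relation is transitive along a path and holds on short pieces, which lie in one
  chart. Connectedness of the interval takes the place of a subdivision.\<close>

theorem monodromy_holonomy:
  assumes \<tau>: "singular_simplex 1 X1 \<tau>"
  shows "monodromy X1 \<tau> (skeleton_holonomy S \<tau>)"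
proof -
  let ?p = "\<lambda>t i. if i = 0 then 1 - t else if i = 1 then t else (0::real)"
  obtain q where q: "continuous_map (top_of_set {0..1}) X1 q" "\<tau> = edge_along q 0 1" "\<And>t. q t = \<tau> (?p t)"
    by (rule path_of_edge[OF \<tau>]) auto
  obtain g' where g': "lift_of FS (skeleton_lift S) 1 \<tau> g'"
    using F.lift_of_exists[OF continuous_map_skeleton_lift[OF r] \<tau>] by blast
  define g where "g t = g' (?p t)" for t
  have "continuous_map (top_of_set {0..1}) euclideanreal (\<lambda>t. ?p t i)" for i :: nat
    by (cases "i = 0"; cases "i = 1") (auto intro!: continuous_intros)
  moreover have p: "?p t \<in> standard_simplex 1" if "t \<in> {0..1}" for t
    using that by (auto simp: standard_simplex_def)
  ultimately have "continuous_map (top_of_set {0..1}) (simplex_space 1) ?p"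
    by (auto simp: continuous_map_in_subtopology continuous_map_componentwise_UNIV)
  then have gc: "continuous_map (top_of_set {0..1}) (step_topology FS) (\<lambda>t. translate FS (g t) (skeleton_lift S (q t)))"
    using continuous_map_compose[of _ _ ?p "step_topology FS" "\<lambda>x. translate FS (g' x) (skeleton_lift S (\<tau> x))"] g'
    by (simp add: lift_of_def o_def g_def q(3))
  have g: "g t \<in> carrier FS" if "t \<in> {0..1}" for t using g' p[OF that] by (simp add: lift_of_def g_def)
  have "monodromy X1 (edge_along q 0 1) (inv\<^bsub>FS\<^esub> g 0 \<otimes>\<^bsub>FS\<^esub> g 1)"
  proof -
    let ?R = "\<lambda>s t. s \<in> {0..1} \<and> t \<in> {0..1} \<and> monodromy X1 (edge_along q s t) (inv\<^bsub>FS\<^esub> g s \<otimes>\<^bsub>FS\<^esub> g t)"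
    have "?R 0 1"
    proof (rule connected_equivalence_relation_gen[where S = "{0..1::real}" and P = "\<lambda>_. True" and R = ?R])
      fix s t u assume *: "?R s t" "?R t u"
      then have "monodromy X1 (edge_along q s u) ((inv\<^bsub>FS\<^esub> g s \<otimes>\<^bsub>FS\<^esub> g t) \<otimes>\<^bsub>FS\<^esub> (inv\<^bsub>FS\<^esub> g t \<otimes>\<^bsub>FS\<^esub> g u))"
        using g by (intro monodromy_composite[OF thin_triangle[OF q(1), of s t u]]) auto
      then show "?R s u" using * g[of s] g[of t] g[of u] by (simp add: F.m_assoc)
    next
      fix a :: real assume a: "a \<in> {0..1}"
      have "a \<in> topspace (top_of_set {0..1})" using a by simp
      then have "q a \<in> topspace X1" using q(1) unfolding continuous_map_def by blast
      then have "q a \<in> one_skeleton S" by (simp only: topspace_skeleton_space)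
      from chart_exists[OF this] obtain U H k where ch: "chart U H k" "q a \<in> U" by (elim exE conjE)
      have "openin (top_of_set {0..1}) {t \<in> topspace (top_of_set {0..1}). q t \<in> U}"
        by (rule openin_continuous_map_preimage[OF q(1)]) (use ch in \<open>simp add: chart_def\<close>)
      moreover have "a \<in> {t \<in> topspace (top_of_set {0..1}). q t \<in> U}" using a ch(2) by simp
      ultimately have "\<exists>d>0. \<forall>t\<in>{0..1}. dist t a < d \<longrightarrow> t \<in> {t \<in> topspace (top_of_set {0..1}). q t \<in> U}"
        unfolding openin_euclidean_subtopology_iff by blast
      then obtain d where d: "0 < d" "\<And>t. \<lbrakk>t \<in> {0..1}; dist t a < d\<rbrakk> \<Longrightarrow> q t \<in> U" by blast
      let ?J = "{0..1} \<inter> ball a d"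
      have "?R s t" if "s \<in> ?J" "t \<in> ?J" for s t
      proof -
        have "q ` ?J \<subseteq> U" using d(2) by (auto simp: dist_commute)
        from chart_monodromy[OF ch(1) q(1) _ _ this that g gc] show ?thesis
          using that by (simp add: convex_Int)
      qed
      moreover have "openin (top_of_set {0..1}) ?J" by (simp add: openin_open_Int)
      ultimately show "\<exists>T. openin (top_of_set {0..1}) T \<and> a \<in> T \<and> (\<forall>s\<in>T. \<forall>t\<in>T. True \<and> True \<longrightarrow> ?R s t)"
        using a d(1) by (intro exI[of _ ?J]) auto
    qed auto
    then show ?thesis by blast
  qed
  moreover have "skeleton_holonomy S \<tau> = inv\<^bsub>FS\<^esub> g 0 \<otimes>\<^bsub>FS\<^esub> g 1"
  proof -
    have "?p 0 = std_vertex 0" "?p 1 = std_vertex 1" by (auto simp: std_vertex_def)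
    then show ?thesis
      using F.holonomy_eq[OF continuous_map_skeleton_lift[OF r] \<tau> g'] by (simp add: skeleton_holonomy_def g_def)
  qed
  ultimately show ?thesis using q(2) by simp
qed

end

section \<open>Evaluation of chains and the class of the face\<close>

definition evaluate :: "('s \<Rightarrow> real) \<Rightarrow> ('s \<Rightarrow>\<^sub>0 real) \<Rightarrow> real"
  where "evaluate b c = (\<Sum>\<sigma>\<in>Poly_Mapping.keys c. Poly_Mapping.lookup c \<sigma> * b \<sigma>)"

abbreviation real_coeffs :: "('s \<Rightarrow>\<^sub>0 int) \<Rightarrow> ('s \<Rightarrow>\<^sub>0 real)"
  where "real_coeffs \<equiv> Poly_Mapping.map real_of_int"

definition coboundary :: "nat \<Rightarrow> (((nat \<Rightarrow> real) \<Rightarrow> 'b) \<Rightarrow> real) \<Rightarrow> ((nat \<Rightarrow> real) \<Rightarrow> 'b) \<Rightarrow> real"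
  where "coboundary p b \<sigma> = (\<Sum>k\<le>p. (-1) ^ k * b (singular_face p k \<sigma>))"

lemma evaluate_superset:
  assumes "finite A" "Poly_Mapping.keys c \<subseteq> A"
  shows "evaluate b c = (\<Sum>\<sigma>\<in>A. Poly_Mapping.lookup c \<sigma> * b \<sigma>)"
  unfolding evaluate_def using assms
  by (intro sum.mono_neutral_left) (auto simp: in_keys_iff)

lemma evaluate_0 [simp]: "evaluate b 0 = 0"
  by (simp add: evaluate_def)

lemma evaluate_add [simp]: "evaluate b (c + d) = evaluate b c + evaluate b d"
proof -
  let ?A = "Poly_Mapping.keys c \<union> Poly_Mapping.keys d"
  have *: "evaluate b x = (\<Sum>\<sigma>\<in>?A. Poly_Mapping.lookup x \<sigma> * b \<sigma>)" if "x \<in> {c, d, c + d}" for x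
    using that Poly_Mapping.keys_add[of c d] by (intro evaluate_superset) auto
  show ?thesis by (simp add: * lookup_add distrib_right sum.distrib)
qed

lemma evaluate_diff [simp]: "evaluate b (c - d) = evaluate b c - evaluate b d"
  using evaluate_add[of b "c - d" d] by simp

lemma evaluate_single [simp]: "evaluate b (Poly_Mapping.single \<sigma> a) = a * b \<sigma>"
  by (simp add: evaluate_def)

lemma evaluate_sum [simp]: "evaluate b (sum f A) = (\<Sum>i\<in>A. evaluate b (f i))"
  by (induction A rule: infinite_finite_induct) auto

lemma evaluate_cong:
  "(\<And>\<sigma>. \<sigma> \<in> Poly_Mapping.keys c \<Longrightarrow> b \<sigma> = b' \<sigma>) \<Longrightarrow> evaluate b c = evaluate b' c"
  by (simp add: evaluate_def)

text \<open>Cochains separate chains. Identities between chains are reduced in this way to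
  identities between coboundaries, without handling finite supports.\<close>

lemma evaluate_eqI:
  assumes "\<And>b. evaluate b c = evaluate b d"
  shows "c = d"
proof (rule poly_mapping_eqI)
  fix \<sigma>
  have *: "evaluate (\<lambda>\<tau>. if \<tau> = \<sigma> then 1 else 0) x = Poly_Mapping.lookup x \<sigma>" for x :: "'a \<Rightarrow>\<^sub>0 real"
    by (simp add: evaluate_def if_distrib[of "(*) _"] sum.delta in_keys_iff cong: if_cong)
  show "Poly_Mapping.lookup c \<sigma> = Poly_Mapping.lookup d \<sigma>"
    using assms[of "\<lambda>\<tau>. if \<tau> = \<sigma> then 1 else 0"] by (simp only: *)
qed

lemma abs_evaluate_le:
  assumes "\<And>\<sigma>. \<sigma> \<in> Poly_Mapping.keys c \<Longrightarrow> \<bar>b \<sigma>\<bar> \<le> D"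
  shows "\<bar>evaluate b c\<bar> \<le> D * l1_norm c"
proof -
  have "\<bar>evaluate b c\<bar> \<le> (\<Sum>\<sigma>\<in>Poly_Mapping.keys c. \<bar>Poly_Mapping.lookup c \<sigma> * b \<sigma>\<bar>)"
    unfolding evaluate_def by (rule sum_abs)
  also have "\<dots> \<le> (\<Sum>\<sigma>\<in>Poly_Mapping.keys c. D * \<bar>Poly_Mapping.lookup c \<sigma>\<bar>)"
    by (rule sum_mono) (use assms in \<open>auto simp: abs_mult mult.commute intro: mult_right_mono\<close>)
  finally show ?thesis by (simp add: l1_norm_def sum_distrib_left)
qed

lemma real_coeffs_lookup: "Poly_Mapping.lookup (real_coeffs z) \<sigma> = real_of_int (Poly_Mapping.lookup z \<sigma>)"
  by (simp add: map.rep_eq when_def)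

lemma real_coeffs_keys: "Poly_Mapping.keys (real_coeffs z) = Poly_Mapping.keys z"
  by (auto simp: in_keys_iff real_coeffs_lookup)

lemma real_coeffs_simps [simp]:
  "real_coeffs 0 = 0" "real_coeffs (y - z) = real_coeffs y - real_coeffs z"
  "real_coeffs (y + z) = real_coeffs y + real_coeffs z"
  "real_coeffs (frag_of \<sigma>) = Poly_Mapping.single \<sigma> 1"
  by (rule poly_mapping_eqI; simp add: real_coeffs_lookup lookup_add lookup_minus lookup_single when_def)+

lemma real_coeffs_sum: "real_coeffs (sum f A) = (\<Sum>i\<in>A. real_coeffs (f i))"
  by (induction A rule: infinite_finite_induct) auto

lemma evaluate_frag_cmul: "evaluate b (real_coeffs (frag_cmul a z)) = real_of_int a * evaluate b (real_coeffs z)"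
proof -
  have "evaluate b (real_coeffs (frag_cmul a z)) =
      (\<Sum>\<sigma>\<in>Poly_Mapping.keys z. Poly_Mapping.lookup (real_coeffs (frag_cmul a z)) \<sigma> * b \<sigma>)"
    by (rule evaluate_superset) (auto simp: real_coeffs_keys dest: subsetD[OF keys_cmul])
  then show ?thesis
    by (simp add: evaluate_def real_coeffs_keys real_coeffs_lookup sum_distrib_left mult.assoc)
qed

lemma evaluate_frag_extend:
  "evaluate b (real_coeffs (frag_extend g z)) = evaluate (\<lambda>\<sigma>. evaluate b (real_coeffs (g \<sigma>))) (real_coeffs z)"
proof -
  have "z \<in> {z. Poly_Mapping.keys z \<subseteq> UNIV}" by simp
  have "Poly_Mapping.keys z \<subseteq> UNIV" by simp
  then show ?thesis
    by (rule frag_induction) (simp_all add: frag_extend_diff)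
qed

lemma evaluate_chain_boundary:
  assumes "0 < p"
  shows "evaluate b (real_coeffs (chain_boundary p z)) = evaluate (coboundary p b) (real_coeffs z)"
  using assms
  by (simp add: chain_boundary_def evaluate_frag_extend real_coeffs_sum evaluate_frag_cmul coboundary_def[abs_def])

lemma evaluate_chain_map:
  "evaluate b (real_coeffs (chain_map p f z)) = evaluate (\<lambda>\<sigma>. b (simplex_map p f \<sigma>)) (real_coeffs z)"
  by (simp add: chain_map_def evaluate_frag_extend)

lemma evaluate_real_chain_boundary:
  assumes "0 < p"
  shows "evaluate b (real_chain_boundary p c) = evaluate (coboundary p b) c"
  using assms by (simp add: real_chain_boundary_def evaluate_def[of _ c] coboundary_def sum_distrib_left mult_ac)

lemma real_chain_boundary_real_coeffs:
  "real_chain_boundary p (real_coeffs z) = real_coeffs (chain_boundary p z)"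
proof (cases "p = 0")
  case False
  then show ?thesis
    by (intro evaluate_eqI) (simp add: evaluate_real_chain_boundary evaluate_chain_boundary)
qed (simp add: real_chain_boundary_def chain_boundary_def)

lemma real_chain_boundary_diff:
  "real_chain_boundary p (c - d) = real_chain_boundary p c - real_chain_boundary p d"
proof (cases "p = 0")
  case False
  then show ?thesis by (intro evaluate_eqI) (simp add: evaluate_real_chain_boundary)
qed (simp add: real_chain_boundary_def)

lemma coboundary_coboundary:
  assumes "singular_simplex (Suc p) X \<sigma>" "0 < p"
  shows "coboundary (Suc p) (coboundary p b) \<sigma> = 0"
proof -
  have "chain_boundary p (chain_boundary (Suc p) (frag_of \<sigma>)) = 0"
    by (rule chain_boundary_boundary_alt) (use assms in \<open>simp add: singular_chain_of\<close>)
  then have "evaluate b (real_coeffs (chain_boundary p (chain_boundary (Suc p) (frag_of \<sigma>)))) = 0" by simp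
  then show ?thesis using \<open>0 < p\<close> by (simp add: evaluate_chain_boundary)
qed

lemma real_boundary_boundary:
  assumes "real_singular_chain (Suc p) X d"
  shows "real_chain_boundary p (real_chain_boundary (Suc p) d) = 0"
proof (cases "p = 0")
  case False
  have "evaluate b (real_chain_boundary p (real_chain_boundary (Suc p) d)) = 0" for b
  proof -
    have "evaluate (coboundary (Suc p) (coboundary p b)) d = evaluate (\<lambda>_. 0) d"
      by (rule evaluate_cong)
        (use assms False in \<open>auto simp: real_singular_chain_def intro!: coboundary_coboundary\<close>)
    then show ?thesis using False by (simp add: evaluate_real_chain_boundary evaluate_def[of "\<lambda>_. 0"])
  qed
  then show ?thesis by (intro evaluate_eqI) simp
qed (simp add: real_chain_boundary_def)

lemma real_singular_chain_diff:
  assumes "real_singular_chain p X c" "real_singular_chain p X d"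
  shows "real_singular_chain p X (c - d)"
proof -
  have "Poly_Mapping.keys (c - d) \<subseteq> Poly_Mapping.keys c \<union> Poly_Mapping.keys d"
    by (auto simp: in_keys_iff lookup_minus)
  then show ?thesis using assms by (auto simp: real_singular_chain_def)
qed

lemma real_singular_chain_boundary:
  assumes "real_singular_chain (Suc p) X d"
  shows "real_singular_chain p X (real_chain_boundary (Suc p) d)"
  unfolding real_singular_chain_def
proof
  fix \<tau> assume "\<tau> \<in> Poly_Mapping.keys (real_chain_boundary (Suc p) d)"
  then have ne: "Poly_Mapping.lookup (real_chain_boundary (Suc p) d) \<tau> \<noteq> 0" by (simp add: in_keys_iff)
  have "\<exists>\<sigma>\<in>Poly_Mapping.keys d. \<exists>k\<le>Suc p. singular_face (Suc p) k \<sigma> = \<tau>"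
  proof (rule ccontr)
    assume "\<not> ?thesis"
    then have "Poly_Mapping.lookup (real_chain_boundary (Suc p) d) \<tau> = 0"
      by (simp add: real_chain_boundary_def lookup_sum lookup_single when_def del: sum.atMost_Suc)
    with ne show False by simp
  qed
  then show "\<tau> \<in> singular_simplex_set p X"
    using assms singular_simplex_singular_face[of "Suc p" X]
    by (fastforce simp: real_singular_chain_def)
qed

lemma singular_relboundary_triangle:
  assumes "triangle X a b c"
  shows "singular_relboundary 1 X {} (frag_of a + frag_of b - frag_of c)"
proof -
  obtain \<sigma> where \<sigma>: "singular_simplex 2 X \<sigma>" "a = singular_face 2 2 \<sigma>" "b = singular_face 2 0 \<sigma>" "c = singular_face 2 1 \<sigma>"
    using assms by (auto simp: triangle_def)
  have "chain_boundary 2 (frag_of \<sigma>) = frag_of a + frag_of b - frag_of c"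
    by (simp add: chain_boundary_of numeral_2_eq_2 \<sigma>(2-))
  then show ?thesis
    unfolding singular_boundary using \<sigma>(1)
    by (metis Suc_1 singular_chain_of)
qed

lemma singular_face_vertices:
  "singular_face 2 0 \<sigma> (std_vertex 0) = \<sigma> (std_vertex 1)" "singular_face 2 0 \<sigma> (std_vertex 1) = \<sigma> (std_vertex 2)"
  "singular_face 2 1 \<sigma> (std_vertex 0) = \<sigma> (std_vertex 0)" "singular_face 2 1 \<sigma> (std_vertex 1) = \<sigma> (std_vertex 2)"
  "singular_face 2 2 \<sigma> (std_vertex 0) = \<sigma> (std_vertex 0)" "singular_face 2 2 \<sigma> (std_vertex 1) = \<sigma> (std_vertex 1)"
  by (simp_all add: singular_face_def std_vertex_in_simplex simplical_face_vertex numeral_2_eq_2)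

section \<open>The fundamental cycle\<close>

context
  fixes S :: "'a set" and r :: "'a word"
  assumes r: "r \<in> derived (free_group S) (carrier (free_group S))"
begin

private abbreviation (input) "P \<equiv> presentation_complex S r"
private abbreviation (input) "F \<equiv> free_group S"
private abbreviation (input) "SK \<equiv> skeleton_space S r"
private abbreviation (input) "bounds \<equiv> singular_relboundary 1 (skeleton_space S r) {}"

lemma relator_closed: "r \<in> carrier F"
  using r F.derived_in_carrier[of "carrier F" S] by auto

lemma relator_letters: "fst ` set r \<subseteq> S"
  using relator_closed by (simp add: carrier_free_group)

lemma bounds_add: "\<lbrakk>bounds x; bounds y\<rbrakk> \<Longrightarrow> bounds (x + y)"
  by (rule singular_relboundary_add)

lemma bounds_diff: "\<lbrakk>bounds x; bounds y\<rbrakk> \<Longrightarrow> bounds (x - y)"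
  by (rule singular_relboundary_diff)

private abbreviation (input) "W h \<equiv> frag_of (word_edge SK h)"

lemma bounds_mult:
  "\<lbrakk>g \<in> carrier F; h \<in> carrier F\<rbrakk> \<Longrightarrow> bounds (W g + W h - W (g \<otimes>\<^bsub>F\<^esub> h))"
  by (rule singular_relboundary_triangle[OF triangle_word_edge_mult[OF relator_letters]])

lemma bounds_one: "bounds (W \<one>\<^bsub>F\<^esub>)"
  using bounds_mult[OF F.one_closed F.one_closed] by simp

lemma bounds_inv:
  assumes "g \<in> carrier F"
  shows "bounds (W g + W (inv\<^bsub>F\<^esub> g))"
proof -
  have "bounds (W g + W (inv\<^bsub>F\<^esub> g) - W \<one>\<^bsub>F\<^esub> + W \<one>\<^bsub>F\<^esub>)"
    using bounds_mult[OF assms F.inv_closed[OF assms]] bounds_one by (intro bounds_add) (simp_all add: assms)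
  then show ?thesis by (simp only: diff_add_cancel)
qed

text \<open>Modulo boundaries \<open>W\<close> is additive with values in an abelian group, so it
  kills commutators.\<close>

lemma bounds_commutator:
  assumes ab: "a \<in> carrier F" "b \<in> carrier F"
  shows "bounds (W (a \<otimes>\<^bsub>F\<^esub> b \<otimes>\<^bsub>F\<^esub> inv\<^bsub>F\<^esub> a \<otimes>\<^bsub>F\<^esub> inv\<^bsub>F\<^esub> b))"
proof -
  let ?a' = "inv\<^bsub>F\<^esub> a" and ?b' = "inv\<^bsub>F\<^esub> b"
  let ?ab = "a \<otimes>\<^bsub>F\<^esub> b"
  let ?aba = "?ab \<otimes>\<^bsub>F\<^esub> ?a'"
  note c = ab F.inv_closed[OF ab(1)] F.inv_closed[OF ab(2)]
  have "bounds ((W a + W ?a') + (W b + W ?b') - (W a + W b - W ?ab) - (W ?ab + W ?a' - W ?aba)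
      - (W ?aba + W ?b' - W (?aba \<otimes>\<^bsub>F\<^esub> ?b')))"
    by (intro bounds_add bounds_diff bounds_inv bounds_mult F.m_closed c)
  then show ?thesis by simp
qed

lemma bounds_derived:
  assumes "g \<in> derived F (carrier F)"
  shows "bounds (W g)"
proof -
  have "g \<in> carrier F \<and> bounds (W g)"
    using assms unfolding derived_def
  proof (induction rule: generate.induct)
    case one then show ?case using bounds_one by simp
  next
    case (incl g)
    then show ?case using bounds_commutator by auto
  next
    case (inv g)
    then have g: "g \<in> carrier F" "bounds (W g)" using bounds_commutator by auto
    have "bounds (W g + W (inv\<^bsub>F\<^esub> g) - W g)" by (intro bounds_diff bounds_inv g)
    then show ?case using g by simp
  next
    case (eng g h)
    then have c: "g \<in> carrier F" "h \<in> carrier F" "bounds (W g)" "bounds (W h)" by auto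
    have "bounds (W g + W h - (W g + W h - W (g \<otimes>\<^bsub>F\<^esub> h)))"
      by (intro bounds_diff bounds_add bounds_mult c)
    then show ?case using c by simp
  qed
  then show ?thesis by blast
qed

private abbreviation (input) "E k \<equiv> face_edge r k"

text \<open>Modulo boundaries an edge is the loop of its holonomy, up to base edges that cancel
  around a closed chain.\<close>

lemma bounds_monodromy:
  assumes \<tau>: "singular_simplex 1 SK \<tau>"
  shows "bounds (frag_of \<tau> + frag_of (base_edge (\<tau> (std_vertex 0))) - frag_of (base_edge (\<tau> (std_vertex 1)))
    - W (skeleton_holonomy S \<tau>))"
proof -
  obtain u where "triangle SK (base_edge (\<tau> (std_vertex 0))) \<tau> u"
    "triangle SK (word_edge SK (skeleton_holonomy S \<tau>)) (base_edge (\<tau> (std_vertex 1))) u"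
    using monodromy_holonomy[OF relator_letters \<tau>] by (auto simp: monodromy_def)
  from bounds_diff[OF this[THEN singular_relboundary_triangle]]
  show ?thesis by (simp add: algebra_simps)
qed

text \<open>Around the triangle the base edges cancel, and by \<open>face_holonomy\<close> what
  remains of the three loops is the loop of \<open>r\<close>. It bounds because \<open>r\<close>
  lies in the commutator subgroup.\<close>

lemma bounds_face: "bounds (chain_boundary 2 (frag_of (face_simplex r)))"
proof -
  have e: "singular_simplex 1 SK (E k)" if "k \<le> 2" for k
    using singular_simplex_face_edge[OF relator_letters] that by auto
  let ?h = "\<lambda>k. skeleton_holonomy S (E k)"
  have m: "bounds (frag_of (E k) + frag_of (base_edge (E k (std_vertex 0))) - frag_of (base_edge (E k (std_vertex 1)))
    - W (?h k))" if "k \<le> 2" for k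
    by (rule bounds_monodromy[OF e[OF that]])
  have h: "?h 2 \<otimes>\<^bsub>F\<^esub> ?h 0 = r \<otimes>\<^bsub>F\<^esub> ?h 1" by (rule face_holonomy[OF relator_closed])
  have hc: "?h k \<in> carrier F" if "k \<le> 2" for k
    unfolding skeleton_holonomy_def
    by (rule F.holonomy_closed[OF continuous_map_skeleton_lift[OF relator_letters] e[OF that]])
  have "bounds ((W (?h 2) + W (?h 0) - W (?h 2 \<otimes>\<^bsub>F\<^esub> ?h 0)) - (W r + W (?h 1) - W (r \<otimes>\<^bsub>F\<^esub> ?h 1)) + W r)"
    by (intro bounds_add bounds_diff bounds_mult hc relator_closed bounds_derived r) auto
  then have "bounds (W (?h 2) + W (?h 0) - W (?h 1))" unfolding h by (simp add: algebra_simps)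
  from bounds_add[OF this bounds_add[OF bounds_diff[OF m[of 0] m[of 1]] m[of 2]]]
  moreover have cb: "chain_boundary 2 (frag_of (face_simplex r)) = frag_of (E 0) - frag_of (E 1) + frag_of (E 2)"
    by (simp add: chain_boundary_of numeral_2_eq_2)
  moreover have v: "E 0 (std_vertex 0) = E 2 (std_vertex 1)" "E 0 (std_vertex 1) = E 1 (std_vertex 1)"
      "E 1 (std_vertex 0) = E 2 (std_vertex 0)"
    by (simp_all only: singular_face_vertices)
  ultimately show ?thesis unfolding v cb by (simp add: algebra_simps)
qed

lemma singular_relcycle_disc_simplex:
  "singular_relcycle 2 (top_of_set (cball 0 1)) (sphere 0 1) (frag_of disc_simplex)"
proof -
  let ?D = "top_of_set (cball 0 1 :: complex set)"
  have *: "singular_simplex 1 (subtopology ?D (sphere 0 1)) (singular_face 2 k disc_simplex)" if k: "k \<le> 2" for k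
  proof -
    have "singular_simplex 1 ?D (singular_face 2 k disc_simplex)"
      using singular_simplex_singular_face[OF singular_simplex_disc_simplex, of k] k by simp
    moreover have "singular_face 2 k disc_simplex y \<in> sphere 0 1" if y: "y \<in> standard_simplex 1" for y
      using disc_simplex_face[OF y k] y by (simp add: singular_face_def norm_sgn)
    ultimately show ?thesis by (auto simp: singular_simplex_subtopology)
  qed
  have "singular_chain 1 (subtopology ?D (sphere 0 1)) (chain_boundary 2 (frag_of disc_simplex))"
    unfolding chain_boundary_of
    by (auto intro!: singular_chain_sum singular_chain_cmul simp: singular_chain_of *[unfolded One_nat_def])
  then show ?thesis
    by (simp add: singular_relcycle singular_chain_of singular_simplex_disc_simplex)
qed

lemma face_map_in_one_skeleton:
  "face_map r \<in> sphere 0 1 \<rightarrow> one_skeleton S"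
  using word_point_in_one_skeleton[OF relator_letters] by (auto simp: face_map_def word_loop_eq)

lemma hom_induced_disc_class:
  "hom_induced 2 (top_of_set (cball 0 1)) (sphere 0 1) P (one_skeleton S) (face_map r) disc_class =
    homologous_rel_set 2 P (one_skeleton S) (frag_of (face_simplex r))"
  using hom_induced_chain_map[OF continuous_map_face_map[OF relator_letters] face_map_in_one_skeleton
      singular_relcycle_disc_simplex]
  by (simp add: disc_class_def chain_map_of face_simplex_def)

lemma hom_induced_inclusion_class:
  assumes "singular_relcycle 2 P {} z"
  shows "hom_induced 2 P {} P (one_skeleton S) id (homologous_rel_set 2 P {} z) =
    homologous_rel_set 2 P (one_skeleton S) z"
proof -
  have "chain_map 2 id z = z" using assms by (auto simp: singular_cycle intro: chain_map_ident)
  then show ?thesis using hom_induced_chain_map[OF continuous_map_id _ assms, of "one_skeleton S"] by simp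
qed

text \<open>A chain \<open>e\<close> of the one-skeleton with the same boundary as the face is
  subtracted from the face. This existence gives access to the choice made in
  \<open>face_class\<close>.\<close>

lemma face_class_exists:
  "\<exists>z. singular_relcycle 2 P {} z \<and> homologous_rel 2 P (one_skeleton S) z (frag_of (face_simplex r))"
proof -
  obtain e where e: "singular_chain 2 SK e" "chain_boundary 2 e = chain_boundary 2 (frag_of (face_simplex r))"
    using bounds_face unfolding singular_boundary by (auto simp: numeral_2_eq_2)
  have f: "singular_chain 2 P (frag_of (face_simplex r))"
    using singular_simplex_face_simplex[OF relator_letters] by (simp add: singular_chain_of)
  have eP: "singular_chain 2 P e" using e(1) singular_chain_subtopology by blast
  have "singular_relcycle 2 P {} (frag_of (face_simplex r) - e)"
    using f eP e(2) by (simp add: singular_cycle singular_chain_diff chain_boundary_diff)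
  moreover have "singular_relboundary 2 P (one_skeleton S) (- e)"
    using singular_chain_minus[THEN iffD2, OF e(1)] by (rule singular_chain_imp_relboundary)
  ultimately show ?thesis
    by (intro exI[of _ "frag_of (face_simplex r) - e"]) (simp add: homologous_rel_def)
qed

lemma face_class_cycle:
  obtains z d where "singular_relcycle 2 P {} z" "face_class S r = homologous_rel_set 2 P {} z"
    "singular_chain 3 P d" "singular_chain 2 SK (z - frag_of (face_simplex r) - chain_boundary 3 d)"
proof -
  let ?R = "\<lambda>\<alpha>. \<alpha> \<in> carrier (homology_group 2 P) \<and> hom_induced 2 P {} P (one_skeleton S) id \<alpha> =
    hom_induced 2 (top_of_set (cball 0 1)) (sphere 0 1) P (one_skeleton S) (face_map r) disc_class"
  obtain z where z: "singular_relcycle 2 P {} z" "homologous_rel 2 P (one_skeleton S) z (frag_of (face_simplex r))"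
    using face_class_exists by blast
  have carrier: "carrier (homology_group 2 P) = homologous_rel_set 2 P {} ` singular_relcycle_set 2 P {}"
    using carrier_relative_homology_group[of 2 P "{}"] by simp
  have "?R (homologous_rel_set 2 P {} z)"
    using z carrier hom_induced_inclusion_class[OF z(1)] homologous_rel_set_eq[of 2 P "one_skeleton S" z]
      hom_induced_disc_class by auto
  then have R: "?R (face_class S r)" unfolding face_class_def by (rule someI)
  then obtain y where y: "singular_relcycle 2 P {} y" "face_class S r = homologous_rel_set 2 P {} y"
    using carrier by auto
  then have "homologous_rel 2 P (one_skeleton S) y (frag_of (face_simplex r))"
    using R hom_induced_inclusion_class[OF y(1)] hom_induced_disc_class homologous_rel_set_eq[of 2 P "one_skeleton S" y]
    by auto
  then have "singular_relboundary 2 P (one_skeleton S) (y - frag_of (face_simplex r))"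
    by (simp only: homologous_rel_def)
  then obtain d where d: "singular_chain 3 P d"
    "(chain_boundary 3 d, y - frag_of (face_simplex r)) \<in> mod_subset 2 SK"
    unfolding singular_relboundary_def by (auto simp: eval_nat_numeral)
  then have "singular_chain 2 SK (chain_boundary 3 d - (y - frag_of (face_simplex r)))" by (simp add: mod_subset_def)
  then have "singular_chain 2 SK (y - frag_of (face_simplex r) - chain_boundary 3 d)"
    using singular_chain_minus by (metis minus_diff_eq)
  with that[OF y d(1)] show ?thesis by blast
qed

text \<open>The part of the cycle in the one-skeleton has the boundary opposite to that of the face,
  so its value is found by evaluating \<open>\<psi>\<close> on the boundary of the face.\<close>

lemma evaluate_fundamental_cycle:
  assumes z: "singular_relcycle 2 P {} z" "singular_chain 3 P d"
      "singular_chain 2 SK (z - frag_of (face_simplex r) - chain_boundary 3 d)"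
    and b: "\<And>T. singular_simplex 3 P T \<Longrightarrow> coboundary 3 b T = 0"
    and \<psi>: "\<And>\<sigma>. singular_simplex 2 SK \<sigma> \<Longrightarrow> b \<sigma> = coboundary 2 \<psi> \<sigma>"
  shows "evaluate b (real_coeffs z) = b (face_simplex r) - coboundary 2 \<psi> (face_simplex r)"
proof -
  let ?f = "frag_of (face_simplex r)"
  define e where "e = z - ?f - chain_boundary 3 d"
  have "evaluate (coboundary 3 b) (real_coeffs d) = evaluate (\<lambda>_. 0) (real_coeffs d)"
    by (rule evaluate_cong) (use z(2) b in \<open>auto simp: real_coeffs_keys singular_chain_def\<close>)
  then have 1: "evaluate b (real_coeffs (chain_boundary 3 d)) = 0"
    by (simp add: evaluate_chain_boundary evaluate_def[of "\<lambda>_. 0"])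
  have "chain_boundary 2 (chain_boundary 3 d) = 0"
    using chain_boundary_boundary_alt[of 2 P d] z(2) by (simp add: eval_nat_numeral)
  then have 2: "chain_boundary 2 e = - chain_boundary 2 ?f"
    using z(1) by (simp add: e_def singular_cycle chain_boundary_diff)
  have "evaluate b (real_coeffs e) = evaluate (coboundary 2 \<psi>) (real_coeffs e)"
    by (rule evaluate_cong) (use z(3) \<psi> in \<open>auto simp: real_coeffs_keys singular_chain_def simp flip: e_def\<close>)
  also have "\<dots> = evaluate \<psi> (real_coeffs (chain_boundary 2 e))" by (simp add: evaluate_chain_boundary)
  also have "\<dots> = - evaluate \<psi> (real_coeffs (chain_boundary 2 ?f))"
    using evaluate_add[of \<psi> "real_coeffs (chain_boundary 2 e)" "real_coeffs (chain_boundary 2 ?f)"]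
    by (simp add: 2 flip: real_coeffs_simps(3) del: evaluate_add)
  also have "\<dots> = - coboundary 2 \<psi> (face_simplex r)" by (simp add: evaluate_chain_boundary)
  finally have "evaluate b (real_coeffs e) = - coboundary 2 \<psi> (face_simplex r)" .
  then show ?thesis using 1 by (simp add: e_def)
qed

end

section \<open>Quasimorphisms bound the simplicial volume from below\<close>

text \<open>The inhomogeneous coboundary of \<open>\<phi>\<close>, which is why it satisfies the
  cocycle identity in a group.\<close>

definition (in monoid) deviation :: "('a \<Rightarrow> real) \<Rightarrow> 'a \<Rightarrow> 'a \<Rightarrow> real"
  where "deviation \<phi> g h = \<phi> g + \<phi> h - \<phi> (g \<otimes> h)"

context group
begin

lemma abs_deviation_le:
  assumes "quasimorphism G \<phi>" "g \<in> carrier G" "h \<in> carrier G"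
  shows "\<bar>deviation \<phi> g h\<bar> \<le> defect G \<phi>"
  unfolding defect_def deviation_def
  by (rule cSup_upper) (use assms in \<open>auto simp: defect_values_def quasimorphism_def\<close>)

lemma defect_nonneg:
  assumes "quasimorphism G \<phi>"
  shows "0 \<le> defect G \<phi>"
  using abs_deviation_le[OF assms one_closed one_closed] by linarith

lemma additive_on_generate:
  assumes K: "K \<subseteq> carrier G" and \<phi>: "\<And>g k. \<lbrakk>g \<in> carrier G; k \<in> K\<rbrakk> \<Longrightarrow> \<phi> (g \<otimes> k) = \<phi> g + (\<phi> k :: real)"
    and ne: "K \<noteq> {}" and n: "n \<in> generate G K" and g: "g \<in> carrier G"
  shows "\<phi> (g \<otimes> n) = \<phi> g + \<phi> n"
proof -
  obtain k0 where "k0 \<in> K" using ne by blast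
  then have \<phi>1: "\<phi> \<one> = 0" using \<phi>[of \<one> k0] K by auto
  have \<phi>inv: "\<phi> (g \<otimes> inv k) = \<phi> g - \<phi> k" if "g \<in> carrier G" "k \<in> K" for g k
    using \<phi>[of "g \<otimes> inv k" k] that K by (auto simp: m_assoc subset_iff)
  show ?thesis using n g
  proof (induction arbitrary: g)
    case one
    then show ?case using \<phi>1 by simp
  next
    case (incl k)
    then show ?case using \<phi> by simp
  next
    case (inv k)
    then have "k \<in> carrier G" using K by blast
    then show ?case using \<phi>1 \<phi>inv[of g k] \<phi>inv[of \<one> k] inv by simp
  next
    case (eng h1 h2)
    have c: "h1 \<in> carrier G" "h2 \<in> carrier G" using eng.hyps generate_in_carrier[OF K] by auto
    have "\<phi> (g \<otimes> (h1 \<otimes> h2)) = \<phi> (g \<otimes> h1) + \<phi> h2"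
      using eng.IH(2)[of "g \<otimes> h1"] c eng.prems by (simp add: m_assoc)
    then show ?case using eng.IH(1)[OF eng.prems] eng.IH(2)[OF c(1)] by simp
  qed
qed

text \<open>On the powers of \<open>n\<close> the quasimorphism is linear, so a bounded deviation
  between \<open>\<phi> (inv g \<otimes> n \<otimes> g)\<close> and \<open>\<phi> n\<close> has to vanish.\<close>

lemma conjugation_invariant:
  assumes q: "quasimorphism G \<phi>" and N: "N \<lhd> G"
    and \<phi>: "\<And>g n. \<lbrakk>g \<in> carrier G; n \<in> N\<rbrakk> \<Longrightarrow> \<phi> (g \<otimes> n) = \<phi> g + \<phi> n"
    and n: "n \<in> N" and g: "g \<in> carrier G"
  shows "\<phi> (inv g \<otimes> n \<otimes> g) = \<phi> n"
proof -
  interpret N: normal N G by fact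
  have Nc: "x \<in> carrier G" if "x \<in> N" for x using that N.subset by blast
  have conj: "inv g \<otimes> x \<otimes> g \<in> N" if "x \<in> N" for x using N.inv_op_closed1[OF g that] .
  have pow: "\<phi> (x [^] (k::nat)) = k * \<phi> x \<and> x [^] k \<in> N" if "x \<in> N" for x k
  proof (induction k)
    case 0
    show ?case using \<phi>[of \<one> \<one>] by simp
  next
    case (Suc k)
    then show ?case using \<phi>[of "x [^] k" x] that Nc by (auto simp: algebra_simps)
  qed
  have cpow: "(inv g \<otimes> n \<otimes> g) [^] k = inv g \<otimes> n [^] k \<otimes> g" for k :: nat
  proof (induction k)
    case (Suc k)
    have "inv g \<otimes> n [^] k \<otimes> g \<otimes> (inv g \<otimes> n \<otimes> g) = inv g \<otimes> n [^] k \<otimes> (g \<otimes> inv g) \<otimes> n \<otimes> g"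
      using g Nc[OF n] by (simp only: m_assoc m_closed inv_closed nat_pow_closed)
    then show ?case using Suc g Nc[OF n] by (simp add: m_assoc)
  qed (use g in simp)
  \<comment> \<open>Bounds the effect of conjugation by \<open>g\<close> at every element of
    \<open>N\<close>. It does not depend on the power \<open>k\<close>, so the growth linear in
    \<open>k\<close> has to vanish.\<close>
  define C where "C = 2 * defect G \<phi> + \<bar>\<phi> g + \<phi> (inv g)\<bar>"
  have bound: "real k * \<bar>\<phi> (inv g \<otimes> n \<otimes> g) - \<phi> n\<bar> \<le> C" for k
  proof -
    have "\<bar>\<phi> (inv g \<otimes> x \<otimes> g) - \<phi> x\<bar> \<le> C" if "x \<in> N" for x
      using abs_deviation_le[OF q, of "inv g" x] abs_deviation_le[OF q, of "inv g \<otimes> x" g] g Nc[OF that]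
      by (simp add: deviation_def C_def)
    from this[of "n [^] k"] have "\<bar>k * \<phi> (inv g \<otimes> n \<otimes> g) - k * \<phi> n\<bar> \<le> C"
      using pow[OF n, of k] pow[OF conj[OF n], of k] by (simp add: cpow)
    then show ?thesis by (simp add: abs_mult flip: right_diff_distrib)
  qed
  show ?thesis
  proof (rule ccontr)
    assume "\<phi> (inv g \<otimes> n \<otimes> g) \<noteq> \<phi> n"
    then obtain k :: nat where "C < real k * \<bar>\<phi> (inv g \<otimes> n \<otimes> g) - \<phi> n\<bar>"
      using reals_Archimedean3[of "\<bar>\<phi> (inv g \<otimes> n \<otimes> g) - \<phi> n\<bar>"] by auto
    then show False using bound[of k] by linarith
  qed
qed

text \<open>In \<open>g n h m\<close> the factor \<open>n\<close> is moved past \<open>h\<close> as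
  a conjugate, and conjugation does not change \<open>\<phi>\<close> on \<open>N\<close>. The
  contributions \<open>\<phi> n\<close> and \<open>\<phi> m\<close> then cancel.\<close>

lemma deviation_on_cosets:
  assumes q: "quasimorphism G \<phi>" and N: "N \<lhd> G"
    and \<phi>: "\<And>g n. \<lbrakk>g \<in> carrier G; n \<in> N\<rbrakk> \<Longrightarrow> \<phi> (g \<otimes> n) = \<phi> g + \<phi> n"
    and g: "g \<in> carrier G" "g' \<in> N #> g" and h: "h \<in> carrier G" "h' \<in> N #> h"
  shows "deviation \<phi> g' h' = deviation \<phi> g h"
proof -
  interpret N: normal N G by fact
  have Nc: "x \<in> carrier G" if "x \<in> N" for x using that N.subset by blast
  have rep: "\<exists>n\<in>N. x' = x \<otimes> n" if x: "x \<in> carrier G" "x' \<in> N #> x" for x x'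
  proof -
    obtain n where n: "n \<in> N" "x' = n \<otimes> x" using x by (auto simp: r_coset_def)
    have "x' = x \<otimes> (inv x \<otimes> n \<otimes> x)" using n x Nc by (simp add: m_assoc[symmetric])
    then show ?thesis using N.inv_op_closed1[OF x(1) n(1)] by blast
  qed
  obtain n where n: "n \<in> N" "g' = g \<otimes> n" using rep[OF g] by blast
  obtain m where m: "m \<in> N" "h' = h \<otimes> m" using rep[OF h] by blast
  have c: "inv h \<otimes> n \<otimes> h \<in> N" using N.inv_op_closed1[OF h(1) n(1)] .
  have "h \<otimes> (inv h \<otimes> n \<otimes> h) = n \<otimes> h" using h n Nc by (simp add: m_assoc[symmetric])
  then have "g' \<otimes> h' = g \<otimes> h \<otimes> (inv h \<otimes> n \<otimes> h) \<otimes> m"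
    using n m Nc g h by (simp add: m_assoc)
  then have "\<phi> (g' \<otimes> h') = \<phi> (g \<otimes> h) + \<phi> n + \<phi> m"
    using \<phi>[of "g \<otimes> h \<otimes> (inv h \<otimes> n \<otimes> h)" m] \<phi>[of "g \<otimes> h" "inv h \<otimes> n \<otimes> h"] conjugation_invariant[OF q N \<phi> n(1) h(1)]
      g h n m c Nc by simp
  then show ?thesis using \<phi>[of g n] \<phi>[of h m] g h n m by (simp add: deviation_def)
qed

end

lemma simplex_map_singular_face:
  "\<lbrakk>1 \<le> p; k \<le> p\<rbrakk> \<Longrightarrow> singular_face p k (simplex_map p f \<sigma>) = simplex_map (p - 1) f (singular_face p k \<sigma>)"
  using simplical_face_in_standard_simplex[of p k]
  by (auto simp: singular_face_def simplex_map_def restrict_def fun_eq_iff)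

lemma coboundary_2:
  "coboundary 2 b \<sigma> = b (singular_face 2 0 \<sigma>) - b (singular_face 2 1 \<sigma>) + b (singular_face 2 2 \<sigma>)"
  by (simp add: coboundary_def eval_nat_numeral)

lemma coboundary_3:
  "coboundary 3 b T = b (singular_face 3 0 T) - b (singular_face 3 1 T) + b (singular_face 3 2 T) - b (singular_face 3 3 T)"
  by (simp add: coboundary_def eval_nat_numeral)

text \<open>Edge labels that multiply on triangles pull back the group cocycle
  \<open>\<beta>\<close>: the four faces of a tetrahedron reproduce the four terms of its
  identity.\<close>

lemma coboundary_of_multiplicative:
  assumes T: "singular_simplex 3 X T"
    and m: "\<And>\<sigma>. singular_simplex 2 X \<sigma> \<Longrightarrow>
      k (singular_face 2 1 \<sigma>) = mul (k (singular_face 2 2 \<sigma>)) (k (singular_face 2 0 \<sigma>))"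
    and k: "\<And>\<tau>. singular_simplex 1 X \<tau> \<Longrightarrow> k \<tau> \<in> A"
    and \<beta>: "\<And>a b c. \<lbrakk>a \<in> A; b \<in> A; c \<in> A\<rbrakk> \<Longrightarrow> \<beta> b c - \<beta> (mul a b) c + \<beta> a (mul b c) - \<beta> a b = (0::real)"
  shows "coboundary 3 (\<lambda>\<sigma>. \<beta> (k (singular_face 2 2 \<sigma>)) (k (singular_face 2 0 \<sigma>))) T = 0"
proof -
  define F where "F j i = singular_face 2 i (singular_face 3 j T)" for i j
  have F: "singular_simplex 2 X (singular_face 3 j T)" if "j \<le> 3" for j
    using singular_simplex_singular_face[OF T, of j] that by simp
  have F': "singular_simplex 1 X (F j i)" if "j \<le> 3" "i \<le> 2" for i j
    using singular_simplex_singular_face[OF F, of j i] that by (simp add: F_def)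
  have comm: "F j i = F i (j - 1)" if "i < j" "j \<le> 3" for i j
    using singular_face_singular_face[of i j 2 T] that by (simp add: F_def)
  have e: "F 2 2 = F 3 2" "F 0 2 = F 3 0" "F 1 0 = F 0 0" "F 1 2 = F 3 1" "F 2 0 = F 0 1"
    using comm[of 2 3] comm[of 0 3] comm[of 0 1] comm[of 1 3] comm[of 0 2] by (simp_all add: numeral_2_eq_2)
  have m': "k (F j 1) = mul (k (F j 2)) (k (F j 0))" if "j \<le> 3" for j
    using m[OF F[OF that]] by (simp add: F_def)
  have "\<beta> (k (F 3 0)) (k (F 0 0)) - \<beta> (k (F 3 1)) (k (F 0 0)) + \<beta> (k (F 3 2)) (k (F 0 1)) - \<beta> (k (F 3 2)) (k (F 3 0)) = 0"
    using \<beta>[OF F'[THEN k] F'[THEN k] F'[THEN k], of 3 2 3 0 0 0] m'[of 3] m'[of 0] e by simp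
  then show ?thesis
    by (simp add: coboundary_3 F_def[symmetric] e e[unfolded One_nat_def])
qed

lemma real_singular_chain_add:
  assumes "real_singular_chain p X c" "real_singular_chain p X d"
  shows "real_singular_chain p X (c + d)"
  using assms Poly_Mapping.keys_add[of c d] by (auto simp: real_singular_chain_def)

lemma real_chain_boundary_add:
  "real_chain_boundary p (c + d) = real_chain_boundary p c + real_chain_boundary p d"
  using real_chain_boundary_diff[of p "c + d" d] by simp

section \<open>Evaluating cocycles on the fundamental class\<close>

context
  fixes S :: "'a set" and r :: "'a word" and X :: "'b topology" and c :: "'a cell_point \<Rightarrow> 'b"
  assumes r: "r \<in> derived (free_group S) (carrier (free_group S))"
    and c: "continuous_map (presentation_complex S r) X c"
begin


text \<open>Homologous integral cycles differ by an integral boundary, so the union in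
  \<open>change_of_coefficients\<close> is one of equal sets.\<close>

lemma simplicial_class:
  obtains z d where "singular_relcycle 2 (presentation_complex S r) {} z" "singular_chain 3 (presentation_complex S r) d"
    "singular_chain 2 (skeleton_space S r) (z - frag_of (face_simplex r) - chain_boundary 3 d)"
    "change_of_coefficients 2 X (fundamental_class S r X c) =
      real_homology_class 2 X (real_coeffs (chain_map 2 c z))"
proof -
  obtain z d where z: "singular_relcycle 2 (presentation_complex S r) {} z" "face_class S r = homologous_rel_set 2 (presentation_complex S r) {} z"
    "singular_chain 3 (presentation_complex S r) d" "singular_chain 2 (skeleton_space S r) (z - frag_of (face_simplex r) - chain_boundary 3 d)"
    by (rule face_class_cycle[OF r])
  have fc: "fundamental_class S r X c = homologous_rel_set 2 X {} (chain_map 2 c z)"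
    using hom_induced_chain_map[OF c _ z(1), of "{}"] by (simp add: fundamental_class_def z(2))
  have eq: "real_homology_class 2 X (real_coeffs y) = real_homology_class 2 X (real_coeffs (chain_map 2 c z))"
    if y: "homologous_rel 2 X {} (chain_map 2 c z) y" for y
  proof -
    obtain d where d: "singular_chain 3 X d" "chain_boundary 3 d = chain_map 2 c z - y"
      using y unfolding homologous_rel_def singular_boundary by auto
    have rd: "real_singular_chain 3 X (real_coeffs d)"
      using d(1) by (simp add: real_singular_chain_def real_coeffs_keys singular_chain_def)
    have b: "real_chain_boundary 3 (real_coeffs d) = real_coeffs (chain_map 2 c z) - real_coeffs y"
      by (simp add: real_chain_boundary_real_coeffs d(2))
    have "(\<exists>d. real_singular_chain 3 X d \<and> real_chain_boundary 3 d = w - real_coeffs y) \<longleftrightarrow>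
        (\<exists>d. real_singular_chain 3 X d \<and> real_chain_boundary 3 d = w - real_coeffs (chain_map 2 c z))" for w
    proof safe
      fix d' assume d': "real_singular_chain 3 X d'" "real_chain_boundary 3 d' = w - real_coeffs y"
      show "\<exists>d. real_singular_chain 3 X d \<and> real_chain_boundary 3 d = w - real_coeffs (chain_map 2 c z)"
        using real_singular_chain_diff[OF d'(1) rd] b d'(2)
        by (intro exI[of _ "d' - real_coeffs d"]) (simp add: real_chain_boundary_diff)
    next
      fix d' assume d': "real_singular_chain 3 X d'" "real_chain_boundary 3 d' = w - real_coeffs (chain_map 2 c z)"
      show "\<exists>d. real_singular_chain 3 X d \<and> real_chain_boundary 3 d = w - real_coeffs y"
        using real_singular_chain_add[OF d'(1) rd] b d'(2)
        by (intro exI[of _ "d' + real_coeffs d"]) (simp add: real_chain_boundary_add)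
    qed
    then show ?thesis by (simp add: real_homology_class_def numeral_3_eq_3)
  qed
  have "change_of_coefficients 2 X (fundamental_class S r X c) =
      (\<Union>y\<in>homologous_rel_set 2 X {} (chain_map 2 c z). real_homology_class 2 X (real_coeffs (chain_map 2 c z)))"
    unfolding change_of_coefficients_def fc
    by (rule SUP_cong[OF refl]) (rule eq, erule CollectD)
  also have "\<dots> = real_homology_class 2 X (real_coeffs (chain_map 2 c z))"
    using homologous_rel_refl[of 2 X "{}" "chain_map 2 c z"] by blast
  finally show ?thesis by (rule that[OF z(1,3,4)])
qed

text \<open>A real boundary does not change the value of a cocycle, which leads back to the integral
  cycle in the presentation complex.\<close>

lemma evaluate_simplicial_class:
  assumes w: "w \<in> change_of_coefficients 2 X (fundamental_class S r X c)"
    and b: "\<And>T. singular_simplex 3 X T \<Longrightarrow> coboundary 3 b T = 0"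
    and \<psi>: "\<And>\<sigma>. singular_simplex 2 (skeleton_space S r) \<sigma> \<Longrightarrow> b (simplex_map 2 c \<sigma>) = coboundary 2 \<psi> \<sigma>"
  shows "evaluate b w = b (simplex_map 2 c (face_simplex r)) - coboundary 2 \<psi> (face_simplex r)"
proof -
  obtain z d where z: "singular_relcycle 2 (presentation_complex S r) {} z" "singular_chain 3 (presentation_complex S r) d"
    "singular_chain 2 (skeleton_space S r) (z - frag_of (face_simplex r) - chain_boundary 3 d)"
    "change_of_coefficients 2 X (fundamental_class S r X c) =
      real_homology_class 2 X (real_coeffs (chain_map 2 c z))"
    by (rule simplicial_class)
  obtain e where e: "real_singular_chain 3 X e" "real_chain_boundary 3 e = w - real_coeffs (chain_map 2 c z)"
    using w unfolding z(4) real_homology_class_def by auto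
  have "evaluate (coboundary 3 b) e = evaluate (\<lambda>_. 0) e"
    by (rule evaluate_cong) (use e(1) b in \<open>auto simp: real_singular_chain_def\<close>)
  then have "evaluate b (w - real_coeffs (chain_map 2 c z)) = 0"
    by (simp add: evaluate_def[of "\<lambda>_. 0"] flip: e(2) add: evaluate_real_chain_boundary)
  then have "evaluate b w = evaluate (\<lambda>\<sigma>. b (simplex_map 2 c \<sigma>)) (real_coeffs z)"
    by (simp add: evaluate_chain_map)
  also have "\<dots> = b (simplex_map 2 c (face_simplex r)) - coboundary 2 \<psi> (face_simplex r)"
  proof (rule evaluate_fundamental_cycle[OF r z(1-3) _ \<psi>])
    fix T assume T: "singular_simplex 3 (presentation_complex S r) T"
    have "singular_face 3 j (simplex_map 3 c T) = simplex_map 2 c (singular_face 3 j T)" if "j \<le> 3" for j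
      using simplex_map_singular_face[of 3 j c T] that by simp
    then show "coboundary 3 (\<lambda>\<sigma>. b (simplex_map 2 c \<sigma>)) T = 0"
      using b[OF singular_simplex_simplex_map[OF T c]] by (simp add: coboundary_3)
  qed
  finally show ?thesis .
qed

end

context
  fixes S :: "'a set" and r :: "'a word" and X :: "'b topology" and c :: "'a cell_point \<Rightarrow> 'b"
  assumes r: "r \<in> derived (free_group S) (carrier (free_group S))"
    and cw: "cw_extension_above 2 (presentation_complex S r) X c"
begin

private abbreviation (input) "K \<equiv> (\<lambda>h. conjugate (free_group S) h r) ` carrier (free_group S)"

lemma continuous_map_cw_inclusion: "continuous_map (presentation_complex S r) X c"
  using cw by (auto simp: cw_extension_above_def embedding_map_def continuous_map_in_subtopology
      dest: homeomorphic_imp_continuous_map)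

lemma conjugates_closed: "K \<subseteq> carrier (free_group S)"
  using relator_closed[OF r] by (auto simp: conjugate_def)

lemma normal_closure: "generate (free_group S) K \<lhd> (free_group S)"
proof (rule F.normal_generateI[OF conjugates_closed])
  fix k g assume "k \<in> K" and g: "g \<in> carrier (free_group S)"
  then obtain h where h: "h \<in> carrier (free_group S)" "k = conjugate (free_group S) h r" by blast
  have "g \<otimes>\<^bsub>free_group S\<^esub> k \<otimes>\<^bsub>free_group S\<^esub> inv\<^bsub>free_group S\<^esub> g = conjugate (free_group S) (g \<otimes>\<^bsub>free_group S\<^esub> h) r"
    using h g relator_closed[OF r] by (simp only: conjugate_def F.m_assoc F.m_closed F.inv_closed F.inv_mult_group)
  then show "g \<otimes>\<^bsub>free_group S\<^esub> k \<otimes>\<^bsub>free_group S\<^esub> inv\<^bsub>free_group S\<^esub> g \<in> K" using g h by blast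
qed

lemma relator_quasimorphism_additive:
  assumes "\<phi> \<in> relator_quasimorphisms S r" "g \<in> carrier (free_group S)" "n \<in> generate (free_group S) K"
  shows "\<phi> (g \<otimes>\<^bsub>free_group S\<^esub> n) = \<phi> g + \<phi> n"
proof (rule F.additive_on_generate[OF conjugates_closed _ _ assms(3,2)])
  show "\<phi> (g \<otimes>\<^bsub>free_group S\<^esub> k) = \<phi> g + \<phi> k" if "g \<in> carrier (free_group S)" "k \<in> K" for g k
    using assms(1) that by (auto simp: relator_quasimorphisms_def)
qed (use F.one_closed in blast)

theorem relator_quasimorphism_bound:
  assumes \<phi>: "\<phi> \<in> relator_quasimorphisms S r"
    and w: "w \<in> change_of_coefficients 2 X (fundamental_class S r X c)"
  shows "\<bar>\<phi> r\<bar> \<le> defect (free_group S) \<phi> * l1_norm w"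
proof -
  define N where "N = generate (free_group S) K"
  have N: "N \<lhd> (free_group S)" unfolding N_def by (rule normal_closure)
  interpret N: normal N "free_group S" by fact
  define H where "H = (free_group S) Mod N"
  define q where "q g = N #>\<^bsub>free_group S\<^esub> g" for g
  have q: "group_hom (free_group S) H q"
    unfolding H_def q_def by (intro group_hom.intro group_hom_axioms.intro F.is_group N.factorgroup_is_group N.r_coset_hom_Mod)
  interpret q: group_hom "free_group S" H q by fact
  note rc = relator_closed[OF r] and rl = relator_letters[OF r]
  have "conjugate (free_group S) \<one>\<^bsub>free_group S\<^esub> r = r" using rc by (simp only: conjugate_def F.l_one F.inv_one F.r_one)
  then have "r \<in> K" by (metis F.one_closed imageI)
  then have rN: "r \<in> N" unfolding N_def by (rule generate.incl)
  have qm: "quasimorphism (free_group S) \<phi>" using \<phi> by (simp add: relator_quasimorphisms_def)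
  have add: "\<phi> (g \<otimes>\<^bsub>free_group S\<^esub> n) = \<phi> g + \<phi> n" if "g \<in> carrier (free_group S)" "n \<in> N" for g n
    using relator_quasimorphism_additive[OF \<phi> that(1)] that(2) by (simp add: N_def)
  \<comment> \<open>Representatives of the cosets are chosen arbitrarily;
    \<open>deviation_on_cosets\<close> makes the value independent of them.\<close>
  define \<beta> where "\<beta> A B = monoid.deviation (free_group S) \<phi> (SOME a. a \<in> A) (SOME b. b \<in> B)" for A B
  have some: "(SOME a. a \<in> q g) \<in> q g" if "g \<in> carrier (free_group S)" for g
    using F.rcos_self[OF that N.subgroup_axioms] unfolding q_def by (rule someI)
  have \<beta>: "\<beta> (q g) (q h) = monoid.deviation (free_group S) \<phi> g h" if "g \<in> carrier (free_group S)" "h \<in> carrier (free_group S)" for g h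
    unfolding \<beta>_def
    by (rule F.deviation_on_cosets[OF qm N add that(1) _ that(2)]) (use some that in \<open>auto simp: q_def\<close>)
  have surj: "\<exists>g\<in>carrier (free_group S). A = q g" if "A \<in> carrier H" for A
    using that by (auto simp: H_def FactGroup_def RCOSETS_def q_def)

  \<comment> \<open>With the classes of the generators as labels the relator evaluates to the
    neutral element of \<open>H\<close>, so the classifying map exists on the 2-cell and from there
    on all of \<open>X\<close>.\<close>
  define a where "a s = q (generator s)" for s :: 'a
  have a: "\<forall>s\<in>S. a s \<in> carrier H" using q.hom_closed[OF generator_closed] by (simp add: a_def)
  have "\<forall>s\<in>fst ` set r. generator s \<in> carrier (free_group S)"
    using rl by (intro ballI generator_closed) (rule subsetD)
  from eval_word_hom_comp[OF q this] have "q r = eval_word H a r"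
    by (simp only: eval_word_generator[OF rc] a_def[abs_def])
  moreover have "q r = \<one>\<^bsub>H\<^esub>"
    using F.coset_join2[OF rc N.subgroup_axioms rN] by (simp add: q_def H_def FactGroup_def)
  ultimately have "continuous_map (presentation_complex S r) (orbit_topology H) (complex_map H a r)"
    by (intro q.H.continuous_map_complex_map rl a) simp
  from q.H.extend_over_cw_extension[OF cw order_refl this]
  obtain f where f: "continuous_map X (orbit_topology H) f"
    and fc: "\<And>p. p \<in> topspace (presentation_complex S r) \<Longrightarrow> f (c p) = complex_map H a r p" by auto
  define k where "k = holonomy H f"
  define b where "b \<sigma> = \<beta> (k (singular_face 2 2 \<sigma>)) (k (singular_face 2 0 \<sigma>))" for \<sigma>
  have kc: "k \<tau> \<in> carrier H" if "singular_simplex 1 X \<tau>" for \<tau>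
    unfolding k_def by (rule q.H.holonomy_closed[OF f that])
  have cocycle: "coboundary 3 b T = 0" if "singular_simplex 3 X T" for T
    unfolding b_def
  proof (rule coboundary_of_multiplicative[OF that])
    fix A B C assume "A \<in> carrier H" "B \<in> carrier H" "C \<in> carrier H"
    then obtain x y z where x: "x \<in> carrier (free_group S)" "y \<in> carrier (free_group S)" "z \<in> carrier (free_group S)" "A = q x" "B = q y" "C = q z"
      using surj by meson
    then show "\<beta> B C - \<beta> (A \<otimes>\<^bsub>H\<^esub> B) C + \<beta> A (B \<otimes>\<^bsub>H\<^esub> C) - \<beta> A B = 0"
      using F.m_assoc[OF x(1-3)] by (simp add: \<beta> F.deviation_def flip: q.hom_mult)
  qed (use q.H.holonomy_triangle[OF f] kc in \<open>simp_all add: k_def\<close>)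
  have bound: "\<bar>b \<sigma>\<bar> \<le> defect (free_group S) \<phi>" if "singular_simplex 2 X \<sigma>" for \<sigma>
  proof -
    have "singular_simplex 1 X (singular_face 2 j \<sigma>)" if "j \<le> 2" for j
      using singular_simplex_singular_face[OF \<open>singular_simplex 2 X \<sigma>\<close>, of j] that by simp
    then obtain x y where "x \<in> carrier (free_group S)" "y \<in> carrier (free_group S)"
      "k (singular_face 2 2 \<sigma>) = q x" "k (singular_face 2 0 \<sigma>) = q y"
      using surj kc by (meson le_numeral_extra(3) order_refl zero_le)
    then show ?thesis using F.abs_deviation_le[OF qm] by (simp add: b_def \<beta>)
  qed
  let ?h = "skeleton_holonomy S"
  have hc: "?h \<tau> \<in> carrier (free_group S)" if "singular_simplex 1 (skeleton_space S r) \<tau>" for \<tau>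
    unfolding skeleton_holonomy_def by (rule F.holonomy_closed[OF continuous_map_skeleton_lift[OF rl] that])
  \<comment> \<open>On the one-skeleton the classifying map is the image of
    \<open>skeleton_lift\<close> under \<open>q\<close>, so its holonomy is the coset of the
    holonomy in the free group.\<close>
  have kh: "k (simplex_map 1 c \<tau>) = q (?h \<tau>)" if \<tau>: "singular_simplex 1 (skeleton_space S r) \<tau>" for \<tau>
    unfolding k_def skeleton_holonomy_def
  proof (rule holonomy_hom[OF q continuous_map_skeleton_lift[OF rl] f \<tau>])
    have "singular_simplex 1 (presentation_complex S r) \<tau>" using \<tau> by (simp add: singular_simplex_subtopology)
    then show "singular_simplex 1 X (simplex_map 1 c \<tau>)"
      by (rule singular_simplex_simplex_map[OF _ continuous_map_cw_inclusion])
    fix x :: "nat \<Rightarrow> real" assume x: "x \<in> standard_simplex 1"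
    then have p: "\<tau> x \<in> one_skeleton S" using \<tau> by (auto simp: singular_simplex_subtopology)
    then have "f (c (\<tau> x)) = skeleton_map H a (\<tau> x)"
      using fc[OF one_skeleton_topspace[OF rl p]] complex_map_skeleton[OF p] by metis
    also have "\<dots> = (\<lambda>t. q (skeleton_lift S (\<tau> x) t))"
      using p q.hom_one[unfolded one_free_group]
      by (auto simp: one_skeleton_def skeleton_map_def jump_def a_def intro!: ext)
    finally show "f (simplex_map 1 c \<tau> x) = (\<lambda>t. q (skeleton_lift S (\<tau> x) t))"
      using x by (simp add: simplex_map_def)
  qed
  define \<psi> where "\<psi> \<tau> = \<phi> (?h \<tau>)" for \<tau>
  have bface: "b (simplex_map 2 c \<sigma>) = monoid.deviation (free_group S) \<phi> (?h (singular_face 2 2 \<sigma>)) (?h (singular_face 2 0 \<sigma>))"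
    if "\<And>j. j \<le> 2 \<Longrightarrow> singular_simplex 1 (skeleton_space S r) (singular_face 2 j \<sigma>)" for \<sigma>
    using that[of 0] that[of 2] simplex_map_singular_face[of 2 2 c \<sigma>] simplex_map_singular_face[of 2 0 c \<sigma>] \<beta> kh hc
    by (simp add: b_def)
  have restr: "b (simplex_map 2 c \<sigma>) = coboundary 2 \<psi> \<sigma>" if \<sigma>: "singular_simplex 2 (skeleton_space S r) \<sigma>" for \<sigma>
  proof -
    have "singular_simplex 1 (skeleton_space S r) (singular_face 2 j \<sigma>)" if "j \<le> 2" for j
      using singular_simplex_singular_face[OF \<sigma>, of j] that by simp
    moreover have "?h (singular_face 2 1 \<sigma>) = ?h (singular_face 2 2 \<sigma>) \<otimes>\<^bsub>free_group S\<^esub> ?h (singular_face 2 0 \<sigma>)"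
      unfolding skeleton_holonomy_def by (rule F.holonomy_triangle[OF continuous_map_skeleton_lift[OF rl] \<sigma>])
    ultimately show ?thesis by (simp add: bface F.deviation_def coboundary_2 \<psi>_def)
  qed
  have edges: "singular_simplex 1 (skeleton_space S r) (face_edge r j)" if "j \<le> 2" for j
    by (rule singular_simplex_face_edge[OF rl that])
  have "evaluate b w = b (simplex_map 2 c (face_simplex r)) - coboundary 2 \<psi> (face_simplex r)"
    by (rule evaluate_simplicial_class[OF r continuous_map_cw_inclusion w cocycle restr])
  \<comment> \<open>On the face the holonomies of edges 2 and 0 multiply to \<open>r\<close> times
    that of edge 1. The discrepancy with that of edge 1 itself is all that the class
    detects.\<close>
  also have "\<dots> = \<phi> (?h (face_edge r 1)) - \<phi> (r \<otimes>\<^bsub>free_group S\<^esub> ?h (face_edge r 1))"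
    using bface[OF edges] face_holonomy[OF rc] by (simp add: F.deviation_def coboundary_2 \<psi>_def)
  also have "\<dots> = - \<phi> r"
  proof -
    let ?g = "?h (face_edge r 1)"
    have g: "?g \<in> carrier (free_group S)" by (intro hc edges) simp
    \<comment> \<open>Additivity is available for factors from \<open>N\<close> on the right, so
      \<open>r\<close> is moved there as a conjugate.\<close>
    have "r \<otimes>\<^bsub>free_group S\<^esub> ?g = ?g \<otimes>\<^bsub>free_group S\<^esub> (inv\<^bsub>free_group S\<^esub> ?g \<otimes>\<^bsub>free_group S\<^esub> r \<otimes>\<^bsub>free_group S\<^esub> ?g)"
      using g rc by (simp only: F.m_assoc[symmetric] F.m_closed F.inv_closed F.r_inv F.l_one)
    then show ?thesis
      using add[OF g N.inv_op_closed1[OF g rN]] F.conjugation_invariant[OF qm N add rN g] by simp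
  qed
  finally have "\<bar>\<phi> r\<bar> = \<bar>evaluate b w\<bar>" by simp
  also have "\<dots> \<le> defect (free_group S) \<phi> * l1_norm w"
  proof (rule abs_evaluate_le)
    obtain z d where "change_of_coefficients 2 X (fundamental_class S r X c) =
      real_homology_class 2 X (real_coeffs (chain_map 2 c z))"
      by (rule simplicial_class[OF r continuous_map_cw_inclusion])
    then have "real_singular_chain 2 X w"
      using w by (simp add: real_homology_class_def real_singular_cycle_def)
    then show "\<bar>b \<sigma>\<bar> \<le> defect (free_group S) \<phi>" if "\<sigma> \<in> Poly_Mapping.keys w" for \<sigma>
      using bound that by (auto simp: real_singular_chain_def)
  qed
  finally show ?thesis .
qed

end

section \<open>A calibrating cocycle\<close>

context
  fixes s :: "real \<Rightarrow> 'v::ab_group_add \<Rightarrow> 'v"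
  assumes vs: "vector_space s"
begin

interpretation vector_space s by (rule vs)

definition sublinear :: "('v \<Rightarrow> real) \<Rightarrow> bool"
  where "sublinear p \<longleftrightarrow> (\<forall>x y. p (x + y) \<le> p x + p y) \<and> (\<forall>a x. 0 < a \<longrightarrow> p (s a x) \<le> a * p x)"

lemma sublinear_0: "sublinear p \<Longrightarrow> p 0 = 0"
proof -
  assume p: "sublinear p"
  then have "p (0 + 0) \<le> p 0 + p 0" "p (s (1/2) 0) \<le> 1/2 * p 0"
    unfolding sublinear_def by (blast, metis zero_less_divide_1_iff zero_less_numeral)
  then show "p 0 = 0" by simp
qed

text \<open>The inequality for the factor \<open>1 / a\<close> is the converse of the one for
  \<open>a\<close>.\<close>

lemma sublinear_scale:
  assumes p: "sublinear p" and a: "0 \<le> a"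
  shows "p (s a x) = a * p x"
proof (cases "a = 0")
  case False
  then have "0 < a" using a by simp
  have "p (s (1 / a) (s a x)) \<le> 1 / a * p (s a x)" "p (s a x) \<le> a * p x"
    by (rule p[unfolded sublinear_def, THEN conjunct2, rule_format]; use \<open>0 < a\<close> in simp)+
  then show ?thesis using \<open>0 < a\<close> by (simp add: field_simps)
qed (use sublinear_0[OF p] in simp)

lemma sublinear_minus:
  assumes "sublinear p"
  shows "- p (- x) \<le> p x"
proof -
  have "p (x + - x) \<le> p x + p (- x)" using assms unfolding sublinear_def by blast
  then show ?thesis using sublinear_0[OF assms] by simp
qed

text \<open>Lowers \<open>p\<close> towards linearity in the direction \<open>y\<close>: the result
  is still sublinear and below \<open>p\<close>, and at \<open>- y\<close> it is at most
  \<open>- p y\<close>. A minimal sublinear functional coincides with it for every \<open>y\<close>,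
  which amounts to additivity.\<close>

definition directional :: "('v \<Rightarrow> real) \<Rightarrow> 'v \<Rightarrow> 'v \<Rightarrow> real"
  where "directional p y x = (INF t\<in>{0..}. p (x + s t y) - t * p y)"

lemma directional_le:
  assumes p: "sublinear p" and t: "0 \<le> t"
  shows "directional p y x \<le> p (x + s t y) - t * p y"
  unfolding directional_def
proof (rule cINF_lower)
  have "- p (- x) \<le> p (x + s u y) - u * p y" if "0 \<le> u" for u
  proof -
    have "p (x + s u y + (- x)) \<le> p (x + s u y) + p (- x)"
      using p unfolding sublinear_def by blast
    then show ?thesis using sublinear_scale[OF p that, of y] by simp
  qed
  then show "bdd_below ((\<lambda>t. p (x + s t y) - t * p y) ` {0..})" by (intro bdd_belowI2) auto
qed (use t in simp)

lemma directional_greatest: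
  "(\<And>t. 0 \<le> t \<Longrightarrow> a \<le> p (x + s t y) - t * p y) \<Longrightarrow> a \<le> directional p y x"
  unfolding directional_def by (rule cINF_greatest) auto

lemma sublinear_directional:
  assumes p: "sublinear p"
  shows "sublinear (directional p y)"
  unfolding sublinear_def
proof (intro conjI allI impI)
  fix x x'
  have *: "directional p y (x + x') \<le> (p (x + s t y) - t * p y) + (p (x' + s u y) - u * p y)"
    if "0 \<le> t" "0 \<le> u" for t u
  proof -
    have "x + x' + s (t + u) y = (x + s t y) + (x' + s u y)" by (simp add: scale_left_distrib algebra_simps)
    then have "p (x + x' + s (t + u) y) \<le> p (x + s t y) + p (x' + s u y)" using p unfolding sublinear_def by metis
    then show ?thesis using directional_le[OF p, of "t + u" y "x + x'"] that by (simp add: algebra_simps)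
  qed
  have "directional p y (x + x') - (p (x' + s u y) - u * p y) \<le> directional p y x" if "0 \<le> u" for u
    by (rule directional_greatest) (use *[OF _ that] in force)
  then have "directional p y (x + x') - directional p y x \<le> directional p y x'"
    by (intro directional_greatest) force
  then show "directional p y (x + x') \<le> directional p y x + directional p y x'" by simp
next
  fix a x assume a: "0 < (a::real)"
  have "directional p y (s a x) / a \<le> p (x + s t y) - t * p y" if "0 \<le> t" for t
  proof -
    have "s a x + s (a * t) y = s a (x + s t y)" by (simp add: scale_right_distrib)
    then have "p (s a x + s (a * t) y) = a * p (x + s t y)" using sublinear_scale[OF p] a by simp
    then have "directional p y (s a x) \<le> a * (p (x + s t y) - t * p y)"
      using directional_le[OF p, of "a * t" y "s a x"] a that by (simp add: algebra_simps)
    then show ?thesis using a by (simp add: field_simps)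
  qed
  then have "directional p y (s a x) / a \<le> directional p y x" by (rule directional_greatest)
  then show "directional p y (s a x) \<le> a * directional p y x" using a by (simp add: field_simps)
qed

text \<open>Zorn's lemma downwards. The pointwise infimum of a chain is finite because every member
  is at least \<open>- q (- x)\<close>, and it is sublinear because below any two members there is
  one of the chain.\<close>

lemma minimal_sublinear_exists:
  assumes q: "sublinear q"
  shows "\<exists>m. sublinear m \<and> m \<le> q \<and> (\<forall>p. sublinear p \<and> p \<le> m \<longrightarrow> p = m)"
proof -
  define A where "A = {p. sublinear p \<and> p \<le> q}"
  let ?P = "\<lambda>p p'. p' \<le> p"
  have "\<exists>m\<in>A. \<forall>p\<in>A. ?P m p \<longrightarrow> p = m"
  proof (rule predicate_Zorn)
    show "partial_order_on A (relation_of ?P A)" by (rule partial_order_on_relation_ofI) auto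
    fix C assume "C \<in> Chains (relation_of ?P A)"
    then have C: "\<And>p p'. p \<in> C \<Longrightarrow> p' \<in> C \<Longrightarrow> p \<in> A \<and> p' \<in> A \<and> (p \<le> p' \<or> p' \<le> p)"
      unfolding Chains_def relation_of_def by blast
    show "\<exists>u\<in>A. \<forall>p\<in>C. u \<le> p"
    proof (cases "C = {}")
      case True
      then show ?thesis using q by (auto simp: A_def)
    next
      case False
      define u where "u x = (INF p\<in>C. p x)" for x
      have "bdd_below ((\<lambda>p. p x) ` C)" for x
      proof (rule bdd_belowI2)
        fix p assume "p \<in> C"
        then have "sublinear p" "p \<le> q" using C by (auto simp: A_def)
        then show "- q (- x) \<le> p x" using sublinear_minus[of p x] by (auto simp: le_fun_def intro: order_trans[rotated])
      qed
      then have low: "u x \<le> p x" if "p \<in> C" for p x unfolding u_def using that by (rule cINF_lower)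
      have great: "a \<le> u x" if "\<And>p. p \<in> C \<Longrightarrow> a \<le> p x" for a x
        unfolding u_def using False that by (rule cINF_greatest)
      have "sublinear u" unfolding sublinear_def
      proof (intro conjI allI impI)
        fix x y
        have *: "u (x + y) \<le> p x + p' y" if pp: "p \<in> C" "p' \<in> C" for p p'
        proof -
          obtain p'' where p'': "p'' \<in> C" "p'' \<le> p" "p'' \<le> p'" using C[OF pp] pp by blast
          have "u (x + y) \<le> p'' (x + y)" by (rule low[OF p''(1)])
          also have "\<dots> \<le> p'' x + p'' y" using C[OF p''(1) p''(1)] by (simp add: A_def sublinear_def)
          also have "\<dots> \<le> p x + p' y" using p'' by (intro add_mono) (auto simp: le_fun_def)
          finally show ?thesis .
        qed
        have "u (x + y) - p' y \<le> u x" if "p' \<in> C" for p' by (rule great) (use *[OF _ that] in force)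
        then have "u (x + y) - u x \<le> u y" by (intro great) force
        then show "u (x + y) \<le> u x + u y" by simp
      next
        fix a x assume a: "0 < (a::real)"
        have "u (s a x) / a \<le> p x" if "p \<in> C" for p
        proof -
          have "u (s a x) \<le> p (s a x)" by (rule low[OF that])
          also have "\<dots> \<le> a * p x" using C[OF that that] a by (simp add: A_def sublinear_def)
          finally show ?thesis using a by (simp add: field_simps)
        qed
        then have "u (s a x) / a \<le> u x" by (rule great)
        then show "u (s a x) \<le> a * u x" using a by (simp add: field_simps)
      qed
      moreover have "u \<le> q"
      proof -
        obtain p where "p \<in> C" using False by blast
        then have "u \<le> p" "p \<le> q" using low C by (auto simp: le_fun_def A_def)
        then show ?thesis by (rule order_trans)
      qed
      ultimately show ?thesis using low by (intro bexI[of _ u]) (auto simp: A_def le_fun_def)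
    qed
  qed
  then show ?thesis unfolding A_def by (auto intro: order_trans)
qed

text \<open>Minimizing below \<open>directional q w\<close> rather than below \<open>q\<close> fixes
  the value at \<open>w\<close>: at \<open>- w\<close> the functional is at most
  \<open>- q w\<close>.\<close>

lemma dominated_linear_functional:
  assumes q: "sublinear q"
  shows "\<exists>f. (\<forall>x y. f (x + y) = f x + f y) \<and> (\<forall>a x. f (s a x) = a * f x) \<and> (\<forall>x. f x \<le> q x) \<and> f w = q w"
proof -
  obtain f where f: "sublinear f" "f \<le> directional q w" "\<And>p. sublinear p \<Longrightarrow> p \<le> f \<Longrightarrow> p = f"
    using minimal_sublinear_exists[OF sublinear_directional[OF q, of w]] by auto
  have dir: "directional f y = f" for y
  proof (rule f(3)[OF sublinear_directional[OF f(1)]])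
    show "directional f y \<le> f"
      using directional_le[OF f(1), of 0 y] by (simp add: le_fun_def)
  qed
  have add: "f (x + y) = f x + f y" for x y
  proof (rule antisym)
    show "f (x + y) \<le> f x + f y" using f(1) by (simp add: sublinear_def)
    show "f x + f y \<le> f (x + y)" using directional_le[OF f(1), of 1 y x] by (simp add: dir)
  qed
  have minus: "f (- x) = - f x" for x using add[of x "- x"] sublinear_0[OF f(1)] by simp
  have scale: "f (s a x) = a * f x" for a x
  proof (cases "0 \<le> a")
    case False
    then have "f (s (- a) x) = - a * f x" by (intro sublinear_scale[OF f(1)]) simp
    then show ?thesis using minus[of "s a x"] by simp
  qed (rule sublinear_scale[OF f(1)])
  have le: "f x \<le> q x" for x
    using f(2) directional_le[OF q, of 0 w x] by (auto simp: le_fun_def intro: order_trans)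
  have "f (- w) \<le> directional q w (- w)" using f(2) by (simp add: le_fun_def)
  also have "\<dots> \<le> - q w" using directional_le[OF q, of 1 w "- w"] sublinear_0[OF q] by simp
  finally have "f w = q w" using minus[of w] le[of w] by simp
  then show ?thesis using add scale le by blast
qed

end

section \<open>The norm on real chains and its dual\<close>

definition scale_chain :: "real \<Rightarrow> ('s \<Rightarrow>\<^sub>0 real) \<Rightarrow> ('s \<Rightarrow>\<^sub>0 real)"
  where "scale_chain a = Poly_Mapping.map ((*) a)"

lemma lookup_scale_chain [simp]: "Poly_Mapping.lookup (scale_chain a c) \<sigma> = a * Poly_Mapping.lookup c \<sigma>"
  by (simp add: scale_chain_def map.rep_eq when_def)

lemma vector_space_scale_chain: "vector_space scale_chain"
  by unfold_locales (auto intro!: poly_mapping_eqI simp: lookup_add algebra_simps)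

lemma l1_norm_superset:
  assumes "finite A" "Poly_Mapping.keys c \<subseteq> A"
  shows "l1_norm c = (\<Sum>\<sigma>\<in>A. \<bar>Poly_Mapping.lookup c \<sigma>\<bar>)"
  unfolding l1_norm_def using assms by (intro sum.mono_neutral_left) (auto simp: in_keys_iff)

lemma l1_norm_triangle: "l1_norm (c + d) \<le> l1_norm c + l1_norm d"
proof -
  let ?A = "Poly_Mapping.keys c \<union> Poly_Mapping.keys d"
  have *: "l1_norm x = (\<Sum>\<sigma>\<in>?A. \<bar>Poly_Mapping.lookup x \<sigma>\<bar>)" if "x \<in> {c, d, c + d}" for x
    using that Poly_Mapping.keys_add[of c d] by (intro l1_norm_superset) auto
  show ?thesis by (simp add: * lookup_add flip: sum.distrib) (simp add: sum_mono abs_triangle_ineq)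
qed

lemma l1_norm_scale_chain: "l1_norm (scale_chain a c) = \<bar>a\<bar> * l1_norm c"
proof -
  have "l1_norm (scale_chain a c) = (\<Sum>\<sigma>\<in>Poly_Mapping.keys c. \<bar>Poly_Mapping.lookup (scale_chain a c) \<sigma>\<bar>)"
    by (rule l1_norm_superset) (auto simp: in_keys_iff)
  then show ?thesis by (simp add: l1_norm_def abs_mult sum_distrib_left)
qed

lemma l1_norm_nonneg [simp]: "0 \<le> l1_norm c"
  by (simp add: l1_norm_def sum_nonneg)

lemma evaluate_scale_chain: "evaluate b (scale_chain a c) = a * evaluate b c"
proof -
  have "evaluate b (scale_chain a c) = (\<Sum>\<sigma>\<in>Poly_Mapping.keys c. Poly_Mapping.lookup (scale_chain a c) \<sigma> * b \<sigma>)"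
    by (rule evaluate_superset) (auto simp: in_keys_iff)
  then show ?thesis by (simp add: evaluate_def sum_distrib_left mult.assoc)
qed

lemma real_chain_boundary_scale_chain:
  "real_chain_boundary p (scale_chain a d) = scale_chain a (real_chain_boundary p d)"
proof (cases "p = 0")
  case True
  then show ?thesis by (auto simp: real_chain_boundary_def intro!: poly_mapping_eqI)
next
  case False
  then show ?thesis by (intro evaluate_eqI) (simp add: evaluate_real_chain_boundary evaluate_scale_chain)
qed

lemma linear_functional_eq_evaluate:
  assumes add: "\<And>x y. f (x + y) = f x + (f y :: real)" and scale: "\<And>a x. f (scale_chain a x) = a * f x"
  shows "f c = evaluate (\<lambda>\<sigma>. f (Poly_Mapping.single \<sigma> 1)) c"
proof -
  have f0: "f 0 = 0" using add[of 0 0] by simp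
  have fsum: "f (sum g A) = (\<Sum>i\<in>A. f (g i))" for g :: "'a \<Rightarrow> _" and A
    by (induction A rule: infinite_finite_induct) (auto simp: add f0)
  have "c = (\<Sum>\<sigma>\<in>Poly_Mapping.keys c. scale_chain (Poly_Mapping.lookup c \<sigma>) (Poly_Mapping.single \<sigma> 1))"
    by (rule evaluate_eqI) (simp add: evaluate_scale_chain evaluate_def[of _ c])
  then have "f c = f (\<Sum>\<sigma>\<in>Poly_Mapping.keys c. scale_chain (Poly_Mapping.lookup c \<sigma>) (Poly_Mapping.single \<sigma> 1))"
    by (rule arg_cong)
  then show ?thesis by (simp add: fsum scale evaluate_def)
qed

text \<open>\<open>q\<close> is the seminorm of the quotient of the chains by the boundaries. A
  linear functional below it is bounded by 1 on simplices and vanishes on boundaries. Equality at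
  \<open>w\<close> gives the seminorm of the class, which is the coset of \<open>w\<close> modulo
  boundaries.\<close>

lemma calibrating_cocycle:
  assumes w: "real_singular_cycle p X w"
  obtains f where "\<And>\<sigma>. \<bar>f \<sigma>\<bar> \<le> 1"
    and "\<And>T. singular_simplex (Suc p) X T \<Longrightarrow> coboundary (Suc p) f T = 0"
    and "evaluate f w = l1_seminorm (real_homology_class p X w)"
proof -
  define Z where "Z = {d. real_singular_chain (Suc p) X d}"
  let ?D = "real_chain_boundary (Suc p)"
  define q where "q c = (INF d\<in>Z. l1_norm (c - ?D d))" for c
  have "0 \<in> Z" by (simp add: Z_def real_singular_chain_def)
  have bd0: "?D 0 = 0" by (simp add: real_chain_boundary_def)
  have bdd: "bdd_below ((\<lambda>d. l1_norm (c - ?D d)) ` Z)" for c by (rule bdd_belowI2[of _ 0]) simp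
  have low: "q c \<le> l1_norm (c - ?D d)" if "d \<in> Z" for c d
    unfolding q_def using bdd that by (rule cINF_lower)
  have great: "a \<le> q c" if "\<And>d. d \<in> Z \<Longrightarrow> a \<le> l1_norm (c - ?D d)" for a c
    unfolding q_def using \<open>0 \<in> Z\<close> that by (intro cINF_greatest) auto
  have Zadd: "d + e \<in> Z" if "d \<in> Z" "e \<in> Z" for d e using that real_singular_chain_add by (auto simp: Z_def)
  have Zscale: "scale_chain a d \<in> Z" if "d \<in> Z" for a d
    using that by (auto simp: Z_def real_singular_chain_def in_keys_iff subset_iff)
  note sl = sublinear_def[OF vector_space_scale_chain]
  have "sublinear scale_chain q" unfolding sl
  proof (intro conjI allI impI)
    fix x y
    have *: "q (x + y) \<le> l1_norm (x - ?D d) + l1_norm (y - ?D e)" if "d \<in> Z" "e \<in> Z" for d e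
    proof -
      have "q (x + y) \<le> l1_norm (x + y - ?D (d + e))" by (rule low[OF Zadd[OF that]])
      also have "x + y - ?D (d + e) = (x - ?D d) + (y - ?D e)" by (simp add: real_chain_boundary_add)
      finally show ?thesis using l1_norm_triangle by (rule order_trans)
    qed
    have "q (x + y) - l1_norm (y - ?D e) \<le> q x" if "e \<in> Z" for e by (rule great) (use *[OF _ that] in force)
    then have "q (x + y) - q x \<le> q y" by (intro great) force
    then show "q (x + y) \<le> q x + q y" by simp
  next
    fix a x assume a: "0 < (a::real)"
    have "q (scale_chain a x) / a \<le> l1_norm (x - ?D d)" if "d \<in> Z" for d
    proof -
      have "scale_chain a x - ?D (scale_chain a d) = scale_chain a (x - ?D d)"
        by (auto intro!: poly_mapping_eqI simp: real_chain_boundary_scale_chain lookup_minus lookup_add algebra_simps)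
      then show ?thesis
        using low[OF Zscale[OF that, of a], of "scale_chain a x"] a by (simp add: l1_norm_scale_chain field_simps)
    qed
    then have "q (scale_chain a x) / a \<le> q x" by (rule great)
    then show "q (scale_chain a x) \<le> a * q x" using a by (simp add: field_simps)
  qed
  from dominated_linear_functional[OF vector_space_scale_chain this, of w]
  obtain f where f: "\<And>x y. f (x + y) = f x + f y" "\<And>a x. f (scale_chain a x) = a * f x"
    "\<And>x. f x \<le> q x" "f w = q w" by auto
  define b where "b \<sigma> = f (Poly_Mapping.single \<sigma> 1)" for \<sigma>
  have fb: "f c = evaluate b c" for c
    unfolding b_def[abs_def] by (rule linear_functional_eq_evaluate[OF f(1,2)])
  have fn: "f c \<le> l1_norm c" for c
    using f(3)[of c] low[OF \<open>0 \<in> Z\<close>, of c] by (simp add: bd0)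
  have fbd: "f (?D d) \<le> 0" if "d \<in> Z" for d
    using f(3)[of "?D d"] low[OF that, of "?D d"] by (simp add: l1_norm_def)
  show thesis
  proof (rule that[of b])
    \<comment> \<open>The bound covers arbitrary functions and not just singular simplices, as
      \<open>q\<close> is defined on all finitely supported chains. Default values in
      \<open>area\<close> are thus bounded as well.\<close>
    show "\<bar>b \<sigma>\<bar> \<le> 1" for \<sigma>
      using fn[of "Poly_Mapping.single \<sigma> 1"] fn[of "Poly_Mapping.single \<sigma> (- 1)"]
      by (simp add: fb l1_norm_def abs_le_iff)
    show "coboundary (Suc p) b T = 0" if "singular_simplex (Suc p) X T" for T
    proof -
      have "Poly_Mapping.single T a \<in> Z" for a using that by (simp add: Z_def real_singular_chain_def)
      from fbd[OF this[of 1]] fbd[OF this[of "- 1"]]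
      show ?thesis by (simp add: fb evaluate_real_chain_boundary)
    qed
    have "(\<lambda>d. w - ?D d) ` Z = real_homology_class p X w"
    proof (intro equalityI subsetI)
      fix c assume "c \<in> (\<lambda>d. w - ?D d) ` Z"
      then obtain d where d: "d \<in> Z" "c = w - ?D d" by blast
      have "real_singular_cycle p X c"
        using w d real_singular_chain_boundary[of p X d] real_boundary_boundary[of p X d]
        by (simp add: real_singular_cycle_def real_chain_boundary_diff Z_def real_singular_chain_diff)
      moreover have "real_chain_boundary (Suc p) (scale_chain (-1) d) = c - w"
        using d(2) by (auto intro!: poly_mapping_eqI simp: real_chain_boundary_scale_chain lookup_minus lookup_add)
      ultimately show "c \<in> real_homology_class p X w"
        using Zscale[OF d(1), of "-1"] by (auto simp: real_homology_class_def Z_def)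
    next
      fix c assume "c \<in> real_homology_class p X w"
      then obtain d where d: "d \<in> Z" "?D d = c - w" by (auto simp: real_homology_class_def Z_def)
      have "c = w - ?D (scale_chain (-1) d)"
        using d(2) by (auto intro!: poly_mapping_eqI simp: real_chain_boundary_scale_chain lookup_minus lookup_add)
      then show "c \<in> (\<lambda>d. w - ?D d) ` Z" using Zscale[OF d(1)] by blast
    qed
    then have "q w = l1_seminorm (real_homology_class p X w)"
      by (simp add: q_def l1_seminorm_def image_image flip: \<open>_ = real_homology_class p X w\<close>)
    then show "evaluate b w = l1_seminorm (real_homology_class p X w)" using f(4) fb by simp
  qed
qed

section \<open>Cocycles on the free group are deviations\<close>

context
  fixes S :: "'a set" and \<beta> :: "'a word \<Rightarrow> 'a word \<Rightarrow> real"
  assumes \<beta>: "\<And>g h k. \<lbrakk>g \<in> carrier (free_group S); h \<in> carrier (free_group S); k \<in> carrier (free_group S)\<rbrakk> \<Longrightarrow>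
    \<beta> h k - \<beta> (g \<otimes>\<^bsub>free_group S\<^esub> h) k + \<beta> g (h \<otimes>\<^bsub>free_group S\<^esub> k) - \<beta> g h = 0"
begin

text \<open>The recursion is forced by the wish that \<open>\<beta>\<close> be the deviation:
  positive letters get the value 0, the value at an inverse letter follows from its product with the
  positive one, and that at \<open>[]\<close> from its product with itself.\<close>

fun primitive :: "'a word \<Rightarrow> real"
  where
    "primitive [] = \<beta> [] []"
  | "primitive (x # w) =
      (if snd x then 0 else \<beta> [inv_letter x] [x] + \<beta> [] []) + primitive w - \<beta> [x] w"

lemma Nil_closed: "[] \<in> carrier (free_group S)"
  by (simp add: carrier_free_group)

lemma cocycle_Nil:
  assumes "g \<in> carrier (free_group S)"
  shows "\<beta> g [] = \<beta> [] []" "\<beta> [] g = \<beta> [] []"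
  using \<beta>[OF assms Nil_closed Nil_closed] \<beta>[OF Nil_closed Nil_closed assms] assms F.l_one[of g S] F.r_one[of g S]
  by simp_all

lemma mult_letter_inverse:
  "[x] \<otimes>\<^bsub>free_group S\<^esub> [inv_letter x] = []"
  by (cases x) (simp add: mult_free_group reduce_word_def inv_letter_def)

lemma mult_letter_reduced:
  "x # w \<in> carrier (free_group S) \<Longrightarrow> [x] \<otimes>\<^bsub>free_group S\<^esub> w = x # w"
  by (simp add: mult_free_group carrier_free_group reduce_word_reduced)

text \<open>If \<open>x\<close> cancels against the first letter of \<open>w\<close>, the recursion
  is run backwards, and the cocycle identity for \<open>x\<close>, its inverse and the rest of
  \<open>w\<close> supplies the missing relation.\<close>

lemma primitive_letter:
  assumes x: "fst x \<in> S" and w: "w \<in> carrier (free_group S)"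
  shows "primitive ([x] \<otimes>\<^bsub>free_group S\<^esub> w) =
    (if snd x then 0 else \<beta> [inv_letter x] [x] + \<beta> [] []) + primitive w - \<beta> [x] w"
proof (cases "reduced_word (x # w)")
  case True
  then have "x # w \<in> carrier (free_group S)" using x w by (simp add: carrier_free_group)
  then show ?thesis using mult_letter_reduced by simp
next
  case False
  then obtain u where u: "w = inv_letter x # u"
    using w by (cases w) (auto simp: carrier_free_group reduced_word_def)
  have c: "[x] \<in> carrier (free_group S)" "[inv_letter x] \<in> carrier (free_group S)" "u \<in> carrier (free_group S)"
    using x w u by (auto simp: carrier_free_group reduced_word_def successively_Cons)
  have wu: "w = [inv_letter x] \<otimes>\<^bsub>free_group S\<^esub> u" using mult_letter_reduced w u by metis
  have "[x] \<otimes>\<^bsub>free_group S\<^esub> w = ([x] \<otimes>\<^bsub>free_group S\<^esub> [inv_letter x]) \<otimes>\<^bsub>free_group S\<^esub> u"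
    unfolding wu by (rule F.m_assoc[symmetric]) (use c in auto)
  then have xw: "[x] \<otimes>\<^bsub>free_group S\<^esub> w = u"
    using c F.l_one[of u S] by (simp add: mult_letter_inverse)
  have 1: "\<beta> [inv_letter x] u - \<beta> [] [] + \<beta> [x] w - \<beta> [x] [inv_letter x] = 0"
    using \<beta>[OF c] cocycle_Nil(2)[OF c(3)] by (simp add: mult_letter_inverse flip: wu)
  have 2: "\<beta> [inv_letter x] [x] = \<beta> [x] [inv_letter x]"
    using \<beta>[OF c(1,2,1)] cocycle_Nil[OF c(1)] mult_letter_inverse[of x] mult_letter_inverse[of "inv_letter x"]
    by simp
  have "primitive w = (if snd x then \<beta> [x] [inv_letter x] + \<beta> [] [] else 0) + primitive u - \<beta> [inv_letter x] u"
    by (simp add: u) (simp add: inv_letter_def)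
  then show ?thesis using 1 2 xw by simp
qed

text \<open>The vanishing of the second cohomology of a free group, by induction over the letters of
  \<open>v\<close>. The primitive is in general unbounded, even for bounded
  \<open>\<beta>\<close>.\<close>

lemma primitive_mult:
  assumes "v \<in> carrier (free_group S)" and w: "w \<in> carrier (free_group S)"
  shows "\<beta> v w = primitive v + primitive w - primitive (v \<otimes>\<^bsub>free_group S\<^esub> w)"
  using assms(1)
proof (induction v)
  case Nil
  then show ?case using cocycle_Nil[OF w] F.l_one[OF w] by simp
next
  case (Cons x v)
  have c: "fst x \<in> S" "[x] \<in> carrier (free_group S)" "v \<in> carrier (free_group S)"
    using Cons.prems by (auto simp: carrier_free_group reduced_word_def successively_Cons)
  have vw: "v \<otimes>\<^bsub>free_group S\<^esub> w \<in> carrier (free_group S)" using c w by simp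
  have "(x # v) \<otimes>\<^bsub>free_group S\<^esub> w = [x] \<otimes>\<^bsub>free_group S\<^esub> (v \<otimes>\<^bsub>free_group S\<^esub> w)"
    using F.m_assoc[OF c(2,3) w] mult_letter_reduced[OF Cons.prems] by simp
  then show ?case
    using primitive_letter[OF c(1) vw] Cons.IH[OF c(3)] \<beta>[OF c(2,3) w] mult_letter_reduced[OF Cons.prems]
    by simp
qed

end

section \<open>Areas in an aspherical space\<close>

text \<open>A choice with a junk value when no filling exists. For a cocycle on an aspherical space
  all fillings give the same value.\<close>

definition area :: "(((nat \<Rightarrow> real) \<Rightarrow> 'b) \<Rightarrow> real) \<Rightarrow> 'b topology \<Rightarrow> ((nat \<Rightarrow> real) \<Rightarrow> 'b) \<Rightarrow>
    ((nat \<Rightarrow> real) \<Rightarrow> 'b) \<Rightarrow> ((nat \<Rightarrow> real) \<Rightarrow> 'b) \<Rightarrow> real"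
  where "area f X a b c = f (SOME \<sigma>. singular_simplex 2 X \<sigma> \<and>
    singular_face 2 2 \<sigma> = a \<and> singular_face 2 0 \<sigma> = b \<and> singular_face 2 1 \<sigma> = c)"

context
  fixes X :: "'b topology" and f :: "((nat \<Rightarrow> real) \<Rightarrow> 'b) \<Rightarrow> real"
  assumes X: "aspherical_2 X"
    and f: "\<And>T. singular_simplex 3 X T \<Longrightarrow> coboundary 3 f T = 0"
begin

lemma cocycle_tetrahedron:
  assumes \<tau>: "singular_simplex 2 X t0" "singular_simplex 2 X t1" "singular_simplex 2 X t2" "singular_simplex 2 X t3"
    and "singular_face 2 2 t0 = singular_face 2 0 t3" "singular_face 2 0 t0 = singular_face 2 0 t1"
      "singular_face 2 1 t0 = singular_face 2 0 t2" "singular_face 2 2 t1 = singular_face 2 1 t3"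
      "singular_face 2 1 t1 = singular_face 2 1 t2" "singular_face 2 2 t2 = singular_face 2 2 t3"
  shows "f t0 - f t1 + f t2 - f t3 = 0"
proof -
  define t where "t i = (if i = 0 then t0 else if i = 1 then t1 else if i = 2 then t2 else t3)" for i :: nat
  have "\<exists>T. singular_simplex 3 X T \<and> (\<forall>i\<le>3. singular_face 3 i T = t i)"
  proof (rule sphere_fill[OF X])
    fix i j :: nat assume "i < j" "j \<le> 3"
    from less_4_cases[OF this] show "singular_face 2 i (t j) = singular_face 2 (j - 1) (t i)"
      using assms by (auto simp: t_def)
  qed (use \<tau> in \<open>simp add: t_def\<close>)
  then obtain T where "singular_simplex 3 X T" "\<And>i. i \<le> 3 \<Longrightarrow> singular_face 3 i T = t i" by blast
  then show ?thesis using f[of T] by (simp add: coboundary_3) (simp add: t_def)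
qed

text \<open>A tetrahedron whose last two vertices coincide has as faces the auxiliary triangles
  \<open>t0\<close> and \<open>t1\<close>, which contain a constant edge, and two fillings of the
  given edges. Using \<open>\<sigma>\<close> twice shows that the auxiliary terms cancel, so that
  \<open>\<sigma>\<close> and \<open>\<tau>\<close> have equal values.\<close>

lemma cocycle_eq_area:
  assumes \<sigma>: "singular_simplex 2 X \<sigma>"
  shows "f \<sigma> = area f X (singular_face 2 2 \<sigma>) (singular_face 2 0 \<sigma>) (singular_face 2 1 \<sigma>)"
proof -
  define \<tau> where "\<tau> = (SOME \<tau>. singular_simplex 2 X \<tau> \<and> singular_face 2 2 \<tau> = singular_face 2 2 \<sigma> \<and>
    singular_face 2 0 \<tau> = singular_face 2 0 \<sigma> \<and> singular_face 2 1 \<tau> = singular_face 2 1 \<sigma>)"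
  have \<tau>: "singular_simplex 2 X \<tau> \<and> singular_face 2 2 \<tau> = singular_face 2 2 \<sigma> \<and>
    singular_face 2 0 \<tau> = singular_face 2 0 \<sigma> \<and> singular_face 2 1 \<tau> = singular_face 2 1 \<sigma>"
    unfolding \<tau>_def by (rule someI[of _ \<sigma>]) (use \<sigma> in simp)
  have s: "singular_simplex 1 X (singular_face 2 0 \<sigma>)" "singular_simplex 1 X (singular_face 2 1 \<sigma>)"
    using singular_simplex_singular_face[OF \<sigma>] by simp_all
  have "singular_face 2 0 \<sigma> (std_vertex 1) = singular_face 2 1 \<sigma> (std_vertex 1)"
    by (simp only: singular_face_vertices)
  then obtain t0 t1 where t: "singular_simplex 2 X t0" "singular_face 2 2 t0 = singular_face 2 0 \<sigma>"
      "singular_face 2 1 t0 = singular_face 2 0 \<sigma>" "singular_simplex 2 X t1"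
      "singular_face 2 2 t1 = singular_face 2 1 \<sigma>" "singular_face 2 1 t1 = singular_face 2 1 \<sigma>"
      "singular_face 2 0 t0 = singular_face 2 0 t1"
    using triangle_unit(2)[OF s(1)] triangle_unit(2)[OF s(2)] unfolding triangle_def by metis
  have "f t0 - f t1 + f \<rho> - f \<sigma> = 0" if "\<rho> = \<sigma> \<or> \<rho> = \<tau>" for \<rho>
    using that \<tau> by (intro cocycle_tetrahedron) (auto simp: t t[unfolded One_nat_def] \<sigma>)
  from this[of \<sigma>] this[of \<tau>] have "f \<sigma> = f \<tau>" by simp
  then show ?thesis by (simp add: area_def \<tau>_def)
qed

lemma triangle_filling:
  assumes "triangle X a b c"
  obtains \<sigma> where "singular_simplex 2 X \<sigma>" "singular_face 2 2 \<sigma> = a" "singular_face 2 0 \<sigma> = b"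
    "singular_face 2 1 \<sigma> = c" "f \<sigma> = area f X a b c"
  using assms cocycle_eq_area unfolding triangle_def by blast

lemma area_tetrahedron:
  assumes "triangle X b c bc" "triangle X ab c abc" "triangle X a bc abc" "triangle X a b ab"
  shows "area f X b c bc - area f X ab c abc + area f X a bc abc - area f X a b ab = 0"
proof -
  obtain t0 where t0: "singular_simplex 2 X t0" "singular_face 2 2 t0 = b" "singular_face 2 0 t0 = c"
      "singular_face 2 1 t0 = bc" "f t0 = area f X b c bc" by (rule triangle_filling[OF assms(1)])
  obtain t1 where t1: "singular_simplex 2 X t1" "singular_face 2 2 t1 = ab" "singular_face 2 0 t1 = c"
      "singular_face 2 1 t1 = abc" "f t1 = area f X ab c abc" by (rule triangle_filling[OF assms(2)])
  obtain t2 where t2: "singular_simplex 2 X t2" "singular_face 2 2 t2 = a" "singular_face 2 0 t2 = bc"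
      "singular_face 2 1 t2 = abc" "f t2 = area f X a bc abc" by (rule triangle_filling[OF assms(3)])
  obtain t3 where t3: "singular_simplex 2 X t3" "singular_face 2 2 t3 = a" "singular_face 2 0 t3 = b"
      "singular_face 2 1 t3 = ab" "f t3 = area f X a b ab" by (rule triangle_filling[OF assms(4)])
  have "f t0 - f t1 + f t2 - f t3 = 0"
    by (rule cocycle_tetrahedron) (simp_all only: t0 t1 t2 t3)
  then show ?thesis by (simp add: t0 t1 t2 t3)
qed

text \<open>The prism between the two triangles is cut into three tetrahedra along the diagonals
  \<open>ua\<close>, \<open>ub\<close>, \<open>uc\<close> of its sides. Each side contributes a term
  that depends on one edge of the triangle only.\<close>

lemma area_prism:
  assumes abc: "triangle X a b c"
    and ab: "triangle X g0 a ua" "triangle X wa g1 ua" and b: "triangle X g1 b ub" "triangle X wb g2 ub"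
    and c: "triangle X g0 c uc" "triangle X wc g2 uc" and w: "triangle X wa wb wc"
  shows "area f X a b c = area f X wa wb wc + (area f X g0 a ua - area f X wa g1 ua)
    + (area f X g1 b ub - area f X wb g2 ub) - (area f X g0 c uc - area f X wc g2 uc)"
proof -
  have 1: "triangle X ua b uc" by (rule triangle_assoc'[OF ab(1) abc c(1)])
  have 2: "triangle X wa ub uc" by (rule triangle_assoc[OF ab(2) b(1) 1])
  show ?thesis
    using area_tetrahedron[OF abc 1 c(1) ab(1)] area_tetrahedron[OF b(1) 1 2 ab(2)]
      area_tetrahedron[OF b(2) c(2) 2 w] by linarith
qed

end

section \<open>Quasimorphisms from calibrating cocycles\<close>

text \<open>With \<open>k\<close> the constant edge, homotopic edges satisfy the same predicate, so
  the choice returns literally the same edge for all of them: a canonical member of each homotopy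
  class.\<close>

definition loop_representative ::
    "'b topology \<Rightarrow> ((nat \<Rightarrow> real) \<Rightarrow> 'b) \<Rightarrow> ((nat \<Rightarrow> real) \<Rightarrow> 'b) \<Rightarrow> (nat \<Rightarrow> real) \<Rightarrow> 'b"
  where "loop_representative X k a = (SOME e. triangle X k a e)"

context
  fixes X :: "'b topology" and x :: 'b
  assumes x: "x \<in> topspace X"
begin

lemma triangle_const_edge: "triangle X (const_edge x) (const_edge x) (const_edge x)"
  using triangle_unit(1)[OF singular_simplex_const_edge[OF x]] by simp

lemma triangle_const_sym:
  assumes "triangle X (const_edge x) a b" "a (std_vertex 0) = x"
  shows "triangle X (const_edge x) b a"
  using triangle_assoc[OF triangle_const_edge assms(1)] triangle_unit(1)[OF triangleD(2)[OF assms(1)]] assms(2) by simp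

lemma triangle_const_trans:
  assumes "triangle X (const_edge x) a b" "triangle X (const_edge x) b c"
  shows "triangle X (const_edge x) a c"
  by (rule triangle_assoc'[OF triangle_const_edge assms])

lemma loop_representative_eqI:
  assumes "triangle X (const_edge x) a b" "a (std_vertex 0) = x"
  shows "loop_representative X (const_edge x) a = loop_representative X (const_edge x) b"
proof -
  have "triangle X (const_edge x) a e \<longleftrightarrow> triangle X (const_edge x) b e" for e
    using triangle_const_trans assms(1) triangle_const_sym[OF assms] by metis
  then show ?thesis by (simp add: loop_representative_def)
qed

lemma triangle_loop_representative:
  assumes "singular_simplex 1 X a" "a (std_vertex 0) = x"
  shows "triangle X (const_edge x) a (loop_representative X (const_edge x) a)"
  unfolding loop_representative_def
  by (rule someI[of _ a]) (use triangle_unit(1)[OF assms(1)] assms(2) in simp)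

end

lemma simplex_map_std_vertex [simp]: "i \<le> 1 \<Longrightarrow> simplex_map 1 c \<tau> (std_vertex i) = c (\<tau> (std_vertex i))"
  by (simp add: simplex_map_def std_vertex_in_simplex)

lemmas simplex_map_std_vertex_Suc [simp] = simplex_map_std_vertex [unfolded One_nat_def]

section \<open>Loops of words in the target space\<close>

context
  fixes S :: "'a set" and r :: "'a word" and X :: "'b topology" and c :: "'a cell_point \<Rightarrow> 'b"
  assumes r: "r \<in> derived (free_group S) (carrier (free_group S))"
    and c: "continuous_map (presentation_complex S r) X c"
begin

private abbreviation (input) "FG \<equiv> free_group S"
private abbreviation (input) "K1 \<equiv> skeleton_space S r"
private abbreviation (input) "k \<equiv> const_edge (c Vertex)"
private abbreviation (input) "C \<equiv> simplex_map 1 c"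
private abbreviation (input) "g0 \<tau> \<equiv> C (base_edge (\<tau> (std_vertex 0)))"
private abbreviation (input) "g1 \<tau> \<equiv> C (base_edge (\<tau> (std_vertex 1)))"

text \<open>Words that are homotopic in \<open>X\<close> give equal loops, so whatever is built from
  these loops depends on a word only through its class in the fundamental group.\<close>

definition "word_loop_class g = loop_representative X k (C (word_edge K1 g))"

private abbreviation (input) "L \<equiv> word_loop_class"

lemma base_point_closed: "c Vertex \<in> topspace X"
  using Vertex_in_topspace[OF relator_letters[OF r]] c by (auto simp: continuous_map_def)

lemma continuous_map_skeleton: "continuous_map K1 X c"
  using c by (rule continuous_map_from_subtopology)

lemma word_edge_image:
  assumes "g \<in> carrier FG"
  shows "singular_simplex 1 X (C (word_edge K1 g))" "C (word_edge K1 g) (std_vertex 0) = c Vertex"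
    "C (word_edge K1 g) (std_vertex 1) = c Vertex"
  using word_edge[OF relator_letters[OF r], of g] assms
  by (simp_all add: carrier_free_group singular_simplex_simplex_map[OF _ continuous_map_skeleton])

lemma triangle_word_loop_class:
  assumes "g \<in> carrier FG"
  shows "triangle X k (C (word_edge K1 g)) (L g)"
  unfolding word_loop_class_def
  by (rule triangle_loop_representative[OF base_point_closed word_edge_image(1,2)[OF assms]])

lemma word_loop_class:
  assumes "g \<in> carrier FG"
  shows "singular_simplex 1 X (L g)" "L g (std_vertex 0) = c Vertex" "L g (std_vertex 1) = c Vertex"
proof -
  note t = triangleD[OF triangle_word_loop_class[OF assms]]
  show "singular_simplex 1 X (L g)" "L g (std_vertex 0) = c Vertex" "L g (std_vertex 1) = c Vertex"
    using t word_edge_image[OF assms] by (simp_all add: const_edge_def std_vertex_in_simplex)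
qed

lemma word_loop_class_eqI:
  assumes "triangle X k (L g) (L h)" "g \<in> carrier FG" "h \<in> carrier FG"
  shows "L g = L h"
proof -
  have *: "L g' = loop_representative X k (L g')" if "g' \<in> carrier FG" for g'
    by (subst word_loop_class_def)
      (rule loop_representative_eqI[OF base_point_closed triangle_word_loop_class[OF that] word_edge_image(2)[OF that]])
  have "L g = loop_representative X k (L g)" by (rule *[OF assms(2)])
  also have "\<dots> = loop_representative X k (L h)"
    by (rule loop_representative_eqI[OF base_point_closed assms(1) word_loop_class(2)[OF assms(2)]])
  also have "\<dots> = L h" by (rule *[OF assms(3), symmetric])
  finally show ?thesis .
qed

lemma triangle_replace_first:
  assumes g: "g \<in> carrier FG" and "triangle X (C (word_edge K1 g)) b u" "triangle X k u u'"
  shows "triangle X (L g) b u'"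
  by (rule triangle_assoc'[OF triangle_word_loop_class[OF g] assms(2,3)])

lemma triangle_word_loop_class_mult:
  assumes g: "g \<in> carrier FG" and h: "h \<in> carrier FG"
  shows "triangle X (L g) (L h) (L (g \<otimes>\<^bsub>FG\<^esub> h))"
proof -
  have gh: "g \<otimes>\<^bsub>FG\<^esub> h \<in> carrier FG" using g h by (rule F.m_closed)
  have "triangle X (C (word_edge K1 g)) (C (word_edge K1 h)) (C (word_edge K1 (g \<otimes>\<^bsub>FG\<^esub> h)))"
    by (rule triangle_map[OF continuous_map_skeleton triangle_word_edge_mult[OF relator_letters[OF r] g h]])
  then have 1: "triangle X (L g) (C (word_edge K1 h)) (L (g \<otimes>\<^bsub>FG\<^esub> h))"
    by (rule triangle_replace_first[OF g _ triangle_word_loop_class[OF gh]])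
  have "triangle X (L g) k (L g)" using triangle_unit(2)[OF word_loop_class(1)[OF g]] word_loop_class(3)[OF g] by simp
  from triangle_assoc[OF this triangle_word_loop_class[OF h] 1] show ?thesis .
qed

lemma word_loop_class_cong:
  assumes c: "g \<in> carrier FG" "g' \<in> carrier FG" "h \<in> carrier FG" "h' \<in> carrier FG"
    and "L g = L g'" "L h = L h'"
  shows "L (g \<otimes>\<^bsub>FG\<^esub> h) = L (g' \<otimes>\<^bsub>FG\<^esub> h')"
proof (rule word_loop_class_eqI)
  have "triangle X k (L g) (L g)" using triangle_unit(1)[OF word_loop_class(1)[OF c(1)]] word_loop_class(2)[OF c(1)] by simp
  moreover have "triangle X (L g) (L h) (L (g' \<otimes>\<^bsub>FG\<^esub> h'))"
    using triangle_word_loop_class_mult[OF c(2,4)] assms(5,6) by simp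
  ultimately show "triangle X k (L (g \<otimes>\<^bsub>FG\<^esub> h)) (L (g' \<otimes>\<^bsub>FG\<^esub> h'))"
    by (rule triangle_assoc[OF _ triangle_word_loop_class_mult[OF c(1,3)]])
qed (use c in auto)

lemma monodromy_image:
  assumes \<tau>: "singular_simplex 1 K1 \<tau>"
  shows "\<exists>u. triangle X (g0 \<tau>) (C \<tau>) u \<and> triangle X (L (skeleton_holonomy S \<tau>)) (g1 \<tau>) u"
proof -
  have h: "skeleton_holonomy S \<tau> \<in> carrier FG"
    unfolding skeleton_holonomy_def
    by (rule F.holonomy_closed[OF continuous_map_skeleton_lift[OF relator_letters[OF r]] \<tau>])
  obtain u where u: "triangle K1 (base_edge (\<tau> (std_vertex 0))) \<tau> u"
    "triangle K1 (word_edge K1 (skeleton_holonomy S \<tau>)) (base_edge (\<tau> (std_vertex 1))) u"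
    using monodromy_holonomy[OF relator_letters[OF r] \<tau>] by (auto simp: monodromy_def)
  note cu = u[THEN triangle_map[OF continuous_map_skeleton]]
  have "C u (std_vertex 0) = c Vertex" using triangleD(4)[OF cu(2)] word_edge_image(2)[OF h] by simp
  then have "triangle X k (C u) (C u)" using triangle_unit(1)[OF triangleD(3)[OF cu(1)]] by simp
  from triangle_replace_first[OF h cu(2) this] cu(1) show ?thesis by blast
qed

text \<open>In \<open>X\<close> the 2-cell fills the triangle of the three boundary edges, so the
  loops of edges 2 and 0 compose to that of edge 1, while their words multiply to \<open>r\<close>
  times the word of edge 1. Cancelling the latter leaves \<open>r\<close>.\<close>

lemma word_loop_class_relator: "L r = L \<one>\<^bsub>FG\<^esub>"
proof -
  note rc = relator_closed[OF r] and rl = relator_letters[OF r]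
  have e: "singular_simplex 1 K1 (face_edge r j)" if "j \<le> 2" for j
    by (rule singular_simplex_face_edge[OF rl that])
  let ?h = "\<lambda>j. skeleton_holonomy S (face_edge r j)"
  have hc: "?h j \<in> carrier FG" if "j \<le> 2" for j
    unfolding skeleton_holonomy_def by (rule F.holonomy_closed[OF continuous_map_skeleton_lift[OF rl] e[OF that]])
  have h: "?h 2 \<otimes>\<^bsub>FG\<^esub> ?h 0 = r \<otimes>\<^bsub>FG\<^esub> ?h 1" by (rule face_holonomy[OF rc])
  have v: "face_edge r 0 (std_vertex 0) = face_edge r 2 (std_vertex 1)"
    "face_edge r 0 (std_vertex 1) = face_edge r 1 (std_vertex 1)"
    "face_edge r 1 (std_vertex 0) = face_edge r 2 (std_vertex 0)"
    by (simp_all only: singular_face_vertices)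
  have t: "triangle X (C (face_edge r 2)) (C (face_edge r 0)) (C (face_edge r 1))"
    by (rule triangle_map[OF c]) (use singular_simplex_face_simplex[OF rl] in \<open>auto simp: triangle_def\<close>)
  obtain u2 where u2: "triangle X (g0 (face_edge r 2)) (C (face_edge r 2)) u2" "triangle X (L (?h 2)) (g1 (face_edge r 2)) u2"
    using monodromy_image[OF e[of 2]] by auto
  obtain u0 where u0: "triangle X (g1 (face_edge r 2)) (C (face_edge r 0)) u0" "triangle X (L (?h 0)) (g1 (face_edge r 1)) u0"
    using monodromy_image[OF e[of 0]] unfolding v by auto
  obtain u1 where u1: "triangle X (g0 (face_edge r 2)) (C (face_edge r 1)) u1" "triangle X (L (?h 1)) (g1 (face_edge r 1)) u1"
    using monodromy_image[OF e[of 1]] unfolding v by auto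
  have a: "triangle X u2 (C (face_edge r 0)) u1" by (rule triangle_assoc'[OF u2(1) t u1(1)])
  have b: "triangle X (L (?h 2)) u0 u1" by (rule triangle_assoc[OF u2(2) u0(1) a])
  have "triangle X (L (r \<otimes>\<^bsub>FG\<^esub> ?h 1)) (g1 (face_edge r 1)) u1"
    using triangle_assoc'[OF triangle_word_loop_class_mult[OF hc hc] u0(2) b] by (simp only: h)
  moreover have "triangle X k u1 u1"
    using triangle_unit(1)[OF triangleD(3)[OF u1(1)]] triangleD(4)[OF u1(2)] word_loop_class(2)[OF hc[of 1]] by simp
  ultimately have "triangle X k (L (?h 1)) (L (r \<otimes>\<^bsub>FG\<^esub> ?h 1))"
    by (rule triangle_right_quotient[OF u1(2)])
  then have "L (?h 1) = L (r \<otimes>\<^bsub>FG\<^esub> ?h 1)"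
    by (rule word_loop_class_eqI) (use hc rc in auto)
  then have "L (?h 1 \<otimes>\<^bsub>FG\<^esub> inv\<^bsub>FG\<^esub> ?h 1) = L (r \<otimes>\<^bsub>FG\<^esub> ?h 1 \<otimes>\<^bsub>FG\<^esub> inv\<^bsub>FG\<^esub> ?h 1)"
    by (intro word_loop_class_cong) (use hc rc in auto)
  then show ?thesis using hc[of 1] rc by (simp only: F.m_assoc F.r_inv F.r_one F.inv_closed)
qed

end

theorem calibrated_quasimorphism:
  fixes S :: "'a set" and X :: "'b topology"
  assumes r: "r \<in> derived (free_group S) (carrier (free_group S))"
    and c: "continuous_map (presentation_complex S r) X c" and X: "aspherical_2 X"
    and f1: "\<And>\<sigma>. \<bar>f \<sigma>\<bar> \<le> 1" and f: "\<And>T. singular_simplex 3 X T \<Longrightarrow> coboundary 3 f T = 0"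
    and w: "w \<in> change_of_coefficients 2 X (fundamental_class S r X c)"
  shows "\<exists>\<phi>\<in>relator_quasimorphisms S r. defect (free_group S) \<phi> \<le> 1 \<and> \<phi> r = evaluate f w"
proof -
  let ?F = "free_group S" and ?SK = "skeleton_space S r" and ?h = "skeleton_holonomy S"
  let ?C = "simplex_map 1 c" and ?A = "area f X"
  let ?g0 = "\<lambda>\<tau>. ?C (base_edge (\<tau> (std_vertex 0)))" and ?g1 = "\<lambda>\<tau>. ?C (base_edge (\<tau> (std_vertex 1)))"
  note rc = relator_closed[OF r] and rl = relator_letters[OF r]
  define L where "L = word_loop_class S r X c"
  have cong: "L (g \<otimes>\<^bsub>?F\<^esub> h) = L (g' \<otimes>\<^bsub>?F\<^esub> h')"
    if "g \<in> carrier ?F" "g' \<in> carrier ?F" "h \<in> carrier ?F" "h' \<in> carrier ?F" "L g = L g'" "L h = L h'" for g g' h h'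
    using word_loop_class_cong[OF r c that(1-4)] that(5,6) unfolding L_def by blast
  have Lmult: "triangle X (L g) (L h) (L (g \<otimes>\<^bsub>?F\<^esub> h))" if "g \<in> carrier ?F" "h \<in> carrier ?F" for g h
    unfolding L_def by (rule triangle_word_loop_class_mult[OF r c that])
  have Lr: "L r = L \<one>\<^bsub>?F\<^esub>" unfolding L_def by (rule word_loop_class_relator[OF r c])
  have A1: "\<bar>?A a b e\<bar> \<le> 1" for a b e unfolding area_def by (rule f1)

  \<comment> \<open>Words in the same classes have literally the same three loops here, so
    \<open>\<beta>\<close> factors through homotopy classes in \<open>X\<close>. Being a value of
    \<open>f\<close>, it is bounded by 1.\<close>
  define \<beta> where "\<beta> g h = ?A (L g) (L h) (L (g \<otimes>\<^bsub>?F\<^esub> h))" for g h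
  have \<beta>: "\<beta> h k - \<beta> (g \<otimes>\<^bsub>?F\<^esub> h) k + \<beta> g (h \<otimes>\<^bsub>?F\<^esub> k) - \<beta> g h = 0"
    if c: "g \<in> carrier ?F" "h \<in> carrier ?F" "k \<in> carrier ?F" for g h k
    using area_tetrahedron[OF X f Lmult[OF c(2,3)] Lmult[OF F.m_closed[OF c(1,2)] c(3)] _ Lmult[OF c(1,2)]]
      Lmult[OF c(1) F.m_closed[OF c(2,3)]] F.m_assoc[OF c]
    by (simp only: \<beta>_def)
  define p where "p = primitive \<beta>"
  have p: "\<beta> g h = p g + p h - p (g \<otimes>\<^bsub>?F\<^esub> h)" if "g \<in> carrier ?F" "h \<in> carrier ?F" for g h
    unfolding p_def by (rule primitive_mult[OF \<beta> that])
  note c1 = F.one_closed[of S]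
  have \<beta>L: "\<beta> g h = \<beta> g' h'"
    if "g \<in> carrier ?F" "g' \<in> carrier ?F" "h \<in> carrier ?F" "h' \<in> carrier ?F" "L g = L g'" "L h = L h'" for g g' h h'
    unfolding \<beta>_def using that cong[OF that] by simp
  have \<beta>1: "\<beta> g \<one>\<^bsub>?F\<^esub> = p \<one>\<^bsub>?F\<^esub>" "\<beta> \<one>\<^bsub>?F\<^esub> g = p \<one>\<^bsub>?F\<^esub>" if "g \<in> carrier ?F" for g
    using p[OF that c1] p[OF c1 that] F.l_one[OF that] F.r_one[OF that] by auto

  \<comment> \<open>Against elements with trivial loop \<open>p\<close> is additive only up to the
    constant \<open>p \<one>\<close>. Subtracting the constant could raise the defect above 1,
    whereas in this difference it cancels, and half the difference of two values of
    \<open>\<beta>\<close> is still bounded by 1.\<close>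
  define \<phi> where "\<phi> g = (p (inv\<^bsub>?F\<^esub> g) - p g) / 2" for g
  have dev: "\<phi> g + \<phi> h - \<phi> (g \<otimes>\<^bsub>?F\<^esub> h) = (\<beta> (inv\<^bsub>?F\<^esub> h) (inv\<^bsub>?F\<^esub> g) - \<beta> g h) / 2"
    if "g \<in> carrier ?F" "h \<in> carrier ?F" for g h
    using that p[OF that] p[OF F.inv_closed[OF that(2)] F.inv_closed[OF that(1)]]
    by (simp only: \<phi>_def F.inv_mult_group) (simp add: field_simps)
  have dev_le: "v \<le> 1" if "v \<in> defect_values ?F \<phi>" for v
  proof -
    obtain g h where gh: "g \<in> carrier ?F" "h \<in> carrier ?F" "v = \<bar>\<phi> g + \<phi> h - \<phi> (g \<otimes>\<^bsub>?F\<^esub> h)\<bar>"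
      using \<open>v \<in> _\<close> by (auto simp: defect_values_def)
    have "\<bar>\<beta> g h\<bar> \<le> 1" for g h unfolding \<beta>_def by (rule A1)
    from this[of g h] this[of "inv\<^bsub>?F\<^esub> h" "inv\<^bsub>?F\<^esub> g"] show ?thesis
      unfolding gh(3) dev[OF gh(1,2)] by (simp add: abs_le_iff)
  qed
  have qm: "quasimorphism ?F \<phi>"
    unfolding quasimorphism_def using dev_le by (intro bdd_aboveI)
  have "\<bar>\<phi> \<one>\<^bsub>?F\<^esub> + \<phi> \<one>\<^bsub>?F\<^esub> - \<phi> (\<one>\<^bsub>?F\<^esub> \<otimes>\<^bsub>?F\<^esub> \<one>\<^bsub>?F\<^esub>)\<bar> \<in> defect_values ?F \<phi>"
    unfolding defect_values_def using c1 by blast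
  then have defect: "defect ?F \<phi> \<le> 1" unfolding defect_def using dev_le by (intro cSup_least) auto
  have Lconj: "L (conjugate ?F h r) = L \<one>\<^bsub>?F\<^esub>" if h: "h \<in> carrier ?F" for h
  proof -
    have "L (h \<otimes>\<^bsub>?F\<^esub> r) = L (h \<otimes>\<^bsub>?F\<^esub> \<one>\<^bsub>?F\<^esub>)" by (rule cong) (use h rc c1 Lr in auto)
    then have "L (h \<otimes>\<^bsub>?F\<^esub> r \<otimes>\<^bsub>?F\<^esub> inv\<^bsub>?F\<^esub> h) = L (h \<otimes>\<^bsub>?F\<^esub> inv\<^bsub>?F\<^esub> h)"
      by (intro cong) (use h rc F.r_one[OF h] in \<open>auto simp del: one_free_group\<close>)
    then show ?thesis using h by (simp only: conjugate_def F.r_inv)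
  qed
  have Linv: "L (inv\<^bsub>?F\<^esub> k) = L \<one>\<^bsub>?F\<^esub>" if k: "k \<in> carrier ?F" "L k = L \<one>\<^bsub>?F\<^esub>" for k
  proof -
    have "L (k \<otimes>\<^bsub>?F\<^esub> inv\<^bsub>?F\<^esub> k) = L (\<one>\<^bsub>?F\<^esub> \<otimes>\<^bsub>?F\<^esub> inv\<^bsub>?F\<^esub> k)"
      by (rule cong) (use k c1 in auto)
    then show ?thesis using k(1) by (simp only: F.r_inv F.l_one F.inv_closed)
  qed
  have "\<phi> (g \<otimes>\<^bsub>?F\<^esub> conjugate ?F h r) = \<phi> g + \<phi> (conjugate ?F h r)"
    if g: "g \<in> carrier ?F" and h: "h \<in> carrier ?F" for g h
  proof -
    have k: "conjugate ?F h r \<in> carrier ?F" using h rc by (simp add: conjugate_def)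
    \<comment> \<open>\<open>\<beta>\<close> cannot distinguish the conjugate from \<one>, so both
      terms of \<open>dev\<close> are the same constant.\<close>
    have "\<beta> g (conjugate ?F h r) = p \<one>\<^bsub>?F\<^esub>"
      using \<beta>L[OF g g k c1 refl Lconj[OF h]] \<beta>1[OF g] by simp
    moreover have "\<beta> (inv\<^bsub>?F\<^esub> conjugate ?F h r) (inv\<^bsub>?F\<^esub> g) = p \<one>\<^bsub>?F\<^esub>"
      using \<beta>L[OF F.inv_closed[OF k] c1 F.inv_closed[OF g] F.inv_closed[OF g] Linv[OF k Lconj[OF h]] refl]
        \<beta>1[OF F.inv_closed[OF g]] by simp
    ultimately show ?thesis using dev[OF g k] by simp
  qed
  then have Q: "\<phi> \<in> relator_quasimorphisms S r" using qm by (simp add: relator_quasimorphisms_def)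

  define u where "u \<tau> = (SOME u. triangle X (?g0 \<tau>) (?C \<tau>) u \<and> triangle X (L (?h \<tau>)) (?g1 \<tau>) u)" for \<tau>
  have u: "triangle X (?g0 \<tau>) (?C \<tau>) (u \<tau>)" "triangle X (L (?h \<tau>)) (?g1 \<tau>) (u \<tau>)"
    if "singular_simplex 1 ?SK \<tau>" for \<tau>
    using someI_ex[OF monodromy_image[OF r c that]] unfolding u_def L_def by auto
  \<comment> \<open>The area between an edge of the one-skeleton and the loop of its holonomy, the
    two being joined by base edges. With this correction to \<open>p\<close>, the cocycle
    \<open>f\<close> becomes a coboundary on the one-skeleton.\<close>
  define \<kappa> where "\<kappa> \<tau> = ?A (?g0 \<tau>) (?C \<tau>) (u \<tau>) - ?A (L (?h \<tau>)) (?g1 \<tau>) (u \<tau>)" for \<tau>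
  define \<psi> where "\<psi> \<tau> = p (?h \<tau>) + \<kappa> \<tau>" for \<tau>
  have hc: "?h \<tau> \<in> carrier ?F" if "singular_simplex 1 ?SK \<tau>" for \<tau>
    unfolding skeleton_holonomy_def by (rule F.holonomy_closed[OF continuous_map_skeleton_lift[OF rl] that])
  \<comment> \<open>Only the loops have to agree, not the words. For the face simplex the words
    differ by the factor \<open>r\<close>, and the right-hand side measures this difference.\<close>
  have prism: "f (simplex_map 2 c \<sigma>) - coboundary 2 \<psi> \<sigma> =
      p (?h (singular_face 2 1 \<sigma>)) - p (?h (singular_face 2 2 \<sigma>) \<otimes>\<^bsub>?F\<^esub> ?h (singular_face 2 0 \<sigma>))"
    if \<sigma>: "singular_simplex 2 (presentation_complex S r) \<sigma>"
      and edges: "\<And>j. j \<le> 2 \<Longrightarrow> singular_simplex 1 ?SK (singular_face 2 j \<sigma>)"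
      and hL: "L (?h (singular_face 2 1 \<sigma>)) = L (?h (singular_face 2 2 \<sigma>) \<otimes>\<^bsub>?F\<^esub> ?h (singular_face 2 0 \<sigma>))" for \<sigma>
  proof -
    let ?E = "\<lambda>j. singular_face 2 j \<sigma>"
    have s: "singular_simplex 2 X (simplex_map 2 c \<sigma>)" by (rule singular_simplex_simplex_map[OF \<sigma> c])
    have E: "singular_face 2 j (simplex_map 2 c \<sigma>) = ?C (?E j)" if "j \<le> 2" for j
      using simplex_map_singular_face[of 2 j c \<sigma>] that by simp
    have v: "?g0 (?E 0) = ?g1 (?E 2)" "?g1 (?E 0) = ?g1 (?E 1)" "?g0 (?E 1) = ?g0 (?E 2)"
      by (simp_all only: singular_face_vertices)
    have t: "triangle X (?C (?E 2)) (?C (?E 0)) (?C (?E 1))"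
      by (rule triangle_map[OF c]) (use \<sigma> in \<open>auto simp: triangle_def\<close>)
    have e: "singular_simplex 1 ?SK (?E 0)" "singular_simplex 1 ?SK (?E 1)" "singular_simplex 1 ?SK (?E 2)"
      by (rule edges, simp)+
    note u0 = u[OF e(1), unfolded v(1,2)]
    note u1 = u[OF e(2), unfolded v(3)]
    note u2 = u[OF e(3)]
    have "f (simplex_map 2 c \<sigma>) = ?A (?C (?E 2)) (?C (?E 0)) (?C (?E 1))"
      using cocycle_eq_area[OF X f s] by (simp only: E order_refl one_le_numeral zero_le)
    also have "\<dots> = ?A (L (?h (?E 2))) (L (?h (?E 0))) (L (?h (?E 1))) + \<kappa> (?E 2) + \<kappa> (?E 0) - \<kappa> (?E 1)"
      unfolding \<kappa>_def v
      by (rule area_prism[OF X f t u2 u0 u1])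
        (use Lmult[OF hc[OF e(3)] hc[OF e(1)]] hL in simp_all)
    also have "?A (L (?h (?E 2))) (L (?h (?E 0))) (L (?h (?E 1))) = \<beta> (?h (?E 2)) (?h (?E 0))"
      by (simp only: \<beta>_def hL)
    also have "\<dots> = p (?h (?E 2)) + p (?h (?E 0)) - p (?h (?E 2) \<otimes>\<^bsub>?F\<^esub> ?h (?E 0))"
      by (intro p hc edges) simp_all
    finally show ?thesis by (simp add: coboundary_2 \<psi>_def)
  qed
  have restr: "f (simplex_map 2 c \<sigma>) = coboundary 2 \<psi> \<sigma>" if \<sigma>: "singular_simplex 2 ?SK \<sigma>" for \<sigma>
  proof -
    have e: "singular_simplex 1 ?SK (singular_face 2 j \<sigma>)" if "j \<le> 2" for j
      using singular_simplex_singular_face[OF \<sigma>, of j] that by simp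
    have "?h (singular_face 2 1 \<sigma>) = ?h (singular_face 2 2 \<sigma>) \<otimes>\<^bsub>?F\<^esub> ?h (singular_face 2 0 \<sigma>)"
      unfolding skeleton_holonomy_def by (rule F.holonomy_triangle[OF continuous_map_skeleton_lift[OF rl] \<sigma>])
    then show ?thesis using prism[OF _ e] \<sigma> by (simp add: singular_simplex_subtopology)
  qed
  have edges: "singular_simplex 1 ?SK (face_edge r j)" if "j \<le> 2" for j
    by (rule singular_simplex_face_edge[OF rl that])
  let ?h1 = "?h (face_edge r 1)"
  have h1: "?h1 \<in> carrier ?F" by (intro hc edges) simp
  have hr: "?h (face_edge r 2) \<otimes>\<^bsub>?F\<^esub> ?h (face_edge r 0) = r \<otimes>\<^bsub>?F\<^esub> ?h1" by (rule face_holonomy[OF rc])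
  have "L (r \<otimes>\<^bsub>?F\<^esub> ?h1) = L (\<one>\<^bsub>?F\<^esub> \<otimes>\<^bsub>?F\<^esub> ?h1)" by (rule cong) (use rc h1 c1 Lr in auto)
  then have hL: "L ?h1 = L (?h (face_edge r 2) \<otimes>\<^bsub>?F\<^esub> ?h (face_edge r 0))" unfolding hr using F.l_one[OF h1] by simp
  have "evaluate f w = f (simplex_map 2 c (face_simplex r)) - coboundary 2 \<psi> (face_simplex r)"
    by (rule evaluate_simplicial_class[OF r c w f restr])
  also have "\<dots> = p ?h1 - p (r \<otimes>\<^bsub>?F\<^esub> ?h1)"
    using prism[OF singular_simplex_face_simplex[OF rl] edges hL] unfolding hr .
  also have "\<dots> = \<beta> r ?h1 - p r" using p[OF rc h1] by simp
  also have "\<beta> r ?h1 = p \<one>\<^bsub>?F\<^esub>" using \<beta>L[OF rc c1 h1 h1 Lr refl] \<beta>1[OF h1] by simp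
  \<comment> \<open>Antisymmetrizing loses nothing at \<open>r\<close>: since the loop of
    \<open>r\<close> is trivial, \<open>p r\<close> and the value of \<open>p\<close> at its inverse
    lie symmetrically about \<open>p \<one>\<close>.\<close>
  also have "p \<one>\<^bsub>?F\<^esub> - p r = \<phi> r"
  proof -
    have "\<beta> r (inv\<^bsub>?F\<^esub> r) = p \<one>\<^bsub>?F\<^esub>"
      using \<beta>L[OF rc c1 F.inv_closed[OF rc] F.inv_closed[OF rc] Lr refl] \<beta>1[OF F.inv_closed[OF rc]] by simp
    then have "p r + p (inv\<^bsub>?F\<^esub> r) = 2 * p \<one>\<^bsub>?F\<^esub>"
      using p[OF rc F.inv_closed[OF rc]] F.r_inv[OF rc] by simp
    then show ?thesis by (simp add: \<phi>_def field_simps)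
  qed
  finally show ?thesis using Q defect by auto
qed

text \<open>Supplies a nonnegative quotient when the seminorm is 0. The exponent sum
  \<open>n\<close> of the letter \<open>s\<close> vanishes on commutators, so the indicator of its
  nonzero values is unchanged by conjugates of \<open>r\<close>; the generator \<open>s\<close> and
  its inverse produce the deviation 2.\<close>

lemma relator_quasimorphism_exists:
  assumes r: "r \<in> derived (free_group S) (carrier (free_group S))" and S: "s \<in> S"
  shows "\<exists>\<phi>\<in>relator_quasimorphisms S r. 0 < defect (free_group S) \<phi> \<and> 0 \<le> \<phi> r"
proof -
  let ?F = "free_group S"
  interpret Z: comm_group integer_group by (rule abelian_integer_group)
  define a :: "'a \<Rightarrow> int" where "a t = (if t = s then 1 else 0)" for t
  define n where "n = eval_word integer_group a"
  interpret n: group_hom ?F integer_group n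
    unfolding n_def
    by (intro group_hom.intro group_hom_axioms.intro F.is_group Z.is_group Z.eval_word_hom) simp
  have "n ` derived ?F (carrier ?F) \<subseteq> {0}"
    using n.derived_img[of "carrier ?F"] Z.derived_eq_singleton by auto
  then have nr: "n r = 0" using r by blast
  note rc = relator_closed[OF r]
  have hom: "n (g \<otimes>\<^bsub>?F\<^esub> h) = n g + n h" if "g \<in> carrier ?F" "h \<in> carrier ?F" for g h
    using n.hom_mult[OF that] by simp
  have inv: "n (inv\<^bsub>?F\<^esub> g) = - n g" if "g \<in> carrier ?F" for g
    using n.hom_inv[OF that] by simp
  define \<phi> :: "'a word \<Rightarrow> real" where "\<phi> g = (if n g = 0 then 0 else 1)" for g
  have conj: "n (conjugate ?F h r) = 0" "conjugate ?F h r \<in> carrier ?F" if "h \<in> carrier ?F" for h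
    using that rc nr by (auto simp: conjugate_def hom inv simp del: one_free_group)
  have bdd: "bdd_above (defect_values ?F \<phi>)"
    by (rule bdd_aboveI[of _ 2]) (auto simp: defect_values_def \<phi>_def)
  then have "\<phi> \<in> relator_quasimorphisms S r"
    using conj by (simp add: relator_quasimorphisms_def quasimorphism_def \<phi>_def hom)
  moreover have "0 < defect ?F \<phi>"
  proof -
    have g: "generator s \<in> carrier ?F" by (rule generator_closed[OF S])
    have "n (generator s) = 1" by (simp add: n_def generator_def a_def)
    then have "\<phi> (generator s) + \<phi> (inv\<^bsub>?F\<^esub> generator s) - \<phi> (generator s \<otimes>\<^bsub>?F\<^esub> inv\<^bsub>?F\<^esub> generator s) = 2"
      using g hom[OF g F.inv_closed[OF g]] inv[OF g] by (simp add: \<phi>_def del: F.r_inv)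
    moreover have "\<bar>\<phi> (generator s) + \<phi> (inv\<^bsub>?F\<^esub> generator s) - \<phi> (generator s \<otimes>\<^bsub>?F\<^esub> inv\<^bsub>?F\<^esub> generator s)\<bar>
        \<in> defect_values ?F \<phi>"
      unfolding defect_values_def using g F.inv_closed[OF g] by blast
    ultimately have "2 \<in> defect_values ?F \<phi>" by simp
    then have "2 \<le> defect ?F \<phi>" unfolding defect_def using bdd by (rule cSup_upper)
    then show ?thesis by simp
  qed
  moreover have "0 \<le> \<phi> r" by (simp add: \<phi>_def)
  ultimately show ?thesis by blast
qed

text \<open>The supremum is formed in the extended reals, where it is meaningful before the
  quotients are known to be bounded.\<close>

theorem proposition3p15:
  fixes S :: "'a set" and r :: "'a word"
    and X :: "'b topology" and c :: "'a cell_point \<Rightarrow> 'b"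
  assumes "r \<in> derived (free_group S) (carrier (free_group S)) - {\<one>\<^bsub>free_group S\<^esub>}"
    and "cw_extension_above 2 (presentation_complex S r) X c"
    and "classifying_space (one_relator_group S r) X (c Vertex)"
  shows "ereal (simplicial_volume S r X c) =
    (SUP \<phi> \<in> {\<phi> \<in> relator_quasimorphisms S r. defect (free_group S) \<phi> > 0}.
      ereal (\<phi> r / defect (free_group S) \<phi>))"
proof -
  let ?F = "free_group S"
  let ?A = "change_of_coefficients 2 X (fundamental_class S r X c)"
  let ?Q = "{\<phi> \<in> relator_quasimorphisms S r. 0 < defect ?F \<phi>}"
  have r: "r \<in> derived ?F (carrier ?F)" "r \<noteq> []" using assms(1) by auto
  note c = continuous_map_cw_inclusion[OF r(1) assms(2)]
  have X: "aspherical_2 X" using assms(3) by (simp add: classifying_space_def aspherical_2_def)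
  obtain z where z: "singular_relcycle 2 (presentation_complex S r) {} z"
    "?A = real_homology_class 2 X (real_coeffs (chain_map 2 c z))"
    by (rule simplicial_class[OF r(1) c])
  define w where "w = real_coeffs (chain_map 2 c z)"
  have "singular_relcycle 2 X {} (chain_map 2 c z)"
    using singular_relcycle_chain_map[OF z(1) c, of "{}"] by simp
  then have w: "real_singular_cycle 2 X w"
    by (simp add: w_def real_singular_cycle_def real_singular_chain_def real_coeffs_keys
        real_chain_boundary_real_coeffs singular_cycle singular_chain_def)
  have A: "?A = real_homology_class 2 X w" by (simp add: z(2) w_def)
  have "real_chain_boundary (Suc 2) 0 = w - w" by (simp add: real_chain_boundary_def)
  then have wA: "w \<in> ?A"
    unfolding A real_homology_class_def using w by (auto simp: real_singular_chain_def intro!: exI[of _ 0])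
  have bdd: "bdd_below (l1_norm ` ?A)" by (rule bdd_belowI2[of _ 0]) simp
  have upper: "\<phi> r \<le> defect ?F \<phi> * l1_norm y" if "\<phi> \<in> relator_quasimorphisms S r" "y \<in> ?A" for \<phi> y
    using relator_quasimorphism_bound[OF r(1) assms(2) that] by linarith
  define V where "V = simplicial_volume S r X c"
  have V: "V = Inf (l1_norm ` ?A)" by (simp add: V_def simplicial_volume_def l1_seminorm_def)
  have V0: "0 \<le> V" unfolding V by (rule cINF_greatest) (use wA in auto)
  have "(SUP \<phi>\<in>?Q. ereal (\<phi> r / defect ?F \<phi>)) \<le> ereal V"
  proof (rule SUP_least)
    fix \<phi> assume \<phi>: "\<phi> \<in> ?Q"
    have "\<phi> r / defect ?F \<phi> \<le> V" unfolding V
      by (rule cINF_greatest) (use upper wA \<phi> in \<open>auto simp: field_simps\<close>)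
    then show "ereal (\<phi> r / defect ?F \<phi>) \<le> ereal V" by simp
  qed
  moreover have "\<exists>\<phi>\<in>?Q. V \<le> \<phi> r / defect ?F \<phi>"
  proof (cases "V = 0")
    \<comment> \<open>A calibrating quasimorphism could have defect 0 here and fall outside the
      index set. A nonnegative value at \<open>r\<close> with positive defect suffices; a letter
      \<open>s\<close> exists since \<open>r\<close> is not empty.\<close>
    case True
    have "fst (hd r) \<in> S" using relator_letters[OF r(1)] r(2) by auto
    from relator_quasimorphism_exists[OF r(1) this] True show ?thesis by auto
  next
    case False
    obtain f where f: "\<And>\<sigma>. \<bar>f \<sigma>\<bar> \<le> 1" "\<And>T. singular_simplex (Suc 2) X T \<Longrightarrow> coboundary (Suc 2) f T = 0"
      "evaluate f w = l1_seminorm (real_homology_class 2 X w)"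
      by (rule calibrating_cocycle[OF w]) blast
    have "coboundary 3 f T = 0" if "singular_simplex 3 X T" for T
      using f(2)[of T] that by simp
    from calibrated_quasimorphism[OF r(1) c X f(1) this wA]
    obtain \<phi> where \<phi>: "\<phi> \<in> relator_quasimorphisms S r" "defect ?F \<phi> \<le> 1" "\<phi> r = evaluate f w" by auto
    have \<phi>V: "\<phi> r = V" using \<phi>(3) f(3) A by (simp add: V_def simplicial_volume_def)
    have "0 < V" using V0 False by simp
    \<comment> \<open>By \<open>upper\<close> a quasimorphism of defect 0 satisfies
      \<open>\<phi> r \<le> 0\<close>, contrary to \<open>\<phi> r = V\<close>.\<close>
    have "defect ?F \<phi> \<noteq> 0" using upper[OF \<phi>(1) wA] \<phi>V \<open>0 < V\<close> by auto
    moreover have "0 \<le> defect ?F \<phi>" using \<phi>(1) by (intro F.defect_nonneg) (simp add: relator_quasimorphisms_def)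
    ultimately have "0 < defect ?F \<phi>" by simp
    \<comment> \<open>Dividing by a positive defect of at most 1 cannot decrease the positive value
      \<open>\<phi> r\<close>.\<close>
    then show ?thesis using \<phi>(1,2) \<phi>V \<open>0 < V\<close> by (intro bexI[of _ \<phi>]) (auto simp: field_simps mult_left_le)
  qed
  then have "ereal V \<le> (SUP \<phi>\<in>?Q. ereal (\<phi> r / defect ?F \<phi>))"
    by (meson SUP_upper2 ereal_less_eq(3))
  ultimately show ?thesis unfolding V_def by (intro antisym)
qed

end
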